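(* Let $\Lambda$ be an algebra, $C$ a $\Lambda$-$\Lambda$-bimodule and $A=\Lambda\oplus C$ the trivial extension algebra with its canonical grading. Assume that the right $\Lambda$-module $C_\Lambda$ belongs to $\mathsf{K}^{\mathrm b}(\operatorname{proj}\Lambda)$. Then $$\mathsf{D}(\operatorname{Mod}\Lambda)\cap\mathsf{K}^{\mathrm b}(\operatorname{proj}^{\mathbb Z}A)=\mathsf{K}^{\mathrm b}(\operatorname{proj}\Lambda)\cap\mathsf{K}^{\mathrm b}(\operatorname{proj}^{\mathbb Z}A)=\bigcup_{a\ge 0}\operatorname{Ker}\bigl((-\otimes^{\mathbb L}_\Lambda C^a)|_{\mathsf K}\bigr).$$
   Context: $k$ is a commutative ring; algebras are $k$-algebras and bimodules are $k$-central. Modules are right modules. The trivial extension algebra $A=\Lambda\oplus C$ has multiplication $(r,c)(s,d)=(rs,rd+cs)$ and is graded by $\deg\Lambda=0$, $\deg C=1$. $\operatorname{proj}\Lambda$ (resp. $\operatorname{proj}^{\mathbb Z}A$) is the category of finitely generated projective $\Lambda$-modules (resp. finitely generated graded projective $A$-modules, with degree-preserving maps). $\mathsf{K}^{\mathrm b}(\operatorname{proj}\Lambda)$ and $\mathsf{K}^{\mathrm b}(\operatorname{proj}^{\mathbb Z}A)$ are the bounded homotopy categories, identified with the subcategories of (graded) perfect complexes in $\mathsf{D}(\operatorname{Mod}\Lambda)$ and in $\mathsf{D}(\operatorname{Mod}^{\mathbb Z}A)$, respectively, where $\operatorname{Mod}^{\mathbb Z}A$ is the category of graded $A$-modules; "belongs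 to" means "is isomorphic in the derived category to an object of". A $\Lambda$-module is regarded as a graded $A$-module concentrated in degree $0$ via the augmentation $A\to\Lambda$, $(r,c)\mapsto r$; in this way objects of $\mathsf{D}(\operatorname{Mod}\Lambda)$ are regarded as objects of $\mathsf{D}(\operatorname{Mod}^{\mathbb Z}A)$, and the intersections above are taken in $\mathsf{D}(\operatorname{Mod}^{\mathbb Z}A)$. $-\otimes^{\mathbb L}_\Lambda C^a$ is the $a$-fold iterate of the endofunctor $-\otimes^{\mathbb L}_\Lambda C$ of $\mathsf{D}(\operatorname{Mod}\Lambda)$ (the identity for $a=0$). Since $C_\Lambda\in\mathsf{K}^{\mathrm b}(\operatorname{proj}\Lambda)$, it preserves $\mathsf{K}^{\mathrm b}(\operatorname{proj}\Lambda)$, and $(-\otimes^{\mathbb L}_\Lambda C^a)|_{\mathsf K}$ is its restriction to $\mathsf{K}^{\mathrm b}(\operatorname{proj}\Lambda)$; $\operatorname{Ker}$ of a functor is the full subcategory of objects sent to $0$. *)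

theory Defs
  imports "HOL-Algebra.Module" "HOL-Algebra.AbelCoset" "HOL-Library.Infinite_Typeclass"
begin

text \<open>
  Size convention. The type variable \<open>'u\<close> plays the role of the universe: every ring, bimodule and
  module whose category is formed has its carrier inside an arbitrary infinite type \<open>'u\<close>. Since \<open>'u\<close>
  has at least as many elements as the rings considered, free modules on sets inside \<open>'u\<close>, countable
  direct sums and tensor products have isomorphic copies inside \<open>'u\<close>, so that the category of modules
  in \<open>'u\<close> is an abelian category with enough projectives.
\<close>

section \<open>Right modules, bimodules and algebras\<close>

text \<open>
  The module record of HOL-Algebra is reused (its fields for a multiplication and a unit are not
  used). For right modules the scalar is written on the right.
\<close>

abbreviation rsmult :: "('r, 'm, 'e) module_scheme \<Rightarrow> 'm \<Rightarrow> 'r \<Rightarrow> 'm" (infixl \<open>\<cdot>\<index>\<close> 70)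
  where "rsmult M m r \<equiv> smult M r m"

locale right_module = R?: ring R + M?: abelian_group M
  for R (structure) and M :: "('r, 'm, 'e) module_scheme" (structure) +
  assumes rsmult_closed: "\<lbrakk>m \<in> carrier M; r \<in> carrier R\<rbrakk> \<Longrightarrow> m \<cdot>\<^bsub>M\<^esub> r \<in> carrier M"
    and rsmult_add_scalar: "\<lbrakk>m \<in> carrier M; r \<in> carrier R; s \<in> carrier R\<rbrakk> \<Longrightarrow>
          m \<cdot>\<^bsub>M\<^esub> (r \<oplus>\<^bsub>R\<^esub> s) = m \<cdot>\<^bsub>M\<^esub> r \<oplus>\<^bsub>M\<^esub> m \<cdot>\<^bsub>M\<^esub> s"
    and rsmult_add: "\<lbrakk>m \<in> carrier M; n \<in> carrier M; r \<in> carrier R\<rbrakk> \<Longrightarrow>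
          (m \<oplus>\<^bsub>M\<^esub> n) \<cdot>\<^bsub>M\<^esub> r = m \<cdot>\<^bsub>M\<^esub> r \<oplus>\<^bsub>M\<^esub> n \<cdot>\<^bsub>M\<^esub> r"
    and rsmult_assoc: "\<lbrakk>m \<in> carrier M; r \<in> carrier R; s \<in> carrier R\<rbrakk> \<Longrightarrow>
          m \<cdot>\<^bsub>M\<^esub> (r \<otimes>\<^bsub>R\<^esub> s) = (m \<cdot>\<^bsub>M\<^esub> r) \<cdot>\<^bsub>M\<^esub> s"
    and rsmult_one: "m \<in> carrier M \<Longrightarrow> m \<cdot>\<^bsub>M\<^esub> \<one>\<^bsub>R\<^esub> = m"

record ('r, 'm) bimodule = "('r, 'm) module" +
  lsmult :: "'r \<Rightarrow> 'm \<Rightarrow> 'm" (infixl \<open>\<bullet>\<index>\<close> 70)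

locale bimodule = right_module R C
  for R (structure) and C :: "('r, 'm, 'e) bimodule_scheme" (structure) +
  assumes lsmult_closed: "\<lbrakk>r \<in> carrier R; c \<in> carrier C\<rbrakk> \<Longrightarrow> r \<bullet>\<^bsub>C\<^esub> c \<in> carrier C"
    and lsmult_add_scalar: "\<lbrakk>r \<in> carrier R; s \<in> carrier R; c \<in> carrier C\<rbrakk> \<Longrightarrow>
          (r \<oplus>\<^bsub>R\<^esub> s) \<bullet>\<^bsub>C\<^esub> c = r \<bullet>\<^bsub>C\<^esub> c \<oplus>\<^bsub>C\<^esub> s \<bullet>\<^bsub>C\<^esub> c"
    and lsmult_add: "\<lbrakk>r \<in> carrier R; c \<in> carrier C; d \<in> carrier C\<rbrakk> \<Longrightarrow>
          r \<bullet>\<^bsub>C\<^esub> (c \<oplus>\<^bsub>C\<^esub> d) = r \<bullet>\<^bsub>C\<^esub> c \<oplus>\<^bsub>C\<^esub> r \<bullet>\<^bsub>C\<^esub> d"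
    and lsmult_assoc: "\<lbrakk>r \<in> carrier R; s \<in> carrier R; c \<in> carrier C\<rbrakk> \<Longrightarrow>
          (r \<otimes>\<^bsub>R\<^esub> s) \<bullet>\<^bsub>C\<^esub> c = r \<bullet>\<^bsub>C\<^esub> (s \<bullet>\<^bsub>C\<^esub> c)"
    and lsmult_one: "c \<in> carrier C \<Longrightarrow> \<one>\<^bsub>R\<^esub> \<bullet>\<^bsub>C\<^esub> c = c"
    and lsmult_rsmult: "\<lbrakk>r \<in> carrier R; c \<in> carrier C; s \<in> carrier R\<rbrakk> \<Longrightarrow>
          (r \<bullet>\<^bsub>C\<^esub> c) \<cdot>\<^bsub>C\<^esub> s = r \<bullet>\<^bsub>C\<^esub> (c \<cdot>\<^bsub>C\<^esub> s)"

text \<open>A (not necessarily commutative) algebra over \<open>k\<close> is a ring with a central structure map.\<close>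

locale nc_algebra = k?: cring k + R?: ring R for k (structure) and R (structure) +
  fixes \<eta>
  assumes structure_map: "\<eta> \<in> ring_hom k R"
    and central: "\<lbrakk>x \<in> carrier k; r \<in> carrier R\<rbrakk> \<Longrightarrow> \<eta> x \<otimes>\<^bsub>R\<^esub> r = r \<otimes>\<^bsub>R\<^esub> \<eta> x"

locale central_bimodule = nc_algebra k R \<eta> + bimodule R C
  for k (structure) and R (structure) and \<eta> and C (structure) +
  assumes bimodule_central: "\<lbrakk>x \<in> carrier k; c \<in> carrier C\<rbrakk> \<Longrightarrow> \<eta> x \<bullet>\<^bsub>C\<^esub> c = c \<cdot>\<^bsub>C\<^esub> \<eta> x"

definition mod_hom ::
  "('r, 'x) ring_scheme \<Rightarrow> ('r, 'm, 'e) module_scheme \<Rightarrow> ('r, 'n, 'f) module_scheme \<Rightarrow> ('m \<Rightarrow> 'n) set"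
  where "mod_hom R M N = {f \<in> hom (add_monoid M) (add_monoid N).
    \<forall>m\<in>carrier M. \<forall>r\<in>carrier R. f (m \<cdot>\<^bsub>M\<^esub> r) = f m \<cdot>\<^bsub>N\<^esub> r}"

definition fin_gen :: "('r, 'x) ring_scheme \<Rightarrow> ('r, 'm, 'e) module_scheme \<Rightarrow> bool"
  where "fin_gen R M \<longleftrightarrow> (\<exists>S. finite S \<and> S \<subseteq> carrier M \<and>
    (\<forall>m\<in>carrier M. \<exists>r\<in>S \<rightarrow> carrier R. m = (\<Oplus>\<^bsub>M\<^esub>s\<in>S. s \<cdot>\<^bsub>M\<^esub> r s)))"


section \<open>Graded modules and the trivial extension algebra\<close>

record ('r, 'm) gmodule = "('r, 'm) module" +
  component :: "int \<Rightarrow> 'm set"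

text \<open>\<open>G j\<close> is the degree \<open>j\<close> part of the graded ring \<open>R\<close>.\<close>

locale graded_module = right_module R M
  for R (structure) and G :: "int \<Rightarrow> 'r set" and M :: "('r, 'm, 'e) gmodule_scheme" (structure) +
  assumes component_subgroup: "additive_subgroup (component M i) M"
    and component_rsmult:
      "\<lbrakk>m \<in> component M i; r \<in> G j\<rbrakk> \<Longrightarrow> m \<cdot>\<^bsub>M\<^esub> r \<in> component M (i + j)"
    and direct_sum: "m \<in> carrier M \<Longrightarrow> \<exists>!f. (\<forall>i. f i \<in> component M i) \<and>
      finite {i. f i \<noteq> \<zero>\<^bsub>M\<^esub>} \<and> m = (\<Oplus>\<^bsub>M\<^esub>i\<in>{i. f i \<noteq> \<zero>\<^bsub>M\<^esub>}. f i)"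

definition gmod_hom :: "('r, 'x) ring_scheme \<Rightarrow> ('r, 'm, 'e) gmodule_scheme \<Rightarrow>
    ('r, 'n, 'f) gmodule_scheme \<Rightarrow> ('m \<Rightarrow> 'n) set"
  where "gmod_hom R M N = {f \<in> mod_hom R M N. \<forall>i. f ` component M i \<subseteq> component N i}"

definition trivial_ext :: "('r, 'x) ring_scheme \<Rightarrow> ('r, 'c, 'e) bimodule_scheme \<Rightarrow> ('r \<times> 'c) ring"
  where "trivial_ext R C =
    \<lparr>carrier = carrier R \<times> carrier C,
     monoid.mult = (\<lambda>(r, c) (s, d). (r \<otimes>\<^bsub>R\<^esub> s, r \<bullet>\<^bsub>C\<^esub> d \<oplus>\<^bsub>C\<^esub> c \<cdot>\<^bsub>C\<^esub> s)),
     one = (\<one>\<^bsub>R\<^esub>, \<zero>\<^bsub>C\<^esub>),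
     zero = (\<zero>\<^bsub>R\<^esub>, \<zero>\<^bsub>C\<^esub>),
     add = (\<lambda>(r, c) (s, d). (r \<oplus>\<^bsub>R\<^esub> s, c \<oplus>\<^bsub>C\<^esub> d))\<rparr>"

definition trivial_ext_grading ::
  "('r, 'x) ring_scheme \<Rightarrow> ('r, 'c, 'e) bimodule_scheme \<Rightarrow> int \<Rightarrow> ('r \<times> 'c) set"
  where "trivial_ext_grading R C j =
    (if j = 0 then carrier R \<times> {\<zero>\<^bsub>C\<^esub>}
     else if j = 1 then {\<zero>\<^bsub>R\<^esub>} \<times> carrier C
     else {(\<zero>\<^bsub>R\<^esub>, \<zero>\<^bsub>C\<^esub>)})"

text \<open>Restriction along the augmentation \<open>(r, c) \<mapsto> r\<close>, placed in degree \<open>0\<close>.\<close>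

definition inflate :: "('r, 'm, 'e) module_scheme \<Rightarrow> ('r \<times> 'c, 'm) gmodule"
  where "inflate M =
    \<lparr>carrier = carrier M, monoid.mult = monoid.mult M, one = one M, zero = zero M, add = add M,
     smult = (\<lambda>(r, c) m. m \<cdot>\<^bsub>M\<^esub> r),
     component = (\<lambda>i. if i = 0 then carrier M else {\<zero>\<^bsub>M\<^esub>})\<rparr>"


section \<open>Categories of modules\<close>

text \<open>
  Ungraded and graded modules are treated uniformly: a category of modules is given by a set of
  objects with an underlying abelian group and by sets of homomorphisms, composed as functions. Only
  the values of a homomorphism on the carrier matter.
\<close>

record ('u, 'x) concrete_cat =
  Ob :: "('u, 'x) ring_scheme set"
  Hom :: "('u, 'x) ring_scheme \<Rightarrow> ('u, 'x) ring_scheme \<Rightarrow> ('u \<Rightarrow> 'u) set"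

definition Mod_cat :: "('r, 'x) ring_scheme \<Rightarrow> ('u, ('r, 'u, unit) module_ext) concrete_cat"
  where "Mod_cat R = \<lparr>Ob = {M. right_module R M}, Hom = mod_hom R\<rparr>"

definition GrMod_cat :: "('r, 'x) ring_scheme \<Rightarrow> (int \<Rightarrow> 'r set) \<Rightarrow>
    ('u, ('r, 'u, ('u, unit) gmodule_ext) module_ext) concrete_cat"
  where "GrMod_cat R G = \<lparr>Ob = {M. graded_module R G M}, Hom = gmod_hom R\<rparr>"

definition projective :: "('u, 'x) concrete_cat \<Rightarrow> ('u, 'x) ring_scheme \<Rightarrow> bool"
  where "projective \<A> P \<longleftrightarrow> P \<in> Ob \<A> \<and>
    (\<forall>M\<in>Ob \<A>. \<forall>N\<in>Ob \<A>. \<forall>g\<in>Hom \<A> M N. \<forall>f\<in>Hom \<A> P N. g ` carrier M = carrier N \<longrightarrow>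
      (\<exists>h\<in>Hom \<A> P M. \<forall>p\<in>carrier P. g (h p) = f p))"

definition proj :: "('r, 'x) ring_scheme \<Rightarrow> ('r, 'u) module set"
  where "proj R = {P. projective (Mod_cat R) P \<and> fin_gen R P}"

definition gr_proj :: "('r, 'x) ring_scheme \<Rightarrow> (int \<Rightarrow> 'r set) \<Rightarrow> ('r, 'u) gmodule set"
  where "gr_proj R G = {P. projective (GrMod_cat R G) P \<and> fin_gen R P}"


section \<open>Complexes\<close>

text \<open>Complexes are cohomologically indexed; \<open>diff X i\<close> maps \<open>obj X i\<close> to \<open>obj X (i + 1)\<close>.\<close>

record ('u, 'x) cpx =
  obj :: "int \<Rightarrow> ('u, 'x) ring_scheme"
  diff :: "int \<Rightarrow> 'u \<Rightarrow> 'u"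

type_synonym ('r, 'u) mod_cpx = "('u, ('r, 'u, unit) module_ext) cpx"
type_synonym ('r, 'u) gmod_cpx = "('u, ('r, 'u, ('u, unit) gmodule_ext) module_ext) cpx"

definition complexes :: "('u, 'x) concrete_cat \<Rightarrow> ('u, 'x) cpx set"
  where "complexes \<A> = {X. \<forall>i. obj X i \<in> Ob \<A> \<and> diff X i \<in> Hom \<A> (obj X i) (obj X (i + 1)) \<and>
    (\<forall>x\<in>carrier (obj X i). diff X (i + 1) (diff X i x) = \<zero>\<^bsub>obj X (i + 2)\<^esub>)}"

definition chain_maps ::
  "('u, 'x) concrete_cat \<Rightarrow> ('u, 'x) cpx \<Rightarrow> ('u, 'x) cpx \<Rightarrow> (int \<Rightarrow> 'u \<Rightarrow> 'u) set"
  where "chain_maps \<A> X Y = {f. \<forall>i. f i \<in> Hom \<A> (obj X i) (obj Y i) \<and>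
    (\<forall>x\<in>carrier (obj X i). f (i + 1) (diff X i x) = diff Y i (f i x))}"

definition homotopic :: "('u, 'x) concrete_cat \<Rightarrow> ('u, 'x) cpx \<Rightarrow> ('u, 'x) cpx \<Rightarrow>
    (int \<Rightarrow> 'u \<Rightarrow> 'u) \<Rightarrow> (int \<Rightarrow> 'u \<Rightarrow> 'u) \<Rightarrow> bool"
  where "homotopic \<A> X Y f g \<longleftrightarrow> (\<exists>h. \<forall>i. h i \<in> Hom \<A> (obj X i) (obj Y (i - 1)) \<and>
    (\<forall>x\<in>carrier (obj X i).
      f i x = g i x \<oplus>\<^bsub>obj Y i\<^esub> (diff Y (i - 1) (h i x) \<oplus>\<^bsub>obj Y i\<^esub> h (i + 1) (diff X i x))))"

definition cocycles :: "('u, 'x) cpx \<Rightarrow> int \<Rightarrow> 'u set"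
  where "cocycles X i = {x \<in> carrier (obj X i). diff X i x = \<zero>\<^bsub>obj X (i + 1)\<^esub>}"

definition coboundaries :: "('u, 'x) cpx \<Rightarrow> int \<Rightarrow> 'u set"
  where "coboundaries X i = diff X (i - 1) ` carrier (obj X (i - 1))"

text \<open>The cohomology group is the set of cosets of the coboundaries in the cocycles.\<close>

definition cohomology :: "('u, 'x) cpx \<Rightarrow> int \<Rightarrow> 'u set set"
  where "cohomology X i = (\<lambda>z. coboundaries X i +>\<^bsub>obj X i\<^esub> z) ` cocycles X i"

definition cohomology_map :: "('u, 'x) cpx \<Rightarrow> (int \<Rightarrow> 'u \<Rightarrow> 'u) \<Rightarrow> int \<Rightarrow> 'u set \<Rightarrow> 'u set"
  where "cohomology_map Y f i S = coboundaries Y i <+>\<^bsub>obj Y i\<^esub> f i ` S"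

definition quasi_isos ::
  "('u, 'x) concrete_cat \<Rightarrow> ('u, 'x) cpx \<Rightarrow> ('u, 'x) cpx \<Rightarrow> (int \<Rightarrow> 'u \<Rightarrow> 'u) set"
  where "quasi_isos \<A> X Y = {f \<in> chain_maps \<A> X Y.
    \<forall>i. bij_betw (cohomology_map Y f i) (cohomology X i) (cohomology Y i)}"

definition acyclic_cpx :: "('u, 'x) cpx \<Rightarrow> bool"
  where "acyclic_cpx X \<longleftrightarrow> (\<forall>i. cocycles X i = coboundaries X i)"

definition zero_cpx :: "('u, 'x) cpx \<Rightarrow> bool"
  where "zero_cpx X \<longleftrightarrow> (\<forall>i. carrier (obj X i) = {\<zero>\<^bsub>obj X i\<^esub>})"

definition bounded_cpx :: "('u, 'x) cpx \<Rightarrow> bool"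
  where "bounded_cpx X \<longleftrightarrow> finite {i. carrier (obj X i) \<noteq> {\<zero>\<^bsub>obj X i\<^esub>}}"

text \<open>The module \<open>M\<close> as a complex concentrated in degree \<open>0\<close>.\<close>

definition stalk :: "('u, 'x) ring_scheme \<Rightarrow> ('u, 'x) cpx"
  where "stalk M = \<lparr>obj = (\<lambda>i. if i = 0 then M else M\<lparr>carrier := {\<zero>\<^bsub>M\<^esub>}\<rparr>), diff = (\<lambda>i x. \<zero>\<^bsub>M\<^esub>)\<rparr>"


section \<open>Isomorphism in the derived category\<close>

text \<open>
  The derived category is the localization of the homotopy category at the quasi-isomorphisms:
  a morphism \<open>X \<rightarrow> Y\<close> is represented by a roof \<open>(Z, s, f)\<close> with a quasi-isomorphism \<open>s : Z \<rightarrow> X\<close> and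
  a chain map \<open>f : Z \<rightarrow> Y\<close>.
\<close>

type_synonym ('u, 'x) roof = "('u, 'x) cpx \<times> (int \<Rightarrow> 'u \<Rightarrow> 'u) \<times> (int \<Rightarrow> 'u \<Rightarrow> 'u)"

definition roofs ::
  "('u, 'x) concrete_cat \<Rightarrow> ('u, 'x) cpx \<Rightarrow> ('u, 'x) cpx \<Rightarrow> ('u, 'x) roof set"
  where "roofs \<A> X Y =
    {(Z, s, f). Z \<in> complexes \<A> \<and> s \<in> quasi_isos \<A> Z X \<and> f \<in> chain_maps \<A> Z Y}"

abbreviation cpx_comp :: "(int \<Rightarrow> 'u \<Rightarrow> 'u) \<Rightarrow> (int \<Rightarrow> 'u \<Rightarrow> 'u) \<Rightarrow> int \<Rightarrow> 'u \<Rightarrow> 'u" (infixl \<open>\<circ>\<^sub>c\<close> 55)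
  where "g \<circ>\<^sub>c f \<equiv> (\<lambda>i. g i \<circ> f i)"

definition id_roof :: "('u, 'x) cpx \<Rightarrow> ('u, 'x) roof"
  where "id_roof X = (X, (\<lambda>i x. x), (\<lambda>i x. x))"

text \<open>Two roofs represent the same morphism iff they are dominated by a common roof.\<close>

definition roof_eq :: "('u, 'x) concrete_cat \<Rightarrow> ('u, 'x) cpx \<Rightarrow> ('u, 'x) cpx \<Rightarrow>
    ('u, 'x) roof \<Rightarrow> ('u, 'x) roof \<Rightarrow> bool"
  where "roof_eq \<A> X Y = (\<lambda>(Z, s, f) (Z', s', f').
    \<exists>W\<in>complexes \<A>. \<exists>u\<in>chain_maps \<A> W Z. \<exists>u'\<in>chain_maps \<A> W Z'.
      s \<circ>\<^sub>c u \<in> quasi_isos \<A> W X \<and>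
      homotopic \<A> W X (s \<circ>\<^sub>c u) (s' \<circ>\<^sub>c u') \<and> homotopic \<A> W Y (f \<circ>\<^sub>c u) (f' \<circ>\<^sub>c u'))"

text \<open>
  The composites of \<open>(Z, s, f) : X \<rightarrow> Y\<close> and \<open>(W, t, g) : Y \<rightarrow> V\<close>: complete \<open>f\<close>, \<open>t\<close> to a square
  \<open>f u \<sim> t v\<close> with \<open>u\<close> a quasi-isomorphism. All choices give equal morphisms.
\<close>

definition roof_composites ::
  "('u, 'x) concrete_cat \<Rightarrow> ('u, 'x) cpx \<Rightarrow> ('u, 'x) roof \<Rightarrow> ('u, 'x) roof \<Rightarrow> ('u, 'x) roof set"
  where "roof_composites \<A> Y = (\<lambda>(Z, s, f) (W, t, g).
    {(U, s \<circ>\<^sub>c u, g \<circ>\<^sub>c v) | U u v. U \<in> complexes \<A> \<and> u \<in> quasi_isos \<A> U Z \<and>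
      v \<in> chain_maps \<A> U W \<and> homotopic \<A> U Y (f \<circ>\<^sub>c u) (t \<circ>\<^sub>c v)})"

definition derived_iso :: "('u, 'x) concrete_cat \<Rightarrow> ('u, 'x) cpx \<Rightarrow> ('u, 'x) cpx \<Rightarrow> bool"
  where "derived_iso \<A> X Y \<longleftrightarrow> X \<in> complexes \<A> \<and> Y \<in> complexes \<A> \<and>
    (\<exists>\<phi>\<in>roofs \<A> X Y. \<exists>\<psi>\<in>roofs \<A> Y X.
      (\<exists>\<rho>\<in>roof_composites \<A> Y \<phi> \<psi>. roof_eq \<A> X X \<rho> (id_roof X)) \<and>
      (\<exists>\<rho>\<in>roof_composites \<A> X \<psi> \<phi>. roof_eq \<A> Y Y \<rho> (id_roof Y)))"

text \<open>
  Full, isomorphism-closed subcategories of a derived category are represented by their sets of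
  objects. The next set consists of the objects belonging to the bounded homotopy category of
  \<open>\<P>\<close>, where \<open>\<P>\<close> is a set of objects of \<open>\<A>\<close>.
\<close>

definition Kb :: "('u, 'x) concrete_cat \<Rightarrow> ('u, 'x) ring_scheme set \<Rightarrow> ('u, 'x) cpx set"
  where "Kb \<A> \<P> = {X \<in> complexes \<A>. \<exists>P\<in>complexes \<A>.
    bounded_cpx P \<and> (\<forall>i. obj P i \<in> \<P>) \<and> derived_iso \<A> X P}"

abbreviation Kb_proj ::
  "('r, 'x) ring_scheme \<Rightarrow> ('r, 'u) mod_cpx set"
  where "Kb_proj R \<equiv> Kb (Mod_cat R) (proj R)"

abbreviation Kb_gr_proj :: "('r, 'x) ring_scheme \<Rightarrow> (int \<Rightarrow> 'r set) \<Rightarrow>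
    ('r, 'u) gmod_cpx set"
  where "Kb_gr_proj R G \<equiv> Kb (GrMod_cat R G) (gr_proj R G)"

definition inflate_cpx :: "('r, 'u) mod_cpx \<Rightarrow>
    ('r \<times> 'c, 'u) gmod_cpx"
  where "inflate_cpx X = \<lparr>obj = (\<lambda>i. inflate (obj X i)), diff = diff X\<rparr>"

text \<open>
  The objects of the derived category of graded modules over the trivial extension which belong to
  a given class \<open>\<S>\<close> of objects of the derived category of \<open>R\<close>-modules.
\<close>

definition in_graded :: "('r, 'x) ring_scheme \<Rightarrow> ('r, 'c, 'e) bimodule_scheme \<Rightarrow>
    ('r, 'u) mod_cpx set \<Rightarrow>
    ('r \<times> 'c, 'u) gmod_cpx set"
  where "in_graded R C \<S> =
    {X. \<exists>M\<in>\<S>. derived_iso (GrMod_cat (trivial_ext R C) (trivial_ext_grading R C)) X (inflate_cpx M)}"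


section \<open>The derived tensor product with a bimodule\<close>

definition balanced :: "('r, 'x) ring_scheme \<Rightarrow> ('r, 'm, 'e) module_scheme \<Rightarrow>
    ('r, 'c, 'f) bimodule_scheme \<Rightarrow> ('t, 'g) ring_scheme \<Rightarrow> ('m \<Rightarrow> 'c \<Rightarrow> 't) \<Rightarrow> bool"
  where "balanced R M C T \<beta> \<longleftrightarrow>
    (\<forall>m\<in>carrier M. \<forall>c\<in>carrier C. \<beta> m c \<in> carrier T) \<and>
    (\<forall>m\<in>carrier M. \<forall>n\<in>carrier M. \<forall>c\<in>carrier C. \<beta> (m \<oplus>\<^bsub>M\<^esub> n) c = \<beta> m c \<oplus>\<^bsub>T\<^esub> \<beta> n c) \<and>
    (\<forall>m\<in>carrier M. \<forall>c\<in>carrier C. \<forall>d\<in>carrier C. \<beta> m (c \<oplus>\<^bsub>C\<^esub> d) = \<beta> m c \<oplus>\<^bsub>T\<^esub> \<beta> m d) \<and>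
    (\<forall>m\<in>carrier M. \<forall>r\<in>carrier R. \<forall>c\<in>carrier C. \<beta> (m \<cdot>\<^bsub>M\<^esub> r) c = \<beta> m (r \<bullet>\<^bsub>C\<^esub> c))"

text \<open>
  \<open>(T, \<tau>)\<close> is a tensor product of \<open>M\<close> and \<open>C\<close> over \<open>R\<close>: a universal balanced map into an abelian
  group, with the right \<open>R\<close>-action induced by the one on \<open>C\<close>.
\<close>

definition is_tensor :: "('r, 'x) ring_scheme \<Rightarrow> ('r, 'u, 'e) module_scheme \<Rightarrow>
    ('r, 'u, 'f) bimodule_scheme \<Rightarrow> ('r, 'u, 'g) module_scheme \<Rightarrow> ('u \<Rightarrow> 'u \<Rightarrow> 'u) \<Rightarrow> bool"
  where "is_tensor R M C T \<tau> \<longleftrightarrow> right_module R T \<and> balanced R M C T \<tau> \<and>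
    (\<forall>m\<in>carrier M. \<forall>c\<in>carrier C. \<forall>r\<in>carrier R. \<tau> m c \<cdot>\<^bsub>T\<^esub> r = \<tau> m (c \<cdot>\<^bsub>C\<^esub> r)) \<and>
    (\<forall>(B :: 'u ring) \<beta>. abelian_group B \<and> balanced R M C B \<beta> \<longrightarrow>
      (\<exists>g\<in>hom (add_monoid T) (add_monoid B).
        (\<forall>m\<in>carrier M. \<forall>c\<in>carrier C. g (\<tau> m c) = \<beta> m c) \<and>
        (\<forall>g'\<in>hom (add_monoid T) (add_monoid B).
          (\<forall>m\<in>carrier M. \<forall>c\<in>carrier C. g' (\<tau> m c) = \<beta> m c) \<longrightarrow> (\<forall>t\<in>carrier T. g' t = g t))))"

definition is_tensor_cpx :: "('r, 'x) ring_scheme \<Rightarrow> ('r, 'u) mod_cpx \<Rightarrow>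
    ('r, 'u, 'f) bimodule_scheme \<Rightarrow> ('r, 'u) mod_cpx \<Rightarrow> bool"
  where "is_tensor_cpx R X C Y \<longleftrightarrow> Y \<in> complexes (Mod_cat R) \<and>
    (\<exists>\<tau>. (\<forall>i. is_tensor R (obj X i) C (obj Y i) (\<tau> i)) \<and>
      (\<forall>i. \<forall>x\<in>carrier (obj X i). \<forall>c\<in>carrier C.
        diff Y i (\<tau> i x c) = \<tau> (i + 1) (diff X i x) c))"

definition K_projective :: "('u, 'x) concrete_cat \<Rightarrow> ('u, 'x) cpx \<Rightarrow> bool"
  where "K_projective \<A> P \<longleftrightarrow> P \<in> complexes \<A> \<and>
    (\<forall>N\<in>complexes \<A>. acyclic_cpx N \<longrightarrow>
      (\<forall>f\<in>chain_maps \<A> P N. homotopic \<A> P N f (\<lambda>i x. \<zero>\<^bsub>obj N i\<^esub>)))"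

text \<open>
  The derived tensor product on objects: apply the underived tensor product to a chosen
  K-projective resolution. The result does not depend on the choices up to isomorphism in the
  derived category.
\<close>

definition derived_tensor :: "('r, 'x) ring_scheme \<Rightarrow> ('r, 'u, 'f) bimodule_scheme \<Rightarrow>
    ('r, 'u) mod_cpx \<Rightarrow> ('r, 'u) mod_cpx"
  where "derived_tensor R C X = (SOME Y. \<exists>P. K_projective (Mod_cat R) P \<and>
    quasi_isos (Mod_cat R) P X \<noteq> {} \<and> is_tensor_cpx R P C Y)"

definition Ker_derived_tensor :: "('r, 'x) ring_scheme \<Rightarrow> ('r, 'u, 'f) bimodule_scheme \<Rightarrow> nat \<Rightarrow>
    ('r, 'u) mod_cpx set"
  where "Ker_derived_tensor R C a = {X \<in> Kb_proj R. \<exists>Z. zero_cpx Z \<and>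
    derived_iso (Mod_cat R) ((derived_tensor R C ^^ a) X) Z}"

end

(*
Let P be a bounded complex of graded projective A-modules, D_j its part of degree j and Q_j the part
of degree j of P (x)_A L, a perfect complex over the base ring L. Projectivity yields exact sequences
0 -> Q_(j-1) (x) C -> D_j -> Q_j -> 0. If P is quasi-isomorphic to a complex M in degree 0, then D_j
is acyclic for j /= 0; hence Q_j is acyclic for j < 0, Q_0 is quasi-isomorphic to M, and Q_j is up to
a shift the j-fold derived tensor product of M with C. As Q_j = 0 for large j, M lies in some kernel.
Conversely, if M lies in the a-th kernel, induction on a resolves M placed in degree n: for a perfect
resolution Q of M the graded module Q + Q (x) C is perfect and is an extension of Q, in degree n, by
Q (x) C, in degree n + 1, to which the induction hypothesis applies.

The first equation of the theorem is about modules with carriers in an arbitrary type, in which direct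
sums and tensor products need not exist. There the kernel of D_j -> Q_j is shown to be contractible when
Q_(j-1) is, by lifting a contraction to P.
*)

theory Submission
  imports Defs
begin

section \<open>Coding pairs and lists in an infinite type\<close>

text \<open>All carriers lie in one type, so every construction is coded inside it: pairs and lists
  are injected into an infinite type, a quotient is carried by representatives of cosets, a tensor
  product by codes of formal sums. Kernels and quotients stay inside any type. This is why
  \<open>mod_cat0\<close>, without biproducts, is separated from \<open>mod_cat\<close>, where
  mapping cones allow chain maps out of K-projective complexes to be lifted along
  quasi-isomorphisms; and why the reduction of \<open>P\<close> to the base ring is not formed as a
  tensor product but as a quotient of each degree part, described by \<open>top\<close>. The
  sequence for \<open>D_j\<close> splits in every complex degree, but the splittings need not
  commute with the differentials. If \<open>D_j\<close> is acyclic, their defect is the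
  quasi-isomorphism from a shift of \<open>Q_j\<close> to the tensor product of
  \<open>Q_(j-1)\<close> with \<open>C\<close>. Kernels consist of perfect complexes by definition.
  That tensoring with \<open>C\<close> preserves perfectness is proved on modules: a module that is
  a perfect complex has a finite resolution by finitely generated projectives, and modules with one
  of length n are closed under sums and retracts.\<close>

lemma ex_inj_prod: "\<exists>f :: 'u::infinite \<times> 'u => 'u. inj f"
proof -
  obtain f where "bij_betw f (UNIV \<times> UNIV :: ('u \<times> 'u) set) (UNIV :: 'u set)"
    using card_of_Times_same_infinite[OF infinite_UNIV] card_of_ordIso by blast
  then show ?thesis by (auto simp: bij_betw_def)
qed

text \<open>Biproducts, mapping cones and induced modules consist of pairs and must again have their
  carriers in \<open>'u\<close>, so one pairing on \<open>'u\<close> is fixed for all of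
  them.\<close>

definition pr :: "'u::infinite => 'u => 'u"
  where "pr a b = (SOME f. inj f) (a, b)"

definition p1 :: "'u::infinite => 'u"
  where "p1 z = (THE a. \<exists>b. z = pr a b)"

definition p2 :: "'u::infinite => 'u"
  where "p2 z = (THE b. \<exists>a. z = pr a b)"

lemma pr_eq_iff [simp]: "pr a b = pr c d \<longleftrightarrow> a = c \<and> b = d"
  unfolding pr_def using someI_ex[OF ex_inj_prod] by (auto dest: injD)

lemma p1_pr [simp]: "p1 (pr a b) = a" and p2_pr [simp]: "p2 (pr a b) = b"
  by (auto simp: p1_def p2_def)

text \<open>Formal sums of pairs, the elements of tensor products, are stored as codes of lists. The
  first component of the outer pair is a tag that tells nonempty lists from the empty one.\<close>

fun list_code :: "'u::infinite list => 'u"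
  where "list_code [] = pr undefined undefined"
  | "list_code (x # xs) = pr (SOME y. y \<noteq> undefined) (pr x (list_code xs))"

lemma some_neq: "(SOME y :: 'u::infinite. y \<noteq> u) \<noteq> u"
proof (rule someI_ex[of "%y. y \<noteq> u"])
  show "\<exists>y. y \<noteq> u" using arb_element[of "{u}"] by auto
qed

lemma list_code_inj: "list_code xs = list_code ys \<longleftrightarrow> xs = ys"
proof (induction xs arbitrary: ys)
  case Nil
  then show ?case using some_neq[of undefined] by (cases ys) (auto dest: sym)
next
  case (Cons x xs)
  then show ?case using some_neq[of undefined] by (cases ys) auto
qed

section \<open>Identities in abelian groups\<close>

text \<open>
  Every abelian group with a carrier in \<open>'u\<close> embeds into the product of all of them. This product is
  a type of class \<open>ab_group_add\<close>, where the simplifier decides linear identities.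
\<close>

typedef ('u, 'x) all_groups =
  "{f :: ('u, 'x) ring_scheme => 'u. \<forall>G. if abelian_group G then f G \<in> carrier G else f G = undefined}"
  by (rule exI[of _ "%G. if abelian_group G then (zero G) else undefined"]) (auto simp: abelian_groupE(2))

setup_lifting type_definition_all_groups

instantiation all_groups :: (type, type) ab_group_add
begin

lift_definition zero_all_groups :: "('a, 'b) all_groups"
  is "%G. if abelian_group G then (zero G) else undefined"
  by (auto simp: abelian_groupE(2))

lift_definition plus_all_groups :: "('a, 'b) all_groups => ('a, 'b) all_groups => ('a, 'b) all_groups"
  is "%f g G. if abelian_group G then f G \<oplus>\<^bsub>G\<^esub> g G else undefined"
  by (auto simp: abelian_groupE(1))

lift_definition uminus_all_groups :: "('a, 'b) all_groups => ('a, 'b) all_groups"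
  is "%f G. if abelian_group G then \<ominus>\<^bsub>G\<^esub> f G else undefined"
  by (auto simp: abelian_group.a_inv_closed)

definition minus_all_groups :: "('a, 'b) all_groups => ('a, 'b) all_groups => ('a, 'b) all_groups"
  where "minus_all_groups f g = f + - g"

instance
proof
  fix a b c :: "('a, 'b) all_groups"
  show "a + b + c = a + (b + c)"
    by transfer (auto simp: fun_eq_iff abelian_groupE(3))
  show "a + b = b + a"
    by transfer (auto simp: fun_eq_iff intro: abelian_groupE(4))
  show "0 + a = a"
    by transfer (auto simp: fun_eq_iff abelian_groupE(5))
  show "- a + a = 0"
    by transfer (auto simp: fun_eq_iff abelian_group.l_neg)
  show "a - b = a + - b" by (fact minus_all_groups_def)
qed

end

text \<open>The inclusion of the factor \<open>G\<close> into the product, zero in all other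
  coordinates. Outside the carrier of \<open>G\<close> it returns zero, so that the value always
  lies in the product.\<close>

lift_definition emb :: "('u, 'x) ring_scheme => 'u => ('u, 'x) all_groups"
  is "%G x H. if abelian_group H then (if H = G \<and> x \<in> carrier G then x else (zero H)) else undefined"
  by (auto simp: abelian_groupE(2))

lemma emb_add:
  assumes "abelian_group G" "x \<in> carrier G" "y \<in> carrier G"
  shows "emb G (x \<oplus>\<^bsub>G\<^esub> y) = emb G x + emb G y"
  using assms by transfer
    (auto simp: fun_eq_iff abelian_groupE(1,2,5) abelian_monoid.r_zero abelian_group.axioms(1))

lemma emb_zero:
  assumes "abelian_group G"
  shows "emb G (zero G) = 0"
  using assms by transfer (auto simp: fun_eq_iff)

lemma emb_neg:
  assumes "abelian_group G" "x \<in> carrier G"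
  shows "emb G (\<ominus>\<^bsub>G\<^esub> x) = - emb G x"
proof -
  interpret abelian_group G by fact
  have "emb G (\<ominus>\<^bsub>G\<^esub> x) + emb G x = 0"
    using emb_add[OF assms(1), of "\<ominus>\<^bsub>G\<^esub> x" x] assms by (simp add: l_neg emb_zero)
  then show ?thesis by (simp add: eq_neg_iff_add_eq_0)
qed

lemma emb_minus:
  assumes "abelian_group G" "x \<in> carrier G" "y \<in> carrier G"
  shows "emb G (x \<ominus>\<^bsub>G\<^esub> y) = emb G x - emb G y"
  using assms by (simp add: a_minus_def emb_add emb_neg abelian_group.a_inv_closed)

text \<open>The coordinate at \<open>G\<close> recovers the element, so an identity may be checked
  in the product, where the simplifier decides it.\<close>

lemma emb_eqI:
  assumes "emb G x = emb G y" "abelian_group G" "x \<in> carrier G" "y \<in> carrier G"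
  shows "x = y"
proof -
  have "Rep_all_groups (emb G z) G = z" if "z \<in> carrier G" for z
    using that assms(2) by (simp add: emb.rep_eq)
  then show ?thesis using assms by metis
qed

lemmas emb_simps = emb_add emb_zero emb_neg emb_minus

section \<open>Cosets\<close>

text \<open>Cohomology groups are sets of cosets. This criterion and the next lemma reduce
  statements on them to cocycles and coboundaries.\<close>

lemma coset_eq_iff:
  assumes "abelian_group G" "additive_subgroup B G" "x \<in> carrier G" "y \<in> carrier G"
  shows "B +>\<^bsub>G\<^esub> x = B +>\<^bsub>G\<^esub> y \<longleftrightarrow> (\<exists>b\<in>B. x = y \<oplus>\<^bsub>G\<^esub> b)"
proof -
  interpret abelian_group G by fact
  interpret additive_subgroup B G by fact
  have BG: "b \<in> B ==> b \<in> carrier G" for b by (rule a_Hcarr)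
  have mem: "z \<in> B +>\<^bsub>G\<^esub> w \<longleftrightarrow> (\<exists>b\<in>B. z = b \<oplus>\<^bsub>G\<^esub> w)" for z w
    by (auto simp: a_r_coset_def')
  show ?thesis
  proof
    assume "B +>\<^bsub>G\<^esub> x = B +>\<^bsub>G\<^esub> y"
    moreover have "x \<in> B +>\<^bsub>G\<^esub> x" using assms(3) mem zero_closed by (metis add.l_one)
    ultimately show "\<exists>b\<in>B. x = y \<oplus>\<^bsub>G\<^esub> b" using mem assms(4) BG a_comm by metis
  next
    assume "\<exists>b\<in>B. x = y \<oplus>\<^bsub>G\<^esub> b"
    then obtain b where b: "b \<in> B" "x = y \<oplus>\<^bsub>G\<^esub> b" by blast
    have "z \<in> B +>\<^bsub>G\<^esub> x \<longleftrightarrow> z \<in> B +>\<^bsub>G\<^esub> y" for z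
    proof
      assume "z \<in> B +>\<^bsub>G\<^esub> x"
      then obtain c where c: "c \<in> B" "z = c \<oplus>\<^bsub>G\<^esub> x" using mem by blast
      have "z = (c \<oplus>\<^bsub>G\<^esub> b) \<oplus>\<^bsub>G\<^esub> y"
        using b c assms(3,4) BG by (simp add: a_ac)
      then show "z \<in> B +>\<^bsub>G\<^esub> y" using mem a_closed b c by metis
    next
      assume "z \<in> B +>\<^bsub>G\<^esub> y"
      then obtain c where c: "c \<in> B" "z = c \<oplus>\<^bsub>G\<^esub> y" using mem by blast
      have "z = (c \<oplus>\<^bsub>G\<^esub> \<ominus>\<^bsub>G\<^esub> b) \<oplus>\<^bsub>G\<^esub> x"
        using assms(4) BG[OF b(1)] BG[OF c(1)] unfolding b(2) c(2) by (intro emb_eqI[of G]) (auto simp: emb_simps abelian_group_axioms)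
      then show "z \<in> B +>\<^bsub>G\<^esub> x" using mem a_closed a_inv_closed b c by metis
    qed
    then show "B +>\<^bsub>G\<^esub> x = B +>\<^bsub>G\<^esub> y" by blast
  qed
qed

text \<open>The image of a coset need not be a full coset; adding \<open>B'\<close> completes it and
  absorbs the image of \<open>B\<close>, which lies in \<open>B'\<close>.\<close>

lemma hom_set_add_coset:
  assumes G: "abelian_group G" and H: "abelian_group H" and f: "f \<in> hom (add_monoid G) (add_monoid H)"
    and B: "additive_subgroup B G" and B': "additive_subgroup B' H" and fB: "f ` B \<subseteq> B'"
    and x: "x \<in> carrier G"
  shows "B' <+>\<^bsub>H\<^esub> f ` (B +>\<^bsub>G\<^esub> x) = B' +>\<^bsub>H\<^esub> f x"
proof -
  interpret G: abelian_group G by fact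
  interpret H: abelian_group H by fact
  interpret B: additive_subgroup B G by fact
  interpret B': additive_subgroup B' H by fact
  have fc: "f y \<in> carrier H" if "y \<in> carrier G" for y
    using f that by (auto simp: hom_def)
  have fa: "f (y \<oplus>\<^bsub>G\<^esub> z) = f y \<oplus>\<^bsub>H\<^esub> f z" if "y \<in> carrier G" "z \<in> carrier G" for y z
    using f that by (auto simp: hom_def)
  have "z \<in> B' <+>\<^bsub>H\<^esub> f ` (B +>\<^bsub>G\<^esub> x) \<longleftrightarrow> z \<in> B' +>\<^bsub>H\<^esub> f x" for z
  proof
    assume "z \<in> B' <+>\<^bsub>H\<^esub> f ` (B +>\<^bsub>G\<^esub> x)"
    then obtain b' b where b: "b' \<in> B'" "b \<in> B" "z = b' \<oplus>\<^bsub>H\<^esub> f (b \<oplus>\<^bsub>G\<^esub> x)"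
      by (auto simp: set_add_def' a_r_coset_def')
    have "z = (b' \<oplus>\<^bsub>H\<^esub> f b) \<oplus>\<^bsub>H\<^esub> f x"
      unfolding b(3) using b x fc fa B.a_Hcarr B'.a_Hcarr by (simp add: H.a_assoc)
    moreover have "b' \<oplus>\<^bsub>H\<^esub> f b \<in> B'" using b fB by auto
    ultimately show "z \<in> B' +>\<^bsub>H\<^esub> f x" by (auto simp: a_r_coset_def')
  next
    assume "z \<in> B' +>\<^bsub>H\<^esub> f x"
    then obtain b' where b: "b' \<in> B'" "z = b' \<oplus>\<^bsub>H\<^esub> f x" by (auto simp: a_r_coset_def')
    have "x \<in> B +>\<^bsub>G\<^esub> x" unfolding a_r_coset_def' using x by (auto intro!: bexI[of _ "(zero G)"])
    then show "z \<in> B' <+>\<^bsub>H\<^esub> f ` (B +>\<^bsub>G\<^esub> x)"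
      using b unfolding set_add_def' by blast
  qed
  then show ?thesis by blast
qed

lemma (in abelian_group) neg_add_cancel:
  shows "a \<in> carrier G ==> b \<in> carrier G ==> a \<oplus> (\<ominus> a \<oplus> b) = b"
    "a \<in> carrier G ==> b \<in> carrier G ==> \<ominus> a \<oplus> (a \<oplus> b) = b"
    "a \<in> carrier G ==> a \<oplus> \<ominus> a = \<zero>" "a \<in> carrier G ==> \<ominus> a \<oplus> a = \<zero>"
    "a \<in> carrier G ==> b \<in> carrier G ==> (b \<oplus> a) \<oplus> \<ominus> a = b"
    "a \<in> carrier G ==> b \<in> carrier G ==> (b \<oplus> \<ominus> a) \<oplus> a = b"
  by (auto intro!: emb_eqI[of G] simp: emb_simps abelian_group_axioms)

lemma (in abelian_group) eq_iff_minus: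
  assumes "a \<in> carrier G" "b \<in> carrier G" "c \<in> carrier G"
  shows "a = b \<oplus> c \<longleftrightarrow> b = a \<oplus> \<ominus> c"
proof
  assume "a = b \<oplus> c"
  then show "b = a \<oplus> \<ominus> c" using assms by (simp add: neg_add_cancel)
next
  assume "b = a \<oplus> \<ominus> c"
  then show "a = b \<oplus> c" using assms by (simp add: neg_add_cancel)
qed

section \<open>Concrete categories of modules\<close>

text \<open>
  The biproduct \<open>bp M N\<close> and the kernel \<open>kn M S\<close> are parameters since their records also carry the
  scalar multiplication and the grading.
\<close>

locale mod_cat0 =
  fixes \<A> :: "('u, 'x) concrete_cat"
    and kn :: "('u, 'x) ring_scheme => 'u set => ('u, 'x) ring_scheme"
  assumes Ob_ab: "M \<in> Ob \<A> ==> abelian_group M"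
    and Hom_hom: "f \<in> Hom \<A> M N ==> f \<in> hom (add_monoid M) (add_monoid N)"
    and Hom_cong: "f \<in> Hom \<A> M N ==> M \<in> Ob \<A> ==> N \<in> Ob \<A> ==>
          (!!x. x \<in> carrier M ==> g x = f x) ==> g \<in> Hom \<A> M N"
    and Hom_id: "M \<in> Ob \<A> ==> (%x. x) \<in> Hom \<A> M M"
    and Hom_comp: "f \<in> Hom \<A> L M ==> g \<in> Hom \<A> M N ==>
          L \<in> Ob \<A> ==> M \<in> Ob \<A> ==> N \<in> Ob \<A> ==> (%x. g (f x)) \<in> Hom \<A> L N"
    and Hom_zero: "M \<in> Ob \<A> ==> N \<in> Ob \<A> ==> (%x. (zero N)) \<in> Hom \<A> M N"
    and Hom_add: "f \<in> Hom \<A> M N ==> g \<in> Hom \<A> M N ==> M \<in> Ob \<A> ==> N \<in> Ob \<A> ==>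
          (%x. f x \<oplus>\<^bsub>N\<^esub> g x) \<in> Hom \<A> M N"
    and Hom_neg: "f \<in> Hom \<A> M N ==> M \<in> Ob \<A> ==> N \<in> Ob \<A> ==> (%x. \<ominus>\<^bsub>N\<^esub> f x) \<in> Hom \<A> M N"
    and kn_Ob: "f \<in> Hom \<A> M N ==> M \<in> Ob \<A> ==> N \<in> Ob \<A> ==>
          kn M {x \<in> carrier M. f x = (zero N)} \<in> Ob \<A>"
    and kn_carrier: "carrier (kn M S) = S"
    and kn_zero: "(zero (kn M S)) = (zero M)"
    and kn_add: "x \<oplus>\<^bsub>kn M S\<^esub> y = x \<oplus>\<^bsub>M\<^esub> y"
    and kn_Hom: "f \<in> Hom \<A> L M ==> L \<in> Ob \<A> ==> f ` carrier L \<subseteq> S ==> f \<in> Hom \<A> L (kn M S)"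
    and kn_inc: "kn M S \<in> Ob \<A> ==> M \<in> Ob \<A> ==> S \<subseteq> carrier M ==> (%x. x) \<in> Hom \<A> (kn M S) M"
begin

lemma Ob_closed [simp]:
  assumes "M \<in> Ob \<A>"
  shows "(zero M) \<in> carrier M"
    "x \<in> carrier M ==> y \<in> carrier M ==> x \<oplus>\<^bsub>M\<^esub> y \<in> carrier M"
    "x \<in> carrier M ==> \<ominus>\<^bsub>M\<^esub> x \<in> carrier M"
    "x \<in> carrier M ==> (zero M) \<oplus>\<^bsub>M\<^esub> x = x"
    "x \<in> carrier M ==> x \<oplus>\<^bsub>M\<^esub> (zero M) = x"
    "\<ominus>\<^bsub>M\<^esub> (zero M) = (zero M)"
    "x \<in> carrier M ==> \<ominus>\<^bsub>M\<^esub> (\<ominus>\<^bsub>M\<^esub> x) = x"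
proof -
  interpret abelian_group M by (rule Ob_ab) fact
  show "(zero M) \<in> carrier M"
    "x \<in> carrier M ==> y \<in> carrier M ==> x \<oplus>\<^bsub>M\<^esub> y \<in> carrier M"
    "x \<in> carrier M ==> \<ominus>\<^bsub>M\<^esub> x \<in> carrier M"
    "x \<in> carrier M ==> (zero M) \<oplus>\<^bsub>M\<^esub> x = x"
    "x \<in> carrier M ==> x \<oplus>\<^bsub>M\<^esub> (zero M) = x"
    "\<ominus>\<^bsub>M\<^esub> (zero M) = (zero M)"
    "x \<in> carrier M ==> \<ominus>\<^bsub>M\<^esub> (\<ominus>\<^bsub>M\<^esub> x) = x"
    by auto
qed

lemma Ob_assoc:
  assumes "M \<in> Ob \<A>" "x \<in> carrier M" "y \<in> carrier M" "z \<in> carrier M"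
  shows "(x \<oplus>\<^bsub>M\<^esub> y) \<oplus>\<^bsub>M\<^esub> z = x \<oplus>\<^bsub>M\<^esub> (y \<oplus>\<^bsub>M\<^esub> z)"
  using abelian_groupE(3)[OF Ob_ab] assms by blast

lemma Ob_comm:
  assumes "M \<in> Ob \<A>" "x \<in> carrier M" "y \<in> carrier M"
  shows "x \<oplus>\<^bsub>M\<^esub> y = y \<oplus>\<^bsub>M\<^esub> x"
  using abelian_groupE(4)[OF Ob_ab] assms by blast

lemma Ob_lcomm:
  assumes "M \<in> Ob \<A>" "x \<in> carrier M" "y \<in> carrier M" "z \<in> carrier M"
  shows "x \<oplus>\<^bsub>M\<^esub> (y \<oplus>\<^bsub>M\<^esub> z) = y \<oplus>\<^bsub>M\<^esub> (x \<oplus>\<^bsub>M\<^esub> z)"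
  using assms Ob_assoc Ob_comm by metis

lemmas Ob_ac = Ob_assoc Ob_comm Ob_lcomm

lemmas Ob_neg_cancel = abelian_group.neg_add_cancel[OF Ob_ab]
lemmas Ob_eq_iff_minus = abelian_group.eq_iff_minus[OF Ob_ab]

lemma Ob_neg_add:
  assumes "M \<in> Ob \<A>" "x \<in> carrier M" "y \<in> carrier M"
  shows "\<ominus>\<^bsub>M\<^esub> (x \<oplus>\<^bsub>M\<^esub> y) = \<ominus>\<^bsub>M\<^esub> x \<oplus>\<^bsub>M\<^esub> \<ominus>\<^bsub>M\<^esub> y"
  using abelian_group.minus_add[OF Ob_ab] assms by blast

lemma Hom_closed: "f \<in> Hom \<A> M N ==> x \<in> carrier M ==> f x \<in> carrier N"
  and Hom_map_add: "f \<in> Hom \<A> M N ==> x \<in> carrier M ==> y \<in> carrier M ==> f (x \<oplus>\<^bsub>M\<^esub> y) = f x \<oplus>\<^bsub>N\<^esub> f y"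
  using Hom_hom[of f M N] by (auto simp: hom_def)

lemma Hom_map_zero:
  assumes "f \<in> Hom \<A> M N" "M \<in> Ob \<A>" "N \<in> Ob \<A>"
  shows "f (zero M) = (zero N)"
proof -
  interpret M: abelian_group M by (rule Ob_ab) fact
  interpret N: abelian_group N by (rule Ob_ab) fact
  have "f (zero M) \<oplus>\<^bsub>N\<^esub> f (zero M) = f (zero M)"
    using Hom_map_add[OF assms(1), of "(zero M)" "(zero M)"] by simp
  then show ?thesis using Hom_closed[OF assms(1), of "(zero M)"] by simp
qed

lemma Hom_map_neg:
  assumes "f \<in> Hom \<A> M N" "M \<in> Ob \<A>" "N \<in> Ob \<A>" "x \<in> carrier M"
  shows "f (\<ominus>\<^bsub>M\<^esub> x) = \<ominus>\<^bsub>N\<^esub> f x"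
proof -
  interpret M: abelian_group M by (rule Ob_ab) fact
  interpret N: abelian_group N by (rule Ob_ab) fact
  have "f (\<ominus>\<^bsub>M\<^esub> x) \<oplus>\<^bsub>N\<^esub> f x = (zero N)"
    using Hom_map_add[OF assms(1), of "\<ominus>\<^bsub>M\<^esub> x" x] assms Hom_map_zero by (simp add: M.l_neg)
  then show ?thesis
    using Hom_closed[OF assms(1)] assms(4) by (intro N.minus_equality[symmetric]) auto
qed

lemmas Hom_map = Hom_closed Hom_map_add Hom_map_zero Hom_map_neg

subsection \<open>Complexes\<close>

lemma cpx_Ob [simp]: "X \<in> complexes \<A> ==> obj X i \<in> Ob \<A>"
  by (simp add: complexes_def)

lemma cpx_diff_Hom: "X \<in> complexes \<A> ==> j = i + 1 ==> diff X i \<in> Hom \<A> (obj X i) (obj X j)"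
  unfolding complexes_def by simp

lemma cpx_diff_closed [simp]:
  "X \<in> complexes \<A> ==> x \<in> carrier (obj X i) ==> j = i + 1 ==> diff X i x \<in> carrier (obj X j)"
  using cpx_diff_Hom Hom_closed by blast

lemma cpx_diff_map [simp]:
  assumes "X \<in> complexes \<A>"
  shows "x \<in> carrier (obj X i) ==> y \<in> carrier (obj X i) ==>
      diff X i (x \<oplus>\<^bsub>obj X i\<^esub> y) = diff X i x \<oplus>\<^bsub>obj X (i + 1)\<^esub> diff X i y"
    "diff X i (zero (obj X i)) = (zero (obj X (i + 1)))"
    "x \<in> carrier (obj X i) ==> diff X i (\<ominus>\<^bsub>obj X i\<^esub> x) = \<ominus>\<^bsub>obj X (i + 1)\<^esub> diff X i x"
  using cpx_diff_Hom[OF assms refl, of i] Hom_map assms by auto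

lemma cpx_diff_diff [simp]:
  assumes "X \<in> complexes \<A>" "x \<in> carrier (obj X i)" "j = i + 1"
  shows "diff X j (diff X i x) = (zero (obj X (j + 1)))"
  using assms unfolding complexes_def by (simp add: add.assoc)

lemma chain_map_Hom: "f \<in> chain_maps \<A> X Y ==> f i \<in> Hom \<A> (obj X i) (obj Y i)"
  by (simp add: chain_maps_def)

lemma chain_map_closed: "f \<in> chain_maps \<A> X Y ==> x \<in> carrier (obj X i) ==> f i x \<in> carrier (obj Y i)"
  using chain_map_Hom Hom_closed by blast

lemma chain_map_add:
  "f \<in> chain_maps \<A> X Y ==> x \<in> carrier (obj X i) ==> y \<in> carrier (obj X i) ==>
    f i (x \<oplus>\<^bsub>obj X i\<^esub> y) = f i x \<oplus>\<^bsub>obj Y i\<^esub> f i y"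
  using chain_map_Hom Hom_map_add by blast

lemma chain_map_zero:
  "f \<in> chain_maps \<A> X Y ==> X \<in> complexes \<A> ==> Y \<in> complexes \<A> ==> f i (zero (obj X i)) = (zero (obj Y i))"
  by (rule Hom_map_zero[OF chain_map_Hom]) auto

lemma chain_map_neg:
  "f \<in> chain_maps \<A> X Y ==> X \<in> complexes \<A> ==> Y \<in> complexes \<A> ==> x \<in> carrier (obj X i) ==>
    f i (\<ominus>\<^bsub>obj X i\<^esub> x) = \<ominus>\<^bsub>obj Y i\<^esub> f i x"
  by (rule Hom_map_neg[OF chain_map_Hom]) auto

lemma chain_map_diff:
  "f \<in> chain_maps \<A> X Y ==> x \<in> carrier (obj X i) ==> j = i + 1 ==> f j (diff X i x) = diff Y i (f i x)"
  by (simp add: chain_maps_def)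

lemmas chain_map = chain_map_closed chain_map_add chain_map_zero chain_map_neg chain_map_diff

lemma chain_mapsI:
  assumes "!!i. f i \<in> Hom \<A> (obj X i) (obj Y i)"
    and "!!i x. x \<in> carrier (obj X i) ==> f (i + 1) (diff X i x) = diff Y i (f i x)"
  shows "f \<in> chain_maps \<A> X Y"
  using assms by (simp add: chain_maps_def)

lemma chain_map_id: "X \<in> complexes \<A> ==> (%i x. x) \<in> chain_maps \<A> X X"
  by (rule chain_mapsI) (simp_all add: Hom_id)

lemma chain_map_comp:
  assumes "f \<in> chain_maps \<A> X Y" "g \<in> chain_maps \<A> Y Z"
    and "X \<in> complexes \<A>" "Y \<in> complexes \<A>" "Z \<in> complexes \<A>"
  shows "(%i x. g i (f i x)) \<in> chain_maps \<A> X Z"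
proof (rule chain_mapsI)
  show "(%x. g i (f i x)) \<in> Hom \<A> (obj X i) (obj Z i)" for i
    by (rule Hom_comp[OF chain_map_Hom[OF assms(1)] chain_map_Hom[OF assms(2)]]) (simp_all add: assms)
  show "g (i + 1) (f (i + 1) (diff X i x)) = diff Z i (g i (f i x))" if "x \<in> carrier (obj X i)" for i x
    using that chain_map_diff[OF assms(1) that refl]
      chain_map_diff[OF assms(2) chain_map_closed[OF assms(1) that] refl] by simp
qed

lemma cocyclesD: "x \<in> cocycles X i ==> x \<in> carrier (obj X i)"
  "x \<in> cocycles X i ==> diff X i x = (zero (obj X (i + 1)))"
  by (auto simp: cocycles_def)

lemma coboundary_cocycle: "X \<in> complexes \<A> ==> x \<in> coboundaries X i ==> x \<in> cocycles X i"
  by (auto simp: cocycles_def coboundaries_def)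

lemma coboundariesI:
  "w \<in> carrier (obj X (i - 1)) ==> x = diff X (i - 1) w ==> x \<in> coboundaries X i"
  by (auto simp: coboundaries_def)

lemma coboundariesE:
  assumes "x \<in> coboundaries X i"
  obtains w where "w \<in> carrier (obj X (i - 1))" "x = diff X (i - 1) w"
  using assms by (auto simp: coboundaries_def)

lemma coboundaries_add:
  assumes "X \<in> complexes \<A>" "x \<in> coboundaries X i" "y \<in> coboundaries X i"
  shows "x \<oplus>\<^bsub>obj X i\<^esub> y \<in> coboundaries X i"
proof -
  obtain v w where "v \<in> carrier (obj X (i - 1))" "x = diff X (i - 1) v"
    "w \<in> carrier (obj X (i - 1))" "y = diff X (i - 1) w"
    using assms(2,3) by (auto elim!: coboundariesE)
  then show ?thesis
    using assms(1) by (intro coboundariesI[where w = "v \<oplus>\<^bsub>obj X (i - 1)\<^esub> w"]) simp_all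
qed

lemma coboundaries_neg:
  assumes "X \<in> complexes \<A>" "x \<in> coboundaries X i"
  shows "\<ominus>\<^bsub>obj X i\<^esub> x \<in> coboundaries X i"
proof -
  obtain w where "w \<in> carrier (obj X (i - 1))" "x = diff X (i - 1) w"
    using assms(2) by (auto elim!: coboundariesE)
  then show ?thesis
    using assms(1) by (intro coboundariesI[where w = "\<ominus>\<^bsub>obj X (i - 1)\<^esub> w"]) simp_all
qed

lemma coboundaries_carrier: "X \<in> complexes \<A> ==> x \<in> coboundaries X i ==> x \<in> carrier (obj X i)"
  by (rule cocyclesD(1)[OF coboundary_cocycle])

lemma coboundaries_zero:
  assumes "X \<in> complexes \<A>"
  shows "(zero (obj X i)) \<in> coboundaries X i"
  using assms by (auto intro!: coboundariesI[where w = "(zero (obj X (i - 1)))"])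

lemma coboundaries_subgroup:
  assumes "X \<in> complexes \<A>"
  shows "additive_subgroup (coboundaries X i) (obj X i)"
proof -
  interpret abelian_group "obj X i" using assms by (intro Ob_ab) simp
  have "subgroup (coboundaries X i) (add_monoid (obj X i))"
  proof (rule add.subgroupI)
    show "coboundaries X i \<subseteq> carrier (obj X i)"
      using coboundary_cocycle[OF assms] by (auto simp: cocycles_def)
    show "coboundaries X i \<noteq> {}" using coboundaries_zero[OF assms] by blast
  qed (use coboundaries_add[OF assms] coboundaries_neg[OF assms] in auto)
  then show ?thesis by (rule additive_subgroup.intro)
qed

lemma chain_map_cocycle:
  assumes "f \<in> chain_maps \<A> X Y" "x \<in> cocycles X i" "X \<in> complexes \<A>" "Y \<in> complexes \<A>"
  shows "f i x \<in> cocycles Y i"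
  using assms chain_map_diff[OF assms(1), of x i "i + 1"]
  by (auto simp: cocycles_def chain_map_zero chain_map_closed)

lemma chain_map_coboundary:
  assumes "f \<in> chain_maps \<A> X Y" "x \<in> coboundaries X i"
  shows "f i x \<in> coboundaries Y i"
  using assms(2) chain_map_closed[OF assms(1)] chain_map_diff[OF assms(1), of _ "i - 1" i]
  by (auto elim!: coboundariesE intro!: coboundariesI)

text \<open>Injectivity and surjectivity on cohomology, spelled out on elements. Injectivity is put
  as triviality of the kernel.\<close>

definition qis :: "('u, 'x) cpx => ('u, 'x) cpx => (int => 'u => 'u) => bool"
  where "qis X Y f \<longleftrightarrow> f \<in> chain_maps \<A> X Y \<and>
    (\<forall>i. \<forall>x\<in>cocycles X i. f i x \<in> coboundaries Y i --> x \<in> coboundaries X i) \<and>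
    (\<forall>i. \<forall>y\<in>cocycles Y i. \<exists>x\<in>cocycles X i. \<exists>b\<in>coboundaries Y i. y = f i x \<oplus>\<^bsub>obj Y i\<^esub> b)"

lemma qisD:
  assumes "qis X Y f"
  shows "f \<in> chain_maps \<A> X Y"
    "x \<in> cocycles X i ==> f i x \<in> coboundaries Y i ==> x \<in> coboundaries X i"
    "y \<in> cocycles Y i ==> \<exists>x\<in>cocycles X i. \<exists>b\<in>coboundaries Y i. y = f i x \<oplus>\<^bsub>obj Y i\<^esub> b"
  using assms by (auto simp: qis_def)

text \<open>Cosets are compared by \<open>coset_eq_iff\<close>; as the map on classes is additive,
  it is injective as soon as only coboundaries become coboundaries. From here on quasi-isomorphisms
  are handled on elements only.\<close>

lemma quasi_isos_iff:
  assumes X: "X \<in> complexes \<A>" and Y: "Y \<in> complexes \<A>"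
  shows "f \<in> quasi_isos \<A> X Y \<longleftrightarrow> qis X Y f"
proof (cases "f \<in> chain_maps \<A> X Y")
  case False
  then show ?thesis by (simp add: quasi_isos_def qis_def)
next
  case f: True
  have map: "cohomology_map Y f i (coboundaries X i +>\<^bsub>obj X i\<^esub> x) = coboundaries Y i +>\<^bsub>obj Y i\<^esub> f i x"
    if "x \<in> cocycles X i" for x i
    unfolding cohomology_map_def using that X Y f
    by (intro hom_set_add_coset Ob_ab Hom_hom chain_map_Hom coboundaries_subgroup)
      (auto simp: cocyclesD chain_map_coboundary)
  have eqX: "coboundaries X i +>\<^bsub>obj X i\<^esub> x = coboundaries X i +>\<^bsub>obj X i\<^esub> y \<longleftrightarrow>
      (\<exists>b\<in>coboundaries X i. x = y \<oplus>\<^bsub>obj X i\<^esub> b)" if "x \<in> cocycles X i" "y \<in> cocycles X i" for x y i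
    using that X by (intro coset_eq_iff Ob_ab coboundaries_subgroup) (auto simp: cocyclesD)
  have eqY: "coboundaries Y i +>\<^bsub>obj Y i\<^esub> x = coboundaries Y i +>\<^bsub>obj Y i\<^esub> y \<longleftrightarrow>
      (\<exists>b\<in>coboundaries Y i. x = y \<oplus>\<^bsub>obj Y i\<^esub> b)" if "x \<in> cocycles Y i" "y \<in> cocycles Y i" for x y i
    using that Y by (intro coset_eq_iff Ob_ab coboundaries_subgroup) (auto simp: cocyclesD)
  note fc = chain_map_cocycle[OF f _ X Y]
  have inj: "inj_on (cohomology_map Y f i) (cohomology X i) \<longleftrightarrow>
      (\<forall>x\<in>cocycles X i. f i x \<in> coboundaries Y i --> x \<in> coboundaries X i)" for i
  proof
    assume L: "inj_on (cohomology_map Y f i) (cohomology X i)"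
    show "\<forall>x\<in>cocycles X i. f i x \<in> coboundaries Y i --> x \<in> coboundaries X i"
    proof (intro ballI impI)
      fix x assume x: "x \<in> cocycles X i" "f i x \<in> coboundaries Y i"
      have z: "(zero (obj X i)) \<in> cocycles X i" using coboundaries_zero[OF X] coboundary_cocycle[OF X] by blast
      have "f i x = f i (zero (obj X i)) \<oplus>\<^bsub>obj Y i\<^esub> f i x"
        using x X Y by (simp add: chain_map_zero[OF f X Y] coboundaries_carrier)
      then have "coboundaries Y i +>\<^bsub>obj Y i\<^esub> f i x = coboundaries Y i +>\<^bsub>obj Y i\<^esub> f i (zero (obj X i))"
        unfolding eqY[OF fc[OF x(1)] fc[OF z]] using x(2) by (rule bexI)
      then have "coboundaries X i +>\<^bsub>obj X i\<^esub> x = coboundaries X i +>\<^bsub>obj X i\<^esub> (zero (obj X i))"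
        using map[OF x(1)] map[OF z] x(1) z
        by - (rule inj_onD[OF L], simp_all add: cohomology_def)
      then obtain b where "b \<in> coboundaries X i" "x = (zero (obj X i)) \<oplus>\<^bsub>obj X i\<^esub> b" using eqX x z by blast
      then show "x \<in> coboundaries X i"
        using X coboundaries_carrier[OF X] by simp
    qed
  next
    assume R: "\<forall>x\<in>cocycles X i. f i x \<in> coboundaries Y i --> x \<in> coboundaries X i"
    show "inj_on (cohomology_map Y f i) (cohomology X i)"
    proof (rule inj_onI)
      fix S T assume "S \<in> cohomology X i" "T \<in> cohomology X i"
        and eq: "cohomology_map Y f i S = cohomology_map Y f i T"
      then obtain x y where xy: "x \<in> cocycles X i" "y \<in> cocycles X i"
        and ST: "S = coboundaries X i +>\<^bsub>obj X i\<^esub> x" "T = coboundaries X i +>\<^bsub>obj X i\<^esub> y"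
        by (auto simp: cohomology_def)
      then obtain b where b: "b \<in> coboundaries Y i" "f i x = f i y \<oplus>\<^bsub>obj Y i\<^esub> b"
        using eq eqY fc map by metis
      have c: "x \<in> carrier (obj X i)" "y \<in> carrier (obj X i)" "b \<in> carrier (obj Y i)"
        using xy b coboundary_cocycle[OF Y] by (auto simp: cocyclesD)
      let ?z = "x \<oplus>\<^bsub>obj X i\<^esub> \<ominus>\<^bsub>obj X i\<^esub> y"
      have z: "?z \<in> cocycles X i"
        using xy X c by (auto simp: cocycles_def Ob_neg_cancel)
      have "f i ?z = b"
        using c X Y b f by (simp add: chain_map Ob_neg_cancel Ob_ac)
      then have "?z \<in> coboundaries X i" using R z b by auto
      moreover have "x = y \<oplus>\<^bsub>obj X i\<^esub> ?z" using c X by (simp add: Ob_neg_cancel Ob_ac)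
      ultimately show "S = T" unfolding ST using eqX xy by blast
    qed
  qed
  have surj: "cohomology_map Y f i ` cohomology X i = cohomology Y i \<longleftrightarrow>
      (\<forall>y\<in>cocycles Y i. \<exists>x\<in>cocycles X i. \<exists>b\<in>coboundaries Y i. y = f i x \<oplus>\<^bsub>obj Y i\<^esub> b)" for i
  proof -
    have eq: "cohomology_map Y f i ` cohomology X i = (%x. coboundaries Y i +>\<^bsub>obj Y i\<^esub> f i x) ` cocycles X i"
      unfolding cohomology_def image_image by (rule image_cong) (simp_all add: map)
    have sub: "(%x. coboundaries Y i +>\<^bsub>obj Y i\<^esub> f i x) ` cocycles X i \<subseteq> cohomology Y i"
      unfolding cohomology_def using fc by (intro image_subsetI imageI)
    have "cohomology_map Y f i ` cohomology X i = cohomology Y i \<longleftrightarrow>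
        cohomology Y i \<subseteq> (%x. coboundaries Y i +>\<^bsub>obj Y i\<^esub> f i x) ` cocycles X i"
      unfolding eq using sub by (intro iffI equalityI) (simp_all only: subset_refl)
    also have "\<dots> \<longleftrightarrow> (\<forall>y\<in>cocycles Y i. \<exists>x\<in>cocycles X i.
        coboundaries Y i +>\<^bsub>obj Y i\<^esub> y = coboundaries Y i +>\<^bsub>obj Y i\<^esub> f i x)"
      unfolding cohomology_def image_subset_iff image_iff ..
    also have "\<dots> \<longleftrightarrow>
        (\<forall>y\<in>cocycles Y i. \<exists>x\<in>cocycles X i. \<exists>b\<in>coboundaries Y i. y = f i x \<oplus>\<^bsub>obj Y i\<^esub> b)"
      by (intro ball_cong bex_cong refl eqY fc)
    finally show ?thesis .
  qed
  show ?thesis unfolding quasi_isos_def qis_def bij_betw_def using inj surj f by (simp add: all_conj_distrib)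
qed

end

text \<open>Biproducts require pairs inside the universe, hence the sort \<open>infinite\<close>.
  What is proved in \<open>mod_cat0\<close> remains available for modules in an arbitrary
  type.\<close>

locale mod_cat = mod_cat0 \<A> kn
  for \<A> :: "('u::infinite, 'x) concrete_cat"
    and bp :: "('u, 'x) ring_scheme => ('u, 'x) ring_scheme => ('u, 'x) ring_scheme" and kn +
  assumes bp_Ob: "M \<in> Ob \<A> ==> N \<in> Ob \<A> ==> bp M N \<in> Ob \<A>"
    and bp_carrier: "carrier (bp M N) = {pr a b | a b. a \<in> carrier M \<and> b \<in> carrier N}"
    and bp_zero: "(zero (bp M N)) = pr (zero M) (zero N)"
    and bp_add: "pr a b \<oplus>\<^bsub>bp M N\<^esub> pr c d = pr (a \<oplus>\<^bsub>M\<^esub> c) (b \<oplus>\<^bsub>N\<^esub> d)"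
    and p1_Hom: "M \<in> Ob \<A> ==> N \<in> Ob \<A> ==> p1 \<in> Hom \<A> (bp M N) M"
    and p2_Hom: "M \<in> Ob \<A> ==> N \<in> Ob \<A> ==> p2 \<in> Hom \<A> (bp M N) N"
    and pr_Hom: "f \<in> Hom \<A> L M ==> g \<in> Hom \<A> L N ==> L \<in> Ob \<A> ==> M \<in> Ob \<A> ==> N \<in> Ob \<A> ==>
          (%x. pr (f x) (g x)) \<in> Hom \<A> L (bp M N)"

context mod_cat0
begin

lemma Ob_emb:
  assumes "M \<in> Ob \<A>"
  shows "x \<in> carrier M ==> y \<in> carrier M ==> emb M (x \<oplus>\<^bsub>M\<^esub> y) = emb M x + emb M y"
    "emb M (zero M) = 0"
    "x \<in> carrier M ==> emb M (\<ominus>\<^bsub>M\<^esub> x) = - emb M x"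
  using assms by (simp_all add: emb_simps Ob_ab)

lemma Ob_eq_iff_emb:
  assumes "M \<in> Ob \<A>" "x \<in> carrier M" "y \<in> carrier M"
  shows "x = y \<longleftrightarrow> emb M x = emb M y"
  by (rule iffI[OF arg_cong emb_eqI[OF _ Ob_ab[OF assms(1)] assms(2,3)]])

lemma cocycles_carrier [simp]: "x \<in> cocycles X i ==> x \<in> carrier (obj X i)"
  by (rule cocyclesD)

lemma cocyclesI: "x \<in> carrier (obj X i) ==> diff X i x = (zero (obj X (i + 1))) ==> x \<in> cocycles X i"
  unfolding cocycles_def by blast

subsection \<open>Cohomologous cocycles\<close>

text \<open>Equality of cohomology classes. On representatives, diagram chases become chains of
  \<open>coh_trans\<close>, \<open>coh_map\<close> and \<open>qis_inj\<close>.\<close>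

definition coh :: "('u, 'x) cpx => int => 'u => 'u => bool"
  where "coh X i x y \<longleftrightarrow> (\<exists>b\<in>coboundaries X i. x = y \<oplus>\<^bsub>obj X i\<^esub> b)"

lemma coh_refl: "X \<in> complexes \<A> ==> x \<in> carrier (obj X i) ==> coh X i x x"
  unfolding coh_def by (rule bexI[OF _ coboundaries_zero]) simp_all

lemma coh_sym:
  assumes "X \<in> complexes \<A>" "y \<in> carrier (obj X i)" "coh X i x y"
  shows "coh X i y x"
proof -
  obtain b where b: "b \<in> coboundaries X i" "x = y \<oplus>\<^bsub>obj X i\<^esub> b"
    using assms(3) unfolding coh_def by blast
  have "y = x \<oplus>\<^bsub>obj X i\<^esub> \<ominus>\<^bsub>obj X i\<^esub> b"
    unfolding b(2) using assms b(1) coboundaries_carrier[OF assms(1) b(1)] by (simp add: Ob_neg_cancel)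
  then show ?thesis unfolding coh_def using coboundaries_neg[OF assms(1) b(1)] by (rule bexI)
qed

lemma coh_trans:
  assumes "X \<in> complexes \<A>" "z \<in> carrier (obj X i)" "coh X i x y" "coh X i y z"
  shows "coh X i x z"
proof -
  obtain b c where b: "b \<in> coboundaries X i" "x = y \<oplus>\<^bsub>obj X i\<^esub> b"
    and c: "c \<in> coboundaries X i" "y = z \<oplus>\<^bsub>obj X i\<^esub> c"
    using assms(3,4) unfolding coh_def by blast
  have "x = z \<oplus>\<^bsub>obj X i\<^esub> (c \<oplus>\<^bsub>obj X i\<^esub> b)"
    unfolding b(2) c(2) using assms b(1) c(1) by (simp add: Ob_assoc coboundaries_carrier)
  then show ?thesis unfolding coh_def using coboundaries_add[OF assms(1) c(1) b(1)] by (rule bexI)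
qed

lemma coh_map:
  assumes "f \<in> chain_maps \<A> X Y" "X \<in> complexes \<A>" "y \<in> carrier (obj X i)" "coh X i x y"
  shows "coh Y i (f i x) (f i y)"
proof -
  obtain b where b: "b \<in> coboundaries X i" "x = y \<oplus>\<^bsub>obj X i\<^esub> b"
    using assms(4) unfolding coh_def by blast
  have "f i x = f i y \<oplus>\<^bsub>obj Y i\<^esub> f i b"
    unfolding b(2) using assms b(1) by (simp add: chain_map_add[OF assms(1)] coboundaries_carrier)
  then show ?thesis unfolding coh_def using chain_map_coboundary[OF assms(1) b(1)] by (rule bexI)
qed

lemma coh_zero_iff:
  assumes "X \<in> complexes \<A>" "x \<in> carrier (obj X i)"
  shows "coh X i x (zero (obj X i)) \<longleftrightarrow> x \<in> coboundaries X i"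
proof
  assume "coh X i x (zero (obj X i))"
  then obtain b where b: "b \<in> coboundaries X i" "x = (zero (obj X i)) \<oplus>\<^bsub>obj X i\<^esub> b" by (auto simp: coh_def)
  then show "x \<in> coboundaries X i" using assms(1) by (simp add: coboundaries_carrier)
next
  assume x: "x \<in> coboundaries X i"
  have "x = (zero (obj X i)) \<oplus>\<^bsub>obj X i\<^esub> x" using assms by simp
  then show "coh X i x (zero (obj X i))" unfolding coh_def using x by (rule bexI)
qed

lemma zero_cocycle: "X \<in> complexes \<A> ==> (zero (obj X i)) \<in> cocycles X i"
  by (rule coboundary_cocycle[OF _ coboundaries_zero])

lemma cocycles_add:
  assumes "X \<in> complexes \<A>" "x \<in> cocycles X i" "y \<in> cocycles X i"
  shows "x \<oplus>\<^bsub>obj X i\<^esub> y \<in> cocycles X i"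
  using assms by (intro cocyclesI) (simp_all add: cocyclesD)

lemma cocycles_neg:
  assumes "X \<in> complexes \<A>" "x \<in> cocycles X i"
  shows "\<ominus>\<^bsub>obj X i\<^esub> x \<in> cocycles X i"
  using assms by (intro cocyclesI) (simp_all add: cocyclesD)

lemma qis_inj:
  assumes q: "qis X Y f" and X: "X \<in> complexes \<A>" and Y: "Y \<in> complexes \<A>"
    and x: "x \<in> cocycles X i" and y: "y \<in> cocycles X i" and c: "coh Y i (f i x) (f i y)"
  shows "coh X i x y"
proof -
  note f = qisD(1)[OF q]
  obtain b where b: "b \<in> coboundaries Y i" "f i x = f i y \<oplus>\<^bsub>obj Y i\<^esub> b"
    using c by (auto simp: coh_def)
  let ?z = "x \<oplus>\<^bsub>obj X i\<^esub> \<ominus>\<^bsub>obj X i\<^esub> y"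
  have z: "?z \<in> cocycles X i" using x y X by (simp add: cocycles_add cocycles_neg)
  have "f i ?z = f i x \<oplus>\<^bsub>obj Y i\<^esub> \<ominus>\<^bsub>obj Y i\<^esub> f i y"
    using x y X Y by (simp add: chain_map_add[OF f] chain_map_neg[OF f])
  also have "\<dots> = b"
    unfolding b(2) using x y X Y b(1)
    by (subst Ob_eq_iff_emb[of "obj Y i"]) (simp_all add: Ob_emb chain_map_closed[OF f] coboundaries_carrier)
  finally have "?z \<in> coboundaries X i" using qisD(2)[OF q z] b by simp
  moreover have "x = y \<oplus>\<^bsub>obj X i\<^esub> ?z"
    using x y X by (subst Ob_eq_iff_emb[of "obj X i"]) (simp_all add: Ob_emb)
  ultimately show ?thesis unfolding coh_def by blast
qed

lemma qis_surj:
  assumes "qis X Y f" "y \<in> cocycles Y i"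
  obtains x where "x \<in> cocycles X i" "coh Y i y (f i x)"
  using qisD(3)[OF assms] unfolding coh_def by blast

lemma qisI:
  assumes f: "f \<in> chain_maps \<A> X Y" and X: "X \<in> complexes \<A>" and Y: "Y \<in> complexes \<A>"
    and inj: "!!i x y. x \<in> cocycles X i ==> y \<in> cocycles X i ==> coh Y i (f i x) (f i y) ==> coh X i x y"
    and surj: "!!i y. y \<in> cocycles Y i ==> \<exists>x\<in>cocycles X i. coh Y i y (f i x)"
  shows "qis X Y f"
  unfolding qis_def
proof (intro conjI allI ballI impI)
  fix i x assume x: "x \<in> cocycles X i" "f i x \<in> coboundaries Y i"
  then have "coh Y i (f i x) (f i (zero (obj X i)))"
    using Y by (simp add: chain_map_zero[OF f X Y] coh_zero_iff chain_map_closed[OF f])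
  then have "coh X i x (zero (obj X i))" by (rule inj[OF x(1) zero_cocycle[OF X]])
  then show "x \<in> coboundaries X i" using x X by (simp add: coh_zero_iff)
qed (use f surj in \<open>simp_all add: coh_def\<close>)

lemma qis_id:
  assumes X: "X \<in> complexes \<A>"
  shows "qis X X (%i x. x)"
proof (rule qisI[OF chain_map_id X X])
  show "\<exists>x\<in>cocycles X i. coh X i y x" if "y \<in> cocycles X i" for i y
    using that X by (intro bexI[of _ y] coh_refl) simp_all
qed (use X in simp_all)

section \<open>Two out of three for quasi-isomorphisms\<close>

context
  fixes X Y Z f g
  assumes X: "X \<in> complexes \<A>" and Y: "Y \<in> complexes \<A>" and Z: "Z \<in> complexes \<A>"
    and f: "f \<in> chain_maps \<A> X Y" and g: "g \<in> chain_maps \<A> Y Z"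
begin

private lemmas gf = chain_map_comp[OF f g X Y Z]
private lemmas fc = chain_map_cocycle[OF f _ X Y]
private lemmas gc = chain_map_cocycle[OF g _ Y Z]

lemma qis_comp:
  assumes qf: "qis X Y f" and qg: "qis Y Z g"
  shows "qis X Z (%i x. g i (f i x))"
proof (rule qisI[OF gf X Z])
  fix i x y assume "x \<in> cocycles X i" "y \<in> cocycles X i" "coh Z i (g i (f i x)) (g i (f i y))"
  then show "coh X i x y"
    by (intro qis_inj[OF qf X Y] qis_inj[OF qg Y Z] fc)
next
  fix i z assume z: "z \<in> cocycles Z i"
  obtain y where y: "y \<in> cocycles Y i" "coh Z i z (g i y)" by (rule qis_surj[OF qg z])
  obtain x where x: "x \<in> cocycles X i" "coh Y i y (f i x)" by (rule qis_surj[OF qf y(1)])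
  have "coh Z i (g i y) (g i (f i x))"
    using x(2) fc[OF x(1)] by (intro coh_map[OF g Y]) simp_all
  then have "coh Z i z (g i (f i x))"
    by (rule coh_trans[OF Z cocycles_carrier[OF gc[OF fc[OF x(1)]]] y(2)])
  then show "\<exists>x\<in>cocycles X i. coh Z i z (g i (f i x))" using x(1) by blast
qed

lemma qis_cancel_left:
  assumes q: "qis X Z (%i x. g i (f i x))" and qg: "qis Y Z g"
  shows "qis X Y f"
proof (rule qisI[OF f X Y])
  fix i x y assume x: "x \<in> cocycles X i" "y \<in> cocycles X i" "coh Y i (f i x) (f i y)"
  then have "coh Z i (g i (f i x)) (g i (f i y))"
    using fc[OF x(2)] by (intro coh_map[OF g Y]) simp_all
  then show "coh X i x y" by (rule qis_inj[OF q X Z x(1,2)])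
next
  fix i y assume y: "y \<in> cocycles Y i"
  obtain x where x: "x \<in> cocycles X i" "coh Z i (g i y) (g i (f i x))" by (rule qis_surj[OF q gc[OF y]])
  then have "coh Y i y (f i x)" by (intro qis_inj[OF qg Y Z y fc])
  then show "\<exists>x\<in>cocycles X i. coh Y i y (f i x)" using x(1) by blast
qed

text \<open>Surjectivity of \<open>f\<close> on cohomology replaces both cocycles of
  \<open>Y\<close> by images of cocycles of \<open>X\<close>, where the composite is
  injective.\<close>

lemma qis_cancel_right:
  assumes q: "qis X Z (%i x. g i (f i x))" and qf: "qis X Y f"
  shows "qis Y Z g"
proof (rule qisI[OF g Y Z])
  fix i x y assume x: "x \<in> cocycles Y i" "y \<in> cocycles Y i" and c: "coh Z i (g i x) (g i y)"
  obtain x' where x': "x' \<in> cocycles X i" "coh Y i x (f i x')" by (rule qis_surj[OF qf x(1)])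
  obtain y' where y': "y' \<in> cocycles X i" "coh Y i y (f i y')" by (rule qis_surj[OF qf x(2)])
  note car = fc[OF x'(1), THEN cocycles_carrier] fc[OF y'(1), THEN cocycles_carrier]
    gc[OF fc[OF x'(1)], THEN cocycles_carrier] gc[OF fc[OF y'(1)], THEN cocycles_carrier]
    gc[OF x(1), THEN cocycles_carrier] gc[OF x(2), THEN cocycles_carrier]
    x(1)[THEN cocycles_carrier] x(2)[THEN cocycles_carrier]
  have "coh Z i (g i (f i x')) (g i x)"
    by (rule coh_sym[OF Z car(3) coh_map[OF g Y car(1) x'(2)]])
  moreover have "coh Z i (g i y) (g i (f i y'))"
    by (rule coh_map[OF g Y car(2) y'(2)])
  ultimately have "coh Z i (g i (f i x')) (g i (f i y'))"
    by (rule coh_trans[OF Z car(4) coh_trans[OF Z car(6) _ c]])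
  then have "coh X i x' y'" by (rule qis_inj[OF q X Z x'(1) y'(1)])
  then have "coh Y i (f i x') (f i y')" using y'(1) by (intro coh_map[OF f X]) simp_all
  then have "coh Y i x (f i y')" by (rule coh_trans[OF Y car(2) x'(2)])
  then show "coh Y i x y" by (rule coh_trans[OF Y car(8) _ coh_sym[OF Y car(2) y'(2)]])
next
  fix i z assume z: "z \<in> cocycles Z i"
  obtain x where x: "x \<in> cocycles X i" "coh Z i z (g i (f i x))" by (rule qis_surj[OF q z])
  then show "\<exists>y\<in>cocycles Y i. coh Z i z (g i y)" by (intro bexI[OF _ fc])
qed

end

text \<open>On a cocycle the term \<open>h (d x)\<close> of the homotopy vanishes and the other one
  is a coboundary.\<close>

lemma homotopic_coh:
  assumes h: "homotopic \<A> X Y f g" and X: "X \<in> complexes \<A>" and Y: "Y \<in> complexes \<A>"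
    and f: "f \<in> chain_maps \<A> X Y" and g: "g \<in> chain_maps \<A> X Y" and x: "x \<in> cocycles X i"
  shows "coh Y i (f i x) (g i x)"
proof -
  obtain h where h: "!!i. h i \<in> Hom \<A> (obj X i) (obj Y (i - 1))" and
    "!!i x. x \<in> carrier (obj X i) ==> f i x = g i x \<oplus>\<^bsub>obj Y i\<^esub> (diff Y (i - 1) (h i x) \<oplus>\<^bsub>obj Y i\<^esub> h (i + 1) (diff X i x))"
    using h unfolding homotopic_def by blast
  then have eq: "f i x = g i x \<oplus>\<^bsub>obj Y i\<^esub> (diff Y (i - 1) (h i x) \<oplus>\<^bsub>obj Y i\<^esub> h (i + 1) (diff X i x))"
    using x by simp
  have hx: "h i x \<in> carrier (obj Y (i - 1))" using Hom_closed[OF h] x by simp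
  have "h (i + 1) (diff X i x) = (zero (obj Y i))"
    using Hom_map_zero[OF h[of "i + 1"]] x X Y by (simp add: cocyclesD)
  then have "f i x = g i x \<oplus>\<^bsub>obj Y i\<^esub> diff Y (i - 1) (h i x)"
    using eq hx Y by simp
  then show ?thesis unfolding coh_def using hx by (intro bexI[OF _ coboundariesI]) simp_all
qed

lemma homotopic_qis:
  assumes h: "homotopic \<A> X Y f g" and X: "X \<in> complexes \<A>" and Y: "Y \<in> complexes \<A>"
    and f: "f \<in> chain_maps \<A> X Y" and g: "g \<in> chain_maps \<A> X Y"
  shows "qis X Y f \<longleftrightarrow> qis X Y g"
proof -
  have c: "coh Y i (f i x) (g i x)" "coh Y i (g i x) (f i x)"
    "f i x \<in> carrier (obj Y i)" "g i x \<in> carrier (obj Y i)" if "x \<in> cocycles X i" for i x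
    using homotopic_coh[OF h X Y f g that] coh_sym[OF Y _ homotopic_coh[OF h X Y f g that]]
      chain_map_closed[OF f] chain_map_closed[OF g] that by simp_all
  show ?thesis
  proof
    assume q: "qis X Y f"
    show "qis X Y g"
    proof (rule qisI[OF g X Y])
      fix i x y assume x: "x \<in> cocycles X i" "y \<in> cocycles X i" "coh Y i (g i x) (g i y)"
      have "coh Y i (f i x) (f i y)"
        by (rule coh_trans[OF Y c(3)[OF x(2)] coh_trans[OF Y c(4)[OF x(2)] c(1)[OF x(1)] x(3)] c(2)[OF x(2)]])
      then show "coh X i x y" by (rule qis_inj[OF q X Y x(1,2)])
    next
      fix i y assume "y \<in> cocycles Y i"
      then obtain x where x: "x \<in> cocycles X i" "coh Y i y (f i x)" by (rule qis_surj[OF q])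
      then show "\<exists>x\<in>cocycles X i. coh Y i y (g i x)"
        by (intro bexI[of _ x] coh_trans[OF Y c(4)[OF x(1)] x(2) c(1)[OF x(1)]] x(1))
    qed
  next
    assume q: "qis X Y g"
    show "qis X Y f"
    proof (rule qisI[OF f X Y])
      fix i x y assume x: "x \<in> cocycles X i" "y \<in> cocycles X i" "coh Y i (f i x) (f i y)"
      have "coh Y i (g i x) (g i y)"
        by (rule coh_trans[OF Y c(4)[OF x(2)] coh_trans[OF Y c(3)[OF x(2)] c(2)[OF x(1)] x(3)] c(1)[OF x(2)]])
      then show "coh X i x y" by (rule qis_inj[OF q X Y x(1,2)])
    next
      fix i y assume "y \<in> cocycles Y i"
      then obtain x where x: "x \<in> cocycles X i" "coh Y i y (g i x)" by (rule qis_surj[OF q])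
      then show "\<exists>x\<in>cocycles X i. coh Y i y (f i x)"
        by (intro bexI[of _ x] coh_trans[OF Y c(3)[OF x(1)] x(2) c(2)[OF x(1)]] x(1))
    qed
  qed
qed

lemma homotopic_refl:
  assumes X: "X \<in> complexes \<A>" and Y: "Y \<in> complexes \<A>" and f: "f \<in> chain_maps \<A> X Y"
  shows "homotopic \<A> X Y f f"
  unfolding homotopic_def
proof (intro exI[of _ "%i x. (zero (obj Y (i - 1)))"] allI conjI ballI)
  fix i x assume x: "x \<in> carrier (obj X i)"
  have "diff Y (i - 1) (zero (obj Y (i - 1))) = (zero (obj Y i))" using cpx_diff_map(2)[OF Y, of "i - 1"] by simp
  then show "f i x = f i x \<oplus>\<^bsub>obj Y i\<^esub> (diff Y (i - 1) (zero (obj Y (i - 1))) \<oplus>\<^bsub>obj Y i\<^esub> (zero (obj Y (i + 1 - 1))))"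
    using Y chain_map_closed[OF f x] by simp
qed (use X Y in \<open>simp add: Hom_zero\<close>)

subsection \<open>Isomorphism in the derived category\<close>

text \<open>The roofs \<open>(Z, s, t)\<close> and \<open>(Z, t, s)\<close> are inverse to each
  other: with identities completing the squares, their composites are \<open>(Z, s, s)\<close> and
  \<open>(Z, t, t)\<close>, which represent identities.\<close>

lemma derived_isoI:
  assumes X: "X \<in> complexes \<A>" and Y: "Y \<in> complexes \<A>" and Z: "Z \<in> complexes \<A>"
    and s: "qis Z X s" and t: "qis Z Y t"
  shows "derived_iso \<A> X Y"
proof -
  have r: "(Z, s, t) \<in> roofs \<A> X Y" "(Z, t, s) \<in> roofs \<A> Y X"
    using assms by (simp_all add: roofs_def quasi_isos_iff qisD)
  have c: "(Z, s', s') \<in> roof_composites \<A> V (Z, s', t') (Z, t', s')"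
    if "t' \<in> chain_maps \<A> Z V" "V \<in> complexes \<A>" for V s' t'
    unfolding roof_composites_def using that Z
    by (auto simp: comp_def quasi_isos_iff qis_id chain_map_id homotopic_refl
        intro!: exI[of _ "%i x. x"])
  have e: "roof_eq \<A> V V (Z, s', s') (id_roof V)" if "qis Z V s'" "V \<in> complexes \<A>" for V s'
    unfolding roof_eq_def id_roof_def prod.case using that Z qisD(1)[OF that(1)]
    by (intro bexI[of _ Z] bexI[of _ "%i x. x"] bexI[of _ s'] conjI)
      (simp_all add: comp_def quasi_isos_iff chain_map_id homotopic_refl)
  show ?thesis unfolding derived_iso_def
    using X Y r c[OF qisD(1)[OF t] Y] c[OF qisD(1)[OF s] X] e[OF s X] e[OF t Y] by blast
qed

end

lemma int_index_simps [simp]: "(i::int) + 1 + 1 = i + 2" "(i::int) - 1 + 2 = i + 1" "(i::int) + 2 - 1 = i + 1"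
  by simp_all

context mod_cat0
begin

text \<open>The definition asks for inverse roofs, whose second legs are mere chain maps. One
  composite makes \<open>f\<close> injective on cohomology and the other makes it surjective, so the
  first roof already has two quasi-isomorphisms as legs.\<close>

lemma derived_isoE:
  assumes "derived_iso \<A> X Y"
  obtains Z s t where "X \<in> complexes \<A>" "Y \<in> complexes \<A>" "Z \<in> complexes \<A>" "qis Z X s" "qis Z Y t"
proof -
  obtain Z s f W t g \<rho> \<rho>' where X: "X \<in> complexes \<A>" and Y: "Y \<in> complexes \<A>"
    and r: "(Z, s, f) \<in> roofs \<A> X Y" "(W, t, g) \<in> roofs \<A> Y X"
    and c: "\<rho> \<in> roof_composites \<A> Y (Z, s, f) (W, t, g)" "\<rho>' \<in> roof_composites \<A> X (W, t, g) (Z, s, f)"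
    and e: "roof_eq \<A> X X \<rho> (id_roof X)" "roof_eq \<A> Y Y \<rho>' (id_roof Y)"
    using assms unfolding derived_iso_def by fast
  have Z: "Z \<in> complexes \<A>" and W: "W \<in> complexes \<A>" and s: "qis Z X s" and t: "qis W Y t"
    and f: "f \<in> chain_maps \<A> Z Y" and g: "g \<in> chain_maps \<A> W X"
    using r X Y by (auto simp: roofs_def quasi_isos_iff)
  note sc = qisD(1)[OF s] and tc = qisD(1)[OF t]
  \<comment> \<open>A common roof \<open>V\<close> shows that \<open>s u a\<close> and
    \<open>g v a\<close> are both homotopic to the same map \<open>a'\<close>. Since
    \<open>s u a\<close> is a quasi-isomorphism, so is \<open>g v a\<close>; \<open>a\<close> is one
    by cancelling \<open>s u\<close>, hence so is \<open>g v\<close>.\<close>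
  have key: "\<exists>U u v. U \<in> complexes \<A> \<and> qis U Z u \<and> v \<in> chain_maps \<A> U W \<and>
      homotopic \<A> U Y (%i x. f i (u i x)) (%i x. t i (v i x)) \<and> qis U X (%i x. g i (v i x))"
    if X: "X \<in> complexes \<A>" and Y: "Y \<in> complexes \<A>" and Z: "Z \<in> complexes \<A>" and W: "W \<in> complexes \<A>"
      and s: "qis Z X s" and f: "f \<in> chain_maps \<A> Z Y" and g: "g \<in> chain_maps \<A> W X"
      and c: "\<rho> \<in> roof_composites \<A> Y (Z, s, f) (W, t, g)" and e: "roof_eq \<A> X X \<rho> (id_roof X)"
    for X Y Z W s f t g \<rho>
  proof -
    note sc = qisD(1)[OF s]
    obtain U u v where U: "U \<in> complexes \<A>" and u: "qis U Z u" and v: "v \<in> chain_maps \<A> U W"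
      and h: "homotopic \<A> U Y (%i x. f i (u i x)) (%i x. t i (v i x))"
      and \<rho>: "\<rho> = (U, %i x. s i (u i x), %i x. g i (v i x))"
      using c Z unfolding roof_composites_def prod.case by (auto simp: comp_def quasi_isos_iff)
    note uc = qisD(1)[OF u]
    obtain V a a' where V: "V \<in> complexes \<A>" and a: "a \<in> chain_maps \<A> V U" and a': "a' \<in> chain_maps \<A> V X"
      and q: "qis V X (%i x. s i (u i (a i x)))"
      and h1: "homotopic \<A> V X (%i x. s i (u i (a i x))) a'"
      and h2: "homotopic \<A> V X (%i x. g i (v i (a i x))) a'"
      using e X unfolding roof_eq_def id_roof_def \<rho> prod.case by (auto simp: comp_def quasi_isos_iff)
    note su = chain_map_comp[OF uc sc U Z X] and gv = chain_map_comp[OF v g U W X]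
    note sua = chain_map_comp[OF a su V U X] and gva = chain_map_comp[OF a gv V U X]
    have qa: "qis V U a" by (rule qis_cancel_left[OF V U X a su q qis_comp[OF U Z X uc sc u s]])
    have "qis V X a'" using homotopic_qis[OF h1 V X sua a'] q by simp
    then have "qis V X (%i x. g i (v i (a i x)))" using homotopic_qis[OF h2 V X gva a'] by simp
    then have "qis U X (%i x. g i (v i x))" by (rule qis_cancel_right[OF V U X a gv _ qa])
    then show ?thesis using U u v h by blast
  qed
  obtain U u v where U: "U \<in> complexes \<A>" and u: "qis U Z u" and v: "v \<in> chain_maps \<A> U W"
    and h: "homotopic \<A> U Y (%i x. f i (u i x)) (%i x. t i (v i x))" and gv: "qis U X (%i x. g i (v i x))"
    using key[OF X Y Z W s f g c(1) e(1)] by blast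
  obtain U' u' v' where U': "U' \<in> complexes \<A>" and v': "v' \<in> chain_maps \<A> U' Z"
    and fv: "qis U' Y (%i x. f i (v' i x))"
    using key[OF Y X W Z t g f c(2) e(2)] by blast
  note uc = qisD(1)[OF u]
  note fu = chain_map_comp[OF uc f U Z Y] and tv = chain_map_comp[OF v tc U W Y]
  have "qis Z Y f"
  proof (rule qisI[OF f Z Y])
    \<comment> \<open>Injectivity: the classes are lifted along \<open>u\<close> to
      \<open>U\<close>, where \<open>f u\<close> is homotopic to \<open>t v\<close>. Cancelling
      \<open>t\<close>, applying \<open>g\<close> and cancelling \<open>g v\<close> leads back to
      \<open>U\<close>.\<close>
    fix i x y assume x: "x \<in> cocycles Z i" and y: "y \<in> cocycles Z i" and xy: "coh Y i (f i x) (f i y)"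
    obtain x' where x': "x' \<in> cocycles U i" "coh Z i x (u i x')" by (rule qis_surj[OF u x])
    obtain y' where y': "y' \<in> cocycles U i" "coh Z i y (u i y')" by (rule qis_surj[OF u y])
    note cyc = chain_map_cocycle[OF uc x'(1) U Z] chain_map_cocycle[OF uc y'(1) U Z]
      chain_map_cocycle[OF v x'(1) U W] chain_map_cocycle[OF v y'(1) U W]
    note fc = chain_map_cocycle[OF f _ Z Y] and tcc = chain_map_cocycle[OF tc _ W Y]
    note car = cocycles_carrier[OF cyc(1)] cocycles_carrier[OF cyc(2)]
      cocycles_carrier[OF cyc(3)] cocycles_carrier[OF cyc(4)]
      cocycles_carrier[OF fc[OF x]] cocycles_carrier[OF fc[OF y]]
      cocycles_carrier[OF fc[OF cyc(1)]] cocycles_carrier[OF fc[OF cyc(2)]]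
      cocycles_carrier[OF tcc[OF cyc(3)]] cocycles_carrier[OF tcc[OF cyc(4)]]
    have 1: "coh Y i (f i (u i x')) (t i (v i x'))" "coh Y i (f i (u i y')) (t i (v i y'))"
      using homotopic_coh[OF h U Y fu tv] x' y' by simp_all
    have 2: "coh Y i (f i x) (f i (u i x'))" "coh Y i (f i y) (f i (u i y'))"
      by (rule coh_map[OF f Z car(1) x'(2)], rule coh_map[OF f Z car(2) y'(2)])
    have "coh Y i (f i (u i x')) (f i (u i y'))"
      by (rule coh_trans[OF Y car(8) coh_trans[OF Y car(6) coh_sym[OF Y car(7) 2(1)] xy] 2(2)])
    then have "coh Y i (t i (v i x')) (t i (v i y'))"
      by (rule coh_trans[OF Y car(10) coh_trans[OF Y car(8) coh_sym[OF Y car(9) 1(1)]] 1(2)])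
    then have "coh W i (v i x') (v i y')" by (rule qis_inj[OF t W Y cyc(3,4)])
    then have "coh X i (g i (v i x')) (g i (v i y'))" by (rule coh_map[OF g W car(4)])
    then have "coh U i x' y'" by (rule qis_inj[OF gv U X x'(1) y'(1)])
    then have "coh Z i (u i x') (u i y')" by (rule coh_map[OF uc U cocycles_carrier[OF y'(1)]])
    then show "coh Z i x y"
      by (rule coh_trans[OF Z cocycles_carrier[OF y] coh_trans[OF Z car(2) x'(2)] coh_sym[OF Z car(2) y'(2)]])
  next
    fix i y assume "y \<in> cocycles Y i"
    then obtain x where x: "x \<in> cocycles U' i" "coh Y i y (f i (v' i x))" by (rule qis_surj[OF fv])
    then show "\<exists>x\<in>cocycles Z i. coh Y i y (f i x)"
      by (intro bexI[of _ "v' i x"] chain_map_cocycle[OF v' _ U' Z])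
  qed
  then show thesis using that X Y Z s by blast
qed

subsection \<open>Mapping cones\<close>

lemma qis_surj_diff:
  assumes "qis X Y f" "y \<in> cocycles Y i"
  obtains x w where "x \<in> cocycles X i" "w \<in> carrier (obj Y (i - 1))"
    "y = f i x \<oplus>\<^bsub>obj Y i\<^esub> diff Y (i - 1) w"
  using qisD(3)[OF assms] by (auto simp: coboundaries_def)

lemma complexesI:
  assumes "!!i. obj X i \<in> Ob \<A>" "!!i. diff X i \<in> Hom \<A> (obj X i) (obj X (i + 1))"
    "!!i x. x \<in> carrier (obj X i) ==> diff X (i + 1) (diff X i x) = (zero (obj X (i + 2)))"
  shows "X \<in> complexes \<A>"
  unfolding complexes_def using assms by simp

end

context mod_cat
begin

lemma bp_mem [simp]: "pr a b \<in> carrier (bp M N) \<longleftrightarrow> a \<in> carrier M \<and> b \<in> carrier N"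
  by (auto simp: bp_carrier)

lemma bpE:
  assumes "z \<in> carrier (bp M N)"
  obtains a b where "z = pr a b" "a \<in> carrier M" "b \<in> carrier N"
  using assms by (auto simp: bp_carrier)

lemma bp_neg:
  assumes "M \<in> Ob \<A>" "N \<in> Ob \<A>" "a \<in> carrier M" "b \<in> carrier N"
  shows "\<ominus>\<^bsub>bp M N\<^esub> pr a b = pr (\<ominus>\<^bsub>M\<^esub> a) (\<ominus>\<^bsub>N\<^esub> b)"
  using Hom_map_neg[OF p1_Hom bp_Ob, of M N "pr a b"] Hom_map_neg[OF p2_Hom bp_Ob, of M N "pr a b"]
    Ob_closed(3)[OF bp_Ob, of M N "pr a b"] assms by (auto elim!: bpE)

definition cone :: "('u, 'x) cpx => ('u, 'x) cpx => (int => 'u => 'u) => ('u, 'x) cpx"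
  where "cone Z X t = \<lparr>obj = (%i. bp (obj Z (i + 1)) (obj X i)),
    diff = (%i z. pr (\<ominus>\<^bsub>obj Z (i + 2)\<^esub> diff Z (i + 1) (p1 z)) (t (i + 1) (p1 z) \<oplus>\<^bsub>obj X (i + 1)\<^esub> diff X i (p2 z)))\<rparr>"

lemma cone_sel [simp]:
  "obj (cone Z X t) i = bp (obj Z (i + 1)) (obj X i)"
  "diff (cone Z X t) i (pr a b) =
    pr (\<ominus>\<^bsub>obj Z (i + 2)\<^esub> diff Z (i + 1) a) (t (i + 1) a \<oplus>\<^bsub>obj X (i + 1)\<^esub> diff X i b)"
  by (simp_all add: cone_def)

context
  fixes X Z t
  assumes X: "X \<in> complexes \<A>" and Z: "Z \<in> complexes \<A>" and t: "t \<in> chain_maps \<A> Z X"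
begin

lemma cone_complex: "cone Z X t \<in> complexes \<A>"
proof (rule complexesI)
  show "obj (cone Z X t) i \<in> Ob \<A>" for i using X Z by (simp add: bp_Ob)
  show "diff (cone Z X t) i \<in> Hom \<A> (obj (cone Z X t) i) (obj (cone Z X t) (i + 1))" for i
  proof -
    have 1: "p1 \<in> Hom \<A> (bp (obj Z (i + 1)) (obj X i)) (obj Z (i + 1))"
      "p2 \<in> Hom \<A> (bp (obj Z (i + 1)) (obj X i)) (obj X i)"
      using X Z by (simp_all add: p1_Hom p2_Hom)
    have B: "bp (obj Z (i + 1)) (obj X i) \<in> Ob \<A>" using X Z by (simp add: bp_Ob)
    have d: "diff Z (i + 1) \<in> Hom \<A> (obj Z (i + 1)) (obj Z (i + 2))"
       "diff X i \<in> Hom \<A> (obj X i) (obj X (i + 1))" "t (i + 1) \<in> Hom \<A> (obj Z (i + 1)) (obj X (i + 1))"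
      using cpx_diff_Hom[OF Z, of "i + 2" "i + 1"] cpx_diff_Hom[OF X] chain_map_Hom[OF t] by simp_all
    show ?thesis unfolding cone_def cpx.simps add.assoc one_add_one
      by (intro pr_Hom Hom_neg Hom_add Hom_comp[OF 1(1) d(1)] Hom_comp[OF 1(1) d(3)] Hom_comp[OF 1(2) d(2)] B)
        (simp_all add: X Z)
  qed
  fix i x assume "x \<in> carrier (obj (cone Z X t) i)"
  then obtain a b where x: "x = pr a b" "a \<in> carrier (obj Z (i + 1))" "b \<in> carrier (obj X i)"
    by (auto elim: bpE)
  have d: "diff X (i + 1) (t (i + 1) a) = t (i + 2) (diff Z (i + 1) a)"
    using chain_map_diff[OF t x(2), of "i + 2"] by simp
  have "t (i + 2) (diff Z (i + 1) a) \<in> carrier (obj X (i + 2))"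
    using chain_map_closed[OF t] x Z by simp
  then show "diff (cone Z X t) (i + 1) (diff (cone Z X t) i x) = (zero (obj (cone Z X t) (i + 2)))"
    using x X Z d chain_map_closed[OF t x(2)] cpx_diff_map(3)[OF Z, of "diff Z (i + 1) a" "i + 2"]
    by (simp add: bp_zero add.commute chain_map_neg[OF t Z X] Ob_neg_cancel)
qed

text \<open>For a cocycle \<open>(a, b)\<close> of the cone, \<open>a\<close> is a cocycle and
  \<open>t a\<close> is the differential of \<open>- b\<close>. Injectivity of \<open>t\<close> on
  cohomology gives \<open>a = d a0\<close>; surjectivity, applied to the cocycle
  \<open>t a0 + b\<close>, gives the cocycle \<open>c\<close> by which \<open>a0\<close> is
  corrected. The cone differential then takes \<open>(- a0 + c, e)\<close> to
  \<open>(a, b)\<close>.\<close>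

lemma cone_acyclic:
  assumes q: "qis Z X t"
  shows "acyclic_cpx (cone Z X t)"
  unfolding acyclic_cpx_def
proof (intro allI equalityI subsetI)
  fix i x assume x: "x \<in> cocycles (cone Z X t) i"
  obtain a b where ab: "x = pr a b" "a \<in> carrier (obj Z (i + 1))" "b \<in> carrier (obj X i)"
    using cocyclesD(1)[OF x] by (auto elim: bpE)
  have d: "\<ominus>\<^bsub>obj Z (i + 2)\<^esub> diff Z (i + 1) a = (zero (obj Z (i + 2)))"
    "t (i + 1) a \<oplus>\<^bsub>obj X (i + 1)\<^esub> diff X i b = (zero (obj X (i + 1)))"
    using cocyclesD(2)[OF x] ab by (simp_all add: bp_zero)
  have da: "diff Z (i + 1) a = (zero (obj Z (i + 2)))"
  proof -
    have "diff Z (i + 1) a = \<ominus>\<^bsub>obj Z (i + 2)\<^esub> (\<ominus>\<^bsub>obj Z (i + 2)\<^esub> diff Z (i + 1) a)" using ab(2) Z by simp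
    also have "\<dots> = (zero (obj Z (i + 2)))" unfolding d(1) using Z by simp
    finally show ?thesis .
  qed
  have ta: "t (i + 1) a = diff X i (\<ominus>\<^bsub>obj X i\<^esub> b)"
  proof -
    have "t (i + 1) a = t (i + 1) a \<oplus>\<^bsub>obj X (i + 1)\<^esub> diff X i b \<oplus>\<^bsub>obj X (i + 1)\<^esub> \<ominus>\<^bsub>obj X (i + 1)\<^esub> diff X i b"
      using ab X chain_map_closed[OF t ab(2)] by (simp add: Ob_neg_cancel)
    then show ?thesis unfolding d(2) using ab X by simp
  qed
  have "a \<in> coboundaries Z (i + 1)"
  proof (rule qisD(2)[OF q])
    show "a \<in> cocycles Z (i + 1)" using ab da by (intro cocyclesI) (simp_all add: add.commute)
    show "t (i + 1) a \<in> coboundaries X (i + 1)"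
      using ab ta X by (intro coboundariesI[where w = "\<ominus>\<^bsub>obj X i\<^esub> b"]) simp_all
  qed
  then obtain a0 where a0: "a0 \<in> carrier (obj Z i)" "a = diff Z i a0" by (auto elim: coboundariesE)
  note ta0 = chain_map_closed[OF t a0(1)]
  have "t i a0 \<oplus>\<^bsub>obj X i\<^esub> b \<in> cocycles X i"
    using a0 ab X ta0 d(2) chain_map_diff[OF t a0(1) refl] by (intro cocyclesI) simp_all
  then obtain c e where c: "c \<in> cocycles Z i" and e: "e \<in> carrier (obj X (i - 1))" and
    eq: "t i a0 \<oplus>\<^bsub>obj X i\<^esub> b = t i c \<oplus>\<^bsub>obj X i\<^esub> diff X (i - 1) e"
    by (rule qis_surj_diff[OF q])
  note tc = chain_map_closed[OF t cocycles_carrier[OF c]]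
  let ?a = "\<ominus>\<^bsub>obj Z i\<^esub> a0 \<oplus>\<^bsub>obj Z i\<^esub> c"
  have de: "diff X (i - 1) e \<in> carrier (obj X i)" using X e by simp
  have "b = \<ominus>\<^bsub>obj X i\<^esub> t i a0 \<oplus>\<^bsub>obj X i\<^esub> (t i a0 \<oplus>\<^bsub>obj X i\<^esub> b)"
    using ab X ta0 by (simp add: Ob_neg_cancel)
  also have "\<dots> = t i ?a \<oplus>\<^bsub>obj X i\<^esub> diff X (i - 1) e"
    unfolding eq using X Z c a0 ta0 tc de
    by (simp add: Ob_assoc chain_map_add[OF t] chain_map_neg[OF t Z X])
  finally have b: "b = t i ?a \<oplus>\<^bsub>obj X i\<^esub> diff X (i - 1) e" .
  have a: "a = \<ominus>\<^bsub>obj Z (i + 1)\<^esub> diff Z i ?a"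
    using a0 Z c by (simp add: cocyclesD)
  show "x \<in> coboundaries (cone Z X t) i"
    using a b ab e a0 c Z
    by (intro coboundariesI[where w = "pr ?a e"]) simp_all
next
  fix i x assume "x \<in> coboundaries (cone Z X t) i"
  then show "x \<in> cocycles (cone Z X t) i" by (rule coboundary_cocycle[OF cone_complex])
qed

end

text \<open>The chain map \<open>(0, f)\<close> into the cone of \<open>t\<close> is null-homotopic,
  because the cone is acyclic. The first component of the null homotopy is the lift
  \<open>g\<close>, the second is the homotopy between \<open>f\<close> and
  \<open>t g\<close>.\<close>

lemma lift_along_qis:
  assumes P: "K_projective \<A> P" and Z: "Z \<in> complexes \<A>" and X: "X \<in> complexes \<A>"
    and q: "qis Z X t" and f: "f \<in> chain_maps \<A> P X"
  obtains g where "g \<in> chain_maps \<A> P Z" "homotopic \<A> P X f (%i x. t i (g i x))"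
proof -
  note t = qisD(1)[OF q]
  have PC: "P \<in> complexes \<A>" using P by (simp add: K_projective_def)
  let ?C = "cone Z X t"
  note C = cone_complex[OF X Z t]
  have F: "(%i x. pr (zero (obj Z (i + 1))) (f i x)) \<in> chain_maps \<A> P ?C"
  proof (rule chain_mapsI)
    show "(%x. pr (zero (obj Z (i + 1))) (f i x)) \<in> Hom \<A> (obj P i) (obj ?C i)" for i
      unfolding cone_sel using PC X Z by (intro pr_Hom Hom_zero chain_map_Hom[OF f]) simp_all
    fix i x assume x: "x \<in> carrier (obj P i)"
    then show "pr (zero (obj Z (i + 1 + 1))) (f (i + 1) (diff P i x)) = diff ?C i (pr (zero (obj Z (i + 1))) (f i x))"
      using X Z chain_map_closed[OF f x]
      by (simp add: chain_map_zero[OF t Z X] chain_map_diff[OF f x] add.commute)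
  qed
  have "homotopic \<A> P ?C (%i x. pr (zero (obj Z (i + 1))) (f i x)) (%i x. (zero (obj ?C i)))"
    using P C F cone_acyclic[OF X Z t q] unfolding K_projective_def by blast
  then obtain h where h: "!!i. h i \<in> Hom \<A> (obj P i) (obj ?C (i - 1))" and
    eq: "!!i x. x \<in> carrier (obj P i) ==> pr (zero (obj Z (i + 1))) (f i x) =
      (zero (obj ?C i)) \<oplus>\<^bsub>obj ?C i\<^esub> (diff ?C (i - 1) (h i x) \<oplus>\<^bsub>obj ?C i\<^esub> h (i + 1) (diff P i x))"
    unfolding homotopic_def by blast
  define \<alpha> where "\<alpha> = (%i x. p1 (h i x))"
  define \<beta> where "\<beta> = (%i x. p2 (h i x))"
  have h': "h i \<in> Hom \<A> (obj P i) (bp (obj Z i) (obj X (i - 1)))" for i using h[of i] by simp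
  have \<alpha>: "\<alpha> i \<in> Hom \<A> (obj P i) (obj Z i)" for i
    unfolding \<alpha>_def using PC X Z by (intro Hom_comp[OF h' p1_Hom] bp_Ob) simp_all
  have \<beta>: "\<beta> i \<in> Hom \<A> (obj P i) (obj X (i - 1))" for i
    unfolding \<beta>_def using PC X Z by (intro Hom_comp[OF h' p2_Hom] bp_Ob) simp_all
  have hp: "h i x = pr (\<alpha> i x) (\<beta> i x)" if "x \<in> carrier (obj P i)" for i x
    using Hom_closed[OF h' that] by (auto simp: \<alpha>_def \<beta>_def elim: bpE)
  have eqs: "(zero (obj Z (i + 1))) = \<ominus>\<^bsub>obj Z (i + 1)\<^esub> diff Z i (\<alpha> i x) \<oplus>\<^bsub>obj Z (i + 1)\<^esub> \<alpha> (i + 1) (diff P i x) \<and>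
    f i x = (t i (\<alpha> i x) \<oplus>\<^bsub>obj X i\<^esub> diff X (i - 1) (\<beta> i x)) \<oplus>\<^bsub>obj X i\<^esub> \<beta> (i + 1) (diff P i x)"
    if x: "x \<in> carrier (obj P i)" for i x
  proof -
    have dx: "diff P i x \<in> carrier (obj P (i + 1))" using x PC by simp
    have c: "\<alpha> i x \<in> carrier (obj Z i)" "\<beta> i x \<in> carrier (obj X (i - 1))"
      "\<alpha> (i + 1) (diff P i x) \<in> carrier (obj Z (i + 1))" "\<beta> (i + 1) (diff P i x) \<in> carrier (obj X i)"
      using Hom_closed[OF \<alpha> x] Hom_closed[OF \<beta> x] Hom_closed[OF \<alpha> dx] Hom_closed[OF \<beta> dx] by simp_all
    have i: "i - 1 + 2 = i + 1" by simp
    show ?thesis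
      using eq[OF x] c X Z chain_map_closed[OF t c(1)] cone_sel(2)[of Z X t "i - 1" "\<alpha> i x" "\<beta> i x"]
      unfolding hp[OF x] hp[OF dx] i by (simp add: bp_zero bp_add)
  qed
  have "\<alpha> \<in> chain_maps \<A> P Z"
  proof (rule chain_mapsI[OF \<alpha>])
    fix i x assume x: "x \<in> carrier (obj P i)"
    have dx: "diff P i x \<in> carrier (obj P (i + 1))" using x PC by simp
    have c: "diff Z i (\<alpha> i x) \<in> carrier (obj Z (i + 1))" "\<alpha> (i + 1) (diff P i x) \<in> carrier (obj Z (i + 1))"
      using Hom_closed[OF \<alpha> x] Hom_closed[OF \<alpha> dx] Z by simp_all
    have "diff Z i (\<alpha> i x) = diff Z i (\<alpha> i x) \<oplus>\<^bsub>obj Z (i + 1)\<^esub> (zero (obj Z (i + 1)))" using c Z by simp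
    also have "\<dots> = \<alpha> (i + 1) (diff P i x)"
      using eqs[OF x] c Z by (simp add: Ob_neg_cancel)
    finally show "\<alpha> (i + 1) (diff P i x) = diff Z i (\<alpha> i x)" ..
  qed
  moreover have "homotopic \<A> P X f (%i x. t i (\<alpha> i x))"
    unfolding homotopic_def
  proof (intro exI[of _ \<beta>] allI conjI ballI \<beta>)
    fix i x assume x: "x \<in> carrier (obj P i)"
    have dx: "diff P i x \<in> carrier (obj P (i + 1))" using x PC by simp
    have c: "t i (\<alpha> i x) \<in> carrier (obj X i)" "diff X (i - 1) (\<beta> i x) \<in> carrier (obj X i)"
      "\<beta> (i + 1) (diff P i x) \<in> carrier (obj X i)"
      using chain_map_closed[OF t Hom_closed[OF \<alpha> x]] Hom_closed[OF \<beta> x] Hom_closed[OF \<beta> dx] X by simp_all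
    show "f i x = t i (\<alpha> i x) \<oplus>\<^bsub>obj X i\<^esub> (diff X (i - 1) (\<beta> i x) \<oplus>\<^bsub>obj X i\<^esub> \<beta> (i + 1) (diff P i x))"
      using eqs[OF x] c X by (simp add: Ob_assoc)
  qed
  ultimately show thesis by (rule that)
qed

end

context mod_cat0
begin

lemma K_projective_complex: "K_projective \<A> P ==> P \<in> complexes \<A>"
  by (simp add: K_projective_def)

text \<open>The null homotopy is constructed by descending induction from the top degree.\<close>

lemma bounded_projective_K_projective:
  assumes P: "P \<in> complexes \<A>" and proj: "!!i. projective \<A> (obj P i)"
    and top: "!!i. i > n ==> carrier (obj P i) = {(zero (obj P i))}"
  shows "K_projective \<A> P"
  unfolding K_projective_def
proof (intro conjI ballI impI)
  fix N f assume N: "N \<in> complexes \<A>" and ac: "acyclic_cpx N" and f: "f \<in> chain_maps \<A> P N"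
  \<comment> \<open>\<open>Q i h\<close> says that \<open>h\<close> is admissible as the null
    homotopy in degree i: besides being a homomorphism it satisfies the one condition from which the
    next component, in degree i - 1, is constructed.\<close>
  define Q where "Q = (%i h. h \<in> Hom \<A> (obj P i) (obj N (i - 1)) \<and>
    (\<forall>x\<in>carrier (obj P (i - 1)). diff N (i - 1) (h (diff P (i - 1) x)) = diff N (i - 1) (f (i - 1) x)))"
  have base: "Q (n + 1) (%x. (zero (obj N n)))"
    unfolding Q_def
  proof (intro conjI ballI)
    fix x assume "x \<in> carrier (obj P (n + 1 - 1))"
    then have x: "x \<in> carrier (obj P n)" by simp
    have "diff P n x \<in> carrier (obj P (n + 1))" using x P by simp
    then have "diff P n x = (zero (obj P (n + 1)))" using top[of "n + 1"] by simp
    then have "diff N n (f n x) = (zero (obj N (n + 1)))"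
      using chain_map_diff[OF f x refl] chain_map_zero[OF f P N] by simp
    then show "diff N (n + 1 - 1) (zero (obj N n)) = diff N (n + 1 - 1) (f (n + 1 - 1) x)" using N by simp
  qed (use P N in \<open>simp add: Hom_zero\<close>)
  have step: "\<exists>h'. Q i h' \<and> (\<forall>x\<in>carrier (obj P i). f i x = diff N (i - 1) (h' x) \<oplus>\<^bsub>obj N i\<^esub> h (diff P i x))"
    if h: "Q (i + 1) h" for i h
  proof -
    have hH: "h \<in> Hom \<A> (obj P (i + 1)) (obj N i)"
      and hd: "!!x. x \<in> carrier (obj P i) ==> diff N i (h (diff P i x)) = diff N i (f i x)"
      using h by (simp_all add: Q_def)
    \<comment> \<open>The map \<open>f - h d\<close> takes values in the cocycles, which are the
      image of the differential because \<open>N\<close> is acyclic. The kernel object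
      \<open>?K\<close> turns this into a surjection inside the category, along which the projective
      term lifts.\<close>
    define \<phi> where "\<phi> = (%x. f i x \<oplus>\<^bsub>obj N i\<^esub> \<ominus>\<^bsub>obj N i\<^esub> h (diff P i x))"
    have \<phi>H: "\<phi> \<in> Hom \<A> (obj P i) (obj N i)"
      unfolding \<phi>_def using P N
      by (intro Hom_add Hom_neg chain_map_Hom[OF f] Hom_comp[OF cpx_diff_Hom[OF P refl] hH]) simp_all
    let ?K = "kn (obj N i) (cocycles N i)"
    have K: "?K \<in> Ob \<A>" unfolding cocycles_def
      by (rule kn_Ob[OF cpx_diff_Hom[OF N refl]]) (simp_all add: N)
    have c: "f i x \<in> carrier (obj N i)" "h (diff P i x) \<in> carrier (obj N i)" if "x \<in> carrier (obj P i)" for x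
      using chain_map_closed[OF f that] Hom_closed[OF hH, of "diff P i x"] that P by simp_all
    have "\<phi> x \<in> cocycles N i" if "x \<in> carrier (obj P i)" for x
      unfolding \<phi>_def using that c[OF that] N hd by (intro cocyclesI) (simp_all add: Ob_neg_cancel)
    then have \<phi>K: "\<phi> \<in> Hom \<A> (obj P i) ?K" by (intro kn_Hom[OF \<phi>H cpx_Ob[OF P]]) blast
    have d: "diff N (i - 1) ` carrier (obj N (i - 1)) = cocycles N i"
      using ac by (simp add: acyclic_cpx_def coboundaries_def)
    have dK: "diff N (i - 1) \<in> Hom \<A> (obj N (i - 1)) ?K"
      using cpx_diff_Hom[OF N, of i "i - 1"] d N by (intro kn_Hom) simp_all
    have "\<exists>h'\<in>Hom \<A> (obj P i) (obj N (i - 1)). \<forall>p\<in>carrier (obj P i). diff N (i - 1) (h' p) = \<phi> p"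
      using proj[of i] K dK \<phi>K N d unfolding projective_def by (simp add: kn_carrier)
    then obtain h' where h': "h' \<in> Hom \<A> (obj P i) (obj N (i - 1))"
      and eq: "!!p. p \<in> carrier (obj P i) ==> diff N (i - 1) (h' p) = \<phi> p" by blast
    have "Q i h'" unfolding Q_def
    proof (intro conjI h' ballI)
      fix x assume x: "x \<in> carrier (obj P (i - 1))"
      then have dx: "diff P (i - 1) x \<in> carrier (obj P i)" using P by simp
      have "h (diff P i (diff P (i - 1) x)) = (zero (obj N i))"
        using x P N Hom_map_zero[OF hH] by simp
      then show "diff N (i - 1) (h' (diff P (i - 1) x)) = diff N (i - 1) (f (i - 1) x)"
        unfolding eq[OF dx] \<phi>_def using chain_map_diff[OF f x, of i] N c(1)[OF dx] by simp
    qed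
    moreover have "f i x = diff N (i - 1) (h' x) \<oplus>\<^bsub>obj N i\<^esub> h (diff P i x)" if x: "x \<in> carrier (obj P i)" for x
      unfolding eq[OF x] \<phi>_def using c[OF x] N by (simp add: Ob_neg_cancel)
    ultimately show ?thesis by blast
  qed
  \<comment> \<open>The index k counts the degrees downwards from n + 1, where the homotopy is
    zero.\<close>
  have "\<exists>g. \<forall>k. Q (n + 1 - int k) (g k) \<and> (\<forall>x\<in>carrier (obj P (n + 1 - int (Suc k))).
      f (n + 1 - int (Suc k)) x = diff N (n + 1 - int (Suc k) - 1) (g (Suc k) x)
        \<oplus>\<^bsub>obj N (n + 1 - int (Suc k))\<^esub> g k (diff P (n + 1 - int (Suc k)) x))"
  proof (rule dependent_nat_choice)
    show "\<exists>h. Q (n + 1 - int 0) h" using base by auto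
    fix h k assume "Q (n + 1 - int k) h"
    then have "Q ((n + 1 - int (Suc k)) + 1) h" by (simp add: algebra_simps)
    from step[OF this] show "\<exists>h'. Q (n + 1 - int (Suc k)) h' \<and> (\<forall>x\<in>carrier (obj P (n + 1 - int (Suc k))).
      f (n + 1 - int (Suc k)) x = diff N (n + 1 - int (Suc k) - 1) (h' x)
        \<oplus>\<^bsub>obj N (n + 1 - int (Suc k))\<^esub> h (diff P (n + 1 - int (Suc k)) x))" .
  qed
  then obtain g where g: "!!k. Q (n + 1 - int k) (g k)" and
    geq: "!!k x. x \<in> carrier (obj P (n + 1 - int (Suc k))) ==>
      f (n + 1 - int (Suc k)) x = diff N (n + 1 - int (Suc k) - 1) (g (Suc k) x)
        \<oplus>\<^bsub>obj N (n + 1 - int (Suc k))\<^esub> g k (diff P (n + 1 - int (Suc k)) x)" by blast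
  define H where "H = (%i. if i > n then (%x. (zero (obj N (i - 1)))) else g (nat (n + 1 - i)))"
  have HH: "H i \<in> Hom \<A> (obj P i) (obj N (i - 1))" for i
    using g[of "nat (n + 1 - i)"] P N by (auto simp: H_def Q_def Hom_zero)
  have Heq: "f i x = diff N (i - 1) (H i x) \<oplus>\<^bsub>obj N i\<^esub> H (i + 1) (diff P i x)"
    if x: "x \<in> carrier (obj P i)" for i x
  proof (cases "i > n")
    case True
    then have x0: "x = (zero (obj P i))" using top x by blast
    have "diff N (i - 1) (H i x) = (zero (obj N i))"
      using True N cpx_diff_map(2)[OF N, of "i - 1"] by (simp add: H_def)
    moreover have "H (i + 1) (diff P i x) = (zero (obj N i))" using True by (simp add: H_def)
    ultimately show ?thesis using N chain_map_zero[OF f P N] by (simp add: x0)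
  next
    case False
    define k where "k = nat (n - i)"
    have i: "n + 1 - int (Suc k) = i" "nat (n + 1 - i) = Suc k" using False by (auto simp: k_def)
    have "H i = g (Suc k)" using False i by (simp add: H_def)
    moreover have "H (i + 1) (diff P i x) = g k (diff P i x)"
    proof (cases "i = n")
      case True
      then have "k = 0" by (simp add: k_def)
      have "diff P i x \<in> carrier (obj P (n + 1))" using x P True by simp
      then have "diff P i x = (zero (obj P (n + 1)))" using top[of "n + 1"] by simp
      moreover have "g 0 (zero (obj P (n + 1))) = (zero (obj N n))"
        using g[of 0] Hom_map_zero[of "g 0" "obj P (n + 1)" "obj N n"] P N by (simp add: Q_def)
      ultimately show ?thesis using True \<open>k = 0\<close> by (simp add: H_def)
    next
      case False
      then show ?thesis using \<open>\<not> i > n\<close> by (simp add: H_def k_def)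
    qed
    ultimately show ?thesis using geq[of x k] x unfolding i by simp
  qed
  show "homotopic \<A> P N f (%i x. (zero (obj N i)))"
    unfolding homotopic_def
  proof (intro exI[of _ H] allI conjI HH ballI)
    fix i x assume x: "x \<in> carrier (obj P i)"
    have dx: "diff P i x \<in> carrier (obj P (i + 1))" using x P by simp
    have "diff N (i - 1) (H i x) \<in> carrier (obj N i)" "H (i + 1) (diff P i x) \<in> carrier (obj N i)"
      using Hom_closed[OF HH x] Hom_closed[OF HH dx] N by simp_all
    then show "f i x = (zero (obj N i)) \<oplus>\<^bsub>obj N i\<^esub> (diff N (i - 1) (H i x) \<oplus>\<^bsub>obj N i\<^esub> H (i + 1) (diff P i x))"
      using Heq[OF x] N by simp
  qed
qed (rule P)

end

context mod_cat
begin

text \<open>The resolution of one end of a roof is lifted along that leg by K-projectivity; two out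
  of three makes the lift a quasi-isomorphism, which is then composed with the other leg.\<close>

lemma transfer_qis:
  assumes P: "K_projective \<A> P" and Z: "Z \<in> complexes \<A>" and X: "X \<in> complexes \<A>" and Y: "Y \<in> complexes \<A>"
    and s: "qis Z X s" and t: "qis Z Y t" and p: "qis P Y p"
  obtains q where "qis P X q"
proof -
  note PC = K_projective_complex[OF P]
  obtain g where g: "g \<in> chain_maps \<A> P Z" and h: "homotopic \<A> P Y p (%i x. t i (g i x))"
    by (rule lift_along_qis[OF P Z Y t qisD(1)[OF p]])
  note tg = chain_map_comp[OF g qisD(1)[OF t] PC Z Y]
  have "qis P Y (%i x. t i (g i x))" using homotopic_qis[OF h PC Y qisD(1)[OF p] tg] p by simp
  then have "qis P Z g" by (rule qis_cancel_left[OF PC Z Y g qisD(1)[OF t] _ t])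
  then have "qis P X (%i x. s i (g i x))" by (rule qis_comp[OF PC Z X g qisD(1)[OF s] _ s])
  then show thesis by (rule that)
qed

lemma qis_lift_qis:
  assumes P: "K_projective \<A> P" and Z: "Z \<in> complexes \<A>" and Y: "Y \<in> complexes \<A>"
    and t: "qis Z Y t" and p: "qis P Y p"
  obtains q where "qis P Z q"
  by (rule transfer_qis[OF P Z Z Y qis_id[OF Z] t p])

subsection \<open>Short exact sequences of complexes\<close>

context
  fixes K F X \<iota> \<epsilon>
  assumes K: "K \<in> complexes \<A>" and F: "F \<in> complexes \<A>" and X: "X \<in> complexes \<A>"
    and \<iota>: "\<iota> \<in> chain_maps \<A> K F" and \<epsilon>: "\<epsilon> \<in> chain_maps \<A> F X"
    and inj: "!!i x. x \<in> carrier (obj K i) ==> \<iota> i x = (zero (obj F i)) ==> x = (zero (obj K i))"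
    and zero: "!!i x. x \<in> carrier (obj K i) ==> \<epsilon> i (\<iota> i x) = (zero (obj X i))"
    and exact: "!!i y. y \<in> carrier (obj F i) ==> \<epsilon> i y = (zero (obj X i)) ==> \<exists>x\<in>carrier (obj K i). y = \<iota> i x"
    and surj: "!!i. \<epsilon> i ` carrier (obj F i) = carrier (obj X i)"
begin

private lemma \<iota>_eq:
  assumes "x \<in> carrier (obj K i)" "y \<in> carrier (obj K i)" "\<iota> i x = \<iota> i y"
  shows "x = y"
proof -
  have "\<iota> i (x \<oplus>\<^bsub>obj K i\<^esub> \<ominus>\<^bsub>obj K i\<^esub> y) = (zero (obj F i))"
    using assms K F chain_map_closed[OF \<iota> assms(2)]
    by (simp add: chain_map_add[OF \<iota>] chain_map_neg[OF \<iota> K F] Ob_neg_cancel)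
  then have "x \<oplus>\<^bsub>obj K i\<^esub> \<ominus>\<^bsub>obj K i\<^esub> y = (zero (obj K i))" using assms K by (intro inj) simp_all
  moreover have "x = (x \<oplus>\<^bsub>obj K i\<^esub> \<ominus>\<^bsub>obj K i\<^esub> y) \<oplus>\<^bsub>obj K i\<^esub> y"
    using assms K by (simp add: Ob_neg_cancel)
  ultimately show ?thesis using assms K by simp
qed

private lemma surjE:
  assumes "y \<in> carrier (obj X i)"
  obtains x where "x \<in> carrier (obj F i)" "y = \<epsilon> i x"
  using surj[of i] assms by blast

private lemma exactE:
  assumes "y \<in> carrier (obj F i)" "z \<in> carrier (obj F i)" "\<epsilon> i y = \<epsilon> i z"
  obtains k where "k \<in> carrier (obj K i)" "y = z \<oplus>\<^bsub>obj F i\<^esub> \<iota> i k"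
proof -
  have "\<epsilon> i (y \<oplus>\<^bsub>obj F i\<^esub> \<ominus>\<^bsub>obj F i\<^esub> z) = (zero (obj X i))"
    using assms X F chain_map_closed[OF \<epsilon> assms(2)]
    by (simp add: chain_map_add[OF \<epsilon>] chain_map_neg[OF \<epsilon> F X] Ob_neg_cancel)
  then obtain k where k: "k \<in> carrier (obj K i)" "y \<oplus>\<^bsub>obj F i\<^esub> \<ominus>\<^bsub>obj F i\<^esub> z = \<iota> i k"
    using exact[of "y \<oplus>\<^bsub>obj F i\<^esub> \<ominus>\<^bsub>obj F i\<^esub> z" i] assms F by auto
  have "y = z \<oplus>\<^bsub>obj F i\<^esub> (y \<oplus>\<^bsub>obj F i\<^esub> \<ominus>\<^bsub>obj F i\<^esub> z)"
    using assms F by (subst Ob_eq_iff_emb[of "obj F i"]) (simp_all add: Ob_emb)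
  then show thesis using that k by simp
qed

text \<open>A special case of the long exact sequence, chased on elements: preimages in
  \<open>F\<close> are corrected by elements of \<open>K\<close>, whose cocycles all bound.\<close>

lemma ses_qis:
  assumes ac: "acyclic_cpx K"
  shows "qis F X \<epsilon>"
  unfolding qis_def
proof (intro conjI allI ballI impI \<epsilon>)
  fix i x assume x: "x \<in> cocycles F i" and "\<epsilon> i x \<in> coboundaries X i"
  then obtain w where w: "w \<in> carrier (obj X (i - 1))" "\<epsilon> i x = diff X (i - 1) w"
    by (auto elim: coboundariesE)
  obtain e where e: "e \<in> carrier (obj F (i - 1))" "w = \<epsilon> (i - 1) e" by (rule surjE[OF w(1)])
  have de: "diff F (i - 1) e \<in> carrier (obj F i)" using e F by simp
  have "\<epsilon> i x = \<epsilon> i (diff F (i - 1) e)" using w e chain_map_diff[OF \<epsilon> e(1), of i] by simp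
  then obtain k where k: "k \<in> carrier (obj K i)" "x = diff F (i - 1) e \<oplus>\<^bsub>obj F i\<^esub> \<iota> i k"
    by (rule exactE[OF cocycles_carrier[OF x] de])
  have ik: "\<iota> i k \<in> carrier (obj F i)" by (rule chain_map_closed[OF \<iota> k(1)])
  have "\<iota> (i + 1) (diff K i k) = diff F i x"
    unfolding k(2) chain_map_diff[OF \<iota> k(1) refl] using de ik e F by simp
  then have "\<iota> (i + 1) (diff K i k) = (zero (obj F (i + 1)))" using cocyclesD(2)[OF x] by simp
  then have "diff K i k = (zero (obj K (i + 1)))" using k K by (intro inj) simp_all
  then have "k \<in> coboundaries K i" using ac k(1) by (auto simp: acyclic_cpx_def intro: cocyclesI)
  then obtain l where l: "l \<in> carrier (obj K (i - 1))" "k = diff K (i - 1) l" by (auto elim: coboundariesE)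
  show "x \<in> coboundaries F i"
    using k(2) l e F chain_map_closed[OF \<iota> l(1)] chain_map_diff[OF \<iota> l(1), of i]
    by (intro coboundariesI[where w = "e \<oplus>\<^bsub>obj F (i - 1)\<^esub> \<iota> (i - 1) l"]) simp_all
next
  fix i y assume y: "y \<in> cocycles X i"
  obtain x where x: "x \<in> carrier (obj F i)" "y = \<epsilon> i x" by (rule surjE[OF cocycles_carrier[OF y]])
  have dx: "diff F i x \<in> carrier (obj F (i + 1))" using x F by simp
  have "\<epsilon> (i + 1) (diff F i x) = (zero (obj X (i + 1)))"
    using cocyclesD(2)[OF y] x chain_map_diff[OF \<epsilon> x(1) refl] by simp
  then obtain k where k: "k \<in> carrier (obj K (i + 1))" "diff F i x = \<iota> (i + 1) k"
    using exact[OF dx] by blast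
  have "\<iota> (i + 2) (diff K (i + 1) k) = (zero (obj F (i + 2)))"
    using chain_map_diff[OF \<iota> k(1), of "i + 2"] k(2)[symmetric] x F by simp
  then have "diff K (i + 1) k = (zero (obj K (i + 2)))" using k K by (intro inj) simp_all
  then have "k \<in> cocycles K (i + 1)" using k(1) by (intro cocyclesI) simp_all
  then have "k \<in> coboundaries K (i + 1)" using ac by (simp add: acyclic_cpx_def)
  then obtain l where l: "l \<in> carrier (obj K i)" "k = diff K i l" by (auto elim: coboundariesE)
  let ?x = "x \<oplus>\<^bsub>obj F i\<^esub> \<ominus>\<^bsub>obj F i\<^esub> \<iota> i l"
  have il: "\<iota> i l \<in> carrier (obj F i)" by (rule chain_map_closed[OF \<iota> l(1)])
  have "?x \<in> cocycles F i"
    using x il F k(2) l chain_map_diff[OF \<iota> l(1) refl] by (intro cocyclesI) (simp_all add: Ob_neg_cancel)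
  moreover have "\<epsilon> i ?x = y"
    using x il F X l zero[OF l(1)] chain_map_closed[OF \<epsilon> x(1)]
    by (simp add: chain_map_add[OF \<epsilon>] chain_map_neg[OF \<epsilon> F X])
  then have "y = \<epsilon> i ?x \<oplus>\<^bsub>obj X i\<^esub> (zero (obj X i))" using y X by simp
  ultimately show "\<exists>x\<in>cocycles F i. \<exists>b\<in>coboundaries X i. y = \<epsilon> i x \<oplus>\<^bsub>obj X i\<^esub> b"
    using coboundaries_zero[OF X, of i] by blast
qed

context
  fixes R r
  assumes R: "R \<in> complexes \<A>" and r: "qis R K r"
begin

private lemmas rc = qisD(1)[OF r]
private lemmas \<iota>r = chain_map_comp[OF rc \<iota> R K F]
private lemmas Cc = cone_complex[OF F R \<iota>r]

text \<open>\<open>X\<close> is the cokernel of \<open>\<iota>\<close>, hence represented by the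
  cone of \<open>\<iota>\<close>, in which \<open>K\<close> may be replaced by \<open>R\<close>.
  This assembles a resolution from those of a kernel and of a middle term, in
  \<open>bounded_fres_perf\<close> and in \<open>inflated_perf\<close>.\<close>

lemma cone_resolution: "qis (cone R F (%i x. \<iota> i (r i x))) X (%i z. \<epsilon> i (p2 z))"
  (is "qis ?C X _")
  unfolding qis_def
proof (intro conjI allI ballI impI)
  show "(%i z. \<epsilon> i (p2 z)) \<in> chain_maps \<A> ?C X"
  proof (rule chain_mapsI)
    show "(%z. \<epsilon> i (p2 z)) \<in> Hom \<A> (obj ?C i) (obj X i)" for i
      unfolding cone_sel using R F X by (intro Hom_comp[OF p2_Hom chain_map_Hom[OF \<epsilon>]] bp_Ob) simp_all
    fix i z assume "z \<in> carrier (obj ?C i)"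
    then obtain a b where z: "z = pr a b" "a \<in> carrier (obj R (i + 1))" "b \<in> carrier (obj F i)"
      by (auto elim: bpE)
    have c: "r (i + 1) a \<in> carrier (obj K (i + 1))" "\<iota> (i + 1) (r (i + 1) a) \<in> carrier (obj F (i + 1))"
      using chain_map_closed[OF rc z(2)] chain_map_closed[OF \<iota>r z(2)] by simp_all
    have "\<epsilon> i b \<in> carrier (obj X i)" by (rule chain_map_closed[OF \<epsilon> z(3)])
    then show "\<epsilon> (i + 1) (p2 (diff ?C i z)) = diff X i (\<epsilon> i (p2 z))"
      using z c F X by (simp add: chain_map_add[OF \<epsilon>] zero chain_map_diff[OF \<epsilon> z(3)])
  qed
next
  fix i z assume z: "z \<in> cocycles ?C i" and "\<epsilon> i (p2 z) \<in> coboundaries X i"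
  then obtain w where w: "w \<in> carrier (obj X (i - 1))" "\<epsilon> i (p2 z) = diff X (i - 1) w"
    by (auto elim: coboundariesE)
  obtain a b where ab: "z = pr a b" "a \<in> carrier (obj R (i + 1))" "b \<in> carrier (obj F i)"
    using cocyclesD(1)[OF z] by (auto elim: bpE)
  have d: "\<ominus>\<^bsub>obj R (i + 2)\<^esub> diff R (i + 1) a = (zero (obj R (i + 2)))"
    "\<iota> (i + 1) (r (i + 1) a) \<oplus>\<^bsub>obj F (i + 1)\<^esub> diff F i b = (zero (obj F (i + 1)))"
    using cocyclesD(2)[OF z] ab by (simp_all add: bp_zero)
  have da: "diff R (i + 1) a = (zero (obj R (i + 2)))"
    using ab(2) R arg_cong[OF d(1), of "a_inv (obj R (i + 2))"] by simp
  have acyc: "a \<in> cocycles R (i + 1)" using ab da by (intro cocyclesI) simp_all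
  obtain e where e: "e \<in> carrier (obj F (i - 1))" "w = \<epsilon> (i - 1) e" by (rule surjE[OF w(1)])
  have de: "diff F (i - 1) e \<in> carrier (obj F i)" using e F by simp
  have "\<epsilon> i b = \<epsilon> i (diff F (i - 1) e)" using w ab e chain_map_diff[OF \<epsilon> e(1), of i] by simp
  then obtain k where k: "k \<in> carrier (obj K i)" "b = diff F (i - 1) e \<oplus>\<^bsub>obj F i\<^esub> \<iota> i k"
    by (rule exactE[OF ab(3) de])
  have ik: "\<iota> i k \<in> carrier (obj F i)" by (rule chain_map_closed[OF \<iota> k(1)])
  have ra: "r (i + 1) a \<in> carrier (obj K (i + 1))" by (rule chain_map_closed[OF rc ab(2)])
  have db: "diff F i b = \<iota> (i + 1) (diff K i k)"
    unfolding k(2) chain_map_diff[OF \<iota> k(1) refl] using de ik e F by simp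
  have dk: "diff K i k \<in> carrier (obj K (i + 1))" using k K by simp
  have "r (i + 1) a \<oplus>\<^bsub>obj K (i + 1)\<^esub> diff K i k = (zero (obj K (i + 1)))"
    using d(2) ra dk K unfolding db by (intro inj) (simp_all add: chain_map_add[OF \<iota>])
  then have rak: "r (i + 1) a = diff K i (\<ominus>\<^bsub>obj K i\<^esub> k)"
    using Ob_eq_iff_minus[of "obj K (i + 1)" "(zero (obj K (i + 1)))" "r (i + 1) a" "diff K i k"] ra dk k K
    by simp
  have "a \<in> coboundaries R (i + 1)"
    using rak k K by (intro qisD(2)[OF r acyc] coboundariesI[where w = "\<ominus>\<^bsub>obj K i\<^esub> k"]) simp_all
  then obtain a0 where a0: "a0 \<in> carrier (obj R i)" "a = diff R i a0" by (auto elim: coboundariesE)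
  have ra0: "r i a0 \<in> carrier (obj K i)" by (rule chain_map_closed[OF rc a0(1)])
  have "r i a0 \<oplus>\<^bsub>obj K i\<^esub> k \<in> cocycles K i"
    using ra0 k K rak chain_map_diff[OF rc a0(1) refl] a0 by (intro cocyclesI) (simp_all add: Ob_neg_cancel)
  then obtain c l where c: "c \<in> cocycles R i" and l: "l \<in> carrier (obj K (i - 1))" and
    eq: "r i a0 \<oplus>\<^bsub>obj K i\<^esub> k = r i c \<oplus>\<^bsub>obj K i\<^esub> diff K (i - 1) l"
    by (rule qis_surj_diff[OF r])
  have rc': "r i c \<in> carrier (obj K i)" by (rule chain_map_closed[OF rc cocycles_carrier[OF c]])
  have dl: "diff K (i - 1) l \<in> carrier (obj K i)" using l K by simp
  \<comment> \<open>As in \<open>cone_acyclic\<close>: \<open>- a0\<close>, corrected by the cocycle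
    \<open>c\<close> that surjectivity of \<open>r\<close> on cohomology provides.\<close>
  let ?a = "\<ominus>\<^bsub>obj R i\<^esub> a0 \<oplus>\<^bsub>obj R i\<^esub> c"
  have a: "a = \<ominus>\<^bsub>obj R (i + 1)\<^esub> diff R i ?a"
    using a0 R c by (simp add: cocyclesD)
  have rA: "r i ?a \<in> carrier (obj K i)" "r i ?a = \<ominus>\<^bsub>obj K i\<^esub> r i a0 \<oplus>\<^bsub>obj K i\<^esub> r i c"
    using a0 c R K ra0 rc' by (simp_all add: chain_map_add[OF rc] chain_map_neg[OF rc R K])
  have "k = \<ominus>\<^bsub>obj K i\<^esub> r i a0 \<oplus>\<^bsub>obj K i\<^esub> (r i a0 \<oplus>\<^bsub>obj K i\<^esub> k)"
    using ra0 k K by (simp add: Ob_neg_cancel)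
  also have "\<dots> = r i ?a \<oplus>\<^bsub>obj K i\<^esub> diff K (i - 1) l"
    unfolding eq rA(2) using K ra0 rc' dl by (simp add: Ob_assoc)
  finally have k': "k = r i ?a \<oplus>\<^bsub>obj K i\<^esub> diff K (i - 1) l" .
  have "\<iota> i k = \<iota> i (r i ?a) \<oplus>\<^bsub>obj F i\<^esub> diff F (i - 1) (\<iota> (i - 1) l)"
    unfolding k' chain_map_add[OF \<iota> rA(1) dl] using chain_map_diff[OF \<iota> l, of i] by simp
  then have b: "b = \<iota> i (r i ?a) \<oplus>\<^bsub>obj F i\<^esub> diff F (i - 1) (e \<oplus>\<^bsub>obj F (i - 1)\<^esub> \<iota> (i - 1) l)"
    using k(2) e de F chain_map_closed[OF \<iota> l] chain_map_closed[OF \<iota> rA(1)] by (simp add: Ob_ac)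
  show "z \<in> coboundaries ?C i"
    using a b ab e a0 c R F l chain_map_closed[OF \<iota> l]
    by (intro coboundariesI[where w = "pr ?a (e \<oplus>\<^bsub>obj F (i - 1)\<^esub> \<iota> (i - 1) l)"]) simp_all
next
  fix i y assume y: "y \<in> cocycles X i"
  obtain b where b: "b \<in> carrier (obj F i)" "y = \<epsilon> i b" by (rule surjE[OF cocycles_carrier[OF y]])
  have db: "diff F i b \<in> carrier (obj F (i + 1))" using b F by simp
  have "\<epsilon> (i + 1) (diff F i b) = (zero (obj X (i + 1)))"
    using cocyclesD(2)[OF y] b chain_map_diff[OF \<epsilon> b(1) refl] by simp
  then obtain k where k: "k \<in> carrier (obj K (i + 1))" "diff F i b = \<iota> (i + 1) k"
    using exact[OF db] by blast
  have "\<iota> (i + 2) (diff K (i + 1) k) = (zero (obj F (i + 2)))"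
    using chain_map_diff[OF \<iota> k(1), of "i + 2"] k(2)[symmetric] b F by simp
  then have "diff K (i + 1) k = (zero (obj K (i + 2)))" using k K by (intro inj) simp_all
  then have "k \<in> cocycles K (i + 1)" using k by (intro cocyclesI) simp_all
  then obtain c l where c: "c \<in> cocycles R (i + 1)" and l': "l \<in> carrier (obj K (i + 1 - 1))" and
    eq': "k = r (i + 1) c \<oplus>\<^bsub>obj K (i + 1)\<^esub> diff K (i + 1 - 1) l"
    by (rule qis_surj_diff[OF r])
  have l: "l \<in> carrier (obj K i)" and eq: "k = r (i + 1) c \<oplus>\<^bsub>obj K (i + 1)\<^esub> diff K i l"
    using l' eq' by simp_all
  have cc: "c \<in> carrier (obj R (i + 1))" using c by simp
  have rc': "r (i + 1) c \<in> carrier (obj K (i + 1))" by (rule chain_map_closed[OF rc cc])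
  have il: "\<iota> i l \<in> carrier (obj F i)" by (rule chain_map_closed[OF \<iota> l(1)])
  have irc: "\<iota> (i + 1) (r (i + 1) c) \<in> carrier (obj F (i + 1))" by (rule chain_map_closed[OF \<iota> rc'])
  \<comment> \<open>Subtracting \<open>\<iota> l\<close> leaves an element whose differential comes
    from \<open>R\<close>, so that it completes \<open>- c\<close> to a cocycle of the cone;
    \<open>\<epsilon>\<close> does not see the correction.\<close>
  let ?b = "b \<oplus>\<^bsub>obj F i\<^esub> \<ominus>\<^bsub>obj F i\<^esub> \<iota> i l"
  have "diff F i ?b = \<iota> (i + 1) (r (i + 1) c)"
    using b il F k(2) l rc' irc K chain_map_diff[OF \<iota> l(1) refl]
    by (simp add: eq chain_map_add[OF \<iota>] Ob_neg_cancel)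
  then have "pr (\<ominus>\<^bsub>obj R (i + 1)\<^esub> c) ?b \<in> cocycles ?C i"
    using c cc b il R F irc K rc' cpx_diff_map(3)[OF R cc]
    by (intro cocyclesI) (simp_all add: bp_zero cocyclesD chain_map_neg[OF \<iota>r R F] Ob_neg_cancel)
  moreover have "\<epsilon> i ?b = y"
    using b il F X l zero[OF l(1)] chain_map_closed[OF \<epsilon> b(1)]
    by (simp add: chain_map_add[OF \<epsilon>] chain_map_neg[OF \<epsilon> F X])
  then have "y = \<epsilon> i (p2 (pr (\<ominus>\<^bsub>obj R (i + 1)\<^esub> c) ?b)) \<oplus>\<^bsub>obj X i\<^esub> (zero (obj X i))" using y X by simp
  ultimately show "\<exists>x\<in>cocycles ?C i. \<exists>b\<in>coboundaries X i. y = \<epsilon> i (p2 x) \<oplus>\<^bsub>obj X i\<^esub> b"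
    using coboundaries_zero[OF X, of i] by blast
qed

end

end

end

section \<open>Shifts and connecting maps\<close>

definition shift :: "('u, 'x) cpx => ('u, 'x) cpx"
  where "shift X = \<lparr>obj = (%i. obj X (i - 1)), diff = (%i. diff X (i - 1))\<rparr>"

lemma shift_sel [simp]: "obj (shift X) i = obj X (i - 1)" "diff (shift X) i = diff X (i - 1)"
  by (simp_all add: shift_def)

context mod_cat0
begin

lemma shift_complex: "X \<in> complexes \<A> ==> shift X \<in> complexes \<A>"
  using cpx_diff_Hom[of X _ "_ - 1"] by (intro complexesI) simp_all

lemma shift_chain_map: "f \<in> chain_maps \<A> X Y ==> (%i. f (i - 1)) \<in> chain_maps \<A> (shift X) (shift Y)"
proof (rule chain_mapsI)
  assume f: "f \<in> chain_maps \<A> X Y"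
  show "f (i - 1) \<in> Hom \<A> (obj (shift X) i) (obj (shift Y) i)" for i
    using chain_map_Hom[OF f, of "i - 1"] by simp
  show "f (i + 1 - 1) (diff (shift X) i x) = diff (shift Y) i (f (i - 1) x)"
    if "x \<in> carrier (obj (shift X) i)" for i x
    using that chain_map_diff[OF f, of x "i - 1" i] by simp
qed

lemma shift_cocycles: "cocycles (shift X) i = cocycles X (i - 1)"
  unfolding cocycles_def by simp

lemma shift_coboundaries: "coboundaries (shift X) i = coboundaries X (i - 1)"
  by (simp add: coboundaries_def)

lemma shift_qis: "qis X Y f ==> qis (shift X) (shift Y) (%i. f (i - 1))"
  using shift_chain_map[of f X Y]
  unfolding qis_def shift_cocycles shift_coboundaries shift_sel by simp

text \<open>The sequence splits in every degree, but the sections \<open>\<sigma>\<close> need not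
  commute with the differentials. Their defect \<open>d \<sigma> - \<sigma> d\<close> takes values
  in the image of \<open>K\<close>; it is the connecting map, and an isomorphism on cohomology
  because \<open>F\<close> is acyclic.\<close>

lemma connecting_qis:
  assumes K: "K \<in> complexes \<A>" and F: "F \<in> complexes \<A>" and X: "X \<in> complexes \<A>"
    and \<iota>: "\<iota> \<in> chain_maps \<A> K F" and \<epsilon>: "\<epsilon> \<in> chain_maps \<A> F X"
    and exact: "!!i y. y \<in> carrier (obj F i) ==> \<epsilon> i y = (zero (obj X i)) ==> \<exists>x\<in>carrier (obj K i). y = \<iota> i x"
    and zero: "!!i x. x \<in> carrier (obj K i) ==> \<epsilon> i (\<iota> i x) = (zero (obj X i))"
    and \<phi>: "!!i. \<phi> i \<in> Hom \<A> (obj F i) (obj K i)"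
    and \<phi>\<iota>: "!!i x. x \<in> carrier (obj K i) ==> \<phi> i (\<iota> i x) = x"
    and \<sigma>: "!!i. \<sigma> i \<in> Hom \<A> (obj X i) (obj F i)"
    and \<epsilon>\<sigma>: "!!i x. x \<in> carrier (obj X i) ==> \<epsilon> i (\<sigma> i x) = x"
    and ac: "acyclic_cpx F"
  obtains \<theta> where "qis (shift X) K \<theta>"
proof -
  define \<delta> where "\<delta> = (%i q. diff F (i - 1) (\<sigma> (i - 1) q) \<oplus>\<^bsub>obj F i\<^esub> \<ominus>\<^bsub>obj F i\<^esub> \<sigma> i (diff X (i - 1) q))"
  have \<iota>_inj: "x = y" if "x \<in> carrier (obj K i)" "y \<in> carrier (obj K i)" "\<iota> i x = \<iota> i y" for i x y
    using arg_cong[OF that(3), of "\<phi> i"] unfolding \<phi>\<iota>[OF that(1)] \<phi>\<iota>[OF that(2)] .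
  have \<sigma>c: "\<sigma> i q \<in> carrier (obj F i)" if "q \<in> carrier (obj X i)" for i q
    by (rule Hom_closed[OF \<sigma> that])
  have c: "diff F (i - 1) (\<sigma> (i - 1) q) \<in> carrier (obj F i)" "\<sigma> i (diff X (i - 1) q) \<in> carrier (obj F i)"
    if "q \<in> carrier (obj X (i - 1))" for i q
    using \<sigma>c[OF that] \<sigma>c[of "diff X (i - 1) q" i] that F X by simp_all
  have \<delta>H: "\<delta> i \<in> Hom \<A> (obj X (i - 1)) (obj F i)" for i
    unfolding \<delta>_def using F X
    by (intro Hom_add Hom_neg Hom_comp[OF \<sigma> cpx_diff_Hom[OF F]] Hom_comp[OF cpx_diff_Hom[OF X] \<sigma>]) simp_all
  have \<delta>c: "\<delta> i q \<in> carrier (obj F i)" if "q \<in> carrier (obj X (i - 1))" for i q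
    by (rule Hom_closed[OF \<delta>H that])
  have \<epsilon>\<delta>: "\<epsilon> i (\<delta> i q) = (zero (obj X i))" if q: "q \<in> carrier (obj X (i - 1))" for i q
    unfolding \<delta>_def using c[OF q] q F X chain_map_diff[OF \<epsilon> \<sigma>c[OF q], of i]
    by (simp add: chain_map_add[OF \<epsilon>] chain_map_neg[OF \<epsilon> F X] \<epsilon>\<sigma> Ob_neg_cancel)
  define t where "t = (%i q. \<phi> i (\<delta> i q))"
  have tH: "t i \<in> Hom \<A> (obj X (i - 1)) (obj K i)" for i
    unfolding t_def using F X K by (intro Hom_comp[OF \<delta>H \<phi>]) simp_all
  have tc: "t i q \<in> carrier (obj K i)" if "q \<in> carrier (obj X (i - 1))" for i q
    by (rule Hom_closed[OF tH that])
  have \<iota>t: "\<iota> i (t i q) = \<delta> i q" if q: "q \<in> carrier (obj X (i - 1))" for i q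
    using exact[OF \<delta>c[OF q] \<epsilon>\<delta>[OF q]] \<phi>\<iota> by (auto simp: t_def)
  have t_diff: "t (i + 1) (diff X (i - 1) q) = \<ominus>\<^bsub>obj K (i + 1)\<^esub> diff K i (t i q)"
    if q: "q \<in> carrier (obj X (i - 1))" for i q
  proof (rule \<iota>_inj)
    have dq: "diff X (i - 1) q \<in> carrier (obj X i)" using q X by simp
    then show 1: "t (i + 1) (diff X (i - 1) q) \<in> carrier (obj K (i + 1))" using tc[of "diff X (i - 1) q" "i + 1"] by simp
    show 2: "\<ominus>\<^bsub>obj K (i + 1)\<^esub> diff K i (t i q) \<in> carrier (obj K (i + 1))" using tc[OF q] K by simp
    have dK: "diff K i (t i q) \<in> carrier (obj K (i + 1))" using tc[OF q] K by simp
    have d\<sigma>: "diff F i (\<sigma> i (diff X (i - 1) q)) \<in> carrier (obj F (i + 1))" using c[OF q] F by simp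
    have z: "\<sigma> (i + 1) (diff X i (diff X (i - 1) q)) = (zero (obj F (i + 1)))"
      using q X F Hom_map_zero[OF \<sigma>, of "i + 1"] by simp
    have "\<iota> (i + 1) (\<ominus>\<^bsub>obj K (i + 1)\<^esub> diff K i (t i q)) = \<ominus>\<^bsub>obj F (i + 1)\<^esub> diff F i (\<delta> i q)"
      using chain_map_neg[OF \<iota> K F dK] chain_map_diff[OF \<iota> tc[OF q] refl] \<iota>t[OF q] by simp
    also have "\<dots> = diff F i (\<sigma> i (diff X (i - 1) q))"
      unfolding \<delta>_def using c[OF q] d\<sigma> q F \<sigma>c[OF q] by (simp add: Ob_neg_add)
    also have "\<dots> = \<delta> (i + 1) (diff X (i - 1) q)"
      unfolding \<delta>_def using d\<sigma> F by (simp add: z)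
    also have "\<dots> = \<iota> (i + 1) (t (i + 1) (diff X (i - 1) q))"
      using \<iota>t[of "diff X (i - 1) q" "i + 1"] dq by simp
    finally show "\<iota> (i + 1) (t (i + 1) (diff X (i - 1) q)) = \<iota> (i + 1) (\<ominus>\<^bsub>obj K (i + 1)\<^esub> diff K i (t i q))" ..
  qed
  \<comment> \<open>\<open>t\<close> anticommutes with the differentials, and \<open>shift\<close>
    leaves the differential without the usual sign; changing the sign of \<open>t\<close> in odd
    degrees makes it a chain map.\<close>
  define \<theta> where "\<theta> = (%i q. if even i then t i q else \<ominus>\<^bsub>obj K i\<^esub> t i q)"
  have \<theta>H: "\<theta> i \<in> Hom \<A> (obj X (i - 1)) (obj K i)" for i
    unfolding \<theta>_def using tH[of i] X K by (cases "even i") (simp_all add: Hom_neg)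
  have "qis (shift X) K \<theta>"
    unfolding qis_def shift_cocycles shift_coboundaries
  proof (intro conjI allI ballI impI)
    show "\<theta> \<in> chain_maps \<A> (shift X) K"
    proof (rule chain_mapsI)
      show "\<theta> i \<in> Hom \<A> (obj (shift X) i) (obj K i)" for i using \<theta>H by simp
      show "\<theta> (i + 1) (diff (shift X) i q) = diff K i (\<theta> i q)" if "q \<in> carrier (obj (shift X) i)" for i q
        using that tc[of q i] K t_diff[of q i] by (simp add: \<theta>_def)
    qed
  next
    fix i q assume q: "q \<in> cocycles X (i - 1)" and b: "\<theta> i q \<in> coboundaries K i"
    note qc = cocycles_carrier[OF q]
    have "t i q = (if even i then \<theta> i q else \<ominus>\<^bsub>obj K i\<^esub> \<theta> i q)"
      using tc[OF qc] K by (simp add: \<theta>_def)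
    then have "t i q \<in> coboundaries K i" using b coboundaries_neg[OF K b] by simp
    then obtain s where s: "s \<in> carrier (obj K (i - 1))" "t i q = diff K (i - 1) s" by (auto elim: coboundariesE)
    have \<iota>s: "\<iota> (i - 1) s \<in> carrier (obj F (i - 1))" by (rule chain_map_closed[OF \<iota> s(1)])
    have "diff X (i - 1) q = (zero (obj X i))" using cocyclesD(2)[OF q] by simp
    then have "\<delta> i q = diff F (i - 1) (\<sigma> (i - 1) q)"
      unfolding \<delta>_def using c[OF qc] F X Hom_map_zero[OF \<sigma>, of i] by simp
    then have eq: "diff F (i - 1) (\<sigma> (i - 1) q) = diff F (i - 1) (\<iota> (i - 1) s)"
      using \<iota>t[OF qc] s chain_map_diff[OF \<iota> s(1), of i] by simp
    have dis: "diff F (i - 1) (\<iota> (i - 1) s) \<in> carrier (obj F i)" using \<iota>s F by simp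
    have "\<sigma> (i - 1) q \<oplus>\<^bsub>obj F (i - 1)\<^esub> \<ominus>\<^bsub>obj F (i - 1)\<^esub> \<iota> (i - 1) s \<in> cocycles F (i - 1)"
      using \<sigma>c[OF qc] \<iota>s F eq dis by (intro cocyclesI) (simp_all add: Ob_neg_cancel)
    then have "\<sigma> (i - 1) q \<oplus>\<^bsub>obj F (i - 1)\<^esub> \<ominus>\<^bsub>obj F (i - 1)\<^esub> \<iota> (i - 1) s \<in> coboundaries F (i - 1)"
      using ac by (simp add: acyclic_cpx_def)
    then have "\<epsilon> (i - 1) (\<sigma> (i - 1) q \<oplus>\<^bsub>obj F (i - 1)\<^esub> \<ominus>\<^bsub>obj F (i - 1)\<^esub> \<iota> (i - 1) s) \<in> coboundaries X (i - 1)"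
      by (rule chain_map_coboundary[OF \<epsilon>])
    then show "q \<in> coboundaries X (i - 1)"
      using \<sigma>c[OF qc] \<iota>s F X qc by (simp add: chain_map_add[OF \<epsilon>] chain_map_neg[OF \<epsilon> F X] \<epsilon>\<sigma> zero[OF s(1)])
  next
    \<comment> \<open>A cocycle \<open>y\<close> of \<open>K\<close> becomes in \<open>F\<close> the
      differential of some \<open>e\<close>. The class of \<open>\<epsilon> e\<close> is mapped to
      that of \<open>y\<close>, since \<open>\<sigma> (\<epsilon> e) - e\<close> comes from
      \<open>K\<close>.\<close>
    have surj: "\<exists>q\<in>cocycles X (i - 1). \<exists>b\<in>coboundaries K i. y = t i q \<oplus>\<^bsub>obj K i\<^esub> b"
      if y: "y \<in> cocycles K i" for i y
    proof -
      have "\<iota> i y \<in> cocycles F i" by (rule chain_map_cocycle[OF \<iota> y K F])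
      then have "\<iota> i y \<in> coboundaries F i" using ac by (simp add: acyclic_cpx_def)
      then obtain e where e: "e \<in> carrier (obj F (i - 1))" "\<iota> i y = diff F (i - 1) e" by (auto elim: coboundariesE)
      define q where "q = \<epsilon> (i - 1) e"
      have qc: "q \<in> carrier (obj X (i - 1))" unfolding q_def by (rule chain_map_closed[OF \<epsilon> e(1)])
      have dq0: "diff X (i - 1) q = (zero (obj X i))"
        unfolding q_def using chain_map_diff[OF \<epsilon> e(1), of i] e(2) zero[OF cocycles_carrier[OF y]] by simp
      then have q: "q \<in> cocycles X (i - 1)" using qc by (intro cocyclesI) simp_all
      let ?k = "\<sigma> (i - 1) q \<oplus>\<^bsub>obj F (i - 1)\<^esub> \<ominus>\<^bsub>obj F (i - 1)\<^esub> e"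
      have kc: "?k \<in> carrier (obj F (i - 1))" using \<sigma>c[OF qc] e F by simp
      have "\<epsilon> (i - 1) ?k = (zero (obj X (i - 1)))"
        using \<sigma>c[OF qc] e F X qc chain_map_closed[OF \<epsilon> e(1)]
        by (simp add: chain_map_add[OF \<epsilon>] chain_map_neg[OF \<epsilon> F X] \<epsilon>\<sigma> q_def[symmetric] Ob_neg_cancel)
      then obtain s where s: "s \<in> carrier (obj K (i - 1))" "?k = \<iota> (i - 1) s" using exact[OF kc] by blast
      have sd: "diff K (i - 1) s \<in> carrier (obj K i)" using s K by simp
      have "\<delta> i q = diff F (i - 1) (\<sigma> (i - 1) q)"
        unfolding \<delta>_def dq0 using c[OF qc] F X Hom_map_zero[OF \<sigma>, of i] by simp
      moreover have "\<iota> i (diff K (i - 1) s) = diff F (i - 1) (\<sigma> (i - 1) q) \<oplus>\<^bsub>obj F i\<^esub> \<ominus>\<^bsub>obj F i\<^esub> \<iota> i y"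
        using chain_map_diff[OF \<iota> s(1), of i] s(2)[symmetric] \<sigma>c[OF qc] e F by simp
      ultimately have "\<iota> i y = \<iota> i (t i q) \<oplus>\<^bsub>obj F i\<^esub> \<iota> i (\<ominus>\<^bsub>obj K i\<^esub> diff K (i - 1) s)"
        using c[OF qc] F chain_map_closed[OF \<iota> cocycles_carrier[OF y]] \<iota>t[OF qc] chain_map_neg[OF \<iota> K F sd]
        by (simp add: Ob_neg_add Ob_neg_cancel)
      also have "\<dots> = \<iota> i (t i q \<oplus>\<^bsub>obj K i\<^esub> \<ominus>\<^bsub>obj K i\<^esub> diff K (i - 1) s)"
        using tc[OF qc] sd K by (simp add: chain_map_add[OF \<iota>])
      finally have "y = t i q \<oplus>\<^bsub>obj K i\<^esub> \<ominus>\<^bsub>obj K i\<^esub> diff K (i - 1) s"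
        using y tc[OF qc] sd K by - (rule \<iota>_inj, simp_all)
      moreover have "\<ominus>\<^bsub>obj K i\<^esub> diff K (i - 1) s \<in> coboundaries K i"
        using s K by (intro coboundaries_neg coboundariesI) simp_all
      ultimately show ?thesis using q by blast
    qed
    fix i y assume y: "y \<in> cocycles K i"
    obtain q b where q: "q \<in> cocycles X (i - 1)" and b: "b \<in> coboundaries K i" "y = t i q \<oplus>\<^bsub>obj K i\<^esub> b"
      using surj[OF y] by blast
    let ?q = "if even i then q else \<ominus>\<^bsub>obj X (i - 1)\<^esub> q"
    have "t i q = \<theta> i ?q"
      using Hom_map_neg[OF tH, of i q] cocycles_carrier[OF q] tc[of q i] X K by (simp add: \<theta>_def)
    then have y: "y = \<theta> i ?q \<oplus>\<^bsub>obj K i\<^esub> b" using b(2) by simp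
    have "?q \<in> cocycles X (i - 1)" using q cocycles_neg[OF X q] by simp
    then show "\<exists>q\<in>cocycles X (i - 1). \<exists>b\<in>coboundaries K i. y = \<theta> i q \<oplus>\<^bsub>obj K i\<^esub> b"
      by (intro bexI[of _ ?q] bexI[of _ b] y b(1))
  qed
  then show thesis by (rule that)
qed

section \<open>Acyclic complexes and homotopy equivalences\<close>

lemma qis_acyclic:
  assumes q: "qis X Y f" and X: "X \<in> complexes \<A>" and Y: "Y \<in> complexes \<A>"
  shows "acyclic_cpx X \<longleftrightarrow> acyclic_cpx Y"
proof
  note f = qisD(1)[OF q]
  assume ac: "acyclic_cpx X"
  have "y \<in> coboundaries Y i" if y: "y \<in> cocycles Y i" for i y
  proof -
    obtain x where x: "x \<in> cocycles X i" "coh Y i y (f i x)" by (rule qis_surj[OF q y])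
    then obtain b where b: "b \<in> coboundaries Y i" "y = f i x \<oplus>\<^bsub>obj Y i\<^esub> b" by (auto simp: coh_def)
    have "x \<in> coboundaries X i" using x ac by (simp add: acyclic_cpx_def)
    then show ?thesis using b coboundaries_add[OF Y chain_map_coboundary[OF f]] by simp
  qed
  then show "acyclic_cpx Y" using coboundary_cocycle[OF Y] by (auto simp: acyclic_cpx_def)
next
  note f = qisD(1)[OF q]
  assume ac: "acyclic_cpx Y"
  have "x \<in> coboundaries X i" if "x \<in> cocycles X i" for i x
    using qisD(2)[OF q that] chain_map_cocycle[OF f that X Y] ac by (simp add: acyclic_cpx_def)
  then show "acyclic_cpx X" using coboundary_cocycle[OF X] by (auto simp: acyclic_cpx_def)
qed

lemma zero_cpx_acyclic:
  assumes X: "X \<in> complexes \<A>" and z: "zero_cpx X"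
  shows "acyclic_cpx X"
  unfolding acyclic_cpx_def
proof (intro allI equalityI subsetI)
  fix i x assume "x \<in> cocycles X i"
  then have "x = (zero (obj X i))" using z cocycles_carrier[of x X i] by (simp add: zero_cpx_def)
  then show "x \<in> coboundaries X i" using coboundaries_zero[OF X] by simp
qed (rule coboundary_cocycle[OF X])

lemma acyclic_qis:
  assumes X: "X \<in> complexes \<A>" and Y: "Y \<in> complexes \<A>" and "acyclic_cpx X" "acyclic_cpx Y"
    and f: "f \<in> chain_maps \<A> X Y"
  shows "qis X Y f"
  unfolding qis_def
proof (intro conjI allI ballI impI f)
  fix i y assume y: "y \<in> cocycles Y i"
  then have "y \<in> coboundaries Y i" using assms(4) by (simp add: acyclic_cpx_def)
  moreover have "y = f i (zero (obj X i)) \<oplus>\<^bsub>obj Y i\<^esub> y" using y Y by (simp add: chain_map_zero[OF f X Y])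
  ultimately show "\<exists>x\<in>cocycles X i. \<exists>b\<in>coboundaries Y i. y = f i x \<oplus>\<^bsub>obj Y i\<^esub> b"
    using zero_cocycle[OF X] by blast
qed (use assms(3) in \<open>simp add: acyclic_cpx_def\<close>)

lemma zero_chain_map:
  "X \<in> complexes \<A> ==> Y \<in> complexes \<A> ==> (%i x. (zero (obj Y i))) \<in> chain_maps \<A> X Y"
  by (rule chain_mapsI) (simp_all add: Hom_zero)

text \<open>The two inverses \<open>f\<close> and \<open>f'\<close> of \<open>g\<close> up to
  homotopy need not be compared: the first makes \<open>g\<close> injective on cohomology, the
  second surjective, and \<open>f\<close> follows by two out of three.\<close>

lemma qis_two_sided:
  assumes X: "X \<in> complexes \<A>" and Y: "Y \<in> complexes \<A>"
    and f: "f \<in> chain_maps \<A> X Y" and g: "g \<in> chain_maps \<A> Y X" and f': "f' \<in> chain_maps \<A> X Y"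
    and fg: "homotopic \<A> Y Y (%i x. x) (%i x. f i (g i x))"
    and gf': "homotopic \<A> X X (%i x. x) (%i x. g i (f' i x))"
  shows "qis X Y f"
proof -
  note cfg = chain_map_comp[OF g f Y X Y] and cgf = chain_map_comp[OF f' g X Y X]
  have q1: "qis Y Y (%i x. f i (g i x))"
    using homotopic_qis[OF fg Y Y chain_map_id[OF Y] cfg] qis_id[OF Y] by simp
  have q2: "qis X X (%i x. g i (f' i x))"
    using homotopic_qis[OF gf' X X chain_map_id[OF X] cgf] qis_id[OF X] by simp
  have "qis Y X g"
  proof (rule qisI[OF g Y X])
    fix i x y assume x: "x \<in> cocycles Y i" "y \<in> cocycles Y i" "coh X i (g i x) (g i y)"
    have "coh Y i (f i (g i x)) (f i (g i y))"
      by (rule coh_map[OF f X chain_map_closed[OF g cocycles_carrier[OF x(2)]] x(3)])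
    then show "coh Y i x y" by (rule qis_inj[OF q1 Y Y x(1,2)])
  next
    fix i y assume "y \<in> cocycles X i"
    then obtain x where x: "x \<in> cocycles X i" "coh X i y (g i (f' i x))" by (rule qis_surj[OF q2])
    then show "\<exists>x\<in>cocycles Y i. coh X i y (g i x)"
      by (intro bexI[of _ "f' i x"] chain_map_cocycle[OF f' _ X Y])
  qed
  then show ?thesis by (rule qis_cancel_right[OF Y X Y g f q1])
qed

end

context mod_cat
begin

text \<open>The identity of \<open>Q\<close> lifts along \<open>f\<close>; the lift \<open>g\<close>
  is again a quasi-isomorphism, so the identity of \<open>P\<close> lifts along it. Unlike a
  quasi-isomorphism, these data survive tensoring.\<close>

lemma K_projective_homotopy_inverse:
  assumes P: "K_projective \<A> P" and Q: "K_projective \<A> Q" and f: "qis P Q f"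
  obtains g f' where "g \<in> chain_maps \<A> Q P" "f' \<in> chain_maps \<A> P Q"
    "homotopic \<A> Q Q (%i x. x) (%i x. f i (g i x))" "homotopic \<A> P P (%i x. x) (%i x. g i (f' i x))"
proof -
  note PC = K_projective_complex[OF P] and QC = K_projective_complex[OF Q]
  obtain g where g: "g \<in> chain_maps \<A> Q P" and h: "homotopic \<A> Q Q (%i x. x) (%i x. f i (g i x))"
    by (rule lift_along_qis[OF Q PC QC f chain_map_id[OF QC]])
  note fg = chain_map_comp[OF g qisD(1)[OF f] QC PC QC]
  have "qis Q Q (%i x. f i (g i x))" using homotopic_qis[OF h QC QC chain_map_id[OF QC] fg] qis_id[OF QC] by simp
  then have q: "qis Q P g" by (rule qis_cancel_left[OF QC PC QC g qisD(1)[OF f] _ f])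
  obtain f' where "f' \<in> chain_maps \<A> P Q" "homotopic \<A> P P (%i x. x) (%i x. g i (f' i x))"
    by (rule lift_along_qis[OF P QC PC q chain_map_id[OF PC]])
  then show thesis using that g h by blast
qed

end

section \<open>Perfect complexes\<close>

locale perf_cat = mod_cat +
  fixes \<P>
  assumes \<P>_projective: "P \<in> \<P> ==> projective \<A> P"
    and \<P>_bp: "P \<in> \<P> ==> Q \<in> \<P> ==> bp P Q \<in> \<P>"
    and \<P>_zero: "P \<in> Ob \<A> ==> carrier P = {(zero P)} ==> P \<in> \<P>"
begin

definition perf :: "('a, 'b) cpx => bool"
  where "perf P \<longleftrightarrow> P \<in> complexes \<A> \<and> bounded_cpx P \<and> (\<forall>i. obj P i \<in> \<P>)"

lemma perf_complex: "perf P ==> P \<in> complexes \<A>"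
  by (simp add: perf_def)

lemma bounded_top:
  assumes "bounded_cpx P"
  obtains n where "!!i. i > n ==> carrier (obj P i) = {(zero (obj P i))}"
proof -
  let ?S = "{i. carrier (obj P i) \<noteq> {(zero (obj P i))}}"
  have "finite ?S" using assms by (simp add: bounded_cpx_def)
  then obtain n where "\<forall>i\<in>?S. i \<le> n" using finite_has_maximal[of ?S]
    by (metis (no_types, lifting) Max.coboundedI)
  then show thesis by (intro that[of n]) force
qed

lemma perf_K_projective:
  assumes "perf P"
  shows "K_projective \<A> P"
proof -
  obtain n where "!!i. i > n ==> carrier (obj P i) = {(zero (obj P i))}"
    using assms bounded_top[of P] by (auto simp: perf_def)
  then show ?thesis
    using assms \<P>_projective by (intro bounded_projective_K_projective[of P n]) (auto simp: perf_def)
qed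

text \<open>A perfect complex is K-projective, so an isomorphism with it in the derived category is
  given by a single quasi-isomorphism starting at it.\<close>

lemma Kb_iff: "X \<in> Kb \<A> \<P> \<longleftrightarrow> X \<in> complexes \<A> \<and> (\<exists>P s. perf P \<and> qis P X s)"
proof
  assume "X \<in> Kb \<A> \<P>"
  then obtain P where X: "X \<in> complexes \<A>" and P: "perf P" and d: "derived_iso \<A> X P"
    by (auto simp: Kb_def perf_def)
  obtain Z s t where Z: "Z \<in> complexes \<A>" and st: "qis Z X s" "qis Z P t" by (rule derived_isoE[OF d])
  note PC = perf_complex[OF P]
  obtain q where "qis P X q" by (rule transfer_qis[OF perf_K_projective[OF P] Z X PC st qis_id[OF PC]])
  then show "X \<in> complexes \<A> \<and> (\<exists>P s. perf P \<and> qis P X s)" using X P by blast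
next
  assume "X \<in> complexes \<A> \<and> (\<exists>P s. perf P \<and> qis P X s)"
  then obtain P s where X: "X \<in> complexes \<A>" and P: "perf P" and s: "qis P X s" by blast
  note PC = perf_complex[OF P]
  have "derived_iso \<A> X P" by (rule derived_isoI[OF X PC PC s qis_id[OF PC]])
  then show "X \<in> Kb \<A> \<P>" using X P by (auto simp: Kb_def perf_def)
qed

lemma perf_cone:
  assumes P: "perf P" and Q: "perf Q" and f: "f \<in> chain_maps \<A> P Q"
  shows "perf (cone P Q f)"
  unfolding perf_def
proof (intro conjI allI)
  show "cone P Q f \<in> complexes \<A>" by (rule cone_complex[OF perf_complex[OF Q] perf_complex[OF P] f])
  show "obj (cone P Q f) i \<in> \<P>" for i using P Q by (simp add: \<P>_bp perf_def)
  let ?S = "%P. {i. carrier (obj P i) \<noteq> {(zero (obj P i))}}"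
  have "finite ((%i. i + 1) -` ?S P)" "finite (?S Q)"
    using P Q by (auto simp only: perf_def bounded_cpx_def intro!: finite_vimageI injI)
  then have "finite ((%i. i + 1) -` ?S P \<union> ?S Q)" by simp
  moreover have "?S (cone P Q f) \<subseteq> (%i. i + 1) -` ?S P \<union> ?S Q"
    by (auto simp: bp_carrier bp_zero)
  ultimately show "bounded_cpx (cone P Q f)" unfolding bounded_cpx_def by (rule rev_finite_subset)
qed

lemma perf_shift:
  assumes "perf P"
  shows "perf (shift P)"
proof -
  have "finite ((%i. i - 1) -` {i. carrier (obj P i) \<noteq> {(zero (obj P i))}})"
    using assms by (auto simp only: perf_def bounded_cpx_def intro!: finite_vimageI injI)
  then show ?thesis using assms by (simp add: perf_def bounded_cpx_def shift_complex vimage_def)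
qed

end

context mod_cat
begin

lemma projectiveD:
  assumes "projective \<A> P" "M \<in> Ob \<A>" "N \<in> Ob \<A>" "g \<in> Hom \<A> M N" "f \<in> Hom \<A> P N"
    "g ` carrier M = carrier N"
  obtains h where "h \<in> Hom \<A> P M" "\<forall>p\<in>carrier P. g (h p) = f p"
  using assms unfolding projective_def by blast

lemma projective_Ob: "projective \<A> P ==> P \<in> Ob \<A>"
  by (simp add: projective_def)

lemma in1_Hom: "M \<in> Ob \<A> ==> N \<in> Ob \<A> ==> (%a. pr a (zero N)) \<in> Hom \<A> M (bp M N)"
  and in2_Hom: "M \<in> Ob \<A> ==> N \<in> Ob \<A> ==> pr (zero M) \<in> Hom \<A> N (bp M N)"
  by (intro pr_Hom Hom_id Hom_zero; assumption)+

lemma projective_bp: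
  assumes P: "projective \<A> P" and Q: "projective \<A> Q"
  shows "projective \<A> (bp P Q)"
  unfolding projective_def
proof (intro conjI ballI impI)
  note PO = projective_Ob[OF P] and QO = projective_Ob[OF Q]
  show B: "bp P Q \<in> Ob \<A>" using PO QO by (rule bp_Ob)
  fix M N g f assume M: "M \<in> Ob \<A>" and N: "N \<in> Ob \<A>" and g: "g \<in> Hom \<A> M N"
    and f: "f \<in> Hom \<A> (bp P Q) N" and s: "g ` carrier M = carrier N"
  obtain h1 where h1: "h1 \<in> Hom \<A> P M" "\<forall>p\<in>carrier P. g (h1 p) = f (pr p (zero Q))"
    by (rule projectiveD[OF P M N g Hom_comp[OF in1_Hom[OF PO QO] f PO B N] s])
  obtain h2 where h2: "h2 \<in> Hom \<A> Q M" "\<forall>p\<in>carrier Q. g (h2 p) = f (pr (zero P) p)"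
    by (rule projectiveD[OF Q M N g Hom_comp[OF in2_Hom[OF PO QO] f QO B N] s])
  have "(%z. h1 (p1 z) \<oplus>\<^bsub>M\<^esub> h2 (p2 z)) \<in> Hom \<A> (bp P Q) M"
    by (intro Hom_add Hom_comp[OF p1_Hom h1(1)] Hom_comp[OF p2_Hom h2(1)] PO QO B M)
  moreover have "g (h1 (p1 z) \<oplus>\<^bsub>M\<^esub> h2 (p2 z)) = f z" if z: "z \<in> carrier (bp P Q)" for z
  proof -
    obtain a b where ab: "z = pr a b" "a \<in> carrier P" "b \<in> carrier Q" using z by (rule bpE)
    have "z = pr a (zero Q) \<oplus>\<^bsub>bp P Q\<^esub> pr (zero P) b" using ab PO QO by (simp add: bp_add)
    then have "f z = f (pr a (zero Q)) \<oplus>\<^bsub>N\<^esub> f (pr (zero P) b)" using Hom_map_add[OF f] ab PO QO by simp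
    then show ?thesis
      using h1(2) h2(2) Hom_map_add[OF g Hom_closed[OF h1(1)] Hom_closed[OF h2(1)]] ab by simp
  qed
  ultimately show "\<exists>h\<in>Hom \<A> (bp P Q) M. \<forall>p\<in>carrier (bp P Q). g (h p) = f p"
    by (intro bexI[of _ "%z. h1 (p1 z) \<oplus>\<^bsub>M\<^esub> h2 (p2 z)"] ballI)
qed

lemma projective_zero:
  assumes P: "P \<in> Ob \<A>" and z: "carrier P = {(zero P)}"
  shows "projective \<A> P"
  unfolding projective_def
proof (intro conjI ballI impI P)
  fix M N g f assume M: "M \<in> Ob \<A>" and N: "N \<in> Ob \<A>" and g: "g \<in> Hom \<A> M N" and f: "f \<in> Hom \<A> P N"
  have "\<forall>p\<in>carrier P. g (zero M) = f p"
    using z Hom_map_zero[OF f P N] Hom_map_zero[OF g M N] by simp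
  then show "\<exists>h\<in>Hom \<A> P M. \<forall>p\<in>carrier P. g (h p) = f p"
    by (intro bexI[of _ "%x. (zero M)"] Hom_zero P M)
qed

lemma projective_retract:
  assumes P: "projective \<A> P" and M: "M \<in> Ob \<A>" and i: "i \<in> Hom \<A> M P" and p: "p \<in> Hom \<A> P M"
    and pi: "!!x. x \<in> carrier M ==> p (i x) = x"
  shows "projective \<A> M"
  unfolding projective_def
proof (intro conjI ballI impI M)
  note PO = projective_Ob[OF P]
  fix L N g f assume L: "L \<in> Ob \<A>" and N: "N \<in> Ob \<A>" and g: "g \<in> Hom \<A> L N" and f: "f \<in> Hom \<A> M N"
    and s: "g ` carrier L = carrier N"
  obtain h where h: "h \<in> Hom \<A> P L" "\<forall>x\<in>carrier P. g (h x) = f (p x)"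
    by (rule projectiveD[OF P L N g Hom_comp[OF p f PO M N] s])
  have "\<forall>x\<in>carrier M. g (h (i x)) = f x" using bspec[OF h(2) Hom_closed[OF i]] pi by simp
  then show "\<exists>h\<in>Hom \<A> M L. \<forall>x\<in>carrier M. g (h x) = f x"
    by (intro bexI[of _ "%x. h (i x)"] Hom_comp[OF i h(1) M PO L])
qed

end

section \<open>Right modules\<close>

lemma right_moduleI:
  assumes "ring R"
    and "!!x y. x \<in> carrier M ==> y \<in> carrier M ==> x \<oplus>\<^bsub>M\<^esub> y \<in> carrier M"
    and "(zero M) \<in> carrier M"
    and "!!x y z. x \<in> carrier M ==> y \<in> carrier M ==> z \<in> carrier M ==>
          (x \<oplus>\<^bsub>M\<^esub> y) \<oplus>\<^bsub>M\<^esub> z = x \<oplus>\<^bsub>M\<^esub> (y \<oplus>\<^bsub>M\<^esub> z)"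
    and "!!x y. x \<in> carrier M ==> y \<in> carrier M ==> x \<oplus>\<^bsub>M\<^esub> y = y \<oplus>\<^bsub>M\<^esub> x"
    and "!!x. x \<in> carrier M ==> (zero M) \<oplus>\<^bsub>M\<^esub> x = x"
    and "!!x. x \<in> carrier M ==> \<exists>y\<in>carrier M. y \<oplus>\<^bsub>M\<^esub> x = (zero M)"
    and "!!m r. m \<in> carrier M ==> r \<in> carrier R ==> m \<cdot>\<^bsub>M\<^esub> r \<in> carrier M"
    and "!!m r s. m \<in> carrier M ==> r \<in> carrier R ==> s \<in> carrier R ==>
          m \<cdot>\<^bsub>M\<^esub> (r \<oplus>\<^bsub>R\<^esub> s) = m \<cdot>\<^bsub>M\<^esub> r \<oplus>\<^bsub>M\<^esub> m \<cdot>\<^bsub>M\<^esub> s"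
    and "!!m n r. m \<in> carrier M ==> n \<in> carrier M ==> r \<in> carrier R ==>
          (m \<oplus>\<^bsub>M\<^esub> n) \<cdot>\<^bsub>M\<^esub> r = m \<cdot>\<^bsub>M\<^esub> r \<oplus>\<^bsub>M\<^esub> n \<cdot>\<^bsub>M\<^esub> r"
    and "!!m r s. m \<in> carrier M ==> r \<in> carrier R ==> s \<in> carrier R ==>
          m \<cdot>\<^bsub>M\<^esub> (r \<otimes>\<^bsub>R\<^esub> s) = (m \<cdot>\<^bsub>M\<^esub> r) \<cdot>\<^bsub>M\<^esub> s"
    and "!!m. m \<in> carrier M ==> m \<cdot>\<^bsub>M\<^esub> \<one>\<^bsub>R\<^esub> = m"
  shows "right_module R M"
proof -
  have "abelian_group M" using assms(2-7) by (rule abelian_groupI)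
  then show ?thesis using assms(1,8-)
    by (simp add: right_module_def right_module_axioms_def)
qed

context right_module
begin

lemmas rm_add_closed = M.a_closed
lemmas rm_zero_closed = M.zero_closed

lemma rsmult_zero: "r \<in> carrier R ==> (zero M) \<cdot>\<^bsub>M\<^esub> r = (zero M)"
  using rsmult_add[of "(zero M)" "(zero M)" r] rsmult_closed[of "(zero M)" r] by simp

lemma rsmult_zero_scalar: "m \<in> carrier M ==> m \<cdot>\<^bsub>M\<^esub> (zero R) = (zero M)"
  using rsmult_add_scalar[of m "(zero R)" "(zero R)"] rsmult_closed[of m "(zero R)"] by simp

lemma rsmult_neg:
  assumes "m \<in> carrier M" "r \<in> carrier R"
  shows "(\<ominus>\<^bsub>M\<^esub> m) \<cdot>\<^bsub>M\<^esub> r = \<ominus>\<^bsub>M\<^esub> (m \<cdot>\<^bsub>M\<^esub> r)"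
proof -
  have "(\<ominus>\<^bsub>M\<^esub> m) \<cdot>\<^bsub>M\<^esub> r \<oplus>\<^bsub>M\<^esub> m \<cdot>\<^bsub>M\<^esub> r = (zero M)"
    using rsmult_add[of "\<ominus>\<^bsub>M\<^esub> m" m r] assms by (simp add: M.l_neg rsmult_zero)
  then show ?thesis using assms rsmult_closed by (intro M.minus_equality[symmetric]) simp_all
qed

text \<open>Transport of the axioms along a surjection compatible with the operations; it serves
  quotients and changes of the record type alike.\<close>

lemma right_module_image:
  assumes Q: "carrier Q = \<pi> ` carrier M" "(zero Q) = \<pi> (zero M)"
    "!!x y. x \<in> carrier M ==> y \<in> carrier M ==> \<pi> x \<oplus>\<^bsub>Q\<^esub> \<pi> y = \<pi> (x \<oplus>\<^bsub>M\<^esub> y)"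
    "!!x r. x \<in> carrier M ==> r \<in> carrier R ==> \<pi> x \<cdot>\<^bsub>Q\<^esub> r = \<pi> (x \<cdot>\<^bsub>M\<^esub> r)"
  shows "right_module R Q"
proof (rule right_moduleI)
  fix x assume "x \<in> carrier Q"
  then obtain a where x: "x = \<pi> a" "a \<in> carrier M" using Q(1) by blast
  then show "\<exists>y\<in>carrier Q. y \<oplus>\<^bsub>Q\<^esub> x = (zero Q)"
    using Q by (intro bexI[of _ "\<pi> (\<ominus>\<^bsub>M\<^esub> a)"]) (auto simp: M.l_neg)
next
  fix x y assume "x \<in> carrier Q" "y \<in> carrier Q"
  then obtain a b where x: "x = \<pi> a" "a \<in> carrier M" "y = \<pi> b" "b \<in> carrier M" using Q(1) by blast
  then show "x \<oplus>\<^bsub>Q\<^esub> y = y \<oplus>\<^bsub>Q\<^esub> x" by (simp add: Q M.a_comm)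
qed (use Q in \<open>auto simp: R.ring_axioms M.a_assoc rsmult_closed
      rsmult_add rsmult_add_scalar rsmult_assoc rsmult_one\<close>)

definition submod
  where "submod H \<longleftrightarrow> H \<subseteq> carrier M \<and> (zero M) \<in> H \<and> (\<forall>x\<in>H. \<forall>y\<in>H. x \<oplus>\<^bsub>M\<^esub> y \<in> H) \<and>
    (\<forall>x\<in>H. \<forall>r\<in>carrier R. x \<cdot>\<^bsub>M\<^esub> r \<in> H)"

lemma submod_neg:
  assumes "submod H" "x \<in> H"
  shows "\<ominus>\<^bsub>M\<^esub> x \<in> H"
proof -
  have x: "x \<in> carrier M" using assms by (auto simp: submod_def)
  have "x \<cdot>\<^bsub>M\<^esub> (\<ominus>\<^bsub>R\<^esub> \<one>\<^bsub>R\<^esub>) \<oplus>\<^bsub>M\<^esub> x = x \<cdot>\<^bsub>M\<^esub> (\<ominus>\<^bsub>R\<^esub> \<one>\<^bsub>R\<^esub> \<oplus>\<^bsub>R\<^esub> \<one>\<^bsub>R\<^esub>)"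
    using x rsmult_add_scalar[of x "\<ominus>\<^bsub>R\<^esub> \<one>\<^bsub>R\<^esub>" "\<one>\<^bsub>R\<^esub>"] by (simp add: rsmult_one)
  also have "\<dots> = (zero M)" using x by (simp add: R.l_neg rsmult_zero_scalar)
  finally have "x \<cdot>\<^bsub>M\<^esub> (\<ominus>\<^bsub>R\<^esub> \<one>\<^bsub>R\<^esub>) = \<ominus>\<^bsub>M\<^esub> x"
    using x rsmult_closed by (intro M.minus_equality[symmetric]) simp_all
  moreover have "x \<cdot>\<^bsub>M\<^esub> (\<ominus>\<^bsub>R\<^esub> \<one>\<^bsub>R\<^esub>) \<in> H" using assms by (simp add: submod_def)
  ultimately show ?thesis by simp
qed

lemma right_module_sub:
  assumes H: "submod H" and K: "carrier K = H" "(zero K) = (zero M)"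
    "!!x y. x \<oplus>\<^bsub>K\<^esub> y = x \<oplus>\<^bsub>M\<^esub> y" "!!x r. x \<cdot>\<^bsub>K\<^esub> r = x \<cdot>\<^bsub>M\<^esub> r"
  shows "right_module R K"
proof -
  have HM: "!!x. x \<in> H ==> x \<in> carrier M" using H by (auto simp: submod_def)
  show ?thesis
  proof (rule right_moduleI)
    fix x assume "x \<in> carrier K"
    then have "x \<in> H" using K by simp
    then show "\<exists>y\<in>carrier K. y \<oplus>\<^bsub>K\<^esub> x = (zero K)"
      unfolding K using HM submod_neg[OF H] by (intro bexI[of _ "\<ominus>\<^bsub>M\<^esub> x"]) (simp_all add: M.l_neg)
  next
    fix x y assume "x \<in> carrier K" "y \<in> carrier K"
    then show "x \<oplus>\<^bsub>K\<^esub> y = y \<oplus>\<^bsub>K\<^esub> x" unfolding K using HM M.a_comm by blast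
  qed (use H HM in \<open>simp_all add: R.ring_axioms K submod_def M.a_assoc
      rsmult_add rsmult_add_scalar rsmult_assoc rsmult_one\<close>)
qed

lemma finsum_mem_submod:
  assumes H: "submod H" and "finite A" "!!a. a \<in> A ==> g a \<in> H"
  shows "finsum M g A \<in> H"
  using assms(2,3)
proof (induction A rule: finite_induct)
  case empty
  then show ?case using H by (simp add: submod_def)
next
  case (insert a A)
  have "g \<in> A \<rightarrow> carrier M" "g a \<in> carrier M" using insert H by (auto simp: submod_def)
  then show ?case using insert H by (simp add: M.finsum_insert submod_def)
qed

end

lemma finsum_hom:
  assumes G: "abelian_group G" and H: "abelian_group H" and f: "f \<in> hom (add_monoid G) (add_monoid H)"
    and "finite A" "g \<in> A \<rightarrow> carrier G"
  shows "f (finsum G g A) = finsum H (%a. f (g a)) A"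
proof -
  interpret G: abelian_group G by fact
  interpret H: abelian_group H by fact
  have fc: "f x \<in> carrier H" if "x \<in> carrier G" for x using f that by (auto simp: hom_def)
  have fa: "f (x \<oplus>\<^bsub>G\<^esub> y) = f x \<oplus>\<^bsub>H\<^esub> f y" if "x \<in> carrier G" "y \<in> carrier G" for x y
    using f that by (auto simp: hom_def)
  have f0: "f (zero G) = (zero H)"
    using fa[of "(zero G)" "(zero G)"] fc[of "(zero G)"] by simp
  show ?thesis using assms(4,5)
  proof (induction A rule: finite_induct)
    case (insert a A)
    have g: "g \<in> A \<rightarrow> carrier G" "g a \<in> carrier G" using insert by auto
    then have "(%a. f (g a)) \<in> A \<rightarrow> carrier H" using fc by auto
    then show ?case using insert g fc fa by (simp add: G.finsum_insert H.finsum_insert)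
  qed (simp add: f0)
qed

text \<open>The sums of multiples of elements of \<open>S\<close> form the least submodule
  containing \<open>S\<close>. In terms of submodules, generation is transported along homomorphisms
  by taking preimages.\<close>

lemma (in right_module) fin_gen_iff:
  "fin_gen R M \<longleftrightarrow> (\<exists>S. finite S \<and> S \<subseteq> carrier M \<and> (\<forall>H. submod H --> S \<subseteq> H --> H = carrier M))"
proof
  assume "fin_gen R M"
  then obtain S where S: "finite S" "S \<subseteq> carrier M"
    and gen: "!!m. m \<in> carrier M ==> \<exists>r\<in>S \<rightarrow> carrier R. m = (\<Oplus>\<^bsub>M\<^esub>s\<in>S. s \<cdot>\<^bsub>M\<^esub> r s)"
    by (auto simp: fin_gen_def)
  have "H = carrier M" if H: "submod H" "S \<subseteq> H" for H
  proof
    show "carrier M \<subseteq> H"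
    proof
      fix m assume "m \<in> carrier M"
      then obtain r where r: "r \<in> S \<rightarrow> carrier R" "m = (\<Oplus>\<^bsub>M\<^esub>s\<in>S. s \<cdot>\<^bsub>M\<^esub> r s)" using gen by blast
      show "m \<in> H" unfolding r(2) using r(1) H S
        by (intro finsum_mem_submod) (auto simp: submod_def Pi_def)
    qed
  qed (use H in \<open>simp add: submod_def\<close>)
  then show "\<exists>S. finite S \<and> S \<subseteq> carrier M \<and> (\<forall>H. submod H --> S \<subseteq> H --> H = carrier M)"
    using S by blast
next
  assume "\<exists>S. finite S \<and> S \<subseteq> carrier M \<and> (\<forall>H. submod H --> S \<subseteq> H --> H = carrier M)"
  then obtain S where S: "finite S" "S \<subseteq> carrier M"
    and gen: "!!H. submod H ==> S \<subseteq> H ==> H = carrier M" by blast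
  define H where "H = {m. \<exists>r\<in>S \<rightarrow> carrier R. m = (\<Oplus>\<^bsub>M\<^esub>s\<in>S. s \<cdot>\<^bsub>M\<^esub> r s)}"
  have cl: "(%s. s \<cdot>\<^bsub>M\<^esub> r s) \<in> S \<rightarrow> carrier M" if "r \<in> S \<rightarrow> carrier R" for r
    using that S rsmult_closed by blast
  have "submod H"
    unfolding submod_def
  proof (intro conjI ballI subsetI)
    show "m \<in> carrier M" if "m \<in> H" for m
      using that cl M.finsum_closed by (auto simp: H_def)
    have "(\<Oplus>\<^bsub>M\<^esub>s\<in>S. s \<cdot>\<^bsub>M\<^esub> (zero R)) = (\<Oplus>\<^bsub>M\<^esub>s\<in>S. (zero M))"
      using S by (intro M.finsum_cong') (auto simp: rsmult_zero_scalar)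
    then show "(zero M) \<in> H" by (auto simp: H_def M.finsum_zero intro!: bexI[of _ "%s. (zero R)"])
  next
    fix x y assume "x \<in> H" "y \<in> H"
    then obtain r t where r: "r \<in> S \<rightarrow> carrier R" "x = (\<Oplus>\<^bsub>M\<^esub>s\<in>S. s \<cdot>\<^bsub>M\<^esub> r s)"
      and t: "t \<in> S \<rightarrow> carrier R" "y = (\<Oplus>\<^bsub>M\<^esub>s\<in>S. s \<cdot>\<^bsub>M\<^esub> t s)" by (auto simp: H_def)
    have "x \<oplus>\<^bsub>M\<^esub> y = (\<Oplus>\<^bsub>M\<^esub>s\<in>S. s \<cdot>\<^bsub>M\<^esub> r s \<oplus>\<^bsub>M\<^esub> s \<cdot>\<^bsub>M\<^esub> t s)"
      unfolding r(2) t(2) by (rule M.finsum_addf[symmetric, OF cl[OF r(1)] cl[OF t(1)]])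
    also have "\<dots> = (\<Oplus>\<^bsub>M\<^esub>s\<in>S. s \<cdot>\<^bsub>M\<^esub> (r s \<oplus>\<^bsub>R\<^esub> t s))"
      using S r t by (intro M.finsum_cong') (auto simp: rsmult_add_scalar Pi_iff subset_iff rsmult_closed)
    finally show "x \<oplus>\<^bsub>M\<^esub> y \<in> H" using r t by (auto simp: H_def intro!: bexI[of _ "%s. r s \<oplus>\<^bsub>R\<^esub> t s"])
  next
    fix x a assume "x \<in> H" and a: "a \<in> carrier R"
    then obtain r where r: "r \<in> S \<rightarrow> carrier R" "x = (\<Oplus>\<^bsub>M\<^esub>s\<in>S. s \<cdot>\<^bsub>M\<^esub> r s)" by (auto simp: H_def)
    have "(%m. m \<cdot>\<^bsub>M\<^esub> a) \<in> hom (add_monoid M) (add_monoid M)"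
      using a by (auto simp: hom_def rsmult_closed rsmult_add)
    then have "x \<cdot>\<^bsub>M\<^esub> a = (\<Oplus>\<^bsub>M\<^esub>s\<in>S. (s \<cdot>\<^bsub>M\<^esub> r s) \<cdot>\<^bsub>M\<^esub> a)"
      unfolding r(2) using finsum_hom[OF M.abelian_group_axioms M.abelian_group_axioms _ S(1) cl[OF r(1)]] by simp
    also have "\<dots> = (\<Oplus>\<^bsub>M\<^esub>s\<in>S. s \<cdot>\<^bsub>M\<^esub> (r s \<otimes>\<^bsub>R\<^esub> a))"
      using S r a by (intro M.finsum_cong') (auto simp: rsmult_assoc Pi_iff subset_iff rsmult_closed)
    finally show "x \<cdot>\<^bsub>M\<^esub> a \<in> H" using r a by (auto simp: H_def intro!: bexI[of _ "%s. r s \<otimes>\<^bsub>R\<^esub> a"])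
  qed
  moreover have "S \<subseteq> H"
  proof
    fix s assume s: "s \<in> S"
    have "(\<Oplus>\<^bsub>M\<^esub>t\<in>S. t \<cdot>\<^bsub>M\<^esub> (if s = t then \<one>\<^bsub>R\<^esub> else (zero R))) = (\<Oplus>\<^bsub>M\<^esub>t\<in>S. if s = t then t else (zero M))"
      using S by (intro M.finsum_cong') (auto simp: rsmult_one rsmult_zero_scalar)
    also have "\<dots> = s" using M.finsum_singleton[OF s S(1), of "%t. t"] S(2) by auto
    finally show "s \<in> H" unfolding H_def
      by (intro CollectI bexI[of _ "%t. if s = t then \<one>\<^bsub>R\<^esub> else (zero R)"]) auto
  qed
  ultimately have "H = carrier M" by (rule gen)
  then show "fin_gen R M" unfolding fin_gen_def using S by (auto simp: H_def)
qed

lemma right_module_bp: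
  fixes R :: "('r, 'x) ring_scheme" and M :: "('r, 'm::infinite, 'e) module_scheme"
    and N :: "('r, 'm, 'f) module_scheme" and B :: "('r, 'm, 'g) module_scheme"
  assumes M: "right_module R M" and N: "right_module R N"
    and B: "carrier B = {pr a b | a b. a \<in> carrier M \<and> b \<in> carrier N}" "(zero B) = pr (zero M) (zero N)"
    "!!a b c d. pr a b \<oplus>\<^bsub>B\<^esub> pr c d = pr (a \<oplus>\<^bsub>M\<^esub> c) (b \<oplus>\<^bsub>N\<^esub> d)"
    "!!a b r. pr a b \<cdot>\<^bsub>B\<^esub> r = pr (a \<cdot>\<^bsub>M\<^esub> r) (b \<cdot>\<^bsub>N\<^esub> r)"
  shows "right_module R B"
proof -
  interpret M: right_module R M by fact
  interpret N: right_module R N by fact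
  show ?thesis
  proof (rule right_moduleI)
    fix x assume "x \<in> carrier B"
    then obtain a b where x: "x = pr a b" "a \<in> carrier M" "b \<in> carrier N" using B(1) by blast
    then show "\<exists>y\<in>carrier B. y \<oplus>\<^bsub>B\<^esub> x = (zero B)"
      using B by (intro bexI[of _ "pr (\<ominus>\<^bsub>M\<^esub> a) (\<ominus>\<^bsub>N\<^esub> b)"]) (auto simp: M.M.l_neg N.M.l_neg)
  qed (use B in \<open>auto simp: M.R.ring_axioms M.M.a_assoc N.M.a_assoc M.rsmult_closed N.rsmult_closed
      M.rsmult_add N.rsmult_add M.rsmult_add_scalar N.rsmult_add_scalar M.rsmult_assoc N.rsmult_assoc
      M.rsmult_one N.rsmult_one intro: M.M.a_comm N.M.a_comm\<close>)
qed

lemma mod_homI: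
  assumes "!!x. x \<in> carrier M ==> f x \<in> carrier N"
    and "!!x y. x \<in> carrier M ==> y \<in> carrier M ==> f (x \<oplus>\<^bsub>M\<^esub> y) = f x \<oplus>\<^bsub>N\<^esub> f y"
    and "!!x r. x \<in> carrier M ==> r \<in> carrier R ==> f (x \<cdot>\<^bsub>M\<^esub> r) = f x \<cdot>\<^bsub>N\<^esub> r"
  shows "f \<in> mod_hom R M N"
  using assms by (auto simp: mod_hom_def hom_def)

lemma mod_homD:
  assumes "f \<in> mod_hom R M N"
  shows "x \<in> carrier M ==> f x \<in> carrier N"
    and "x \<in> carrier M ==> y \<in> carrier M ==> f (x \<oplus>\<^bsub>M\<^esub> y) = f x \<oplus>\<^bsub>N\<^esub> f y"
    and "x \<in> carrier M ==> r \<in> carrier R ==> f (x \<cdot>\<^bsub>M\<^esub> r) = f x \<cdot>\<^bsub>N\<^esub> r"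
  using assms by (auto simp: mod_hom_def hom_def)

lemma mod_hom_zero:
  assumes "f \<in> mod_hom R M N" "right_module R M" "right_module R N"
  shows "f (zero M) = (zero N)"
proof -
  interpret M: right_module R M by fact
  interpret N: right_module R N by fact
  show ?thesis using mod_homD(2)[OF assms(1), of "(zero M)" "(zero M)"] mod_homD(1)[OF assms(1), of "(zero M)"] by simp
qed

text \<open>The preimages of a submodule of \<open>B\<close> under \<open>i\<close> and
  \<open>j\<close> are submodules that contain the generators, hence everything. Stated for maps
  \<open>i\<close> and \<open>j\<close> rather than a fixed biproduct, it covers \<open>mbp\<close>
  and \<open>gbp\<close>.\<close>

lemma fin_gen_bp:
  assumes M: "right_module R M" and N: "right_module R N" and B: "right_module R B"
    and i: "i \<in> mod_hom R M B" and j: "j \<in> mod_hom R N B"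
    and ij: "!!z. z \<in> carrier B ==> \<exists>a\<in>carrier M. \<exists>b\<in>carrier N. z = i a \<oplus>\<^bsub>B\<^esub> j b"
    and "fin_gen R M" "fin_gen R N"
  shows "fin_gen R B"
proof -
  interpret M: right_module R M by fact
  interpret N: right_module R N by fact
  interpret B: right_module R B by fact
  obtain S where S: "finite S" "S \<subseteq> carrier M" "!!H. M.submod H ==> S \<subseteq> H ==> H = carrier M"
    using \<open>fin_gen R M\<close> M.fin_gen_iff by blast
  obtain T where T: "finite T" "T \<subseteq> carrier N" "!!H. N.submod H ==> T \<subseteq> H ==> H = carrier N"
    using \<open>fin_gen R N\<close> N.fin_gen_iff by blast
  have "H = carrier B" if H: "B.submod H" "i ` S \<union> j ` T \<subseteq> H" for H
  proof
    have "M.submod {m \<in> carrier M. i m \<in> H}"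
      using H(1) mod_homD[OF i] mod_hom_zero[OF i M B] by (auto simp: M.submod_def B.submod_def M.rsmult_closed)
    then have 1: "{m \<in> carrier M. i m \<in> H} = carrier M" using S(2) H(2) by (intro S(3)) auto
    have "N.submod {m \<in> carrier N. j m \<in> H}"
      using H(1) mod_homD[OF j] mod_hom_zero[OF j N B] by (auto simp: N.submod_def B.submod_def N.rsmult_closed)
    then have 2: "{m \<in> carrier N. j m \<in> H} = carrier N" using T(2) H(2) by (intro T(3)) auto
    show "carrier B \<subseteq> H"
    proof
      fix z assume "z \<in> carrier B"
      then obtain a b where "a \<in> carrier M" "b \<in> carrier N" "z = i a \<oplus>\<^bsub>B\<^esub> j b" using ij by blast
      moreover have "i a \<in> H" "j b \<in> H" using 1 2 calculation(1,2) unfolding set_eq_iff mem_Collect_eq by blast+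
      ultimately show "z \<in> H" using H(1) by (simp add: B.submod_def)
    qed
  qed (use H in \<open>simp add: B.submod_def\<close>)
  then show ?thesis unfolding B.fin_gen_iff using S(1,2) T(1,2) mod_homD(1)[OF i] mod_homD(1)[OF j]
    by (intro exI[of _ "i ` S \<union> j ` T"]) auto
qed

lemma fin_gen_image:
  assumes M: "right_module R M" and N: "right_module R N" and f: "f \<in> mod_hom R M N"
    and s: "f ` carrier M = carrier N" and "fin_gen R M"
  shows "fin_gen R N"
proof -
  interpret M: right_module R M by fact
  interpret N: right_module R N by fact
  obtain S where S: "finite S" "S \<subseteq> carrier M" "!!H. M.submod H ==> S \<subseteq> H ==> H = carrier M"
    using \<open>fin_gen R M\<close> M.fin_gen_iff by blast
  have "H = carrier N" if H: "N.submod H" "f ` S \<subseteq> H" for H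
  proof
    have "M.submod {m \<in> carrier M. f m \<in> H}"
      using H(1) mod_homD[OF f] mod_hom_zero[OF f M N] by (auto simp: M.submod_def N.submod_def M.rsmult_closed)
    then have "{m \<in> carrier M. f m \<in> H} = carrier M" using S(2) H(2) by (intro S(3)) auto
    then have "\<forall>m\<in>carrier M. f m \<in> H" unfolding set_eq_iff mem_Collect_eq by blast
    then show "carrier N \<subseteq> H" unfolding s[symmetric] by (simp add: image_subset_iff)
  qed (use H in \<open>simp add: N.submod_def\<close>)
  then show ?thesis unfolding N.fin_gen_iff using S(1,2) mod_homD(1)[OF f]
    by (intro exI[of _ "f ` S"]) auto
qed

lemma fin_gen_zero:
  assumes M: "right_module R M" and z: "carrier M = {(zero M)}"
  shows "fin_gen R M"
proof -
  interpret M: right_module R M by fact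
  show ?thesis unfolding M.fin_gen_iff using z by (intro exI[of _ "{}"]) (auto simp: M.submod_def)
qed

section \<open>The category of right modules\<close>

lemma Ob_Mod_cat [simp]: "M \<in> Ob (Mod_cat R) \<longleftrightarrow> right_module R M"
  and Hom_Mod_cat [simp]: "Hom (Mod_cat R) = mod_hom R"
  by (simp_all add: Mod_cat_def)

definition mbp :: "('r, 'u::infinite) module => ('r, 'u) module => ('r, 'u) module"
  where "mbp M N = \<lparr>carrier = {pr a b | a b. a \<in> carrier M \<and> b \<in> carrier N},
    monoid.mult = undefined, one = undefined, zero = pr (zero M) (zero N),
    add = (%x y. pr (p1 x \<oplus>\<^bsub>M\<^esub> p1 y) (p2 x \<oplus>\<^bsub>N\<^esub> p2 y)),
    smult = (%r x. pr (p1 x \<cdot>\<^bsub>M\<^esub> r) (p2 x \<cdot>\<^bsub>N\<^esub> r))\<rparr>"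

definition mkn :: "('r, 'u) module => 'u set => ('r, 'u) module"
  where "mkn M S = M\<lparr>carrier := S\<rparr>"

lemma mbp_sel [simp]:
  "carrier (mbp M N) = {pr a b | a b. a \<in> carrier M \<and> b \<in> carrier N}"
  "(zero (mbp M N)) = pr (zero M) (zero N)"
  "x \<oplus>\<^bsub>mbp M N\<^esub> y = pr (p1 x \<oplus>\<^bsub>M\<^esub> p1 y) (p2 x \<oplus>\<^bsub>N\<^esub> p2 y)"
  "x \<cdot>\<^bsub>mbp M N\<^esub> r = pr (p1 x \<cdot>\<^bsub>M\<^esub> r) (p2 x \<cdot>\<^bsub>N\<^esub> r)"
  by (simp_all add: mbp_def)

lemma mkn_sel [simp]:
  "carrier (mkn M S) = S" "(zero (mkn M S)) = (zero M)" "x \<oplus>\<^bsub>mkn M S\<^esub> y = x \<oplus>\<^bsub>M\<^esub> y" "x \<cdot>\<^bsub>mkn M S\<^esub> r = x \<cdot>\<^bsub>M\<^esub> r"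
  by (simp_all add: mkn_def)

lemma mod_hom_cong:
  assumes "f \<in> mod_hom R M N" "right_module R M" "!!x. x \<in> carrier M ==> g x = f x"
  shows "g \<in> mod_hom R M N"
proof -
  interpret M: right_module R M by fact
  show ?thesis using mod_homD[OF assms(1)] assms(3) by (intro mod_homI) (simp_all add: M.rsmult_closed)
qed

lemma mod_hom_id: "(%x. x) \<in> mod_hom R M M"
  by (rule mod_homI) simp_all

lemma mod_hom_comp:
  assumes "f \<in> mod_hom R L M" "g \<in> mod_hom R M N"
  shows "(%x. g (f x)) \<in> mod_hom R L N"
  using mod_homD[OF assms(1)] mod_homD[OF assms(2)] by (intro mod_homI) simp_all

lemma mod_hom_const_zero:
  assumes "right_module R N"
  shows "(%x. (zero N)) \<in> mod_hom R M N"
proof -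
  interpret N: right_module R N by fact
  show ?thesis by (intro mod_homI) (simp_all add: N.rsmult_zero)
qed

lemma mod_hom_add:
  assumes "f \<in> mod_hom R M N" "g \<in> mod_hom R M N" "right_module R N"
  shows "(%x. f x \<oplus>\<^bsub>N\<^esub> g x) \<in> mod_hom R M N"
proof -
  interpret N: right_module R N by fact
  show ?thesis using mod_homD[OF assms(1)] mod_homD[OF assms(2)]
    by (intro mod_homI) (simp_all add: N.rsmult_add N.M.a_ac)
qed

lemma mod_hom_neg:
  assumes "f \<in> mod_hom R M N" "right_module R N"
  shows "(%x. \<ominus>\<^bsub>N\<^esub> f x) \<in> mod_hom R M N"
proof -
  interpret N: right_module R N by fact
  show ?thesis using mod_homD[OF assms(1)]
    by (intro mod_homI) (simp_all add: N.rsmult_neg N.M.minus_add)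
qed

lemma mod_hom_map_neg:
  assumes "f \<in> mod_hom R M N" "right_module R M" "right_module R N" "x \<in> carrier M"
  shows "f (\<ominus>\<^bsub>M\<^esub> x) = \<ominus>\<^bsub>N\<^esub> f x"
proof -
  interpret M: right_module R M by fact
  interpret N: right_module R N by fact
  have "f (\<ominus>\<^bsub>M\<^esub> x) \<oplus>\<^bsub>N\<^esub> f x = (zero N)"
    using mod_homD(2)[OF assms(1), of "\<ominus>\<^bsub>M\<^esub> x" x] assms mod_hom_zero[OF assms(1-3)] by (simp add: M.M.l_neg)
  then show ?thesis using mod_homD(1)[OF assms(1)] assms(4) by (intro N.M.minus_equality[symmetric]) simp_all
qed

lemma kernel_submod:
  assumes "f \<in> mod_hom R M N" "right_module R M" "right_module R N"
  shows "right_module.submod R M {x \<in> carrier M. f x = (zero N)}"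
proof -
  interpret M: right_module R M by fact
  interpret N: right_module R N by fact
  show ?thesis using mod_homD[OF assms(1)] mod_hom_zero[OF assms]
    by (simp add: M.submod_def M.rsmult_closed N.rsmult_zero subset_iff)
qed

lemma image_submod:
  assumes f: "f \<in> mod_hom R M N" and M: "right_module R M" and N: "right_module R N"
  shows "right_module.submod R N (f ` carrier M)"
proof -
  interpret M: right_module R M by fact
  interpret N: right_module R N by fact
  show ?thesis unfolding N.submod_def
  proof (intro conjI ballI)
    show "(zero N) \<in> f ` carrier M" using mod_hom_zero[OF f M N] by (intro image_eqI[of _ _ "(zero M)"]) simp_all
    show "x \<oplus>\<^bsub>N\<^esub> y \<in> f ` carrier M" if xy: "x \<in> f ` carrier M" "y \<in> f ` carrier M" for x y
    proof -
      obtain a b where "x = f a" "y = f b" "a \<in> carrier M" "b \<in> carrier M" using xy by blast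
      then show ?thesis using mod_homD(2)[OF f] by (intro image_eqI[of _ _ "a \<oplus>\<^bsub>M\<^esub> b"]) simp_all
    qed
    show "x \<cdot>\<^bsub>N\<^esub> r \<in> f ` carrier M" if x: "x \<in> f ` carrier M" and r: "r \<in> carrier R" for x r
    proof -
      obtain a where "x = f a" "a \<in> carrier M" using x by blast
      then show ?thesis using mod_homD(3)[OF f] r by (intro image_eqI[of _ _ "a \<cdot>\<^bsub>M\<^esub> r"]) (simp_all add: M.rsmult_closed)
    qed
  qed (use mod_homD(1)[OF f] in blast)
qed

lemma mod_cat0_Mod:
  fixes R :: "('r, 'x) ring_scheme"
  shows "mod_cat0 (Mod_cat R :: ('u, ('r, 'u, unit) module_ext) concrete_cat) mkn"
proof (rule mod_cat0.intro)
  fix M N :: "('r, 'u) module" assume MN: "M \<in> Ob (Mod_cat R)" "N \<in> Ob (Mod_cat R)"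
  then have M: "right_module R M" and N: "right_module R N" by simp_all
  show "(%x. (zero N)) \<in> Hom (Mod_cat R) M N" unfolding Hom_Mod_cat by (rule mod_hom_const_zero[OF N])
next
  fix M :: "('r, 'u) module" assume "M \<in> Ob (Mod_cat R)"
  then show "abelian_group M" by (simp add: right_module_def)
next
  fix f and M N :: "('r, 'u) module" assume f: "f \<in> Hom (Mod_cat R) M N"
    and "M \<in> Ob (Mod_cat R)" "N \<in> Ob (Mod_cat R)"
  then have M: "right_module R M" and N: "right_module R N" by simp_all
  show "mkn M {x \<in> carrier M. f x = (zero N)} \<in> Ob (Mod_cat R)" unfolding Ob_Mod_cat
    using f by (intro right_module.right_module_sub[OF M kernel_submod[OF _ M N, of f]]) simp_all
next
  fix f and M N :: "('r, 'u) module" assume "f \<in> Hom (Mod_cat R) M N"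
  then show "f \<in> hom (add_monoid M) (add_monoid N)" by (simp add: mod_hom_def)
next
  fix f g and M N :: "('r, 'u) module"
  assume "f \<in> Hom (Mod_cat R) M N" "M \<in> Ob (Mod_cat R)" "!!x. x \<in> carrier M ==> g x = f x"
  then show "g \<in> Hom (Mod_cat R) M N" unfolding Ob_Mod_cat Hom_Mod_cat by (rule mod_hom_cong)
next
  fix f and L M :: "('r, 'u) module" and S
  assume "f \<in> Hom (Mod_cat R) L M" "f ` carrier L \<subseteq> S"
  then show "f \<in> Hom (Mod_cat R) L (mkn M S)" using mod_homD[of f R L M]
    unfolding Hom_Mod_cat by (intro mod_homI) auto
next
  fix M :: "('r, 'u) module" and S assume "S \<subseteq> carrier M"
  then show "(%x. x) \<in> Hom (Mod_cat R) (mkn M S) M" unfolding Hom_Mod_cat by (intro mod_homI) auto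
qed (simp_all add: mod_hom_neg mod_hom_id mod_hom_comp mod_hom_add)

lemma mod_cat_Mod:
  fixes R :: "('r, 'x) ring_scheme"
  shows "mod_cat (Mod_cat R :: ('u::infinite, ('r, 'u, unit) module_ext) concrete_cat) mbp mkn"
proof (rule mod_cat.intro[OF mod_cat0_Mod mod_cat_axioms.intro])
  fix M N :: "('r, 'u) module" assume MN: "M \<in> Ob (Mod_cat R)" "N \<in> Ob (Mod_cat R)"
  then have M: "right_module R M" and N: "right_module R N" by simp_all
  show "mbp M N \<in> Ob (Mod_cat R)" unfolding Ob_Mod_cat by (rule right_module_bp[OF M N]) simp_all
  show "p1 \<in> Hom (Mod_cat R) (mbp M N) M" "p2 \<in> Hom (Mod_cat R) (mbp M N) N"
    unfolding Hom_Mod_cat by (auto intro!: mod_homI)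
next
  fix f g and L M N :: "('r, 'u) module"
  assume "f \<in> Hom (Mod_cat R) L M" "g \<in> Hom (Mod_cat R) L N"
  then have f: "f \<in> mod_hom R L M" and g: "g \<in> mod_hom R L N" by simp_all
  show "(%x. pr (f x) (g x)) \<in> Hom (Mod_cat R) L (mbp M N)"
    unfolding Hom_Mod_cat using mod_homD[OF f] mod_homD[OF g] by (intro mod_homI) auto
qed simp_all

lemma fin_gen_mbp:
  assumes M: "right_module R M" and N: "right_module R N" and "fin_gen R M" "fin_gen R N"
  shows "fin_gen R (mbp M N)"
proof -
  interpret M: right_module R M by fact
  interpret N: right_module R N by fact
  have B: "right_module R (mbp M N)" by (rule right_module_bp[OF M N]) simp_all
  show ?thesis
  proof (rule fin_gen_bp[OF M N B _ _ _ assms(3,4)])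
    show "(%a. pr a (zero N)) \<in> mod_hom R M (mbp M N)" "(%b. pr (zero M) b) \<in> mod_hom R N (mbp M N)"
      by (auto intro!: mod_homI simp: M.rsmult_zero N.rsmult_zero)
    fix z assume "z \<in> carrier (mbp M N)"
    then obtain a b where "z = pr a b" "a \<in> carrier M" "b \<in> carrier N" by auto
    then show "\<exists>a\<in>carrier M. \<exists>b\<in>carrier N. z = pr a (zero N) \<oplus>\<^bsub>mbp M N\<^esub> pr (zero M) b"
      by (intro bexI[of _ a] bexI[of _ b]) simp_all
  qed
qed

lemma perf_cat_Mod:
  fixes R :: "('r, 'x) ring_scheme"
  shows "perf_cat (Mod_cat R :: ('u::infinite, ('r, 'u, unit) module_ext) concrete_cat) mbp mkn (proj R)"
proof -
  interpret mod_cat "Mod_cat R :: ('u, ('r, 'u, unit) module_ext) concrete_cat" mbp mkn by (rule mod_cat_Mod)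
  show ?thesis
  proof
    fix P Q :: "('r, 'u) module" assume "P \<in> proj R" "Q \<in> proj R"
    then show "mbp P Q \<in> proj R"
      by (auto simp: proj_def intro!: projective_bp fin_gen_mbp dest: projective_Ob)
  next
    fix P :: "('r, 'u) module" assume "P \<in> Ob (Mod_cat R)" "carrier P = {(zero P)}"
    then show "P \<in> proj R" by (simp add: proj_def projective_zero fin_gen_zero)
  qed (simp add: proj_def)
qed

text \<open>Quotients have to live in the same universe, so the carrier consists of representatives of the cosets.\<close>

lemma (in right_module) ex_quotient:
  assumes I: "submod I"
  obtains Q :: "('r, 'm) module" and \<pi> where "right_module R Q" "\<pi> \<in> mod_hom R M Q"
    "\<pi> ` carrier M = carrier Q" "\<forall>x\<in>carrier M. \<pi> x = (zero Q) \<longleftrightarrow> x \<in> I"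
proof -
  have IM: "i \<in> carrier M" if "i \<in> I" for i using I that by (auto simp: submod_def)
  have I0: "(zero M) \<in> I" and Ia: "i \<in> I ==> j \<in> I ==> i \<oplus>\<^bsub>M\<^esub> j \<in> I" and Is: "i \<in> I ==> r \<in> carrier R ==> i \<cdot>\<^bsub>M\<^esub> r \<in> I" for i j r
    using I by (simp_all add: submod_def)
  define rel where "rel = (%x y. y \<in> carrier M \<and> (\<exists>i\<in>I. x = y \<oplus>\<^bsub>M\<^esub> i))"
  define \<rho> where "\<rho> = (%x. SOME y. rel x y)"
  have refl: "rel x x" if "x \<in> carrier M" for x
    unfolding rel_def using that I0 by (intro conjI bexI[of _ "(zero M)"]) simp_all
  have sym: "rel y x" if "rel x y" "x \<in> carrier M" for x y
  proof -
    obtain i where i: "i \<in> I" "y \<in> carrier M" "x = y \<oplus>\<^bsub>M\<^esub> i" using \<open>rel x y\<close> by (auto simp: rel_def)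
    then have "y = x \<oplus>\<^bsub>M\<^esub> \<ominus>\<^bsub>M\<^esub> i" using IM by (simp add: M.neg_add_cancel)
    then show ?thesis unfolding rel_def using that(2) submod_neg[OF I i(1)] by blast
  qed
  have trans: "rel x z" if xy: "rel x y" and yz: "rel y z" for x y z
  proof -
    obtain i where i: "i \<in> I" "x = y \<oplus>\<^bsub>M\<^esub> i" using xy unfolding rel_def by blast
    obtain j where j: "j \<in> I" "y = z \<oplus>\<^bsub>M\<^esub> j" and z: "z \<in> carrier M" using yz unfolding rel_def by blast
    note ij = i j
    then have "x = z \<oplus>\<^bsub>M\<^esub> (j \<oplus>\<^bsub>M\<^esub> i)" using IM z by (simp add: M.a_assoc)
    then show ?thesis unfolding rel_def using z Ia ij by blast
  qed
  have \<rho>: "rel x (\<rho> x)" if "x \<in> carrier M" for x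
    unfolding \<rho>_def using refl[OF that] by (rule someI)
  have \<rho>c: "\<rho> x \<in> carrier M" if "x \<in> carrier M" for x using \<rho>[OF that] by (simp add: rel_def)
  have \<rho>_eq: "\<rho> x = \<rho> y" if "rel x y" "x \<in> carrier M" for x y
  proof -
    \<comment> \<open>The two predicates coincide, so the choice operator returns the same
      representative for both.\<close>
    have "rel x = rel y" using that sym trans by (intro ext) blast
    then show ?thesis by (simp add: \<rho>_def)
  qed
  have \<rho>_iff: "\<rho> x = \<rho> y \<longleftrightarrow> rel x y" if "x \<in> carrier M" "y \<in> carrier M" for x y
  proof
    assume "\<rho> x = \<rho> y"
    then show "rel x y" using trans[OF \<rho>[OF that(1)]] sym[OF \<rho>[OF that(2)] that(2)] by simp
  qed (rule \<rho>_eq[OF _ that(1)])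
  define Q :: "('r, 'm) module" where "Q = \<lparr>carrier = \<rho> ` carrier M, monoid.mult = undefined, one = undefined,
    zero = \<rho> (zero M), add = (%x y. \<rho> (x \<oplus>\<^bsub>M\<^esub> y)), smult = (%r x. \<rho> (x \<cdot>\<^bsub>M\<^esub> r))\<rparr>"
  have add: "\<rho> x \<oplus>\<^bsub>Q\<^esub> \<rho> y = \<rho> (x \<oplus>\<^bsub>M\<^esub> y)" if xy: "x \<in> carrier M" "y \<in> carrier M" for x y
  proof -
    obtain i j where ij: "i \<in> I" "x = \<rho> x \<oplus>\<^bsub>M\<^esub> i" "j \<in> I" "y = \<rho> y \<oplus>\<^bsub>M\<^esub> j"
      using \<rho>[OF xy(1)] \<rho>[OF xy(2)] by (auto simp: rel_def)
    have "x \<oplus>\<^bsub>M\<^esub> y = (\<rho> x \<oplus>\<^bsub>M\<^esub> i) \<oplus>\<^bsub>M\<^esub> (\<rho> y \<oplus>\<^bsub>M\<^esub> j)" using ij by simp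
    also have "\<dots> = (\<rho> x \<oplus>\<^bsub>M\<^esub> \<rho> y) \<oplus>\<^bsub>M\<^esub> (i \<oplus>\<^bsub>M\<^esub> j)"
      using \<rho>c xy ij(1,3) IM by (simp add: M.a_ac)
    finally have "rel (x \<oplus>\<^bsub>M\<^esub> y) (\<rho> x \<oplus>\<^bsub>M\<^esub> \<rho> y)" unfolding rel_def using \<rho>c xy ij Ia by blast
    from \<rho>_eq[OF this] show ?thesis using xy by (simp add: Q_def)
  qed
  have smult: "\<rho> x \<cdot>\<^bsub>Q\<^esub> r = \<rho> (x \<cdot>\<^bsub>M\<^esub> r)" if xy: "x \<in> carrier M" "r \<in> carrier R" for x r
  proof -
    obtain i where ij: "i \<in> I" "x = \<rho> x \<oplus>\<^bsub>M\<^esub> i" using \<rho>[OF xy(1)] by (auto simp: rel_def)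
    have "x \<cdot>\<^bsub>M\<^esub> r = (\<rho> x \<oplus>\<^bsub>M\<^esub> i) \<cdot>\<^bsub>M\<^esub> r" using ij by simp
    also have "\<dots> = \<rho> x \<cdot>\<^bsub>M\<^esub> r \<oplus>\<^bsub>M\<^esub> i \<cdot>\<^bsub>M\<^esub> r"
      using \<rho>c xy ij(1) IM by (simp add: rsmult_add)
    finally have "rel (x \<cdot>\<^bsub>M\<^esub> r) (\<rho> x \<cdot>\<^bsub>M\<^esub> r)" unfolding rel_def using \<rho>c xy ij Is rsmult_closed by blast
    from \<rho>_eq[OF this] show ?thesis using xy by (simp add: Q_def rsmult_closed)
  qed
  have "right_module R Q" by (rule right_module_image[of _ \<rho>]) (simp_all add: add smult, simp_all add: Q_def)
  moreover have "\<rho> \<in> mod_hom R M Q" using add smult by (intro mod_homI) (simp_all, simp add: Q_def)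
  moreover have "\<rho> ` carrier M = carrier Q" by (simp add: Q_def)
  moreover have "\<forall>x\<in>carrier M. \<rho> x = (zero Q) \<longleftrightarrow> x \<in> I"
    using \<rho>_iff IM by (auto simp: Q_def rel_def)
  ultimately show thesis by (rule that)
qed

lemma mod_hom_factor:
  assumes M: "right_module R M" and Q: "right_module R Q" and N: "right_module R N"
    and \<pi>: "\<pi> \<in> mod_hom R M Q" and s: "\<pi> ` carrier M = carrier Q" and f: "f \<in> mod_hom R M N"
    and z: "!!x. x \<in> carrier M ==> \<pi> x = (zero Q) ==> f x = (zero N)"
  obtains h where "h \<in> mod_hom R Q N" "\<forall>x\<in>carrier M. h (\<pi> x) = f x"
proof -
  interpret M: right_module R M by fact
  interpret Q: right_module R Q by fact
  interpret N: right_module R N by fact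
  define h where "h = (%q. f (SOME x. x \<in> carrier M \<and> \<pi> x = q))"
  have h: "h (\<pi> x) = f x" if x: "x \<in> carrier M" for x
  proof -
    define y where "y = (SOME y. y \<in> carrier M \<and> \<pi> y = \<pi> x)"
    have y: "y \<in> carrier M" "\<pi> y = \<pi> x"
      using someI[of "%y. y \<in> carrier M \<and> \<pi> y = \<pi> x" x] x by (simp_all add: y_def)
    have "\<pi> (y \<oplus>\<^bsub>M\<^esub> \<ominus>\<^bsub>M\<^esub> x) = (zero Q)"
      using x y mod_homD[OF \<pi>] mod_hom_map_neg[OF \<pi> M Q] by (simp add: Q.M.r_neg)
    then have "f (y \<oplus>\<^bsub>M\<^esub> \<ominus>\<^bsub>M\<^esub> x) = (zero N)" using x y by (intro z) simp_all
    then have 1: "f y \<oplus>\<^bsub>N\<^esub> \<ominus>\<^bsub>N\<^esub> f x = (zero N)"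
      using x y mod_homD[OF f] mod_hom_map_neg[OF f M N] by simp
    have "f y = (f y \<oplus>\<^bsub>N\<^esub> \<ominus>\<^bsub>N\<^esub> f x) \<oplus>\<^bsub>N\<^esub> f x"
      using x y mod_homD(1)[OF f] by (simp add: N.M.a_assoc N.M.l_neg)
    also have "\<dots> = f x" unfolding 1 using mod_homD(1)[OF f x] by simp
    finally show ?thesis unfolding h_def y_def .
  qed
  have "h \<in> mod_hom R Q N"
  proof (rule mod_homI)
    fix x assume "x \<in> carrier Q"
    then obtain a where "x = \<pi> a" "a \<in> carrier M" unfolding s[symmetric] by blast
    then show "h x \<in> carrier N" using h mod_homD(1)[OF f] by simp
  next
    fix x y assume "x \<in> carrier Q" "y \<in> carrier Q"
    then obtain a b where x: "x = \<pi> a" "a \<in> carrier M" "y = \<pi> b" "b \<in> carrier M" unfolding s[symmetric] by blast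
    have "x \<oplus>\<^bsub>Q\<^esub> y = \<pi> (a \<oplus>\<^bsub>M\<^esub> b)" using x mod_homD(2)[OF \<pi>] by simp
    then show "h (x \<oplus>\<^bsub>Q\<^esub> y) = h x \<oplus>\<^bsub>N\<^esub> h y" using x h mod_homD(2)[OF f] by simp
  next
    fix x r assume "x \<in> carrier Q" and r: "r \<in> carrier R"
    then obtain a where x: "x = \<pi> a" "a \<in> carrier M" unfolding s[symmetric] by blast
    have "x \<cdot>\<^bsub>Q\<^esub> r = \<pi> (a \<cdot>\<^bsub>M\<^esub> r)" using x r mod_homD(3)[OF \<pi>] by simp
    then show "h (x \<cdot>\<^bsub>Q\<^esub> r) = h x \<cdot>\<^bsub>N\<^esub> r" using x h r mod_homD(3)[OF f] by (simp add: M.rsmult_closed)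
  qed
  then show thesis using that h by blast
qed

section \<open>Tensor products\<close>

lemma balancedD:
  assumes "balanced R M C T \<beta>"
  shows "m \<in> carrier M ==> c \<in> carrier C ==> \<beta> m c \<in> carrier T"
    and "m \<in> carrier M ==> n \<in> carrier M ==> c \<in> carrier C ==> \<beta> (m \<oplus>\<^bsub>M\<^esub> n) c = \<beta> m c \<oplus>\<^bsub>T\<^esub> \<beta> n c"
    and "m \<in> carrier M ==> c \<in> carrier C ==> d \<in> carrier C ==> \<beta> m (c \<oplus>\<^bsub>C\<^esub> d) = \<beta> m c \<oplus>\<^bsub>T\<^esub> \<beta> m d"
    and "m \<in> carrier M ==> r \<in> carrier R ==> c \<in> carrier C ==> \<beta> (m \<cdot>\<^bsub>M\<^esub> r) c = \<beta> m (r \<bullet>\<^bsub>C\<^esub> c)"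
  using assms by (simp_all add: balanced_def)

lemma balancedI:
  assumes "!!m c. m \<in> carrier M ==> c \<in> carrier C ==> \<beta> m c \<in> carrier T"
    and "!!m n c. m \<in> carrier M ==> n \<in> carrier M ==> c \<in> carrier C ==> \<beta> (m \<oplus>\<^bsub>M\<^esub> n) c = \<beta> m c \<oplus>\<^bsub>T\<^esub> \<beta> n c"
    and "!!m c d. m \<in> carrier M ==> c \<in> carrier C ==> d \<in> carrier C ==> \<beta> m (c \<oplus>\<^bsub>C\<^esub> d) = \<beta> m c \<oplus>\<^bsub>T\<^esub> \<beta> m d"
    and "!!m r c. m \<in> carrier M ==> r \<in> carrier R ==> c \<in> carrier C ==> \<beta> (m \<cdot>\<^bsub>M\<^esub> r) c = \<beta> m (r \<bullet>\<^bsub>C\<^esub> c)"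
  shows "balanced R M C T \<beta>"
  using assms by (simp add: balanced_def)

text \<open>Lists of pairs stand for formal sums in the tensor product; the value is that of the
  homomorphism induced by \<open>\<beta>\<close>.\<close>

definition pair_sum :: "('t, 'g) ring_scheme => ('m => 'c => 't) => ('m \<times> 'c) list => 't"
  where "pair_sum B \<beta> l = foldr (%(m, c) s. \<beta> m c \<oplus>\<^bsub>B\<^esub> s) l (zero B)"

lemma pair_sum_simps [simp]:
  "pair_sum B \<beta> [] = (zero B)" "pair_sum B \<beta> ((m, c) # l) = \<beta> m c \<oplus>\<^bsub>B\<^esub> pair_sum B \<beta> l"
  by (simp_all add: pair_sum_def)

context
  fixes R :: "('r, 'x) ring_scheme" and M :: "('r, 'm, 'e) module_scheme"
    and C :: "('r, 'c, 'f) bimodule_scheme" and B :: "('t, 'g) ring_scheme" and \<beta>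
  assumes M: "right_module R M" and C: "bimodule R C" and B: "abelian_group B" and \<beta>: "balanced R M C B \<beta>"
begin

interpretation M: right_module R M by (rule M)
interpretation C: bimodule R C by (rule C)
interpretation B: abelian_group B by (rule B)

lemma balanced_zero:
  assumes "c \<in> carrier C"
  shows "\<beta> (zero M) c = (zero B)"
  using balancedD(2)[OF \<beta>, of "(zero M)" "(zero M)" c] balancedD(1)[OF \<beta>, of "(zero M)" c] assms by simp

lemma balanced_neg:
  assumes "m \<in> carrier M" "c \<in> carrier C"
  shows "\<beta> (\<ominus>\<^bsub>M\<^esub> m) c = \<ominus>\<^bsub>B\<^esub> \<beta> m c"
  using balancedD(2)[OF \<beta>, of "\<ominus>\<^bsub>M\<^esub> m" m c] balancedD(1)[OF \<beta>] assms balanced_zero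
  by (intro B.minus_equality[symmetric]) (simp_all add: M.M.l_neg)

lemma pair_sum_closed: "set l \<subseteq> carrier M \<times> carrier C ==> pair_sum B \<beta> l \<in> carrier B"
  by (induction l) (auto simp: balancedD(1)[OF \<beta>])

lemma pair_sum_append: "set l \<subseteq> carrier M \<times> carrier C ==> set l' \<subseteq> carrier M \<times> carrier C ==>
    pair_sum B \<beta> (l @ l') = pair_sum B \<beta> l \<oplus>\<^bsub>B\<^esub> pair_sum B \<beta> l'"
  by (induction l) (auto simp: balancedD(1)[OF \<beta>] pair_sum_closed B.a_assoc)

lemma pair_sum_neg: "set l \<subseteq> carrier M \<times> carrier C ==>
    pair_sum B \<beta> (map (%(m, c). (\<ominus>\<^bsub>M\<^esub> m, c)) l) = \<ominus>\<^bsub>B\<^esub> pair_sum B \<beta> l"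
  by (induction l) (auto simp: balancedD(1)[OF \<beta>] pair_sum_closed balanced_neg B.minus_add B.minus_equality[OF B.l_zero[OF B.zero_closed] B.zero_closed B.zero_closed])

lemma pair_sum_add_scalar: "set l \<subseteq> carrier M \<times> carrier C ==> r \<in> carrier R ==> s \<in> carrier R ==>
    pair_sum B \<beta> (map (%(m, c). (m, c \<cdot>\<^bsub>C\<^esub> (r \<oplus>\<^bsub>R\<^esub> s))) l) =
    pair_sum B \<beta> (map (%(m, c). (m, c \<cdot>\<^bsub>C\<^esub> r)) l) \<oplus>\<^bsub>B\<^esub> pair_sum B \<beta> (map (%(m, c). (m, c \<cdot>\<^bsub>C\<^esub> s)) l)"
proof (induction l)
  case (Cons a l)
  obtain m c where a: "a = (m, c)" by (cases a)
  have wf: "set (map (%(m, c). (m, c \<cdot>\<^bsub>C\<^esub> t)) l) \<subseteq> carrier M \<times> carrier C" if "t \<in> carrier R" for t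
    using Cons.prems(1) that by (auto simp: C.rsmult_closed)
  show ?case using Cons a pair_sum_closed[OF wf]
    by (simp add: balancedD[OF \<beta>] C.rsmult_closed C.rsmult_add_scalar B.a_ac)
qed simp

text \<open>Whether the action of \<open>R\<close> respects the identification of formal sums is
  tested with \<open>\<beta> m (c r)\<close> in place of \<open>\<beta> m c\<close>, which therefore
  has to be balanced again.\<close>

lemma balanced_rsmult:
  assumes "r \<in> carrier R"
  shows "balanced R M C B (%m c. \<beta> m (c \<cdot>\<^bsub>C\<^esub> r))"
  using assms balancedD[OF \<beta>]
  by (intro balancedI) (simp_all add: C.rsmult_closed C.rsmult_add C.lsmult_closed C.lsmult_rsmult)

end

lemma pair_sum_map: "pair_sum B \<beta> (map (%(m, c). (m, g c)) l) = pair_sum B (%m c. \<beta> m (g c)) l"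
  by (induction l) auto

text \<open>
  Elements of the tensor product are finite sums of pairs; two sums are identified iff no balanced map
  into a group in the universe separates them, which makes the universal property immediate.
\<close>

lemma ex_tensor:
  fixes R :: "('r, 'x) ring_scheme" and M :: "('r, 'u::infinite, 'e) module_scheme"
    and C :: "('r, 'u, 'f) bimodule_scheme"
  assumes M: "right_module R M" and C: "bimodule R C"
  obtains T :: "('r, 'u) module" and \<tau> where "is_tensor R M C T \<tau>"
proof -
  interpret M: right_module R M by (rule M)
  interpret C: bimodule R C by (rule C)
  define wf where "wf = (%l. set l \<subseteq> carrier M \<times> carrier C)"
  define good where "good = (%(B :: 'u ring) \<beta>. abelian_group B \<and> balanced R M C B \<beta>)"
  \<comment> \<open>Equivalent lists have literally the same predicate \<open>eqv l\<close>, so that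
    \<open>rep\<close> chooses the same representative for them; the code of this representative is
    the element of the tensor product.\<close>
  define eqv where "eqv = (%l l'. wf l' \<and> (\<forall>B \<beta>. good B \<beta> --> pair_sum B \<beta> l = pair_sum B \<beta> l'))"
  define rep where "rep = (%l. SOME l'. eqv l l')"
  define dc where "dc = (%x. THE l :: ('u \<times> 'u) list. list_code (map (%(a, b). pr a b) l) = x)"
  define cl where "cl = (%l. list_code (map (%(a, b). pr a b) (rep l)))"
  have code_inj: "list_code (map (%(a, b). pr a b) l) = list_code (map (%(a, b). pr a b) l') \<longleftrightarrow> l = l'"
    for l l' :: "('u \<times> 'u) list"
  proof -
    have "inj (%(a :: 'u, b). pr a b)" by (auto intro!: injI)
    then show ?thesis by (simp add: list_code_inj inj_map_eq_map)
  qed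
  have dc: "dc (cl l) = rep l" for l unfolding dc_def cl_def code_inj by simp
  have refl: "wf l ==> eqv l l" for l by (simp add: eqv_def)
  have rep: "eqv l (rep l)" if "wf l" for l unfolding rep_def by (rule someI[of "eqv l", OF refl[OF that]])
  have cl_eqI: "cl l = cl l'" if "wf l" "wf l'" "!!B \<beta>. good B \<beta> ==> pair_sum B \<beta> l = pair_sum B \<beta> l'" for l l'
  proof -
    have "eqv l = eqv l'" using that(3) unfolding eqv_def by (intro ext) simp
    then show ?thesis by (simp add: cl_def rep_def)
  qed
  have wf_rep: "wf l ==> wf (rep l)" and sum_rep: "wf l ==> good B \<beta> ==> pair_sum B \<beta> (rep l) = pair_sum B \<beta> l" for l B \<beta>
    using rep[of l] by (simp_all add: eqv_def)
  note ps = pair_sum_closed[OF M C] pair_sum_append[OF M C] pair_sum_neg[OF M C] pair_sum_add_scalar[OF M C]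
  have wf_append: "wf (l @ l') \<longleftrightarrow> wf l \<and> wf l'" for l l' by (simp add: wf_def)
  have wf_neg: "wf l ==> wf (map (%(m, c). (\<ominus>\<^bsub>M\<^esub> m, c)) l)" for l by (auto simp: wf_def)
  have wf_smult: "wf l ==> r \<in> carrier R ==> wf (map (%(m, c). (m, c \<cdot>\<^bsub>C\<^esub> r)) l)" for l r
    by (auto simp: wf_def C.rsmult_closed)
  have good_rsmult: "good B \<beta> ==> r \<in> carrier R ==> good B (%m c. \<beta> m (c \<cdot>\<^bsub>C\<^esub> r))" for B \<beta> r
    unfolding good_def by (intro conjI balanced_rsmult[OF M C]) simp_all
  define T :: "('r, 'u) module" where "T = \<lparr>carrier = cl ` {l. wf l}, monoid.mult = undefined, one = undefined,
    zero = cl [], add = (%x y. cl (dc x @ dc y)), smult = (%r x. cl (map (%(m, c). (m, c \<cdot>\<^bsub>C\<^esub> r)) (dc x)))\<rparr>"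
  have Tz: "(zero T) = cl []" and Tc: "carrier T = cl ` {l. wf l}" by (simp_all add: T_def)
  have TE: "\<exists>l. wf l \<and> x = cl l" if "x \<in> carrier T" for x using that by (auto simp: Tc)
  have Ta: "cl l \<oplus>\<^bsub>T\<^esub> cl l' = cl (l @ l')" if "wf l" "wf l'" for l l'
  proof -
    have "cl (rep l @ rep l') = cl (l @ l')"
    proof (rule cl_eqI)
      fix B \<beta> assume g: "good B \<beta>"
      then show "pair_sum B \<beta> (rep l @ rep l') = pair_sum B \<beta> (l @ l')"
        using sum_rep[OF that(1) g] sum_rep[OF that(2) g] wf_rep that
        by (simp add: good_def ps(2) wf_def)
    qed (use that wf_rep wf_append in simp_all)
    then show ?thesis by (simp add: T_def dc)
  qed
  have Ts: "cl l \<cdot>\<^bsub>T\<^esub> r = cl (map (%(m, c). (m, c \<cdot>\<^bsub>C\<^esub> r)) l)" if "wf l" "r \<in> carrier R" for l r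
  proof -
    have "cl (map (%(m, c). (m, c \<cdot>\<^bsub>C\<^esub> r)) (rep l)) = cl (map (%(m, c). (m, c \<cdot>\<^bsub>C\<^esub> r)) l)"
    proof (rule cl_eqI)
      fix B \<beta> assume "good B \<beta>"
      from good_rsmult[OF this that(2)] show
        "pair_sum B \<beta> (map (%(m, c). (m, c \<cdot>\<^bsub>C\<^esub> r)) (rep l)) = pair_sum B \<beta> (map (%(m, c). (m, c \<cdot>\<^bsub>C\<^esub> r)) l)"
        unfolding pair_sum_map by (rule sum_rep[OF that(1)])
    qed (use that wf_rep wf_smult in simp_all)
    then show ?thesis by (simp add: T_def dc)
  qed
  have T: "right_module R T"
  proof (rule right_moduleI)
    show "ring R" by (rule M.R.ring_axioms)
    show "(zero T) \<in> carrier T" by (simp add: Tc Tz wf_def)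
    fix x y assume "x \<in> carrier T" "y \<in> carrier T"
    then obtain l l' where l: "wf l" "x = cl l" "wf l'" "y = cl l'" using TE by meson
    show "x \<oplus>\<^bsub>T\<^esub> y \<in> carrier T" unfolding l(2,4) Ta[OF l(1,3)] using l by (simp add: Tc wf_append)
    show "x \<oplus>\<^bsub>T\<^esub> y = y \<oplus>\<^bsub>T\<^esub> x" unfolding l(2,4) Ta[OF l(1,3)] Ta[OF l(3,1)]
    proof (rule cl_eqI)
      fix B \<beta> assume "good B \<beta>"
      then show "pair_sum B \<beta> (l @ l') = pair_sum B \<beta> (l' @ l)"
        using l by (simp add: good_def wf_def ps abelian_groupE(4))
    qed (use l wf_append in simp_all)
    fix r assume r: "r \<in> carrier R"
    show "(x \<oplus>\<^bsub>T\<^esub> y) \<cdot>\<^bsub>T\<^esub> r = x \<cdot>\<^bsub>T\<^esub> r \<oplus>\<^bsub>T\<^esub> y \<cdot>\<^bsub>T\<^esub> r"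
      unfolding l(2,4) Ta[OF l(1,3)] Ts[OF l(1) r] Ts[OF l(3) r] using l r
      by (simp add: Ts Ta wf_append wf_smult)
  next
    fix x y z assume "x \<in> carrier T" "y \<in> carrier T" "z \<in> carrier T"
    then obtain l l' l'' where l: "wf l" "x = cl l" "wf l'" "y = cl l'" "wf l''" "z = cl l''" using TE by meson
    then show "(x \<oplus>\<^bsub>T\<^esub> y) \<oplus>\<^bsub>T\<^esub> z = x \<oplus>\<^bsub>T\<^esub> (y \<oplus>\<^bsub>T\<^esub> z)" by (simp add: Ta wf_append)
  next
    fix x assume "x \<in> carrier T"
    then obtain l where l: "wf l" "x = cl l" using TE by meson
    have "wf []" by (simp add: wf_def)
    then show "(zero T) \<oplus>\<^bsub>T\<^esub> x = x" unfolding Tz l(2) using Ta[of "[]" l] l by simp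
    have "map (%(m, c). (m, c \<cdot>\<^bsub>C\<^esub> \<one>\<^bsub>R\<^esub>)) l = map (%z. z) l"
      using l(1) by (intro map_cong) (auto simp: wf_def C.rsmult_one)
    then show "x \<cdot>\<^bsub>T\<^esub> \<one>\<^bsub>R\<^esub> = x" using Ts[OF l(1), of "\<one>\<^bsub>R\<^esub>"] l by simp
    have "cl (map (%(m, c). (\<ominus>\<^bsub>M\<^esub> m, c)) l @ l) = cl []"
    proof (rule cl_eqI)
      fix B \<beta> assume "good B \<beta>"
      then show "pair_sum B \<beta> (map (%(m, c). (\<ominus>\<^bsub>M\<^esub> m, c)) l @ l) = pair_sum B \<beta> []"
        using l wf_neg[OF l(1)] by (simp add: good_def wf_def ps abelian_group.l_neg)
    qed (use l wf_append wf_neg in \<open>simp_all add: wf_def\<close>)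
    then show "\<exists>y\<in>carrier T. y \<oplus>\<^bsub>T\<^esub> x = (zero T)"
      using l wf_neg[OF l(1)] Ta[OF wf_neg[OF l(1)] l(1)] unfolding Tc Tz
      by (intro bexI[of _ "cl (map (%(m, c). (\<ominus>\<^bsub>M\<^esub> m, c)) l)"] imageI) simp_all
    fix r assume r: "r \<in> carrier R"
    show "x \<cdot>\<^bsub>T\<^esub> r \<in> carrier T" unfolding l(2) Ts[OF l(1) r] using l r by (simp add: Tc wf_smult)
    fix s assume s: "s \<in> carrier R"
    show "x \<cdot>\<^bsub>T\<^esub> (r \<oplus>\<^bsub>R\<^esub> s) = x \<cdot>\<^bsub>T\<^esub> r \<oplus>\<^bsub>T\<^esub> x \<cdot>\<^bsub>T\<^esub> s"
      unfolding l(2) Ts[OF l(1) r] Ts[OF l(1) s] Ts[OF l(1) M.R.a_closed[OF r s]]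
        Ta[OF wf_smult[OF l(1) r] wf_smult[OF l(1) s]]
    proof (rule cl_eqI)
      fix B \<beta> assume "good B \<beta>"
      then show "pair_sum B \<beta> (map (%(m, c). (m, c \<cdot>\<^bsub>C\<^esub> (r \<oplus>\<^bsub>R\<^esub> s))) l) =
        pair_sum B \<beta> (map (%(m, c). (m, c \<cdot>\<^bsub>C\<^esub> r)) l @ map (%(m, c). (m, c \<cdot>\<^bsub>C\<^esub> s)) l)"
        using l r s wf_smult[OF l(1)] by (simp add: good_def wf_def ps)
    qed (use l r s wf_append wf_smult in simp_all)
    have "map (%(m, c). (m, c \<cdot>\<^bsub>C\<^esub> (r \<otimes>\<^bsub>R\<^esub> s))) l = map (%(m, c). (m, c \<cdot>\<^bsub>C\<^esub> s)) (map (%(m, c). (m, c \<cdot>\<^bsub>C\<^esub> r)) l)"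
      using l(1) r s by (auto simp: wf_def C.rsmult_assoc)
    then show "x \<cdot>\<^bsub>T\<^esub> (r \<otimes>\<^bsub>R\<^esub> s) = (x \<cdot>\<^bsub>T\<^esub> r) \<cdot>\<^bsub>T\<^esub> s"
      unfolding l(2) Ts[OF l(1) M.R.m_closed[OF r s]] Ts[OF l(1) r] Ts[OF wf_smult[OF l(1) r] s] by (rule arg_cong)
  qed
  define \<tau> where "\<tau> = (%m c. cl [(m, c)])"
  have wf1: "wf [(m, c)]" if "m \<in> carrier M" "c \<in> carrier C" for m c using that by (simp add: wf_def)
  have goodD: "good B \<beta> ==> abelian_group B" "good B \<beta> ==> balanced R M C B \<beta>" for B \<beta> by (simp_all add: good_def)
  have "is_tensor R M C T \<tau>"
    unfolding is_tensor_def
  proof (intro conjI T ballI allI impI)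
    show "balanced R M C T \<tau>"
    proof (rule balancedI)
      fix m c assume m: "m \<in> carrier M" and c: "c \<in> carrier C"
      show "\<tau> m c \<in> carrier T" unfolding \<tau>_def Tc using wf1[OF m c] by blast
    next
      fix m n c assume m: "m \<in> carrier M" and n: "n \<in> carrier M" and c: "c \<in> carrier C"
      show "\<tau> (m \<oplus>\<^bsub>M\<^esub> n) c = \<tau> m c \<oplus>\<^bsub>T\<^esub> \<tau> n c"
        unfolding \<tau>_def Ta[OF wf1[OF m c] wf1[OF n c]]
      proof (rule cl_eqI)
        fix B \<beta> assume g: "good B \<beta>"
        interpret B: abelian_group B by (rule goodD(1)[OF g])
        show "pair_sum B \<beta> [(m \<oplus>\<^bsub>M\<^esub> n, c)] = pair_sum B \<beta> ([(m, c)] @ [(n, c)])"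
          using m n c balancedD[OF goodD(2)[OF g]] by (simp add: B.a_assoc)
      qed (use m n c in \<open>simp_all add: wf_def\<close>)
    next
      fix m c d assume m: "m \<in> carrier M" and c: "c \<in> carrier C" and d: "d \<in> carrier C"
      show "\<tau> m (c \<oplus>\<^bsub>C\<^esub> d) = \<tau> m c \<oplus>\<^bsub>T\<^esub> \<tau> m d"
        unfolding \<tau>_def Ta[OF wf1[OF m c] wf1[OF m d]]
      proof (rule cl_eqI)
        fix B \<beta> assume g: "good B \<beta>"
        interpret B: abelian_group B by (rule goodD(1)[OF g])
        show "pair_sum B \<beta> [(m, c \<oplus>\<^bsub>C\<^esub> d)] = pair_sum B \<beta> ([(m, c)] @ [(m, d)])"
          using m c d balancedD[OF goodD(2)[OF g]] by (simp add: B.a_assoc)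
      qed (use m c d in \<open>simp_all add: wf_def\<close>)
    next
      fix m r c assume m: "m \<in> carrier M" and r: "r \<in> carrier R" and c: "c \<in> carrier C"
      show "\<tau> (m \<cdot>\<^bsub>M\<^esub> r) c = \<tau> m (r \<bullet>\<^bsub>C\<^esub> c)"
        unfolding \<tau>_def
      proof (rule cl_eqI)
        fix B \<beta> assume g: "good B \<beta>"
        show "pair_sum B \<beta> [(m \<cdot>\<^bsub>M\<^esub> r, c)] = pair_sum B \<beta> [(m, r \<bullet>\<^bsub>C\<^esub> c)]"
          using m r c balancedD(4)[OF goodD(2)[OF g]] by simp
      qed (use m r c in \<open>simp_all add: wf_def M.rsmult_closed C.lsmult_closed\<close>)
    qed
    show "\<tau> m c \<cdot>\<^bsub>T\<^esub> r = \<tau> m (c \<cdot>\<^bsub>C\<^esub> r)" if "m \<in> carrier M" "c \<in> carrier C" "r \<in> carrier R" for m c r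
      unfolding \<tau>_def using Ts[OF wf1[OF that(1,2)] that(3)] by simp
    fix B :: "'u ring" and \<beta> assume "abelian_group B \<and> balanced R M C B \<beta>"
    then have B: "abelian_group B" and \<beta>: "balanced R M C B \<beta>" and g: "good B \<beta>" by (simp_all add: good_def)
    interpret B: abelian_group B by (rule B)
    define h where "h = (%x. pair_sum B \<beta> (dc x))"
    have h: "h (cl l) = pair_sum B \<beta> l" if "wf l" for l
      unfolding h_def dc by (rule sum_rep[OF that g])
    have hom: "h \<in> hom (add_monoid T) (add_monoid B)"
    proof (rule homI)
      show "h x \<in> carrier (add_monoid B)" if "x \<in> carrier (add_monoid T)" for x
        using TE[of x] that h pair_sum_closed[OF M C B \<beta>] by (auto simp: wf_def)
      show "h (x \<otimes>\<^bsub>add_monoid T\<^esub> y) = h x \<otimes>\<^bsub>add_monoid B\<^esub> h y"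
        if xy: "x \<in> carrier (add_monoid T)" "y \<in> carrier (add_monoid T)" for x y
      proof -
        obtain l l' where l: "wf l" "x = cl l" "wf l'" "y = cl l'" using TE[of x] TE[of y] xy by auto
        then show ?thesis using h[OF l(1)] h[OF l(3)] h[of "l @ l'"] wf_append
          pair_sum_append[OF M C B \<beta>] by (simp add: Ta wf_def)
      qed
    qed
    have gen: "h (\<tau> m c) = \<beta> m c" if "m \<in> carrier M" "c \<in> carrier C" for m c
      unfolding \<tau>_def h[OF wf1[OF that]] using that balancedD(1)[OF \<beta>] by simp
    \<comment> \<open>Every element is the class of a list, and the class of \<open>a # l\<close> is
      the sum of a generator and the class of \<open>l\<close>; so a homomorphism is determined by
      induction on the list.\<close>
    have uniq: "h' (cl l) = h (cl l)" if h': "h' \<in> hom (add_monoid T) (add_monoid B)"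
      and e: "!!m c. m \<in> carrier M ==> c \<in> carrier C ==> h' (\<tau> m c) = \<beta> m c" and "wf l" for h' l
      using \<open>wf l\<close>
    proof (induction l)
      case Nil
      have z: "(zero T) \<in> carrier T" "(zero T) \<oplus>\<^bsub>T\<^esub> (zero T) = (zero T)"
        using T by (simp_all add: right_module_def abelian_groupE(2,5))
      have "h' (zero T) \<oplus>\<^bsub>B\<^esub> h' (zero T) = h' (zero T)" "h' (zero T) \<in> carrier B"
        using h' z unfolding hom_def by (simp, metis, auto)
      then have "h' (zero T) = (zero B)" by simp
      then show ?case using h[of "[]"] by (simp add: Tz wf_def)
    next
      case (Cons a l)
      obtain m c where a: "a = (m, c)" by (cases a)
      have mc: "m \<in> carrier M" "c \<in> carrier C" "wf l" using Cons.prems by (simp_all add: wf_def a)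
      have split: "cl (a # l) = \<tau> m c \<oplus>\<^bsub>T\<^esub> cl l"
        unfolding \<tau>_def Ta[OF wf1[OF mc(1,2)] mc(3)] by (simp add: a)
      have T': "\<tau> m c \<in> carrier T" "cl l \<in> carrier T" using wf1[OF mc(1,2)] mc(3) by (auto simp: Tc \<tau>_def)
      have "h' (cl (a # l)) = h' (\<tau> m c) \<oplus>\<^bsub>B\<^esub> h' (cl l)"
        unfolding split using h' T' by (simp add: hom_def)
      also have "\<dots> = h (\<tau> m c) \<oplus>\<^bsub>B\<^esub> h (cl l)" using Cons.IH mc e gen by simp
      also have "\<dots> = h (cl (a # l))"
        unfolding split using hom T' by (simp add: hom_def)
      finally show ?case .
    qed
    show "\<exists>g\<in>hom (add_monoid T) (add_monoid B). (\<forall>m\<in>carrier M. \<forall>c\<in>carrier C. g (\<tau> m c) = \<beta> m c) \<and>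
        (\<forall>g'\<in>hom (add_monoid T) (add_monoid B). (\<forall>m\<in>carrier M. \<forall>c\<in>carrier C. g' (\<tau> m c) = \<beta> m c) -->
          (\<forall>t\<in>carrier T. g' t = g t))"
    proof (intro bexI[OF _ hom] conjI ballI impI)
      fix h' t assume h': "h' \<in> hom (add_monoid T) (add_monoid B)"
        and e: "\<forall>m\<in>carrier M. \<forall>c\<in>carrier C. h' (\<tau> m c) = \<beta> m c" and t: "t \<in> carrier T"
      obtain l where l: "wf l" "t = cl l" using TE[OF t] by blast
      show "h' t = h t" unfolding l(2) by (rule uniq[OF h' _ l(1)]) (use e in blast)
    qed (use gen in simp)
  qed
  then show thesis by (rule that)
qed

text \<open>The universal property in \<open>is_tensor\<close> ranges over groups of the bare type
  \<open>'u ring\<close>. Forgetting the further fields of a module makes it applicable to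
  modules.\<close>

definition group_of :: "('u, 'e) ring_scheme => 'u ring"
  where "group_of B = \<lparr>carrier = carrier B, monoid.mult = undefined, one = undefined, zero = (zero B), add = add B\<rparr>"

lemma group_of_sel [simp]:
  "carrier (group_of B) = carrier B" "(zero (group_of B)) = (zero B)" "x \<oplus>\<^bsub>group_of B\<^esub> y = x \<oplus>\<^bsub>B\<^esub> y"
  by (simp_all add: group_of_def)

lemma abelian_group_group_of: "abelian_group B ==> abelian_group (group_of B)"
  by (rule abelian_groupI) (unfold group_of_sel, (rule abelian_groupE; assumption)+)

lemma hom_group_of: "hom (add_monoid T) (add_monoid (group_of B)) = hom (add_monoid T) (add_monoid B)"
  by (simp add: hom_def)

lemma balanced_group_of: "balanced R M C (group_of B) \<beta> \<longleftrightarrow> balanced R M C B \<beta>"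
  by (simp add: balanced_def)

lemma tensorD:
  assumes "is_tensor R M C T \<tau>"
  shows "right_module R T" "balanced R M C T \<tau>"
    "m \<in> carrier M ==> c \<in> carrier C ==> r \<in> carrier R ==> \<tau> m c \<cdot>\<^bsub>T\<^esub> r = \<tau> m (c \<cdot>\<^bsub>C\<^esub> r)"
  using assms by (simp_all add: is_tensor_def)

lemmas tensor_closed = balancedD(1)[OF tensorD(2)]

lemma tensor_universal:
  fixes B :: "('u, 'b) ring_scheme" and T :: "('r, 'u, 'g) module_scheme"
  assumes T: "is_tensor R M C T \<tau>" and B: "abelian_group B" and \<beta>: "balanced R M C B \<beta>"
  obtains g where "g \<in> hom (add_monoid T) (add_monoid B)" "\<forall>m\<in>carrier M. \<forall>c\<in>carrier C. g (\<tau> m c) = \<beta> m c"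
proof -
  have "abelian_group (group_of B) \<and> balanced R M C (group_of B) \<beta>"
    using B \<beta> by (simp add: abelian_group_group_of balanced_group_of)
  then obtain g where "g \<in> hom (add_monoid T) (add_monoid (group_of B))"
    "\<forall>m\<in>carrier M. \<forall>c\<in>carrier C. g (\<tau> m c) = \<beta> m c"
    using T unfolding is_tensor_def by blast
  then show thesis unfolding hom_group_of by (rule that)
qed

text \<open>Uniqueness is formulated relative to a balanced map; it is applied to the one that
  \<open>f\<close> itself induces on pairs.\<close>

lemma tensor_ext:
  fixes B :: "('u, 'b) ring_scheme" and T :: "('r, 'u, 'g) module_scheme"
  assumes T: "is_tensor R M C T \<tau>" and B: "abelian_group B"
    and f: "f \<in> hom (add_monoid T) (add_monoid B)" and g: "g \<in> hom (add_monoid T) (add_monoid B)"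
    and eq: "!!m c. m \<in> carrier M ==> c \<in> carrier C ==> f (\<tau> m c) = g (\<tau> m c)" and t: "t \<in> carrier T"
    and M: "right_module R M" and C: "bimodule R C"
  shows "f t = g t"
proof -
  interpret M: right_module R M by (rule M)
  interpret C: bimodule R C by (rule C)
  have fc: "x \<in> carrier T ==> f x \<in> carrier B"
    "x \<in> carrier T ==> y \<in> carrier T ==> f (x \<oplus>\<^bsub>T\<^esub> y) = f x \<oplus>\<^bsub>B\<^esub> f y" for x y
    using f by (auto simp: hom_def)
  have "balanced R M C B (%m c. f (\<tau> m c))"
    using balancedD[OF tensorD(2)[OF T]] fc by (intro balancedI) (simp_all add: C.lsmult_closed M.rsmult_closed)
  then have "abelian_group (group_of B) \<and> balanced R M C (group_of B) (%m c. f (\<tau> m c))"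
    using B by (simp add: abelian_group_group_of balanced_group_of)
  then obtain h where "\<forall>g'\<in>hom (add_monoid T) (add_monoid (group_of B)).
      (\<forall>m\<in>carrier M. \<forall>c\<in>carrier C. g' (\<tau> m c) = f (\<tau> m c)) --> (\<forall>t\<in>carrier T. g' t = h t)"
    using T unfolding is_tensor_def by blast
  then have h: "!!g' t. g' \<in> hom (add_monoid T) (add_monoid B) ==>
      \<forall>m\<in>carrier M. \<forall>c\<in>carrier C. g' (\<tau> m c) = f (\<tau> m c) ==> t \<in> carrier T ==> g' t = h t"
    unfolding hom_group_of by blast
  have "f t = h t" by (rule h[OF f _ t]) simp
  moreover have "g t = h t" by (rule h[OF g _ t]) (simp add: eq)
  ultimately show ?thesis by simp
qed

lemma mod_hom_hom: "f \<in> mod_hom R M N ==> f \<in> hom (add_monoid M) (add_monoid N)"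
  by (simp add: mod_hom_def)

lemma right_module_group: "right_module R M ==> abelian_group M"
  by (simp add: right_module_def)

section \<open>Tensor products of complexes and the derived tensor product\<close>

context
  fixes R :: "('r, 'x) ring_scheme" and C :: "('r, 'u::infinite, 'f) bimodule_scheme"
  assumes C: "bimodule R C"
begin

interpretation C: bimodule R C by (rule C)

lemma tensor_mod_hom_ext:
  fixes N :: "('r, 'u, 'n) module_scheme"
  assumes T: "is_tensor R M C T \<tau>" and M: "right_module R M" and N: "right_module R N"
    and f: "f \<in> mod_hom R T N" and g: "g \<in> mod_hom R T N"
    and eq: "!!m c. m \<in> carrier M ==> c \<in> carrier C ==> f (\<tau> m c) = g (\<tau> m c)" and t: "t \<in> carrier T"
  shows "f t = g t"
  by (rule tensor_ext[OF T right_module_group[OF N] mod_hom_hom[OF f] mod_hom_hom[OF g] eq t M C])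

text \<open>The universal property provides an additive map. Its linearity follows from uniqueness:
  for fixed r both sides are additive in \<open>t\<close> and agree on the generators.\<close>

lemma tensor_universal_mod:
  fixes N :: "('r, 'u, 'n) module_scheme"
  assumes T: "is_tensor R M C T \<tau>" and M: "right_module R M" and N: "right_module R N"
    and \<beta>: "balanced R M C N \<beta>"
    and s: "!!m c r. m \<in> carrier M ==> c \<in> carrier C ==> r \<in> carrier R ==> \<beta> m c \<cdot>\<^bsub>N\<^esub> r = \<beta> m (c \<cdot>\<^bsub>C\<^esub> r)"
  obtains g where "g \<in> mod_hom R T N" "\<forall>m\<in>carrier M. \<forall>c\<in>carrier C. g (\<tau> m c) = \<beta> m c"
proof -
  interpret N: right_module R N by (rule N)
  interpret T: right_module R T by (rule tensorD(1)[OF T])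
  obtain g where g: "g \<in> hom (add_monoid T) (add_monoid N)"
    and gen: "\<forall>m\<in>carrier M. \<forall>c\<in>carrier C. g (\<tau> m c) = \<beta> m c"
    by (rule tensor_universal[OF T N.M.abelian_group_axioms \<beta>])
  have gc: "x \<in> carrier T ==> g x \<in> carrier N"
    "x \<in> carrier T ==> y \<in> carrier T ==> g (x \<oplus>\<^bsub>T\<^esub> y) = g x \<oplus>\<^bsub>N\<^esub> g y" for x y
    using g by (auto simp: hom_def)
  have "g (t \<cdot>\<^bsub>T\<^esub> r) = g t \<cdot>\<^bsub>N\<^esub> r" if t: "t \<in> carrier T" and r: "r \<in> carrier R" for t r
  proof (rule tensor_ext[OF T N.M.abelian_group_axioms _ _ _ t M C])
    show "(%t. g (t \<cdot>\<^bsub>T\<^esub> r)) \<in> hom (add_monoid T) (add_monoid N)"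
      using gc r by (auto simp: hom_def T.rsmult_closed T.rsmult_add)
    show "(%t. g t \<cdot>\<^bsub>N\<^esub> r) \<in> hom (add_monoid T) (add_monoid N)"
      using gc r by (auto simp: hom_def N.rsmult_closed N.rsmult_add)
    show "g (\<tau> m c \<cdot>\<^bsub>T\<^esub> r) = g (\<tau> m c) \<cdot>\<^bsub>N\<^esub> r" if "m \<in> carrier M" "c \<in> carrier C" for m c
      using that r gen s tensorD(3)[OF T that r] by (simp add: C.rsmult_closed)
  qed
  then have "g \<in> mod_hom R T N" using gc by (intro mod_homI) simp_all
  then show thesis using gen by (rule that)
qed

lemma tensor_map:
  assumes T: "is_tensor R M C T \<tau>" and T': "is_tensor R M' C T' \<tau>'" and M: "right_module R M"
    and M': "right_module R M'" and f: "f \<in> mod_hom R M M'"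
  obtains g where "g \<in> mod_hom R T T'" "\<forall>m\<in>carrier M. \<forall>c\<in>carrier C. g (\<tau> m c) = \<tau>' (f m) c"
proof (rule tensor_universal_mod[OF T M tensorD(1)[OF T']])
  show "balanced R M C T' (%m c. \<tau>' (f m) c)"
    using balancedD[OF tensorD(2)[OF T']] mod_homD[OF f] by (intro balancedI) simp_all
  show "\<tau>' (f m) c \<cdot>\<^bsub>T'\<^esub> r = \<tau>' (f m) (c \<cdot>\<^bsub>C\<^esub> r)"
    if "m \<in> carrier M" "c \<in> carrier C" "r \<in> carrier R" for m c r
    using tensorD(3)[OF T'] mod_homD[OF f] that by simp
qed (rule that)

text \<open>The relation \<open>is_tensor_cpx\<close> with the family \<open>\<tau>\<close> made
  explicit, because maps and homotopies are constructed on the generators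
  \<open>\<tau> i x c\<close>.\<close>

definition tens :: "('r, 'u) mod_cpx => ('r, 'u) mod_cpx => (int => 'u => 'u => 'u) => bool"
  where "tens X Y \<tau> \<longleftrightarrow> Y \<in> complexes (Mod_cat R) \<and> (\<forall>i. is_tensor R (obj X i) C (obj Y i) (\<tau> i)) \<and>
    (\<forall>i. \<forall>x\<in>carrier (obj X i). \<forall>c\<in>carrier C. diff Y i (\<tau> i x c) = \<tau> (i + 1) (diff X i x) c)"

lemma is_tensor_cpx_iff: "is_tensor_cpx R X C Y \<longleftrightarrow> (\<exists>\<tau>. tens X Y \<tau>)"
  by (auto simp: is_tensor_cpx_def tens_def)

lemma tensD:
  assumes "tens X Y \<tau>"
  shows "Y \<in> complexes (Mod_cat R)" "is_tensor R (obj X i) C (obj Y i) (\<tau> i)"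
    "x \<in> carrier (obj X i) ==> c \<in> carrier C ==> j = i + 1 ==> diff Y i (\<tau> i x c) = \<tau> j (diff X i x) c"
  using assms by (auto simp: tens_def)

interpretation mod_cat "Mod_cat R :: ('u, ('r, 'u, unit) module_ext) concrete_cat" mbp mkn
  by (rule mod_cat_Mod)

lemma mcpx_mod [simp]: "(X :: ('r, 'u) mod_cpx) \<in> complexes (Mod_cat R) ==> right_module R (obj X i)"
  using cpx_Ob[of X i] by simp

lemma mcpx_diff: "(X :: ('r, 'u) mod_cpx) \<in> complexes (Mod_cat R) ==> j = i + 1 ==> diff X i \<in> mod_hom R (obj X i) (obj X j)"
  using cpx_diff_Hom[of X j i] by simp

lemma ex_tens:
  assumes X: "X \<in> complexes (Mod_cat R)"
  obtains Y \<tau> where "tens X Y \<tau>"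
proof -
  have "\<forall>i. \<exists>Z. is_tensor R (obj X i) C (fst Z :: ('r, 'u) module) (snd Z)"
  proof
    fix i
    obtain T :: "('r, 'u) module" and \<tau> where "is_tensor R (obj X i) C T \<tau>"
      by (rule ex_tensor[OF mcpx_mod[OF X] C])
    then show "\<exists>Z. is_tensor R (obj X i) C (fst Z :: ('r, 'u) module) (snd Z)" by (intro exI[of _ "(T, \<tau>)"]) simp
  qed
  from choice[OF this] obtain Z where "\<forall>i. is_tensor R (obj X i) C (fst (Z i) :: ('r, 'u) module) (snd (Z i))" ..
  then have T: "!!i. is_tensor R (obj X i) C (fst (Z i) :: ('r, 'u) module) (snd (Z i))" by blast
  have "\<forall>i. \<exists>g. g \<in> mod_hom R (fst (Z i)) (fst (Z (i + 1))) \<and>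
      (\<forall>m\<in>carrier (obj X i). \<forall>c\<in>carrier C. g (snd (Z i) m c) = snd (Z (i + 1)) (diff X i m) c)"
  proof
    fix i
    show "\<exists>g. g \<in> mod_hom R (fst (Z i)) (fst (Z (i + 1))) \<and>
      (\<forall>m\<in>carrier (obj X i). \<forall>c\<in>carrier C. g (snd (Z i) m c) = snd (Z (i + 1)) (diff X i m) c)"
      by (rule tensor_map[OF T[of i] T[of "i + 1"] mcpx_mod[OF X] mcpx_mod[OF X] mcpx_diff[OF X refl]]) blast
  qed
  from choice[OF this] obtain d where d: "!!i. d i \<in> mod_hom R (fst (Z i)) (fst (Z (i + 1)))" and
     dg: "!!i m c. m \<in> carrier (obj X i) ==> c \<in> carrier C ==> d i (snd (Z i) m c) = snd (Z (i + 1)) (diff X i m) c"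
    by blast
  define Y where "Y = \<lparr>obj = (%i. fst (Z i)), diff = d\<rparr>"
  have "Y \<in> complexes (Mod_cat R)"
  proof (rule complexesI)
    show "obj Y i \<in> Ob (Mod_cat R)" for i using tensorD(1)[OF T[of i]] by (simp add: Y_def)
    show "diff Y i \<in> Hom (Mod_cat R) (obj Y i) (obj Y (i + 1))" for i using d by (simp add: Y_def)
    fix i t assume "t \<in> carrier (obj Y i)"
    then have t: "t \<in> carrier (fst (Z i))" by (simp add: Y_def)
    have dd: "d (i + 1) \<in> mod_hom R (fst (Z (i + 1))) (fst (Z (i + 2)))" using d[of "i + 1"] by simp
    have "d (i + 1) (d i t) = (zero (fst (Z (i + 2))))"
    proof (rule tensor_mod_hom_ext[OF T mcpx_mod[OF X] _ _ _ _ t])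
      show N: "right_module R (fst (Z (i + 2)))" by (rule tensorD(1)[OF T])
      show "(%t. d (i + 1) (d i t)) \<in> mod_hom R (fst (Z i)) (fst (Z (i + 2)))" by (rule mod_hom_comp[OF d dd])
      show "(%t. (zero (fst (Z (i + 2))))) \<in> mod_hom R (fst (Z i)) (fst (Z (i + 2)))" by (rule mod_hom_const_zero[OF N])
      fix m c assume m: "m \<in> carrier (obj X i)" and c: "c \<in> carrier C"
      have "d (i + 1) (d i (snd (Z i) m c)) = snd (Z (i + 2)) (diff X (i + 1) (diff X i m)) c"
        using dg[OF m c] dg[of "diff X i m" "i + 1" c] m c X by simp
      also have "\<dots> = snd (Z (i + 2)) (zero (obj X (i + 2))) c" using m X by simp
      also have "\<dots> = (zero (fst (Z (i + 2))))"
        by (rule balanced_zero[OF mcpx_mod[OF X] C right_module_group[OF N] tensorD(2)[OF T] c])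
      finally show "d (i + 1) (d i (snd (Z i) m c)) = (zero (fst (Z (i + 2))))" .
    qed
    then show "diff Y (i + 1) (diff Y i t) = (zero (obj Y (i + 2)))" by (simp add: Y_def)
  qed
  then have "tens X Y (%i. snd (Z i))" unfolding tens_def using T dg by (simp add: Y_def)
  then show thesis by (rule that)
qed

context
  fixes X X' Y Y' \<tau> \<tau>'
  assumes X: "X \<in> complexes (Mod_cat R)" and X': "X' \<in> complexes (Mod_cat R)"
    and t: "tens X Y \<tau>" and t': "tens X' Y' \<tau>'"
begin

private lemmas Y = tensD(1)[OF t] and Y' = tensD(1)[OF t']

lemma ex_tens_map:
  assumes f: "f \<in> chain_maps (Mod_cat R) X X'"
  obtains F where "F \<in> chain_maps (Mod_cat R) Y Y'"
    "\<forall>i. \<forall>x\<in>carrier (obj X i). \<forall>c\<in>carrier C. F i (\<tau> i x c) = \<tau>' i (f i x) c"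
proof -
  have fH: "f i \<in> mod_hom R (obj X i) (obj X' i)" for i using chain_map_Hom[OF f, of i] by simp
  have "\<forall>i. \<exists>g. g \<in> mod_hom R (obj Y i) (obj Y' i) \<and>
      (\<forall>m\<in>carrier (obj X i). \<forall>c\<in>carrier C. g (\<tau> i m c) = \<tau>' i (f i m) c)"
  proof
    fix i
    show "\<exists>g. g \<in> mod_hom R (obj Y i) (obj Y' i) \<and>
      (\<forall>m\<in>carrier (obj X i). \<forall>c\<in>carrier C. g (\<tau> i m c) = \<tau>' i (f i m) c)"
      by (rule tensor_map[OF tensD(2)[OF t] tensD(2)[OF t'] mcpx_mod[OF X] mcpx_mod[OF X'] fH]) blast
  qed
  from choice[OF this] obtain F where FH: "!!i. F i \<in> mod_hom R (obj Y i) (obj Y' i)" and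
     F: "!!i m c. m \<in> carrier (obj X i) ==> c \<in> carrier C ==> F i (\<tau> i m c) = \<tau>' i (f i m) c"
    by blast
  have "F \<in> chain_maps (Mod_cat R) Y Y'"
  proof (rule chain_mapsI)
    show "F i \<in> Hom (Mod_cat R) (obj Y i) (obj Y' i)" for i using FH by simp
    fix i y assume y: "y \<in> carrier (obj Y i)"
    show "F (i + 1) (diff Y i y) = diff Y' i (F i y)"
    proof (rule tensor_mod_hom_ext[OF tensD(2)[OF t] mcpx_mod[OF X] mcpx_mod[OF Y']
        mod_hom_comp[OF mcpx_diff[OF Y refl] FH] mod_hom_comp[OF FH mcpx_diff[OF Y' refl]] _ y])
      fix m c assume m: "m \<in> carrier (obj X i)" and c: "c \<in> carrier C"
      show "F (i + 1) (diff Y i (\<tau> i m c)) = diff Y' i (F i (\<tau> i m c))"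
        using m c X chain_map_closed[OF f m] chain_map_diff[OF f m refl]
        by (simp add: tensD(3)[OF t m c refl] F tensD(3)[OF t' _ c refl])
    qed
  qed
  then show thesis using that F by blast
qed

text \<open>The maps induced by a homotopy form a homotopy again; as both sides are homomorphisms,
  the identity is checked on the generators \<open>\<tau> i m c\<close>.\<close>

lemma tens_homotopic:
  assumes h: "homotopic (Mod_cat R) X X' f g"
    and f: "f \<in> chain_maps (Mod_cat R) X X'" and g: "g \<in> chain_maps (Mod_cat R) X X'"
    and F: "F \<in> chain_maps (Mod_cat R) Y Y'" and G: "G \<in> chain_maps (Mod_cat R) Y Y'"
    and Ff: "\<forall>i. \<forall>x\<in>carrier (obj X i). \<forall>c\<in>carrier C. F i (\<tau> i x c) = \<tau>' i (f i x) c"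
    and Gg: "\<forall>i. \<forall>x\<in>carrier (obj X i). \<forall>c\<in>carrier C. G i (\<tau> i x c) = \<tau>' i (g i x) c"
  shows "homotopic (Mod_cat R) Y Y' F G"
proof -
  obtain h where h': "!!i. h i \<in> Hom (Mod_cat R) (obj X i) (obj X' (i - 1))" and
    heq: "!!i x. x \<in> carrier (obj X i) ==>
      f i x = g i x \<oplus>\<^bsub>obj X' i\<^esub> (diff X' (i - 1) (h i x) \<oplus>\<^bsub>obj X' i\<^esub> h (i + 1) (diff X i x))"
    using h unfolding homotopic_def by blast
  have hH: "h i \<in> mod_hom R (obj X i) (obj X' (i - 1))" for i using h'[of i] by simp
  have "\<forall>i. \<exists>g. g \<in> mod_hom R (obj Y i) (obj Y' (i - 1)) \<and>
      (\<forall>m\<in>carrier (obj X i). \<forall>c\<in>carrier C. g (\<tau> i m c) = \<tau>' (i - 1) (h i m) c)"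
  proof
    fix i
    show "\<exists>g. g \<in> mod_hom R (obj Y i) (obj Y' (i - 1)) \<and>
      (\<forall>m\<in>carrier (obj X i). \<forall>c\<in>carrier C. g (\<tau> i m c) = \<tau>' (i - 1) (h i m) c)"
      by (rule tensor_map[OF tensD(2)[OF t] tensD(2)[OF t'] mcpx_mod[OF X] mcpx_mod[OF X'] hH]) blast
  qed
  from choice[OF this] obtain H where HH: "!!i. H i \<in> mod_hom R (obj Y i) (obj Y' (i - 1))" and
     H: "!!i m c. m \<in> carrier (obj X i) ==> c \<in> carrier C ==> H i (\<tau> i m c) = \<tau>' (i - 1) (h i m) c"
    by blast
  show ?thesis unfolding homotopic_def
  proof (intro exI[of _ H] allI conjI ballI)
    show "H i \<in> Hom (Mod_cat R) (obj Y i) (obj Y' (i - 1))" for i using HH by simp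
    fix i y assume y: "y \<in> carrier (obj Y i)"
    have dH: "diff Y' (i - 1) \<in> mod_hom R (obj Y' (i - 1)) (obj Y' i)" by (rule mcpx_diff[OF Y']) simp
    have H1: "H (i + 1) \<in> mod_hom R (obj Y (i + 1)) (obj Y' i)" using HH[of "i + 1"] by simp
    have FG: "F i \<in> mod_hom R (obj Y i) (obj Y' i)" "G i \<in> mod_hom R (obj Y i) (obj Y' i)"
      using chain_map_Hom[OF F, of i] chain_map_Hom[OF G, of i] by simp_all
    show "F i y = G i y \<oplus>\<^bsub>obj Y' i\<^esub> (diff Y' (i - 1) (H i y) \<oplus>\<^bsub>obj Y' i\<^esub> H (i + 1) (diff Y i y))"
    proof (rule tensor_mod_hom_ext[OF tensD(2)[OF t] mcpx_mod[OF X] mcpx_mod[OF Y'] FG(1) _ _ y])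
      show "(%y. G i y \<oplus>\<^bsub>obj Y' i\<^esub> (diff Y' (i - 1) (H i y) \<oplus>\<^bsub>obj Y' i\<^esub> H (i + 1) (diff Y i y)))
        \<in> mod_hom R (obj Y i) (obj Y' i)"
        by (intro mod_hom_add FG mod_hom_comp[OF HH dH] mod_hom_comp[OF mcpx_diff[OF Y refl] H1] mcpx_mod[OF Y'])
      fix m c assume m: "m \<in> carrier (obj X i)" and c: "c \<in> carrier C"
      have dm: "diff X i m \<in> carrier (obj X (i + 1))" using m X by simp
      have cl: "g i m \<in> carrier (obj X' i)" "h i m \<in> carrier (obj X' (i - 1))"
        "diff X' (i - 1) (h i m) \<in> carrier (obj X' i)" "h (i + 1) (diff X i m) \<in> carrier (obj X' i)"
        using chain_map_closed[OF g m] mod_homD(1)[OF hH m] mod_homD(1)[OF hH dm] X' by simp_all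
      note add = balancedD(2)[OF tensorD(2)[OF tensD(2)[OF t', of i]] _ _ c]
      have "F i (\<tau> i m c) = \<tau>' i (f i m) c" using Ff m c by simp
      also have "\<dots> = \<tau>' i (g i m) c \<oplus>\<^bsub>obj Y' i\<^esub> (\<tau>' i (diff X' (i - 1) (h i m)) c \<oplus>\<^bsub>obj Y' i\<^esub> \<tau>' i (h (i + 1) (diff X i m)) c)"
        unfolding heq[OF m] using cl X' by (simp add: add)
      also have "\<tau>' i (diff X' (i - 1) (h i m)) c = diff Y' (i - 1) (H i (\<tau> i m c))"
        using tensD(3)[OF t' cl(2) c, of i] H[OF m c] by simp
      also have "\<tau>' i (h (i + 1) (diff X i m)) c = H (i + 1) (diff Y i (\<tau> i m c))"
        using tensD(3)[OF t m c refl] H[OF dm c] by simp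
      finally show "F i (\<tau> i m c) = G i (\<tau> i m c) \<oplus>\<^bsub>obj Y' i\<^esub>
          (diff Y' (i - 1) (H i (\<tau> i m c)) \<oplus>\<^bsub>obj Y' i\<^esub> H (i + 1) (diff Y i (\<tau> i m c)))"
        using Gg m c by simp
    qed
  qed
qed

end

lemma tens_shift: "tens X Y \<tau> ==> tens (shift X) (shift Y) (%i. \<tau> (i - 1))"
  by (auto simp: tens_def shift_complex)

text \<open>A quasi-isomorphism need not survive tensoring, but between K-projective complexes it is
  a homotopy equivalence, and homotopies do survive.\<close>

lemma tens_qis:
  assumes P: "K_projective (Mod_cat R) P" and Q: "K_projective (Mod_cat R) Q" and p: "qis P Q p"
    and t: "tens P Y \<tau>" and t': "tens Q Z \<sigma>"
  obtains q where "qis Y Z q"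
proof -
  note PC = K_projective_complex[OF P] and QC = K_projective_complex[OF Q] and pc = qisD(1)[OF p]
  note Y = tensD(1)[OF t] and Z = tensD(1)[OF t']
  obtain g f' where g: "g \<in> chain_maps (Mod_cat R) Q P" and f': "f' \<in> chain_maps (Mod_cat R) P Q"
    and h: "homotopic (Mod_cat R) Q Q (%i x. x) (%i x. p i (g i x))"
    and h': "homotopic (Mod_cat R) P P (%i x. x) (%i x. g i (f' i x))"
    by (rule K_projective_homotopy_inverse[OF P Q p])
  obtain F where F: "F \<in> chain_maps (Mod_cat R) Y Z" "\<forall>i. \<forall>x\<in>carrier (obj P i). \<forall>c\<in>carrier C. F i (\<tau> i x c) = \<sigma> i (p i x) c"
    by (rule ex_tens_map[OF PC QC t t' pc])
  obtain G where G: "G \<in> chain_maps (Mod_cat R) Z Y" "\<forall>i. \<forall>x\<in>carrier (obj Q i). \<forall>c\<in>carrier C. G i (\<sigma> i x c) = \<tau> i (g i x) c"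
    by (rule ex_tens_map[OF QC PC t' t g])
  obtain F' where F': "F' \<in> chain_maps (Mod_cat R) Y Z" "\<forall>i. \<forall>x\<in>carrier (obj P i). \<forall>c\<in>carrier C. F' i (\<tau> i x c) = \<sigma> i (f' i x) c"
    by (rule ex_tens_map[OF PC QC t t' f'])
  have FG: "homotopic (Mod_cat R) Z Z (%i x. x) (%i x. F i (G i x))"
    by (rule tens_homotopic[OF QC QC t' t' h chain_map_id[OF QC] chain_map_comp[OF g pc QC PC QC]
          chain_map_id[OF Z] chain_map_comp[OF G(1) F(1) Z Y Z]])
      (use F(2) G(2) chain_map_closed[OF g] in simp_all)
  have GF': "homotopic (Mod_cat R) Y Y (%i x. x) (%i x. G i (F' i x))"
    by (rule tens_homotopic[OF PC PC t t h' chain_map_id[OF PC] chain_map_comp[OF f' g PC QC PC]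
          chain_map_id[OF Y] chain_map_comp[OF F'(1) G(1) Y Z Y]])
      (use F'(2) G(2) chain_map_closed[OF f'] in simp_all)
  show thesis by (rule that[OF qis_two_sided[OF Y Z F(1) G(1) F'(1) FG GF']])
qed

text \<open>The identity of an acyclic K-projective complex is null-homotopic, and tensoring
  preserves this.\<close>

lemma tens_acyclic:
  assumes Q: "K_projective (Mod_cat R) Q" and ac: "acyclic_cpx Q" and t: "tens Q T \<tau>"
  shows "acyclic_cpx T"
  unfolding acyclic_cpx_def
proof (intro allI equalityI subsetI)
  note QC = K_projective_complex[OF Q] and T = tensD(1)[OF t]
  fix i x assume x: "x \<in> cocycles T i"
  have z: "\<tau> i (zero (obj Q i)) c = (zero (obj T i))" if "c \<in> carrier C" for i c
    by (rule balanced_zero[OF mcpx_mod[OF QC] C right_module_group[OF mcpx_mod[OF T]] tensorD(2)[OF tensD(2)[OF t]] that])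
  have "homotopic (Mod_cat R) Q Q (%i x. x) (%i x. (zero (obj Q i)))"
    using Q ac QC chain_map_id[OF QC] unfolding K_projective_def by simp
  then have "homotopic (Mod_cat R) T T (%i x. x) (%i x. (zero (obj T i)))"
    by (rule tens_homotopic[OF QC QC t t _ chain_map_id[OF QC] zero_chain_map[OF QC QC]
          chain_map_id[OF T] zero_chain_map[OF T T]]) (simp_all add: z)
  then have "coh T i x (zero (obj T i))"
    by (rule homotopic_coh[OF _ T T chain_map_id[OF T] zero_chain_map[OF T T] x])
  then show "x \<in> coboundaries T i" using coh_zero_iff[OF T cocycles_carrier[OF x]] by simp
qed (rule coboundary_cocycle[OF tensD(1)[OF t]])

text \<open>The choice in \<open>derived_tensor\<close> comes from some unknown K-projective
  resolution. It is compared with the given one by lifting and \<open>tens_qis\<close>, so that any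
  K-projective resolution may be used for computations.\<close>

lemma derived_tensor_qis:
  assumes Q: "K_projective (Mod_cat R) Q" and X: "X \<in> complexes (Mod_cat R)" and q: "qis Q X q" and t: "tens Q T \<tau>"
  obtains s where "derived_tensor R C X \<in> complexes (Mod_cat R)" "qis (derived_tensor R C X) T s"
proof -
  note QC = K_projective_complex[OF Q]
  have "\<exists>P. K_projective (Mod_cat R) P \<and> quasi_isos (Mod_cat R) P X \<noteq> {} \<and> is_tensor_cpx R P C T"
    using Q q t quasi_isos_iff[OF QC X] by (auto simp: is_tensor_cpx_iff)
  then have "\<exists>P. K_projective (Mod_cat R) P \<and> quasi_isos (Mod_cat R) P X \<noteq> {} \<and> is_tensor_cpx R P C (derived_tensor R C X)"
    unfolding derived_tensor_def by (rule someI)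
  then obtain P p \<sigma> where P: "K_projective (Mod_cat R) P" and p: "p \<in> quasi_isos (Mod_cat R) P X"
    and t': "tens P (derived_tensor R C X) \<sigma>" by (auto simp: is_tensor_cpx_iff)
  have "qis P X p" using p quasi_isos_iff[OF K_projective_complex[OF P] X] by simp
  then obtain f where f: "qis P Q f" by (rule qis_lift_qis[OF P QC X q])
  obtain s where "qis (derived_tensor R C X) T s" by (rule tens_qis[OF P Q f t' t])
  then show thesis by (rule that[OF tensD(1)[OF t']])
qed

end

section \<open>Finite resolutions\<close>

context mod_cat
begin

context
  fixes F X \<epsilon>
  assumes F: "F \<in> complexes \<A>" and X: "X \<in> complexes \<A>" and \<epsilon>: "\<epsilon> \<in> chain_maps \<A> F X"
begin

definition kernel_cpx :: "('u, 'x) cpx"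
  where "kernel_cpx = \<lparr>obj = (%i. kn (obj F i) {x \<in> carrier (obj F i). \<epsilon> i x = (zero (obj X i))}), diff = diff F\<rparr>"

lemma kernel_cpx_sel [simp]:
  "obj kernel_cpx i = kn (obj F i) {x \<in> carrier (obj F i). \<epsilon> i x = (zero (obj X i))}" "diff kernel_cpx = diff F"
  by (simp_all add: kernel_cpx_def)

lemma kernel_cpx_Ob: "kn (obj F i) {x \<in> carrier (obj F i). \<epsilon> i x = (zero (obj X i))} \<in> Ob \<A>"
  by (rule kn_Ob[OF chain_map_Hom[OF \<epsilon>] cpx_Ob[OF F] cpx_Ob[OF X]])

lemma kernel_inc: "(%x. x) \<in> Hom \<A> (kn (obj F i) {x \<in> carrier (obj F i). \<epsilon> i x = (zero (obj X i))}) (obj F i)"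
  by (rule kn_inc[OF kernel_cpx_Ob cpx_Ob[OF F]]) blast

lemma kernel_complex: "kernel_cpx \<in> complexes \<A>"
proof (rule complexesI)
  show "obj kernel_cpx i \<in> Ob \<A>" for i unfolding kernel_cpx_sel by (rule kernel_cpx_Ob)
  show "diff kernel_cpx i \<in> Hom \<A> (obj kernel_cpx i) (obj kernel_cpx (i + 1))" for i
    unfolding kernel_cpx_sel
  proof (rule kn_Hom[OF _ kernel_cpx_Ob])
    show "diff F i \<in> Hom \<A> (kn (obj F i) {x \<in> carrier (obj F i). \<epsilon> i x = (zero (obj X i))}) (obj F (i + 1))"
      using Hom_comp[OF kernel_inc cpx_diff_Hom[OF F refl] kernel_cpx_Ob cpx_Ob[OF F] cpx_Ob[OF F]] .
    show "diff F i ` carrier (kn (obj F i) {x \<in> carrier (obj F i). \<epsilon> i x = (zero (obj X i))}) \<subseteq>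
       {x \<in> carrier (obj F (i + 1)). \<epsilon> (i + 1) x = (zero (obj X (i + 1)))}"
      using F X chain_map_diff[OF \<epsilon>] by (auto simp: kn_carrier)
  qed
qed (use F in \<open>simp add: kn_carrier kn_zero\<close>)

lemma kernel_inc_chain_map: "(%i x. x) \<in> chain_maps \<A> kernel_cpx F"
proof (rule chain_mapsI)
  show "(%x. x) \<in> Hom \<A> (obj kernel_cpx i) (obj F i)" for i unfolding kernel_cpx_sel by (rule kernel_inc)
qed simp

lemma kernel_resolution:
  assumes s: "!!i. \<epsilon> i ` carrier (obj F i) = carrier (obj X i)" and R: "R \<in> complexes \<A>" and r: "qis R kernel_cpx r"
  shows "r \<in> chain_maps \<A> R F" "qis (cone R F r) X (%i z. \<epsilon> i (p2 z))"
proof -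
  show "r \<in> chain_maps \<A> R F"
    using chain_map_comp[OF qisD(1)[OF r] kernel_inc_chain_map R kernel_complex F] .
  show "qis (cone R F r) X (%i z. \<epsilon> i (p2 z))"
    by (rule cone_resolution[OF kernel_complex F X kernel_inc_chain_map \<epsilon> _ _ _ s R r])
      (auto simp: kn_carrier kn_zero)
qed

end

end

text \<open>A resolution of length n by finitely generated projective modules, some of which may be
  zero. The recursion through kernels lets proofs run by induction on n over modules.\<close>

primrec fres :: "('r, 'x) ring_scheme => nat => ('r, 'u::infinite) module => bool"
  where "fres R 0 M \<longleftrightarrow> M \<in> proj R"
  | "fres R (Suc n) M \<longleftrightarrow> right_module R M \<and> (\<exists>P\<in>proj R. \<exists>\<alpha>\<in>mod_hom R P M.
      \<alpha> ` carrier P = carrier M \<and> fres R n (mkn P {x \<in> carrier P. \<alpha> x = (zero M)}))"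

lemma proj_module: "P \<in> proj R ==> right_module R P"
  by (simp add: proj_def projective_def)

lemma fres_module: "fres R n M ==> right_module R M"
  by (cases n) (simp_all add: proj_module)

lemma mkn_module:
  assumes "\<alpha> \<in> mod_hom R P M" "right_module R P" "right_module R M"
  shows "right_module R (mkn P {x \<in> carrier P. \<alpha> x = (zero M)})"
  by (rule right_module.right_module_sub[OF assms(2) kernel_submod[OF assms]]) simp_all

lemma mkn_hom: "f \<in> mod_hom R L M ==> f ` carrier L \<subseteq> S ==> f \<in> mod_hom R L (mkn M S)"
  using mod_homD[of f R L M] by (intro mod_homI) auto

lemma mkn_hom_inc: "S \<subseteq> carrier M ==> (%x. x) \<in> mod_hom R (mkn M S) M"
  by (intro mod_homI) auto

lemma mbp_module: "right_module R M ==> right_module R N ==> right_module R (mbp M N)"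
  by (rule right_module_bp) simp_all

lemma mbp_hom: "f \<in> mod_hom R L M ==> g \<in> mod_hom R L N ==> (%x. pr (f x) (g x)) \<in> mod_hom R L (mbp M N)"
  using mod_homD[of f R L M] mod_homD[of g R L N] by (intro mod_homI) auto

lemma p1_mod_hom: "p1 \<in> mod_hom R (mbp M N) M" and p2_mod_hom: "p2 \<in> mod_hom R (mbp M N) N"
  by (auto intro!: mod_homI)

lemma mod_hom_proj_lift:
  fixes P M N :: "('r, 'u) module"
  assumes "P \<in> proj R" "right_module R M" "right_module R N" "g \<in> mod_hom R M N" "g ` carrier M = carrier N"
    "f \<in> mod_hom R P N"
  obtains h where "h \<in> mod_hom R P M" "\<forall>p\<in>carrier P. g (h p) = f p"
proof -
  have "\<exists>h\<in>Hom (Mod_cat R) P M. \<forall>p\<in>carrier P. g (h p) = f p"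
    using assms unfolding proj_def projective_def by simp
  then show thesis using that by auto
qed

lemma zero_proj:
  fixes P :: "('r, 'u::infinite) module"
  assumes "right_module R P" "carrier P = {(zero P)}"
  shows "P \<in> proj R"
  using perf_cat.\<P>_zero[OF perf_cat_Mod, of P R] assms by simp

lemma proj_retract:
  fixes P M :: "('r, 'u::infinite) module"
  assumes P: "P \<in> proj R" and M: "right_module R M" and i: "i \<in> mod_hom R M P" and p: "p \<in> mod_hom R P M"
    and pi: "!!x. x \<in> carrier M ==> p (i x) = x"
  shows "M \<in> proj R"
proof -
  have "projective (Mod_cat R) M"
    by (rule mod_cat.projective_retract[OF mod_cat_Mod, of R P M i p]) (use assms in \<open>simp_all add: proj_def\<close>)
  moreover have "p ` carrier P = carrier M"
    using mod_homD(1)[OF i] mod_homD(1)[OF p] pi by force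
  then have "fin_gen R M"
    using fin_gen_image[OF proj_module[OF P] M p] P by (simp add: proj_def)
  ultimately show ?thesis by (simp add: proj_def)
qed

text \<open>The identity covers \<open>P\<close> with kernel zero, so a resolution may be prolonged
  by zeros.\<close>

lemma proj_fres: "P \<in> proj R ==> fres R n P"
proof (induction n arbitrary: P)
  case (Suc n)
  note M = proj_module[OF Suc.prems]
  interpret P: right_module R P by (rule M)
  have "mkn P {x \<in> carrier P. x = (zero P)} \<in> proj R"
    by (rule zero_proj[OF mkn_module[OF mod_hom_id M M]]) auto
  then have "fres R n (mkn P {x \<in> carrier P. x = (zero P)})" by (rule Suc.IH)
  then show ?case using M Suc.prems
    by (auto intro!: bexI[of _ P] bexI[of _ "%x. x"] mod_hom_id)
qed simp

text \<open>
  A retract version of Schanuel's lemma: the kernel of a cover of \<open>M\<close> is a retract of the sum of the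
  cover and the kernel of a cover of \<open>N\<close>.
\<close>

lemma schanuel_retract:
  fixes P P' M N :: "('r, 'u::infinite) module"
  assumes P: "P \<in> proj R" and P': "P' \<in> proj R" and M: "right_module R M" and N: "right_module R N"
    and \<alpha>: "\<alpha> \<in> mod_hom R P M" "\<alpha> ` carrier P = carrier M"
    and \<beta>: "\<beta> \<in> mod_hom R P' N" "\<beta> ` carrier P' = carrier N"
    and i: "i \<in> mod_hom R M N" and p: "p \<in> mod_hom R N M" and pi: "!!x. x \<in> carrier M ==> p (i x) = x"
  obtains j q where
    "j \<in> mod_hom R (mkn P {x \<in> carrier P. \<alpha> x = (zero M)}) (mbp (mkn P' {x \<in> carrier P'. \<beta> x = (zero N)}) P)"
    "q \<in> mod_hom R (mbp (mkn P' {x \<in> carrier P'. \<beta> x = (zero N)}) P) (mkn P {x \<in> carrier P. \<alpha> x = (zero M)})"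
    "!!x. x \<in> carrier P ==> \<alpha> x = (zero M) ==> q (j x) = x"
proof -
  interpret M: right_module R M by (rule M)
  interpret P: right_module R P by (rule proj_module[OF P])
  let ?L = "{x \<in> carrier P. \<alpha> x = (zero M)}" and ?K = "{x \<in> carrier P'. \<beta> x = (zero N)}"
  obtain u where u: "u \<in> mod_hom R P P'" "\<forall>x\<in>carrier P. \<beta> (u x) = i (\<alpha> x)"
    by (rule mod_hom_proj_lift[OF P proj_module[OF P'] N \<beta> mod_hom_comp[OF \<alpha>(1) i]])
  obtain v where v: "v \<in> mod_hom R P' P" "\<forall>x\<in>carrier P'. \<alpha> (v x) = p (\<beta> x)"
    by (rule mod_hom_proj_lift[OF P' proj_module[OF P] M \<alpha> mod_hom_comp[OF \<beta>(1) p]])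
  note uv = mod_hom_comp[OF u(1) v(1)]
  have c: "u x \<in> carrier P'" "v (u x) \<in> carrier P" if "x \<in> carrier P" for x
    using mod_homD(1)[OF u(1) that] mod_homD(1)[OF uv that] by simp_all
  show thesis
  proof (rule that)
    have "u \<in> mod_hom R (mkn P ?L) P'" using mod_hom_comp[OF mkn_hom_inc[of ?L P] u(1)] by auto
    then have "u \<in> mod_hom R (mkn P ?L) (mkn P' ?K)"
      using c u(2) mod_hom_zero[OF i M N] by (intro mkn_hom) auto
    then show "(%x. pr (u x) x) \<in> mod_hom R (mkn P ?L) (mbp (mkn P' ?K) P)"
      by (rule mbp_hom) (auto intro: mkn_hom_inc)
    have "(%x. x \<oplus>\<^bsub>P\<^esub> \<ominus>\<^bsub>P\<^esub> v (u x)) \<in> mod_hom R P P"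
      by (intro mod_hom_add mod_hom_id mod_hom_neg uv proj_module P)
    note h2 = mod_hom_comp[OF p2_mod_hom[of R "mkn P' ?K" P] this]
    have "v \<in> mod_hom R (mkn P' ?K) P" using mod_hom_comp[OF mkn_hom_inc[of ?K P'] v(1)] by auto
    note h1 = mod_hom_comp[OF p1_mod_hom[of R "mkn P' ?K" P] this]
    have "\<alpha> (v k \<oplus>\<^bsub>P\<^esub> (x \<oplus>\<^bsub>P\<^esub> \<ominus>\<^bsub>P\<^esub> v (u x))) = (zero M)" "v k \<oplus>\<^bsub>P\<^esub> (x \<oplus>\<^bsub>P\<^esub> \<ominus>\<^bsub>P\<^esub> v (u x)) \<in> carrier P"
      if k: "k \<in> carrier P'" "\<beta> k = (zero N)" and x: "x \<in> carrier P" for k x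
    proof -
      have vk: "v k \<in> carrier P" by (rule mod_homD(1)[OF v(1) k(1)])
      then show "v k \<oplus>\<^bsub>P\<^esub> (x \<oplus>\<^bsub>P\<^esub> \<ominus>\<^bsub>P\<^esub> v (u x)) \<in> carrier P" using c x by simp
      have "\<alpha> (v k) = (zero M)" using v(2) k mod_hom_zero[OF p N M] by simp
      moreover have "\<alpha> (v (u x)) = \<alpha> x" using v(2) u(2) c x pi mod_homD(1)[OF \<alpha>(1)] by simp
      moreover have "\<alpha> x \<in> carrier M" by (rule mod_homD(1)[OF \<alpha>(1) x])
      ultimately show "\<alpha> (v k \<oplus>\<^bsub>P\<^esub> (x \<oplus>\<^bsub>P\<^esub> \<ominus>\<^bsub>P\<^esub> v (u x))) = (zero M)"
        using c x vk mod_homD(2)[OF \<alpha>(1)] mod_hom_map_neg[OF \<alpha>(1) proj_module[OF P] M] by (simp add: M.M.r_neg)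
    qed
    then show "(%z. v (p1 z) \<oplus>\<^bsub>P\<^esub> (p2 z \<oplus>\<^bsub>P\<^esub> \<ominus>\<^bsub>P\<^esub> v (u (p2 z)))) \<in> mod_hom R (mbp (mkn P' ?K) P) (mkn P ?L)"
      by (intro mkn_hom mod_hom_add h1 h2 proj_module P) auto
    fix x assume x: "x \<in> carrier P" "\<alpha> x = (zero M)"
    then show "v (p1 (pr (u x) x)) \<oplus>\<^bsub>P\<^esub> (p2 (pr (u x) x) \<oplus>\<^bsub>P\<^esub> \<ominus>\<^bsub>P\<^esub> v (u (p2 (pr (u x) x)))) = x"
      using c by (simp add: P.M.a_lcomm P.M.r_neg)
  qed
qed

text \<open>The two closure properties depend on each other: the kernel of a cover of a retract is
  by \<open>schanuel_retract\<close> a retract of a sum, and the sum case uses the retract case to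
  pass from the sum of the kernels to the kernel of the sum.\<close>

lemma fres_retract_bp:
  fixes R :: "('r, 'x) ring_scheme"
  shows "(\<forall>(N :: ('r, 'u::infinite) module) (M :: ('r, 'u) module) i p. fres R n N --> right_module R M --> i \<in> mod_hom R M N -->
      p \<in> mod_hom R N M --> (\<forall>x\<in>carrier M. p (i x) = x) --> fres R n M) \<and>
    (\<forall>(K :: ('r, 'u) module) K'. fres R n K --> fres R n K' --> fres R n (mbp K K'))"
proof (induction n)
  case 0
  have "fres R 0 M" if "fres R 0 N" "right_module R M" "i \<in> mod_hom R M N" "p \<in> mod_hom R N M"
    "!!x. x \<in> carrier M ==> p (i x) = x" for N M :: "('r, 'u) module" and i p
    using proj_retract[of N R M i p] that by simp
  moreover have "fres R 0 (mbp K K')" if "fres R 0 K" "fres R 0 K'" for K K' :: "('r, 'u) module"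
    using perf_cat.\<P>_bp[OF perf_cat_Mod, of K R K'] that by simp
  ultimately show ?case by blast
next
  case (Suc n)
  have retr: "fres R n M" if "fres R n N" "right_module R M" "i \<in> mod_hom R M N" "p \<in> mod_hom R N M"
    "!!x. x \<in> carrier M ==> p (i x) = x" for N M :: "('r, 'u) module" and i p
    using Suc.IH that by blast
  have bp: "fres R n (mbp K K')" if "fres R n K" "fres R n K'" for K K' :: "('r, 'u) module"
    using Suc.IH that by blast
  show ?case
  proof (intro conjI allI impI)
    fix N M :: "('r, 'u) module" and i p
    assume N: "fres R (Suc n) N" and M: "right_module R M" and i: "i \<in> mod_hom R M N"
      and p: "p \<in> mod_hom R N M" and pi: "\<forall>x\<in>carrier M. p (i x) = x"
    note NM = fres_module[OF N]
    obtain P :: "('r, 'u) module" and \<beta> where P: "P \<in> proj R" and \<beta>: "\<beta> \<in> mod_hom R P N" "\<beta> ` carrier P = carrier N"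
      and K: "fres R n (mkn P {x \<in> carrier P. \<beta> x = (zero N)})" using N by auto
    note pb = mod_hom_comp[OF \<beta>(1) p]
    have s: "(%x. p (\<beta> x)) ` carrier P = carrier M"
    proof -
      have "p ` carrier N = carrier M" using mod_homD(1)[OF p] mod_homD(1)[OF i] pi by force
      then show ?thesis unfolding \<beta>(2)[symmetric] image_image .
    qed
    obtain j q where jq: "j \<in> mod_hom R (mkn P {x \<in> carrier P. p (\<beta> x) = (zero M)}) (mbp (mkn P {x \<in> carrier P. \<beta> x = (zero N)}) P)"
      "q \<in> mod_hom R (mbp (mkn P {x \<in> carrier P. \<beta> x = (zero N)}) P) (mkn P {x \<in> carrier P. p (\<beta> x) = (zero M)})"
      "!!x. x \<in> carrier P ==> p (\<beta> x) = (zero M) ==> q (j x) = x"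
      using schanuel_retract[OF P P M NM pb s \<beta> i p] pi by blast
    have "fres R n (mkn P {x \<in> carrier P. p (\<beta> x) = (zero M)})"
      by (rule retr[OF bp[OF K proj_fres[OF P]] mkn_module[OF pb proj_module[OF P] M] jq(1,2)]) (simp add: jq(3))
    then show "fres R (Suc n) M" using M P pb s by auto
  next
    fix K K' :: "('r, 'u) module" assume K: "fres R (Suc n) K" and K': "fres R (Suc n) K'"
    note KM = fres_module[OF K] fres_module[OF K']
    obtain P :: "('r, 'u) module" and \<alpha> where P: "P \<in> proj R" and \<alpha>: "\<alpha> \<in> mod_hom R P K" "\<alpha> ` carrier P = carrier K"
      and k: "fres R n (mkn P {x \<in> carrier P. \<alpha> x = (zero K)})" using K by auto
    obtain P' :: "('r, 'u) module" and \<alpha>' where P': "P' \<in> proj R" and \<alpha>': "\<alpha>' \<in> mod_hom R P' K'" "\<alpha>' ` carrier P' = carrier K'"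
      and k': "fres R n (mkn P' {x \<in> carrier P'. \<alpha>' x = (zero K')})" using K' by auto
    let ?P = "mbp P P'" and ?f = "%z. pr (\<alpha> (p1 z)) (\<alpha>' (p2 z))"
    have PP: "?P \<in> proj R" by (rule perf_cat.\<P>_bp[OF perf_cat_Mod P P'])
    have f: "?f \<in> mod_hom R ?P (mbp K K')"
      by (rule mbp_hom[OF mod_hom_comp[OF p1_mod_hom \<alpha>(1)] mod_hom_comp[OF p2_mod_hom \<alpha>'(1)]])
    have s: "?f ` carrier ?P = carrier (mbp K K')"
    proof (intro equalityI subsetI)
      fix z assume "z \<in> carrier (mbp K K')"
      then obtain x y where z: "z = pr x y" "x \<in> carrier K" "y \<in> carrier K'" by auto
      obtain a where a: "x = \<alpha> a" "a \<in> carrier P" using z(2) \<alpha>(2) by blast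
      obtain b where b: "y = \<alpha>' b" "b \<in> carrier P'" using z(3) \<alpha>'(2) by blast
      show "z \<in> ?f ` carrier ?P" using z a b by (intro image_eqI[of _ _ "pr a b"]) auto
    qed (use mod_homD(1)[OF f] in blast)
    let ?L = "mkn ?P {z \<in> carrier ?P. ?f z = (zero (mbp K K'))}"
      and ?M = "mbp (mkn P {x \<in> carrier P. \<alpha> x = (zero K)}) (mkn P' {x \<in> carrier P'. \<alpha>' x = (zero K')})"
    have "fres R n ?L"
      by (rule retr[OF bp[OF k k'] mkn_module[OF f proj_module[OF PP] mbp_module[OF KM]], of "%x. x" "%x. x"])
        (auto intro!: mod_homI)
    then show "fres R (Suc n) (mbp K K')" using mbp_module[OF KM] PP f s by (auto simp del: mbp_sel)
  qed
qed

lemma fres_retract: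
  fixes M N :: "('r, 'u::infinite) module"
  assumes "fres R n N" "right_module R M" "i \<in> mod_hom R M N" "p \<in> mod_hom R N M"
    "!!x. x \<in> carrier M ==> p (i x) = x"
  shows "fres R n M"
  using fres_retract_bp[of R n] assms by blast

lemma fres_bp: "fres R n K ==> fres R n K' ==> fres R n (mbp K K')"
  using fres_retract_bp[of R n] by blast

text \<open>\<open>schanuel_retract\<close> for identity maps: the kernel of any cover, and not only
  of the one in the given resolution, has a resolution shorter by one.\<close>

lemma fres_kernel:
  fixes P N :: "('r, 'u::infinite) module"
  assumes N: "fres R (Suc n) N" and P: "P \<in> proj R" and \<alpha>: "\<alpha> \<in> mod_hom R P N" "\<alpha> ` carrier P = carrier N"
  shows "fres R n (mkn P {x \<in> carrier P. \<alpha> x = (zero N)})"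
proof -
  note NM = fres_module[OF N]
  obtain P' :: "('r, 'u) module" and \<beta> where P': "P' \<in> proj R" and \<beta>: "\<beta> \<in> mod_hom R P' N" "\<beta> ` carrier P' = carrier N"
    and K: "fres R n (mkn P' {x \<in> carrier P'. \<beta> x = (zero N)})" using N by auto
  obtain j q where jq: "j \<in> mod_hom R (mkn P {x \<in> carrier P. \<alpha> x = (zero N)}) (mbp (mkn P' {x \<in> carrier P'. \<beta> x = (zero N)}) P)"
    "q \<in> mod_hom R (mbp (mkn P' {x \<in> carrier P'. \<beta> x = (zero N)}) P) (mkn P {x \<in> carrier P. \<alpha> x = (zero N)})"
    "!!x. x \<in> carrier P ==> \<alpha> x = (zero N) ==> q (j x) = x"
    using schanuel_retract[OF P P' NM NM \<alpha> \<beta> mod_hom_id mod_hom_id] by blast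
  show ?thesis
    by (rule fres_retract[OF fres_bp[OF K proj_fres[OF P]] mkn_module[OF \<alpha>(1) proj_module[OF P] NM] jq(1,2)])
      (simp add: jq(3))
qed

context
  fixes R :: "('r, 'x) ring_scheme"
begin

interpretation perf_cat "Mod_cat R :: ('u::infinite, ('r, 'u, unit) module_ext) concrete_cat" mbp mkn "proj R"
  by (rule perf_cat_Mod)

lemma mcpx_module: "(X :: ('r, 'u::infinite) mod_cpx) \<in> complexes (Mod_cat R) ==> right_module R (obj X i)"
  using cpx_Ob[of X i] by simp

lemma fres_SucI:
  fixes M P :: "('r, 'u::infinite) module"
  assumes "right_module R M" "P \<in> proj R" "\<alpha> \<in> mod_hom R P M" "\<alpha> ` carrier P = carrier M"
    "fres R n (mkn P {x \<in> carrier P. \<alpha> x = (zero M)})"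
  shows "fres R (Suc n) M"
  using assms by auto

text \<open>The clause on zero modules keeps the complex of covers bounded in
  \<open>bounded_fres_perf\<close>.\<close>

lemma fres_cover:
  fixes M :: "('r, 'u::infinite) module"
  assumes M: "fres R (Suc n) M"
  obtains P :: "('r, 'u) module" and \<alpha> where "P \<in> proj R" "\<alpha> \<in> mod_hom R P M" "\<alpha> ` carrier P = carrier M"
    "carrier M = {(zero M)} --> carrier P = {(zero P)}"
proof (cases "carrier M = {(zero M)}")
  case True
  then show thesis by (intro that[of M "%x. x"] zero_proj[OF fres_module[OF M]] mod_hom_id) simp_all
next
  case False
  then show thesis using M that by auto
qed

text \<open>
  Induction on the length of the resolutions: cover \<open>X\<close> by the contractible complex with terms
  \<open>P\<^sup>i \<oplus> P\<^sup>i\<^sup>-\<^sup>1\<close>, where \<open>P\<^sup>i\<close> covers \<open>X\<^sup>i\<close>; the kernel has shorter resolutions.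
\<close>

lemma bounded_fres_perf:
  fixes X :: "('r, 'u::infinite) mod_cpx"
  assumes "X \<in> complexes (Mod_cat R)" "bounded_cpx X" "!!i. fres R n (obj X i)"
  shows "\<exists>P q. perf P \<and> qis P X q"
  using assms
proof (induction n arbitrary: X)
  case 0
  then show ?case using qis_id by (auto simp: perf_def)
next
  case (Suc n)
  note X = Suc.prems(1)
  have "\<forall>i. \<exists>Z :: ('r, 'u) module \<times> ('u => 'u). fst Z \<in> proj R \<and> snd Z \<in> mod_hom R (fst Z) (obj X i) \<and> snd Z ` carrier (fst Z) = carrier (obj X i) \<and>
    (carrier (obj X i) = {(zero (obj X i))} --> carrier (fst Z) = {(zero (fst Z))})"
  proof
    fix i
    obtain P :: "('r, 'u) module" and \<alpha> where "P \<in> proj R" "\<alpha> \<in> mod_hom R P (obj X i)" "\<alpha> ` carrier P = carrier (obj X i)"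
      "carrier (obj X i) = {(zero (obj X i))} --> carrier P = {(zero P)}"
      by (rule fres_cover[OF Suc.prems(3)])
    then show "\<exists>Z :: ('r, 'u) module \<times> ('u => 'u). fst Z \<in> proj R \<and> snd Z \<in> mod_hom R (fst Z) (obj X i) \<and> snd Z ` carrier (fst Z) = carrier (obj X i) \<and>
      (carrier (obj X i) = {(zero (obj X i))} --> carrier (fst Z) = {(zero (fst Z))})"
      by (intro exI[of _ "(P, \<alpha>)"]) simp
  qed
  from choice[OF this] obtain Z :: "int => ('r, 'u) module \<times> ('u => 'u)" where Z: "!!i. fst (Z i) \<in> proj R" "!!i. snd (Z i) \<in> mod_hom R (fst (Z i)) (obj X i)"
    "!!i. snd (Z i) ` carrier (fst (Z i)) = carrier (obj X i)"
    "!!i. carrier (obj X i) = {(zero (obj X i))} ==> carrier (fst (Z i)) = {(zero (fst (Z i)))}" by blast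
  define P where "P i = fst (Z i)" for i
  define \<alpha> where "\<alpha> i = snd (Z i)" for i
  note Z = Z[folded P_def \<alpha>_def]
  note PM = proj_module[OF Z(1)]
  define F :: "('r, 'u) mod_cpx" where "F = \<lparr>obj = (%i. mbp (P i) (P (i - 1))), diff = (%i z. pr (zero (P (i + 1))) (p1 z))\<rparr>"
  have Fo: "obj F i = mbp (P i) (P (i - 1))" and Fd: "diff F i z = pr (zero (P (i + 1))) (p1 z)" for i z
    by (simp_all add: F_def)
  have Fp: "obj F i \<in> proj R" for i unfolding Fo by (rule \<P>_bp[OF Z(1) Z(1)])
  have F: "F \<in> complexes (Mod_cat R)"
  proof (rule complexesI)
    show "obj F i \<in> Ob (Mod_cat R)" for i using proj_module[OF Fp] by simp
    have "(%z. pr (zero (P (i + 1))) (p1 z)) \<in> mod_hom R (mbp (P i) (P (i - 1))) (mbp (P (i + 1)) (P i))" for i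
      by (intro mbp_hom mod_hom_const_zero PM p1_mod_hom)
    then show "diff F i \<in> Hom (Mod_cat R) (obj F i) (obj F (i + 1))" for i
      by (simp add: F_def)
    show "diff F (i + 1) (diff F i x) = (zero (obj F (i + 2)))" for i x by (simp add: Fo Fd)
  qed
  have "bounded_cpx F"
  proof -
    let ?S = "{i. carrier (obj X i) \<noteq> {(zero (obj X i))}}"
    have f: "finite ?S" using Suc.prems(2) by (simp add: bounded_cpx_def)
    have "finite ((%i. i - 1) -` ?S)" by (rule finite_vimageI[OF f]) (auto intro: injI)
    then have "finite (?S \<union> (%i. i - 1) -` ?S)" using f by simp
    moreover have "{i. carrier (obj F i) \<noteq> {(zero (obj F i))}} \<subseteq> ?S \<union> (%i. i - 1) -` ?S"
      using Z(4) by (auto simp: Fo)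
    ultimately show ?thesis unfolding bounded_cpx_def by (rule rev_finite_subset)
  qed
  then have Fperf: "perf F" using F Fp by (simp add: perf_def)
  \<comment> \<open>On the summand \<open>P i\<close> the map is the cover, on
    \<open>P (i - 1)\<close> it is the cover followed by the differential; since the differential of
    \<open>F\<close> sends \<open>(a, b)\<close> to \<open>(0, a)\<close>, this commutes with the
    differentials.\<close>
  define \<epsilon> where "\<epsilon> = (%i z. \<alpha> i (p1 z) \<oplus>\<^bsub>obj X i\<^esub> diff X (i - 1) (\<alpha> (i - 1) (p2 z)))"
  have dH: "diff X (i - 1) \<in> mod_hom R (obj X (i - 1)) (obj X i)" for i
    using cpx_diff_Hom[OF X, of i "i - 1"] by simp
  have \<epsilon>H: "\<epsilon> i \<in> mod_hom R (obj F i) (obj X i)" for i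
    unfolding \<epsilon>_def Fo by (intro mod_hom_add mod_hom_comp[OF p1_mod_hom Z(2)]
        mod_hom_comp[OF mod_hom_comp[OF p2_mod_hom Z(2)] dH] mcpx_module X)
  have \<alpha>0: "\<alpha> i (zero (P i)) = (zero (obj X i))" for i by (rule mod_hom_zero[OF Z(2) PM mcpx_module[OF X]])
  have \<alpha>c: "a \<in> carrier (P i) ==> \<alpha> i a \<in> carrier (obj X i)" for a i by (rule mod_homD(1)[OF Z(2)])
  have \<epsilon>: "\<epsilon> \<in> chain_maps (Mod_cat R) F X"
  proof (rule chain_mapsI)
    show "\<epsilon> i \<in> Hom (Mod_cat R) (obj F i) (obj X i)" for i using \<epsilon>H by simp
    fix i z assume "z \<in> carrier (obj F i)"
    then obtain a b where z: "z = pr a b" "a \<in> carrier (P i)" "b \<in> carrier (P (i - 1))" by (auto simp: Fo)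
    have d: "diff X (i - 1) (\<alpha> (i - 1) b) \<in> carrier (obj X i)" using X \<alpha>c[OF z(3)] by simp
    have dd: "diff X i (diff X (i - 1) (\<alpha> (i - 1) b)) = (zero (obj X (i + 1)))" using X \<alpha>c[OF z(3)] by simp
    show "\<epsilon> (i + 1) (diff F i z) = diff X i (\<epsilon> i z)"
      using z X \<alpha>c[OF z(2)] \<alpha>c[OF z(3)] d dd by (simp add: \<epsilon>_def Fd \<alpha>0 mcpx_module)
  qed
  have \<epsilon>s: "\<epsilon> i ` carrier (obj F i) = carrier (obj X i)" for i
  proof
    show "\<epsilon> i ` carrier (obj F i) \<subseteq> carrier (obj X i)" using mod_homD(1)[OF \<epsilon>H] by blast
    show "carrier (obj X i) \<subseteq> \<epsilon> i ` carrier (obj F i)"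
    proof
      fix x assume "x \<in> carrier (obj X i)"
      then obtain a where a: "x = \<alpha> i a" "a \<in> carrier (P i)" using Z(3)[of i] by blast
      interpret P: right_module R "P (i - 1)" by (rule PM)
      have d0: "diff X (i - 1) (zero (obj X (i - 1))) = (zero (obj X i))" using cpx_diff_map(2)[OF X, of "i - 1"] by simp
      have "x = \<epsilon> i (pr a (zero (P (i - 1))))"
        using a X \<alpha>c[OF a(2)] by (simp add: \<epsilon>_def \<alpha>0 d0 mcpx_module)
      then show "x \<in> \<epsilon> i ` carrier (obj F i)" using a P.M.zero_closed by (intro image_eqI) (auto simp: Fo)
    qed
  qed
  let ?K = "kernel_cpx F X \<epsilon>"
  have "\<exists>P q. perf P \<and> qis P ?K q"
  proof (rule Suc.IH)
    show "?K \<in> complexes (Mod_cat R)" by (rule kernel_complex[OF F X \<epsilon>])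
    show "fres R n (obj ?K i)" for i
      unfolding kernel_cpx_sel[OF F X \<epsilon>] by (rule fres_kernel[OF Suc.prems(3) Fp \<epsilon>H \<epsilon>s])
    have "carrier (obj ?K i) = {(zero (obj ?K i))}" if "carrier (obj F i) = {(zero (obj F i))}" for i
      unfolding kernel_cpx_sel[OF F X \<epsilon>] using that mod_hom_zero[OF \<epsilon>H proj_module[OF Fp] mcpx_module[OF X]] by auto
    then show "bounded_cpx ?K" using \<open>bounded_cpx F\<close> unfolding bounded_cpx_def
      by (elim rev_finite_subset) blast
  qed
  then obtain Q r where Q: "perf Q" and r: "qis Q ?K r" by blast
  note res = kernel_resolution[OF F X \<epsilon> \<epsilon>s perf_complex[OF Q] r]
  show ?case using perf_cone[OF Q Fperf res(1)] res(2) by blast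
qed

text \<open>In the stalk complex all coboundaries are zero, and in degree 0 every element is a
  cocycle; the quasi-isomorphism carries this over to the cohomology of \<open>P\<close>.\<close>

lemma qis_stalkD:
  fixes N :: "('r, 'u::infinite) module"
  assumes q: "qis P (stalk N) q" and P: "P \<in> complexes (Mod_cat R)" and N: "stalk N \<in> complexes (Mod_cat R)"
  shows "i \<noteq> 0 ==> cocycles P i = coboundaries P i"
    "q 0 ` cocycles P 0 = carrier N" "{x \<in> cocycles P 0. q 0 x = (zero N)} = coboundaries P 0"
proof -
  note qc = qisD(1)[OF q]
  have NM: "right_module R N" using mcpx_module[OF N, of 0] by (simp add: stalk_def)
  interpret N: right_module R N by (rule NM)
  have B0: "coboundaries (stalk N) i = {(zero N)}" for i
    by (auto simp: coboundaries_def stalk_def)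
  have Z0: "cocycles (stalk N) 0 = carrier N" by (auto simp: cocycles_def stalk_def)
  show "cocycles P i = coboundaries P i" if "i \<noteq> 0"
  proof (intro equalityI subsetI)
    fix x assume x: "x \<in> cocycles P i"
    have "q i x \<in> carrier (obj (stalk N) i)" by (rule chain_map_closed[OF qc cocycles_carrier[OF x]])
    also have "carrier (obj (stalk N) i) = coboundaries (stalk N) i" unfolding B0 using that by (simp add: stalk_def)
    finally have "q i x \<in> coboundaries (stalk N) i" .
    then show "x \<in> coboundaries P i" by (rule qisD(2)[OF q x])
  qed (rule coboundary_cocycle[OF P])
  have q0: "q 0 x \<in> carrier N" if "x \<in> cocycles P 0" for x
    using chain_map_closed[OF qc cocycles_carrier[OF that]] by (simp add: stalk_def)
  show "q 0 ` cocycles P 0 = carrier N"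
  proof (intro equalityI subsetI)
    fix y assume "y \<in> carrier N"
    then obtain x b where x: "x \<in> cocycles P 0" "b \<in> coboundaries (stalk N) 0" "y = q 0 x \<oplus>\<^bsub>obj (stalk N) 0\<^esub> b"
      using qisD(3)[OF q, of y 0] Z0 by blast
    then have "y = q 0 x" using q0[OF x(1)] B0[of 0] by (simp add: stalk_def)
    then show "y \<in> q 0 ` cocycles P 0" using x(1) by blast
  qed (use q0 in blast)
  show "{x \<in> cocycles P 0. q 0 x = (zero N)} = coboundaries P 0"
  proof (intro equalityI subsetI)
    fix x assume "x \<in> {x \<in> cocycles P 0. q 0 x = (zero N)}"
    then show "x \<in> coboundaries P 0" by (intro qisD(2)[OF q]) (simp_all add: B0)
  next
    fix x assume x: "x \<in> coboundaries P 0"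
    have "q 0 x \<in> coboundaries (stalk N) 0" by (rule chain_map_coboundary[OF qc x])
    then show "x \<in> {x \<in> cocycles P 0. q 0 x = (zero N)}" using B0[of 0] coboundary_cocycle[OF P x] by simp
  qed
qed

text \<open>The complex \<open>P\<close> of projectives is cut at degree 0. Above it all cocycles
  are coboundaries, so \<open>P\<close> splits from the top downwards and the cocycles of degree 0
  are projective. Below it \<open>P\<close> resolves the coboundaries of degree 0. The module
  \<open>N\<close> is the quotient of these cocycles by these coboundaries.\<close>

lemma stalk_Kb_fres:
  fixes N :: "('r, 'u::infinite) module"
  assumes "stalk N \<in> Kb_proj R"
  shows "\<exists>n. fres R n N"
proof -
  obtain P q where N: "stalk N \<in> complexes (Mod_cat R)" and P: "perf P" and q: "qis P (stalk N) q"
    using assms unfolding Kb_iff by blast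
  note PC = perf_complex[OF P]
  note st = qis_stalkD[OF q PC N]
  have NM: "right_module R N" using mcpx_module[OF N, of 0] by (simp add: stalk_def)
  have Pp: "obj P i \<in> proj R" for i using P by (simp add: perf_def)
  note PM = proj_module[OF Pp]
  have dH: "diff P i \<in> mod_hom R (obj P i) (obj P (i + 1))" for i using cpx_diff_Hom[OF PC refl, of i] by simp
  obtain m where m: "!!i. \<bar>i\<bar> > m ==> carrier (obj P i) = {(zero (obj P i))}" and m0: "m \<ge> 0"
  proof -
    let ?S = "{i. carrier (obj P i) \<noteq> {(zero (obj P i))}}"
    have "finite ?S" using P by (simp add: perf_def bounded_cpx_def)
    then have "finite (insert 0 (abs ` ?S))" by simp
    then have "\<bar>i\<bar> \<le> Max (insert 0 (abs ` ?S))" if "i \<in> ?S" for i using that by (intro Max_ge) auto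
    moreover have "Max (insert 0 (abs ` ?S)) \<ge> 0" using \<open>finite (insert 0 (abs ` ?S))\<close> by (intro Max_ge) auto
    ultimately show thesis using that[of "Max (insert 0 (abs ` ?S))"] by fastforce
  qed
  let ?Z = "%i. mkn (obj P i) (cocycles P i)" and ?B = "%i. mkn (obj P i) (coboundaries P i)"
  have ZM: "right_module R (?Z i)" for i unfolding cocycles_def by (rule mkn_module[OF dH PM PM])
  have BM: "right_module R (?B i)" for i
  proof (rule right_module.right_module_sub[OF PM])
    show "right_module.submod R (obj P i) (coboundaries P i)"
      unfolding coboundaries_def using image_submod[OF dH[of "i - 1"] PM PM] by simp
  qed simp_all
  have dB: "diff P i \<in> mod_hom R (obj P i) (?B (i + 1))" for i
    by (rule mkn_hom[OF dH]) (simp add: coboundaries_def)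
  have dBs: "diff P i ` carrier (obj P i) = carrier (?B (i + 1))" for i by (simp add: coboundaries_def)
  \<comment> \<open>Descent from degree m + 1, where \<open>P\<close> is zero, to degree 0.\<close>
  have Zp: "?Z (m + 1 - int k) \<in> proj R" if "int k \<le> m + 1" for k
    using that
  proof (induction k)
    case 0
    have "cocycles P (m + 1) = {(zero (obj P (m + 1)))}"
    proof (intro equalityI subsetI)
      fix x assume "x \<in> cocycles P (m + 1)"
      then show "x \<in> {(zero (obj P (m + 1)))}" using m[of "m + 1"] m0 cocycles_carrier[of x P "m + 1"] by simp
    next
      fix x assume "x \<in> {(zero (obj P (m + 1)))}"
      then show "x \<in> cocycles P (m + 1)" using zero_cocycle[OF PC, of "m + 1"] by simp
    qed
    then show ?case using ZM[of "m + 1"] by (intro zero_proj) simp_all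
  next
    case (Suc k)
    define i where "i = m + 1 - int (Suc k)"
    have i: "i \<ge> 0" and i1: "m + 1 - int k = i + 1" using Suc.prems by (simp_all add: i_def)
    have Zi: "?Z (i + 1) \<in> proj R" using Suc.IH Suc.prems unfolding i1 by simp
    have ZB: "cocycles P (i + 1) = coboundaries P (i + 1)" using i by (intro st(1)) simp
    \<comment> \<open>Projectivity of the cocycles in degree i + 1 splits the differential onto
      them, so that \<open>x - s (d x)\<close> projects onto the cocycles in degree i.\<close>
    obtain s where s: "s \<in> mod_hom R (?Z (i + 1)) (obj P i)" "\<forall>z\<in>carrier (?Z (i + 1)). diff P i (s z) = z"
      by (rule mod_hom_proj_lift[OF Zi PM BM dB dBs, of "%x. x"]) (auto simp: ZB intro: mod_hom_id)
    have dZ: "diff P i \<in> mod_hom R (obj P i) (?Z (i + 1))" unfolding ZB by (rule dB)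
    interpret M: right_module R "obj P i" by (rule PM)
    interpret M': right_module R "obj P (i + 1)" by (rule PM)
    have sc: "s (diff P i x) \<in> carrier (obj P i)" "diff P i (s (diff P i x)) = diff P i x" if "x \<in> carrier (obj P i)" for x
      using mod_homD(1)[OF s(1)] s(2) mod_homD(1)[OF dZ that] by simp_all
    have "(%x. x \<oplus>\<^bsub>obj P i\<^esub> \<ominus>\<^bsub>obj P i\<^esub> s (diff P i x)) \<in> mod_hom R (obj P i) (obj P i)"
      by (intro mod_hom_add mod_hom_id mod_hom_neg mod_hom_comp[OF dZ s(1)] PM)
    then have p: "(%x. x \<oplus>\<^bsub>obj P i\<^esub> \<ominus>\<^bsub>obj P i\<^esub> s (diff P i x)) \<in> mod_hom R (obj P i) (?Z i)"
    proof (rule mkn_hom)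
      show "(%x. x \<oplus>\<^bsub>obj P i\<^esub> \<ominus>\<^bsub>obj P i\<^esub> s (diff P i x)) ` carrier (obj P i) \<subseteq> cocycles P i"
      proof (rule image_subsetI, rule cocyclesI)
        fix x assume x: "x \<in> carrier (obj P i)"
        then show "x \<oplus>\<^bsub>obj P i\<^esub> \<ominus>\<^bsub>obj P i\<^esub> s (diff P i x) \<in> carrier (obj P i)" using sc by simp
        have "diff P i x \<in> carrier (obj P (i + 1))" by (rule mod_homD(1)[OF dH x])
        then show "diff P i (x \<oplus>\<^bsub>obj P i\<^esub> \<ominus>\<^bsub>obj P i\<^esub> s (diff P i x)) = (zero (obj P (i + 1)))"
          using x sc mod_homD(2)[OF dH] mod_hom_map_neg[OF dH PM PM] by (simp add: M'.M.r_neg)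
      qed
    qed
    have "?Z i \<in> proj R"
    proof (rule proj_retract[OF Pp ZM mkn_hom_inc p])
      show "cocycles P i \<subseteq> carrier (obj P i)" by (auto simp: cocycles_carrier)
      fix x assume "x \<in> carrier (?Z i)"
      then have x: "x \<in> cocycles P i" by simp
      have "s (zero (obj P (i + 1))) = (zero (obj P i))" using mod_hom_zero[OF s(1) ZM PM] by simp
      then show "x \<oplus>\<^bsub>obj P i\<^esub> \<ominus>\<^bsub>obj P i\<^esub> s (diff P i x) = x"
        using x cocyclesD(2)[OF x] cocycles_carrier[OF x] PC by (simp add: mcpx_module)
    qed
    then show ?case unfolding i_def .
  qed
  have "?Z (m + 1 - int (nat (m + 1))) \<in> proj R" using m0 by (intro Zp) simp
  then have Z0: "?Z 0 \<in> proj R" using m0 by simp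
  \<comment> \<open>Ascent from degree - m, where the coboundaries vanish because \<open>P\<close>
    is zero one degree lower. Below degree 0 they coincide with the cocycles, the kernel of the next
    differential, so each degree adds one to the length.\<close>
  have Bf: "fres R k (?B (int k - m))" if "int k \<le> m" for k
    using that
  proof (induction k)
    case 0
    have "coboundaries P (- m) = {(zero (obj P (- m)))}"
      using m[of "- m - 1"] m0 cpx_diff_map(2)[OF PC, of "- m - 1"] by (simp add: coboundaries_def)
    then show ?case using BM[of "- m"] by (simp add: zero_proj)
  next
    case (Suc k)
    define i where "i = int k - m"
    have i: "i < 0" "int (Suc k) - m = i + 1" using Suc.prems by (simp_all add: i_def)
    have "coboundaries P i = {x \<in> carrier (obj P i). diff P i x = (zero (?B (i + 1)))}"
      using st(1)[of i] i(1) unfolding cocycles_def by simp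
    then have "fres R k (mkn (obj P i) {x \<in> carrier (obj P i). diff P i x = (zero (?B (i + 1)))})"
      using Suc by (simp add: i_def)
    then show ?case unfolding i(2) by (rule fres_SucI[OF BM Pp dB dBs])
  qed
  have "fres R (nat m) (?B (int (nat m) - m))" using m0 by (intro Bf) simp
  then have B0: "fres R (nat m) (?B 0)" using m0 by simp
  have qH: "q 0 \<in> mod_hom R (obj P 0) N"
    using chain_map_Hom[OF qisD(1)[OF q], of 0] by (simp add: stalk_def)
  have Zs: "cocycles P 0 \<subseteq> carrier (obj P 0)" by (auto simp: cocycles_carrier)
  have "q 0 \<in> mod_hom R (?Z 0) N" using mod_hom_comp[OF mkn_hom_inc[OF Zs] qH] .
  moreover have "q 0 ` carrier (?Z 0) = carrier N" using st(2) by simp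
  moreover have "mkn (?Z 0) {x \<in> carrier (?Z 0). q 0 x = (zero N)} = ?B 0" using st(3) by (simp add: mkn_def)
  ultimately have "fres R (Suc (nat m)) N" using B0 by (intro fres_SucI[OF NM Z0, of "q 0"]) (simp_all only:)
  then show ?thesis by blast
qed

end

section \<open>Perfectness of tensor products with C\<close>

context
  fixes R :: "('u::infinite, 'x) ring_scheme" and C :: "('u, 'u) bimodule"
  assumes C: "bimodule R C"
begin

interpretation C: bimodule R C by (rule C)

interpretation perf_cat "Mod_cat R :: ('u, ('u, 'u, unit) module_ext) concrete_cat" mbp mkn "proj R"
  by (rule perf_cat_Mod)

lemma truncate_sel [simp]:
  "carrier (module.truncate C) = carrier C" "(zero (module.truncate C)) = (zero C)"
  "x \<oplus>\<^bsub>module.truncate C\<^esub> y = x \<oplus>\<^bsub>C\<^esub> y" "x \<cdot>\<^bsub>module.truncate C\<^esub> r = x \<cdot>\<^bsub>C\<^esub> r"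
  by (simp_all add: module.defs)

lemma truncate_module: "right_module R (module.truncate C)"
  by (rule C.right_module_image[of _ "%x. x"]) simp_all

text \<open>Quantified over all tensor products because they are fixed up to isomorphism only. The
  property passes to sums and retracts, which leads from \<open>regular\<close> to all finitely
  generated projectives.\<close>

definition tfres :: "nat => ('u, 'u) module => bool"
  where "tfres n M \<longleftrightarrow> right_module R M \<and> (\<forall>T \<tau>. is_tensor R M C (T :: ('u, 'u) module) \<tau> --> fres R n T)"

lemma tfresD: "tfres n M ==> right_module R M" "tfres n M ==> is_tensor R M C (T :: ('u, 'u) module) \<tau> ==> fres R n T"
  by (simp_all add: tfres_def) blast

definition regular :: "('u, 'u) module"
  where "regular = \<lparr>carrier = carrier R, monoid.mult = undefined, one = undefined, zero = (zero R),
    add = add R, smult = (%r x. x \<otimes>\<^bsub>R\<^esub> r)\<rparr>"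

lemma regular_sel [simp]:
  "carrier regular = carrier R" "(zero regular) = (zero R)" "x \<oplus>\<^bsub>regular\<^esub> y = x \<oplus>\<^bsub>R\<^esub> y" "x \<cdot>\<^bsub>regular\<^esub> r = x \<otimes>\<^bsub>R\<^esub> r"
  by (simp_all add: regular_def)

lemma regular_module: "right_module R regular"
proof (rule right_moduleI)
  show "\<exists>y\<in>carrier regular. y \<oplus>\<^bsub>regular\<^esub> x = (zero regular)" if "x \<in> carrier regular" for x
    using that by (intro bexI[of _ "\<ominus>\<^bsub>R\<^esub> x"]) (simp_all add: C.R.l_neg)
qed (simp_all add: C.R.ring_axioms C.R.a_ac C.R.l_distr C.R.r_distr C.R.m_assoc)

text \<open>Multiplication and the map \<open>c -> \<tau> 1 c\<close> exhibit the tensor product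
  with the regular module as a retract of \<open>C\<close>.\<close>

lemma tfres_regular:
  assumes c: "fres R n (module.truncate C)"
  shows "tfres n regular"
  unfolding tfres_def
proof (intro conjI allI impI regular_module)
  fix T :: "('u, 'u) module" and \<tau> assume T: "is_tensor R regular C T \<tau>"
  note TM = tensorD(1)[OF T]
  obtain f where f: "f \<in> mod_hom R T (module.truncate C)" "\<forall>m\<in>carrier regular. \<forall>c\<in>carrier C. f (\<tau> m c) = m \<bullet>\<^bsub>C\<^esub> c"
  proof (rule tensor_universal_mod[OF C T regular_module truncate_module])
    show "balanced R regular C (module.truncate C) (%m c. m \<bullet>\<^bsub>C\<^esub> c)"
      by (rule balancedI) (simp_all add: C.lsmult_closed C.lsmult_add C.lsmult_add_scalar C.lsmult_assoc)
  qed (simp_all add: C.lsmult_rsmult)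
  have g: "(%c. \<tau> \<one>\<^bsub>R\<^esub> c) \<in> mod_hom R (module.truncate C) T"
    using balancedD[OF tensorD(2)[OF T]] tensorD(3)[OF T] by (intro mod_homI) simp_all
  have "\<tau> \<one>\<^bsub>R\<^esub> (f t) = t" if t: "t \<in> carrier T" for t
  proof (rule tensor_mod_hom_ext[OF C T regular_module TM mod_hom_comp[OF f(1) g] mod_hom_id _ t])
    fix m c assume m: "m \<in> carrier regular" and c: "c \<in> carrier C"
    have "\<tau> \<one>\<^bsub>R\<^esub> (m \<bullet>\<^bsub>C\<^esub> c) = \<tau> (\<one>\<^bsub>R\<^esub> \<cdot>\<^bsub>regular\<^esub> m) c"
      using balancedD(4)[OF tensorD(2)[OF T], of "\<one>\<^bsub>R\<^esub>" m c] m c by simp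
    then show "\<tau> \<one>\<^bsub>R\<^esub> (f (\<tau> m c)) = \<tau> m c" using f(2) m c by simp
  qed
  then show "fres R n T" by (rule fres_retract[OF c TM f(1) g])
qed

lemma tfres_retract:
  assumes N: "tfres n N" and M: "right_module R M" and i: "i \<in> mod_hom R M N" and p: "p \<in> mod_hom R N M"
    and pi: "!!x. x \<in> carrier M ==> p (i x) = x"
  shows "tfres n M"
  unfolding tfres_def
proof (intro conjI allI impI M)
  fix T :: "('u, 'u) module" and \<tau> assume T: "is_tensor R M C T \<tau>"
  note TM = tensorD(1)[OF T] and NM = tfresD(1)[OF N]
  obtain S :: "('u, 'u) module" and \<sigma> where S: "is_tensor R N C S \<sigma>" by (rule ex_tensor[OF NM C])
  obtain i' where i': "i' \<in> mod_hom R T S" "\<forall>m\<in>carrier M. \<forall>c\<in>carrier C. i' (\<tau> m c) = \<sigma> (i m) c"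
    by (rule tensor_map[OF C T S M NM i])
  obtain p' where p': "p' \<in> mod_hom R S T" "\<forall>m\<in>carrier N. \<forall>c\<in>carrier C. p' (\<sigma> m c) = \<tau> (p m) c"
    by (rule tensor_map[OF C S T NM M p])
  have "p' (i' t) = t" if t: "t \<in> carrier T" for t
    by (rule tensor_mod_hom_ext[OF C T M TM mod_hom_comp[OF i'(1) p'(1)] mod_hom_id _ t])
      (use i'(2) p'(2) mod_homD(1)[OF i] pi in simp)
  then show "fres R n T" by (rule fres_retract[OF tfresD(2)[OF N S] TM i'(1) p'(1)])
qed

lemma tensor_zero:
  assumes M: "right_module R M" and z: "carrier M = {(zero M)}" and T: "is_tensor R M C (T :: ('u, 'u) module) \<tau>"
  shows "carrier T = {(zero T)}"
proof -
  note TM = tensorD(1)[OF T]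
  interpret T: right_module R T by (rule TM)
  have "t = (zero T)" if t: "t \<in> carrier T" for t
    by (rule tensor_mod_hom_ext[OF C T M TM mod_hom_id mod_hom_const_zero[OF TM] _ t])
      (use z balanced_zero[OF M C right_module_group[OF TM] tensorD(2)[OF T]] in simp)
  then show ?thesis by auto
qed

lemma tfres_zero:
  assumes M: "right_module R M" and z: "carrier M = {(zero M)}"
  shows "tfres n M"
  unfolding tfres_def
proof (intro conjI allI impI M)
  fix T :: "('u, 'u) module" and \<tau> assume T: "is_tensor R M C T \<tau>"
  show "fres R n T" by (rule proj_fres[OF zero_proj[OF tensorD(1)[OF T] tensor_zero[OF M z T]]])
qed

lemma tfres_bp:
  assumes M: "tfres n M" and N: "tfres n N"
  shows "tfres n (mbp M N)"
  unfolding tfres_def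
proof (intro conjI allI impI)
  note MM = tfresD(1)[OF M] and NM = tfresD(1)[OF N]
  interpret M: right_module R M by (rule MM)
  interpret N: right_module R N by (rule NM)
  show B: "right_module R (mbp M N)" by (rule mbp_module[OF MM NM])
  fix T :: "('u, 'u) module" and \<tau> assume T: "is_tensor R (mbp M N) C T \<tau>"
  note TM = tensorD(1)[OF T]
  obtain U :: "('u, 'u) module" and \<upsilon> where U: "is_tensor R M C U \<upsilon>" by (rule ex_tensor[OF MM C])
  obtain V :: "('u, 'u) module" and \<nu> where V: "is_tensor R N C V \<nu>" by (rule ex_tensor[OF NM C])
  have j: "(%a. pr a (zero N)) \<in> mod_hom R M (mbp M N)" "(%b. pr (zero M) b) \<in> mod_hom R N (mbp M N)"
    by (rule mbp_hom[OF mod_hom_id mod_hom_const_zero[OF NM]], rule mbp_hom[OF mod_hom_const_zero[OF MM] mod_hom_id])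
  obtain t1 where t1: "t1 \<in> mod_hom R T U" "\<forall>m\<in>carrier (mbp M N). \<forall>c\<in>carrier C. t1 (\<tau> m c) = \<upsilon> (p1 m) c"
    by (rule tensor_map[OF C T U B MM p1_mod_hom])
  obtain t2 where t2: "t2 \<in> mod_hom R T V" "\<forall>m\<in>carrier (mbp M N). \<forall>c\<in>carrier C. t2 (\<tau> m c) = \<nu> (p2 m) c"
    by (rule tensor_map[OF C T V B NM p2_mod_hom])
  obtain s1 where s1: "s1 \<in> mod_hom R U T" "\<forall>m\<in>carrier M. \<forall>c\<in>carrier C. s1 (\<upsilon> m c) = \<tau> (pr m (zero N)) c"
    by (rule tensor_map[OF C U T MM B j(1)])
  obtain s2 where s2: "s2 \<in> mod_hom R V T" "\<forall>m\<in>carrier N. \<forall>c\<in>carrier C. s2 (\<nu> m c) = \<tau> (pr (zero M) m) c"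
    by (rule tensor_map[OF C V T NM B j(2)])
  have i: "(%x. pr (t1 x) (t2 x)) \<in> mod_hom R T (mbp U V)" by (rule mbp_hom[OF t1(1) t2(1)])
  have p: "(%z. s1 (p1 z) \<oplus>\<^bsub>T\<^esub> s2 (p2 z)) \<in> mod_hom R (mbp U V) T"
    by (rule mod_hom_add[OF mod_hom_comp[OF p1_mod_hom s1(1)] mod_hom_comp[OF p2_mod_hom s2(1)] TM])
  have "s1 (p1 (pr (t1 t) (t2 t))) \<oplus>\<^bsub>T\<^esub> s2 (p2 (pr (t1 t) (t2 t))) = t" if t: "t \<in> carrier T" for t
  proof (rule tensor_mod_hom_ext[OF C T B TM mod_hom_comp[OF i p] mod_hom_id _ t])
    fix m c assume m: "m \<in> carrier (mbp M N)" and c: "c \<in> carrier C"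
    obtain a b where ab: "m = pr a b" "a \<in> carrier M" "b \<in> carrier N" using m by auto
    have "\<tau> (pr a (zero N) \<oplus>\<^bsub>mbp M N\<^esub> pr (zero M) b) c = \<tau> (pr a (zero N)) c \<oplus>\<^bsub>T\<^esub> \<tau> (pr (zero M) b) c"
      using mod_homD(1)[OF j(1)] mod_homD(1)[OF j(2)] ab c by (intro balancedD(2)[OF tensorD(2)[OF T]])
    then have \<tau>m: "\<tau> m c = \<tau> (pr a (zero N)) c \<oplus>\<^bsub>T\<^esub> \<tau> (pr (zero M) b) c" using ab by simp
    have "t1 (\<tau> m c) = \<upsilon> a c" "t2 (\<tau> m c) = \<nu> b c"
      using bspec[OF bspec[OF t1(2) m] c] bspec[OF bspec[OF t2(2) m] c] ab(1) by simp_all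
    then have "s1 (t1 (\<tau> m c)) = \<tau> (pr a (zero N)) c" "s2 (t2 (\<tau> m c)) = \<tau> (pr (zero M) b) c"
      using s1(2) s2(2) c ab(2,3) by simp_all
    then show "s1 (p1 (pr (t1 (\<tau> m c)) (t2 (\<tau> m c)))) \<oplus>\<^bsub>T\<^esub> s2 (p2 (pr (t1 (\<tau> m c)) (t2 (\<tau> m c)))) = \<tau> m c"
      unfolding \<tau>m[symmetric] p1_pr p2_pr by (simp only: \<tau>m)
  qed
  then show "fres R n T"
    by (rule fres_retract[OF fres_bp[OF tfresD(2)[OF M U] tfresD(2)[OF N V]] TM i p])
qed

text \<open>A finitely generated projective module is a retract of a finite free one. The free
  module is built together with its map by induction on the generators, as an iterated
  biproduct.\<close>

lemma proj_tfres:
  assumes c: "fres R n (module.truncate C)" and Q: "Q \<in> proj R"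
  shows "tfres n Q"
proof -
  note QM = proj_module[OF Q]
  interpret Q: right_module R Q by (rule QM)
  obtain S where S: "finite S" "S \<subseteq> carrier Q" "!!H. Q.submod H ==> S \<subseteq> H ==> H = carrier Q"
  proof -
    have "fin_gen R Q" using Q by (simp add: proj_def)
    then show thesis using Q.fin_gen_iff that by blast
  qed
  have "\<exists>F f. tfres n F \<and> f \<in> mod_hom R F Q \<and> S \<subseteq> f ` carrier F"
    using S(1,2)
  proof (induction S rule: finite_induct)
    case empty
    let ?Z = "mkn Q {x \<in> carrier Q. x = (zero Q)}"
    have "right_module R ?Z" by (rule mkn_module[OF mod_hom_id QM QM])
    then have "tfres n ?Z" by (rule tfres_zero) auto
    then show ?case
      by (intro exI[of _ ?Z] exI[of _ "%x. (zero Q)"] conjI mod_hom_const_zero[OF QM] empty_subsetI)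
  next
    case (insert s S)
    obtain F f where F: "tfres n F" and f: "f \<in> mod_hom R F Q" "S \<subseteq> f ` carrier F"
      using insert.IH insert.prems by blast
    note FM = tfresD(1)[OF F]
    interpret F: right_module R F by (rule FM)
    have s: "s \<in> carrier Q" using insert by simp
    have "(%r. s \<cdot>\<^bsub>Q\<^esub> r) \<in> mod_hom R regular Q"
      using s by (intro mod_homI) (simp_all add: Q.rsmult_closed Q.rsmult_add_scalar Q.rsmult_assoc)
    then have g: "(%z. f (p1 z) \<oplus>\<^bsub>Q\<^esub> s \<cdot>\<^bsub>Q\<^esub> p2 z) \<in> mod_hom R (mbp F regular) Q"
      by (intro mod_hom_add mod_hom_comp[OF p1_mod_hom f(1)] mod_hom_comp[OF p2_mod_hom] QM)
    have "x \<in> (%z. f (p1 z) \<oplus>\<^bsub>Q\<^esub> s \<cdot>\<^bsub>Q\<^esub> p2 z) ` carrier (mbp F regular)" if "x \<in> insert s S" for x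
      using that
    proof
      assume "x = s"
      then show ?thesis using s mod_hom_zero[OF f(1) FM QM]
        by (intro image_eqI[of _ _ "pr (zero F) \<one>\<^bsub>R\<^esub>"]) (simp_all add: Q.rsmult_one)
    next
      assume "x \<in> S"
      then obtain a where a: "x = f a" "a \<in> carrier F" using f(2) by blast
      then show ?thesis using s mod_homD(1)[OF f(1) a(2)]
        by (intro image_eqI[of _ _ "pr a (zero R)"]) (simp_all add: Q.rsmult_zero_scalar)
    qed
    then show ?case using tfres_bp[OF F tfres_regular[OF c]] g by blast
  qed
  then obtain F f where F: "tfres n F" and f: "f \<in> mod_hom R F Q" "S \<subseteq> f ` carrier F" by blast
  note FM = tfresD(1)[OF F]
  have s: "f ` carrier F = carrier Q" by (rule S(3)[OF image_submod[OF f(1) FM QM] f(2)])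
  obtain h where "h \<in> mod_hom R Q F" "\<forall>x\<in>carrier Q. f (h x) = x"
    by (rule mod_hom_proj_lift[OF Q FM QM f(1) s mod_hom_id])
  then show ?thesis using tfres_retract[OF F QM _ f(1)] by blast
qed

text \<open>The terms of the tensor product have resolutions of the same length as \<open>C\<close>;
  this common bound is what \<open>bounded_fres_perf\<close> starts from.\<close>

lemma tens_perf:
  assumes C_Kb: "stalk (module.truncate C) \<in> Kb_proj R" and Q: "perf Q" and t: "tens R C Q T \<tau>"
  shows "\<exists>P q. perf P \<and> qis P T q"
proof -
  obtain n where n: "fres R n (module.truncate C)" using stalk_Kb_fres[OF C_Kb] by blast
  note T = tensD(1)[OF C t]
  have Qp: "obj Q i \<in> proj R" for i using Q by (simp add: perf_def)
  show ?thesis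
  proof (rule bounded_fres_perf[OF T])
    show "fres R n (obj T i)" for i by (rule tfresD(2)[OF proj_tfres[OF n Qp] tensD(2)[OF C t]])
    have "carrier (obj T i) = {(zero (obj T i))}" if "carrier (obj Q i) = {(zero (obj Q i))}" for i
      by (rule tensor_zero[OF proj_module[OF Qp] that tensD(2)[OF C t]])
    moreover have "finite {i. carrier (obj Q i) \<noteq> {(zero (obj Q i))}}" using Q by (simp add: perf_def bounded_cpx_def)
    ultimately show "bounded_cpx T" unfolding bounded_cpx_def by (elim rev_finite_subset) blast
  qed
qed

end

section \<open>Graded modules\<close>

lemma graded_module_right: "graded_module R G M ==> right_module R M"
  by (simp add: graded_module_def)

context graded_module
begin

lemma comp_carrier: "x \<in> component M i ==> x \<in> carrier M"
  by (rule additive_subgroup.a_Hcarr[OF component_subgroup])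

lemma comp_zero: "(zero M) \<in> component M i"
  by (rule additive_subgroup.zero_closed[OF component_subgroup])

lemma comp_add: "x \<in> component M i ==> y \<in> component M i ==> x \<oplus>\<^bsub>M\<^esub> y \<in> component M i"
  by (rule additive_subgroup.a_closed[OF component_subgroup])

lemma comp_neg: "x \<in> component M i ==> \<ominus>\<^bsub>M\<^esub> x \<in> component M i"
  using additive_subgroup.a_subgroup[OF component_subgroup, THEN subgroup.m_inv_closed, of x i]
  by (simp add: a_inv_def)

text \<open>The homogeneous component of degree i of \<open>m\<close>, read off from the unique
  decomposition.\<close>

definition hc where
  "hc i m = (THE f. (\<forall>i. f i \<in> component M i) \<and> finite {i. f i \<noteq> (zero M)} \<and> m = (\<Oplus>\<^bsub>M\<^esub>i\<in>{i. f i \<noteq> (zero M)}. f i)) i"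

lemma hc:
  assumes "m \<in> carrier M"
  shows "hc i m \<in> component M i" "finite {i. hc i m \<noteq> (zero M)}"
    "(\<Oplus>\<^bsub>M\<^esub>i\<in>{i. hc i m \<noteq> (zero M)}. hc i m) = m"
  using theI'[OF direct_sum[OF assms]] by (simp_all add: hc_def)

lemma finsum_support:
  assumes "finite S" "!!i. i \<notin> S ==> f i = (zero M)" "!!i. f i \<in> carrier M"
  shows "finsum M f {i. f i \<noteq> (zero M)} = finsum M f S"
  by (rule M.add.finprod_mono_neutral_cong_left) (use assms in auto)

lemma hc_unique:
  assumes f: "!!i. f i \<in> component M i" and S: "finite S" "!!i. i \<notin> S ==> f i = (zero M)"
    and m: "m = finsum M f S"
  shows "hc i m = f i"
proof -
  have fc: "!!i. f i \<in> carrier M" using f comp_carrier by blast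
  have mc: "m \<in> carrier M" unfolding m using fc by (intro M.finsum_closed) auto
  have "finite {i. f i \<noteq> (zero M)}" by (rule finite_subset[OF _ S(1)]) (use S(2) in auto)
  moreover have "m = (\<Oplus>\<^bsub>M\<^esub>i\<in>{i. f i \<noteq> (zero M)}. f i)" unfolding m using finsum_support[OF S fc] by simp
  ultimately have "(THE f. (\<forall>i. f i \<in> component M i) \<and> finite {i. f i \<noteq> (zero M)} \<and> m = (\<Oplus>\<^bsub>M\<^esub>i\<in>{i. f i \<noteq> (zero M)}. f i)) = f"
    using f by (intro the1_equality[OF direct_sum[OF mc]]) simp
  then show ?thesis by (simp add: hc_def)
qed

lemma hc_carrier: "m \<in> carrier M ==> hc i m \<in> carrier M"
  using hc(1) comp_carrier by blast

lemma hc_add: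
  assumes "m \<in> carrier M" "n \<in> carrier M"
  shows "hc i (m \<oplus>\<^bsub>M\<^esub> n) = hc i m \<oplus>\<^bsub>M\<^esub> hc i n"
proof (rule hc_unique)
  let ?S = "{i. hc i m \<noteq> (zero M)} \<union> {i. hc i n \<noteq> (zero M)}"
  show fS: "finite ?S" using hc(2)[OF assms(1)] hc(2)[OF assms(2)] by simp
  show "hc i m \<oplus>\<^bsub>M\<^esub> hc i n \<in> component M i" for i using hc(1) assms comp_add by simp
  show "hc i m \<oplus>\<^bsub>M\<^esub> hc i n = (zero M)" if "i \<notin> ?S" for i using that by simp
  have "m = finsum M (%i. hc i m) ?S" "n = finsum M (%i. hc i n) ?S"
    using finsum_support[OF fS, of "%i. hc i m"] finsum_support[OF fS, of "%i. hc i n"]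
      hc(3)[OF assms(1)] hc(3)[OF assms(2)] hc_carrier assms by simp_all
  moreover have "finsum M (%i. hc i m \<oplus>\<^bsub>M\<^esub> hc i n) ?S = finsum M (%i. hc i m) ?S \<oplus>\<^bsub>M\<^esub> finsum M (%i. hc i n) ?S"
    using hc_carrier assms by (intro M.finsum_addf) auto
  ultimately show "m \<oplus>\<^bsub>M\<^esub> n = finsum M (%i. hc i m \<oplus>\<^bsub>M\<^esub> hc i n) ?S" by simp
qed

lemma hc_homogeneous:
  assumes "m \<in> component M j"
  shows "hc i m = (if i = j then m else (zero M))"
proof (rule hc_unique[where S = "{j}"])
  show "(if i = j then m else (zero M)) \<in> component M i" for i using assms comp_zero by simp
  show "m = finsum M (%i. if i = j then m else (zero M)) {j}"
    using comp_carrier[OF assms] by (subst M.finsum_insert) auto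
qed auto

lemma hc_zero: "hc i (zero M) = (zero M)"
  using hc_homogeneous[OF comp_zero[of i], of i] by simp

lemma homogeneous_induct:
  assumes m: "m \<in> carrier M" and zero: "P (zero M)" and hom: "!!i x. x \<in> component M i ==> P x"
    and add: "!!x y. x \<in> carrier M ==> y \<in> carrier M ==> P x ==> P y ==> P (x \<oplus>\<^bsub>M\<^esub> y)"
  shows "P m"
proof -
  have "P (finsum M (%i. hc i m) S)" if "finite S" for S
    using that
  proof (induction S rule: finite_induct)
    case (insert a S)
    have c: "(%i. hc i m) \<in> S \<rightarrow> carrier M" "hc a m \<in> carrier M" using hc_carrier[OF m] by auto
    show ?case using insert c add[OF c(2) M.finsum_closed[OF c(1)] hom[OF hc(1)[OF m]]]
      by (simp add: M.finsum_insert)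
  qed (simp add: zero)
  from this[OF hc(2)[OF m]] show ?thesis unfolding hc(3)[OF m] .
qed

end

text \<open>The unique decomposition is replaced by a family \<open>q\<close> of additive
  projections, which is easier to supply: applying \<open>q j\<close> to any decomposition isolates
  its term of degree j and proves uniqueness.\<close>

lemma graded_moduleI:
  assumes M: "right_module R M"
    and c: "!!i x. x \<in> component M i ==> x \<in> carrier M"
    and z: "!!i. (zero M) \<in> component M i"
    and a: "!!i x y. x \<in> component M i ==> y \<in> component M i ==> x \<oplus>\<^bsub>M\<^esub> y \<in> component M i"
    and n: "!!i x. x \<in> component M i ==> \<ominus>\<^bsub>M\<^esub> x \<in> component M i"
    and s: "!!i j m r. m \<in> component M i ==> r \<in> G j ==> m \<cdot>\<^bsub>M\<^esub> r \<in> component M (i + j)"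
    and q: "!!i m. m \<in> carrier M ==> q i m \<in> component M i"
    and qa: "!!i m n. m \<in> carrier M ==> n \<in> carrier M ==> q i (m \<oplus>\<^bsub>M\<^esub> n) = q i m \<oplus>\<^bsub>M\<^esub> q i n"
    and qs: "!!m. m \<in> carrier M ==> \<exists>S. finite S \<and> (\<forall>i. i \<notin> S --> q i m = (zero M)) \<and> m = finsum M (%i. q i m) S"
    and qh: "!!i j m. m \<in> component M j ==> q i m = (if i = j then m else (zero M))"
  shows "graded_module R G M"
proof -
  interpret right_module R M by (rule M)
  have supp: "finsum M f {i. f i \<noteq> (zero M)} = finsum M f S"
    if "finite S" "!!i. i \<notin> S ==> f i = (zero M)" "!!i. f i \<in> carrier M" for f and S :: "int set"
    by (rule M.add.finprod_mono_neutral_cong_left) (use that in auto)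
  show ?thesis
  proof (intro graded_module.intro graded_module_axioms.intro M)
    fix i
    show "additive_subgroup (component M i) M"
    proof (intro additive_subgroup.intro M.add.subgroupI)
      show "component M i \<subseteq> carrier M" using c by blast
      show "component M i \<noteq> {}" using z by blast
    qed (use a n in auto)
  next
    fix m assume m: "m \<in> carrier M"
    obtain S where S: "finite S" "!!i. i \<notin> S ==> q i m = (zero M)" "m = finsum M (%i. q i m) S"
      using qs[OF m] by blast
    have qc: "q i m \<in> carrier M" for i using q[OF m] c by blast
    show "\<exists>!f. (\<forall>i. f i \<in> component M i) \<and> finite {i. f i \<noteq> (zero M)} \<and> m = (\<Oplus>\<^bsub>M\<^esub>i\<in>{i. f i \<noteq> (zero M)}. f i)"
    proof (rule ex1I[of _ "%i. q i m"], intro conjI allI)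
      show "q i m \<in> component M i" for i by (rule q[OF m])
      show "finite {i. q i m \<noteq> (zero M)}" by (rule finite_subset[OF _ S(1)]) (use S(2) in auto)
      show "m = (\<Oplus>\<^bsub>M\<^esub>i\<in>{i. q i m \<noteq> (zero M)}. q i m)" using supp[OF S(1,2) qc] S(3) by simp
      fix f assume f: "(\<forall>i. f i \<in> component M i) \<and> finite {i. f i \<noteq> (zero M)} \<and> m = (\<Oplus>\<^bsub>M\<^esub>i\<in>{i. f i \<noteq> (zero M)}. f i)"
      then have fc: "f i \<in> component M i" "f i \<in> carrier M" for i using c by blast+
      have "q j m = f j" for j
      proof -
        have qhom: "q j \<in> hom (add_monoid M) (add_monoid M)" using q c qa by (auto simp: hom_def)
        \<comment> \<open>The index j is added to the support so that the sum below, with a single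
          nonzero term at j, also covers the case that \<open>f j\<close> is zero.\<close>
        have "finsum M f {i. f i \<noteq> (zero M)} = finsum M f (insert j {i. f i \<noteq> (zero M)})"
          using f fc(2) by (intro supp) simp_all
        moreover have "m = finsum M f {i. f i \<noteq> (zero M)}" using f by (rule conjunct2[OF conjunct2])
        ultimately have "q j m = q j (finsum M f (insert j {i. f i \<noteq> (zero M)}))" by (simp only:)
        also have "\<dots> = finsum M (%i. q j (f i)) (insert j {i. f i \<noteq> (zero M)})"
          using f fc by (intro finsum_hom[OF M.abelian_group_axioms M.abelian_group_axioms qhom]) auto
        also have "\<dots> = finsum M (%i. if j = i then f i else (zero M)) (insert j {i. f i \<noteq> (zero M)})"
          using qh[OF fc(1)] fc(2) by (intro M.finsum_cong') auto
        also have "\<dots> = f j"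
          using f fc(2) by (intro M.finsum_singleton) auto
        finally show ?thesis .
      qed
      then show "f = (%i. q i m)" by (intro ext) simp
    qed
  qed (rule s)
qed

lemma gmod_homI:
  assumes "f \<in> mod_hom R M N" "!!i x. x \<in> component M i ==> f x \<in> component N i"
  shows "f \<in> gmod_hom R M N"
  using assms by (auto simp: gmod_hom_def)

lemma gmod_homD:
  assumes "f \<in> gmod_hom R M N"
  shows "f \<in> mod_hom R M N" "x \<in> component M i ==> f x \<in> component N i"
  using assms by (auto simp: gmod_hom_def)

lemma gmod_hom_hc:
  assumes f: "f \<in> gmod_hom R M N" and M: "graded_module R G M" and N: "graded_module R G N" and m: "m \<in> carrier M"
  shows "f (graded_module.hc M i m) = graded_module.hc N i (f m)"
proof -
  interpret M: graded_module R G M by (rule M)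
  interpret N: graded_module R G N by (rule N)
  note fm = gmod_homD(1)[OF f] and f0 = mod_hom_zero[OF gmod_homD(1)[OF f] M.right_module_axioms N.right_module_axioms]
  show ?thesis
  proof (rule M.homogeneous_induct[OF m])
    show "f (M.hc i (zero M)) = N.hc i (f (zero M))" by (simp add: M.hc_zero N.hc_zero f0)
    show "f (M.hc i x) = N.hc i (f x)" if "x \<in> component M j" for j x
      using M.hc_homogeneous[OF that] N.hc_homogeneous[OF gmod_homD(2)[OF f that]] f0 by simp
    show "f (M.hc i (x \<oplus>\<^bsub>M\<^esub> y)) = N.hc i (f (x \<oplus>\<^bsub>M\<^esub> y))"
      if "x \<in> carrier M" "y \<in> carrier M" "f (M.hc i x) = N.hc i (f x)" "f (M.hc i y) = N.hc i (f y)" for x y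
      using that mod_homD[OF fm] by (simp add: M.hc_add N.hc_add M.hc_carrier)
  qed
qed

section \<open>The category of graded modules\<close>

definition gbp :: "('r, 'u::infinite) gmodule => ('r, 'u) gmodule => ('r, 'u) gmodule"
  where "gbp M N = \<lparr>carrier = {pr a b | a b. a \<in> carrier M \<and> b \<in> carrier N},
    monoid.mult = undefined, one = undefined, zero = pr (zero M) (zero N),
    add = (%x y. pr (p1 x \<oplus>\<^bsub>M\<^esub> p1 y) (p2 x \<oplus>\<^bsub>N\<^esub> p2 y)),
    smult = (%r x. pr (p1 x \<cdot>\<^bsub>M\<^esub> r) (p2 x \<cdot>\<^bsub>N\<^esub> r)),
    component = (%i. {pr a b | a b. a \<in> component M i \<and> b \<in> component N i})\<rparr>"

definition gkn :: "('r, 'u) gmodule => 'u set => ('r, 'u) gmodule"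
  where "gkn M S = M\<lparr>carrier := S, component := (%i. component M i \<inter> S)\<rparr>"

lemma gbp_sel [simp]:
  "carrier (gbp M N) = {pr a b | a b. a \<in> carrier M \<and> b \<in> carrier N}"
  "(zero (gbp M N)) = pr (zero M) (zero N)"
  "x \<oplus>\<^bsub>gbp M N\<^esub> y = pr (p1 x \<oplus>\<^bsub>M\<^esub> p1 y) (p2 x \<oplus>\<^bsub>N\<^esub> p2 y)"
  "x \<cdot>\<^bsub>gbp M N\<^esub> r = pr (p1 x \<cdot>\<^bsub>M\<^esub> r) (p2 x \<cdot>\<^bsub>N\<^esub> r)"
  "component (gbp M N) i = {pr a b | a b. a \<in> component M i \<and> b \<in> component N i}"
  by (simp_all add: gbp_def)

lemma gkn_sel [simp]:
  "carrier (gkn M S) = S" "(zero (gkn M S)) = (zero M)" "x \<oplus>\<^bsub>gkn M S\<^esub> y = x \<oplus>\<^bsub>M\<^esub> y" "x \<cdot>\<^bsub>gkn M S\<^esub> r = x \<cdot>\<^bsub>M\<^esub> r"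
  "component (gkn M S) i = component M i \<inter> S"
  by (simp_all add: gkn_def)

lemma graded_module_gbp:
  assumes M: "graded_module R G M" and N: "graded_module R G N"
  shows "graded_module R G (gbp M N)"
proof -
  interpret M: graded_module R G M by (rule M)
  interpret N: graded_module R G N by (rule N)
  have B: "right_module R (gbp M N)"
    by (rule right_module_bp[OF M.right_module_axioms N.right_module_axioms]) simp_all
  interpret B: right_module R "gbp M N" by (rule B)
  have neg: "\<ominus>\<^bsub>gbp M N\<^esub> pr a b = pr (\<ominus>\<^bsub>M\<^esub> a) (\<ominus>\<^bsub>N\<^esub> b)" if "a \<in> carrier M" "b \<in> carrier N" for a b
    using that by (intro B.M.minus_equality) (simp_all add: M.M.l_neg N.M.l_neg)
  show ?thesis
  proof (rule graded_moduleI[OF B, of _ "%i z. pr (M.hc i (p1 z)) (N.hc i (p2 z))"])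
    show "x \<in> component (gbp M N) i ==> x \<in> carrier (gbp M N)" for i x
      using M.comp_carrier N.comp_carrier by auto
    show "\<ominus>\<^bsub>gbp M N\<^esub> x \<in> component (gbp M N) i" if x: "x \<in> component (gbp M N) i" for i x
    proof -
      obtain a b where "x = pr a b" "a \<in> component M i" "b \<in> component N i" using x by auto
      then show ?thesis using neg[of a b] M.comp_carrier N.comp_carrier M.comp_neg N.comp_neg by simp
    qed
    fix m assume m: "m \<in> carrier (gbp M N)"
    then obtain a b where ab: "m = pr a b" "a \<in> carrier M" "b \<in> carrier N" by auto
    let ?S = "{i. M.hc i a \<noteq> (zero M)} \<union> {i. N.hc i b \<noteq> (zero N)}" and ?g = "%i. pr (M.hc i a) (N.hc i b)"
    have fS: "finite ?S" using M.hc(2)[OF ab(2)] N.hc(2)[OF ab(3)] by simp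
    have g: "?g \<in> ?S \<rightarrow> carrier (gbp M N)" using M.hc_carrier[OF ab(2)] N.hc_carrier[OF ab(3)] by auto
    have p1: "p1 (finsum (gbp M N) ?g ?S) = finsum M (%i. p1 (?g i)) ?S"
      by (rule finsum_hom[OF B.M.abelian_group_axioms M.M.abelian_group_axioms _ fS g]) (auto simp: hom_def)
    have p2: "p2 (finsum (gbp M N) ?g ?S) = finsum N (%i. p2 (?g i)) ?S"
      by (rule finsum_hom[OF B.M.abelian_group_axioms N.M.abelian_group_axioms _ fS g]) (auto simp: hom_def)
    have "finsum M (%i. M.hc i a) ?S = a" "finsum N (%i. N.hc i b) ?S = b"
      using M.finsum_support[OF fS, of "%i. M.hc i a"] N.finsum_support[OF fS, of "%i. N.hc i b"]
        M.hc(3)[OF ab(2)] N.hc(3)[OF ab(3)] M.hc_carrier[OF ab(2)] N.hc_carrier[OF ab(3)] by simp_all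
    moreover have "finsum (gbp M N) ?g ?S \<in> carrier (gbp M N)" by (rule B.M.finsum_closed[OF g])
    ultimately have eq: "pr a b = finsum (gbp M N) ?g ?S" using p1 p2 by auto
    then show "\<exists>S. finite S \<and> (\<forall>i. i \<notin> S --> pr (M.hc i (p1 m)) (N.hc i (p2 m)) = (zero (gbp M N))) \<and>
        m = finsum (gbp M N) (%i. pr (M.hc i (p1 m)) (N.hc i (p2 m))) S"
      unfolding ab(1) p1_pr p2_pr
    proof (intro exI[of _ ?S] conjI fS eq allI impI)
      show "pr (M.hc i a) (N.hc i b) = (zero (gbp M N))" if "i \<notin> ?S" for i using that by simp
    qed
  qed (auto simp: M.comp_zero N.comp_zero M.comp_add N.comp_add M.component_rsmult N.component_rsmult
      M.hc N.hc M.hc_add N.hc_add M.hc_homogeneous N.hc_homogeneous)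
qed

text \<open>Graded homomorphisms commute with homogeneous components, so the components of an
  element of the kernel lie in the kernel.\<close>

lemma graded_module_gkn:
  assumes f: "f \<in> gmod_hom R M N" and M: "graded_module R G M" and N: "graded_module R G N"
    and GR: "!!j. G j \<subseteq> carrier R"
  shows "graded_module R G (gkn M {x \<in> carrier M. f x = (zero N)})"
proof -
  interpret M: graded_module R G M by (rule M)
  interpret N: graded_module R G N by (rule N)
  note fm = gmod_homD(1)[OF f]
  let ?K = "{x \<in> carrier M. f x = (zero N)}"
  have sub: "M.submod ?K" by (rule kernel_submod[OF fm M.right_module_axioms N.right_module_axioms])
  have K: "right_module R (gkn M ?K)" by (rule M.right_module_sub[OF sub]) simp_all
  interpret K: right_module R "gkn M ?K" by (rule K)
  have KM: "x \<in> carrier M" if "x \<in> ?K" for x using that by simp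
  have neg: "\<ominus>\<^bsub>gkn M ?K\<^esub> x = \<ominus>\<^bsub>M\<^esub> x" if "x \<in> ?K" for x
    using that M.submod_neg[OF sub that] by (intro K.M.minus_equality) (simp_all add: M.M.l_neg)
  have hcK: "M.hc i x \<in> ?K" if "x \<in> ?K" for i x
    using that M.hc_carrier gmod_hom_hc[OF f M N, of x i] by (simp add: N.hc_zero)
  show ?thesis
  proof (rule graded_moduleI[OF K, of _ M.hc])
    fix i x assume "x \<in> component (gkn M ?K) i"
    then have x: "x \<in> ?K" "x \<in> component M i" by simp_all
    show "x \<in> carrier (gkn M ?K)" using x by simp
    have "\<ominus>\<^bsub>gkn M ?K\<^esub> x = \<ominus>\<^bsub>M\<^esub> x" by (rule neg[OF x(1)])
    then show "\<ominus>\<^bsub>gkn M ?K\<^esub> x \<in> component (gkn M ?K) i"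
      using M.comp_neg[OF x(2)] M.submod_neg[OF sub x(1)] by simp
  next
    fix i show "(zero (gkn M ?K)) \<in> component (gkn M ?K) i" using sub by (simp add: M.comp_zero M.submod_def)
  next
    fix i x y assume "x \<in> component (gkn M ?K) i" "y \<in> component (gkn M ?K) i"
    then have x: "x \<in> ?K" "x \<in> component M i" "y \<in> ?K" "y \<in> component M i" by simp_all
    have "x \<oplus>\<^bsub>M\<^esub> y \<in> ?K" using sub x unfolding M.submod_def by blast
    then show "x \<oplus>\<^bsub>gkn M ?K\<^esub> y \<in> component (gkn M ?K) i" using M.comp_add[OF x(2,4)] by simp
  next
    fix i j m r assume "m \<in> component (gkn M ?K) i" and r: "r \<in> G j"
    then have m: "m \<in> ?K" "m \<in> component M i" by simp_all
    have "m \<cdot>\<^bsub>M\<^esub> r \<in> component M (i + j)" by (rule M.component_rsmult[OF m(2) r])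
    moreover have "f (m \<cdot>\<^bsub>M\<^esub> r) = (zero N)"
      using mod_homD(3)[OF fm, of m r] m GR[of j] r by (auto simp: N.rsmult_zero)
    ultimately show "m \<cdot>\<^bsub>gkn M ?K\<^esub> r \<in> component (gkn M ?K) (i + j)" using M.comp_carrier by simp
  next
    fix i m assume "m \<in> carrier (gkn M ?K)"
    then have m: "m \<in> ?K" by simp
    show "M.hc i m \<in> component (gkn M ?K) i" using M.hc(1)[OF KM[OF m]] hcK[OF m] by simp
  next
    fix m assume "m \<in> carrier (gkn M ?K)"
    then have m: "m \<in> ?K" by simp
    let ?S = "{i. M.hc i m \<noteq> (zero M)}"
    have "(%x. x) (finsum (gkn M ?K) (%i. M.hc i m) ?S) = finsum M (%i. M.hc i m) ?S"
      by (rule finsum_hom[OF K.M.abelian_group_axioms M.M.abelian_group_axioms _ M.hc(2)[OF KM[OF m]]])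
        (use hcK[OF m] in \<open>auto simp: hom_def\<close>)
    then have "m = finsum (gkn M ?K) (%i. M.hc i m) ?S" using M.hc(3)[OF KM[OF m]] by simp
    then show "\<exists>S. finite S \<and> (\<forall>i. i \<notin> S --> M.hc i m = (zero (gkn M ?K))) \<and> m = finsum (gkn M ?K) (%i. M.hc i m) S"
      using M.hc(2)[OF KM[OF m]] by (intro exI[of _ ?S]) simp
  qed (auto simp: M.hc_add M.hc_homogeneous)
qed

lemma Ob_GrMod_cat [simp]: "M \<in> Ob (GrMod_cat R G) \<longleftrightarrow> graded_module R G M"
  and Hom_GrMod_cat [simp]: "Hom (GrMod_cat R G) = gmod_hom R"
  by (simp_all add: GrMod_cat_def)

lemma mod_cat0_GrMod:
  fixes R :: "('r, 'x) ring_scheme"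
  assumes GR: "!!j. G j \<subseteq> carrier R"
  shows "mod_cat0 (GrMod_cat R G :: ('u, ('r, 'u, ('u, unit) gmodule_ext) module_ext) concrete_cat) gkn"
proof (rule mod_cat0.intro)
  fix M N :: "('r, 'u) gmodule" assume MN: "M \<in> Ob (GrMod_cat R G)" "N \<in> Ob (GrMod_cat R G)"
  then have M: "graded_module R G M" and N: "graded_module R G N" by simp_all
  show "(%x. (zero N)) \<in> Hom (GrMod_cat R G) M N" unfolding Hom_GrMod_cat
    by (intro gmod_homI mod_hom_const_zero graded_module_right[OF N] graded_module.comp_zero[OF N])
next
  fix M :: "('r, 'u) gmodule" assume "M \<in> Ob (GrMod_cat R G)"
  then show "abelian_group M" by (simp add: right_module_group[OF graded_module_right])
next
  fix f and M N :: "('r, 'u) gmodule" assume "f \<in> Hom (GrMod_cat R G) M N"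
    and "M \<in> Ob (GrMod_cat R G)" "N \<in> Ob (GrMod_cat R G)"
  then have f: "f \<in> gmod_hom R M N" and M: "graded_module R G M" and N: "graded_module R G N" by simp_all
  show "gkn M {x \<in> carrier M. f x = (zero N)} \<in> Ob (GrMod_cat R G)"
    unfolding Ob_GrMod_cat by (rule graded_module_gkn[OF f M N GR])
  show "(%x. \<ominus>\<^bsub>N\<^esub> f x) \<in> Hom (GrMod_cat R G) M N" unfolding Hom_GrMod_cat
    by (intro gmod_homI mod_hom_neg gmod_homD[OF f] graded_module_right[OF N] graded_module.comp_neg[OF N])
next
  fix f and M N :: "('r, 'u) gmodule" assume "f \<in> Hom (GrMod_cat R G) M N"
  then show "f \<in> hom (add_monoid M) (add_monoid N)" by (simp add: gmod_hom_def mod_hom_def)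
next
  fix f g and M N :: "('r, 'u) gmodule"
  assume "f \<in> Hom (GrMod_cat R G) M N" "M \<in> Ob (GrMod_cat R G)" and e: "!!x. x \<in> carrier M ==> g x = f x"
  then have f: "f \<in> gmod_hom R M N" and M: "graded_module R G M" by simp_all
  show "g \<in> Hom (GrMod_cat R G) M N" unfolding Hom_GrMod_cat
    using gmod_homD(2)[OF f] e[OF graded_module.comp_carrier[OF M]]
    by (intro gmod_homI mod_hom_cong[OF gmod_homD(1)[OF f] graded_module_right[OF M] e]) simp_all
next
  fix f g and L M N :: "('r, 'u) gmodule"
  assume "f \<in> Hom (GrMod_cat R G) L M" "g \<in> Hom (GrMod_cat R G) M N"
  then have f: "f \<in> gmod_hom R L M" and g: "g \<in> gmod_hom R M N" by simp_all
  show "(%x. g (f x)) \<in> Hom (GrMod_cat R G) L N" unfolding Hom_GrMod_cat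
    by (intro gmod_homI mod_hom_comp[OF gmod_homD(1)[OF f] gmod_homD(1)[OF g]] gmod_homD(2)[OF g] gmod_homD(2)[OF f])
next
  fix f g and M N :: "('r, 'u) gmodule"
  assume "f \<in> Hom (GrMod_cat R G) M N" "g \<in> Hom (GrMod_cat R G) M N" "N \<in> Ob (GrMod_cat R G)"
  then have f: "f \<in> gmod_hom R M N" and g: "g \<in> gmod_hom R M N" and N: "graded_module R G N" by simp_all
  show "(%x. f x \<oplus>\<^bsub>N\<^esub> g x) \<in> Hom (GrMod_cat R G) M N" unfolding Hom_GrMod_cat
    by (intro gmod_homI mod_hom_add gmod_homD[OF f] gmod_homD[OF g] graded_module_right[OF N] graded_module.comp_add[OF N])
next
  fix f and L M :: "('r, 'u) gmodule" and S
  assume "f \<in> Hom (GrMod_cat R G) L M" "L \<in> Ob (GrMod_cat R G)" and S: "f ` carrier L \<subseteq> S"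
  then have f: "f \<in> gmod_hom R L M" and L: "graded_module R G L" by simp_all
  show "f \<in> Hom (GrMod_cat R G) L (gkn M S)" unfolding Hom_GrMod_cat
    using mod_homD[OF gmod_homD(1)[OF f]] gmod_homD(2)[OF f] S graded_module.comp_carrier[OF L]
    by (intro gmod_homI mod_homI) auto
next
  fix M :: "('r, 'u) gmodule" and S assume "S \<subseteq> carrier M"
  then show "(%x. x) \<in> Hom (GrMod_cat R G) (gkn M S) M" unfolding Hom_GrMod_cat by (intro gmod_homI mod_homI) auto
next
  fix M :: "('r, 'u) gmodule" show "(%x. x) \<in> Hom (GrMod_cat R G) M M"
    by (simp add: gmod_homI mod_hom_id)
qed simp_all

lemma mod_cat_GrMod:
  fixes R :: "('r, 'x) ring_scheme"
  assumes GR: "!!j. G j \<subseteq> carrier R"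
  shows "mod_cat (GrMod_cat R G :: ('u::infinite, ('r, 'u, ('u, unit) gmodule_ext) module_ext) concrete_cat) gbp gkn"
proof (rule mod_cat.intro[OF mod_cat0_GrMod[OF GR] mod_cat_axioms.intro])
  fix M N :: "('r, 'u) gmodule" assume MN: "M \<in> Ob (GrMod_cat R G)" "N \<in> Ob (GrMod_cat R G)"
  then have M: "graded_module R G M" and N: "graded_module R G N" by simp_all
  show "gbp M N \<in> Ob (GrMod_cat R G)" unfolding Ob_GrMod_cat by (rule graded_module_gbp[OF M N])
  show "p1 \<in> Hom (GrMod_cat R G) (gbp M N) M" "p2 \<in> Hom (GrMod_cat R G) (gbp M N) N"
    unfolding Hom_GrMod_cat by (auto intro!: gmod_homI mod_homI)
next
  fix f g and L M N :: "('r, 'u) gmodule"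
  assume "f \<in> Hom (GrMod_cat R G) L M" "g \<in> Hom (GrMod_cat R G) L N"
  then have f: "f \<in> gmod_hom R L M" and g: "g \<in> gmod_hom R L N" by simp_all
  show "(%x. pr (f x) (g x)) \<in> Hom (GrMod_cat R G) L (gbp M N)"
    unfolding Hom_GrMod_cat using mod_homD[OF gmod_homD(1)[OF f]] mod_homD[OF gmod_homD(1)[OF g]]
      gmod_homD(2)[OF f] gmod_homD(2)[OF g] by (intro gmod_homI mod_homI) auto
qed simp_all

lemma perf_cat_GrMod:
  fixes R :: "('r, 'x) ring_scheme"
  assumes GR: "!!j. G j \<subseteq> carrier R"
  shows "perf_cat (GrMod_cat R G :: ('u::infinite, ('r, 'u, ('u, unit) gmodule_ext) module_ext) concrete_cat)
    gbp gkn (gr_proj R G)"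
proof -
  interpret mod_cat "GrMod_cat R G :: ('u, ('r, 'u, ('u, unit) gmodule_ext) module_ext) concrete_cat" gbp gkn
    by (rule mod_cat_GrMod[OF GR])
  show ?thesis
  proof
    fix P Q :: "('r, 'u) gmodule" assume PQ: "P \<in> gr_proj R G" "Q \<in> gr_proj R G"
    then have p: "projective (GrMod_cat R G) P" "projective (GrMod_cat R G) Q" and f: "fin_gen R P" "fin_gen R Q"
      by (simp_all add: gr_proj_def)
    have P: "graded_module R G P" and Q: "graded_module R G Q" using p projective_Ob by simp_all
    interpret P: graded_module R G P by (rule P)
    interpret Q: graded_module R G Q by (rule Q)
    have "fin_gen R (gbp P Q)"
    proof (rule fin_gen_bp[OF P.right_module_axioms Q.right_module_axioms
          graded_module_right[OF graded_module_gbp[OF P Q]] _ _ _ f])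
      show "(%a. pr a (zero Q)) \<in> mod_hom R P (gbp P Q)" "(%b. pr (zero P) b) \<in> mod_hom R Q (gbp P Q)"
        by (auto intro!: mod_homI simp: P.rsmult_zero Q.rsmult_zero)
      fix z assume "z \<in> carrier (gbp P Q)"
      then obtain a b where "z = pr a b" "a \<in> carrier P" "b \<in> carrier Q" by auto
      then show "\<exists>a\<in>carrier P. \<exists>b\<in>carrier Q. z = pr a (zero Q) \<oplus>\<^bsub>gbp P Q\<^esub> pr (zero P) b"
        by (intro bexI[of _ a] bexI[of _ b]) simp_all
    qed
    then show "gbp P Q \<in> gr_proj R G" unfolding gr_proj_def using projective_bp[OF p] by simp
  next
    fix P :: "('r, 'u) gmodule" assume P: "P \<in> Ob (GrMod_cat R G)" "carrier P = {(zero P)}"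
    then have "fin_gen R P" by (intro fin_gen_zero graded_module_right) simp_all
    then show "P \<in> gr_proj R G" using projective_zero[OF P] by (simp add: gr_proj_def)
  qed (simp add: gr_proj_def)
qed

text \<open>\<open>inflate\<close> placed in an arbitrary degree, since the induction in
  \<open>inflated_perf\<close> raises the degree.\<close>

definition infl :: "int => ('r, 'm, 'e) module_scheme => ('r \<times> 'c, 'm) gmodule"
  where "infl n M = (inflate M)\<lparr>component := (%i. if i = n then carrier M else {(zero M)})\<rparr>"

lemma infl_sel [simp]:
  "carrier (infl n M) = carrier M" "(zero (infl n M)) = (zero M)" "x \<oplus>\<^bsub>infl n M\<^esub> y = x \<oplus>\<^bsub>M\<^esub> y"
  "x \<cdot>\<^bsub>infl n M\<^esub> a = x \<cdot>\<^bsub>M\<^esub> fst a" "component (infl n M) i = (if i = n then carrier M else {(zero M)})"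
  by (simp_all add: infl_def inflate_def split: prod.split)

lemma infl_0: "infl 0 M = inflate M"
  by (simp add: infl_def inflate_def)

text \<open>The part of degree \<open>j\<close>, restricted along \<open>r \<mapsto> (r, 0)\<close>.\<close>

definition deg_part :: "('r, 'c, 'f) bimodule_scheme => ('r \<times> 'c, 'u) gmodule => int => ('r, 'u) module"
  where "deg_part C M j = \<lparr>carrier = component M j, monoid.mult = undefined, one = undefined,
    zero = (zero M), add = add M, smult = (%r m. m \<cdot>\<^bsub>M\<^esub> (r, (zero C)))\<rparr>"

lemma deg_part_sel [simp]:
  "carrier (deg_part C M j) = component M j" "(zero (deg_part C M j)) = (zero M)"
  "x \<oplus>\<^bsub>deg_part C M j\<^esub> y = x \<oplus>\<^bsub>M\<^esub> y" "x \<cdot>\<^bsub>deg_part C M j\<^esub> r = x \<cdot>\<^bsub>M\<^esub> (r, (zero C))"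
  by (simp_all add: deg_part_def)

text \<open>The module induced from \<open>Q\<close> along the inclusion of \<open>R\<close> into
  \<open>A\<close>: \<open>Q\<close> in degree n plus its tensor product \<open>T\<close> with
  \<open>C\<close> in degree n + 1. An element of \<open>C\<close> carries \<open>Q\<close> into
  \<open>T\<close> by \<open>\<tau>\<close> and annihilates \<open>T\<close>.\<close>

definition ext_mod :: "('u::infinite, 'u, 'f) bimodule_scheme => ('u, 'u) module => ('u, 'u) module =>
    ('u => 'u => 'u) => int => ('u \<times> 'u, 'u) gmodule"
  where "ext_mod C Q T \<tau> n = \<lparr>carrier = {pr q t | q t. q \<in> carrier Q \<and> t \<in> carrier T},
    monoid.mult = undefined, one = undefined, zero = pr (zero Q) (zero T),
    add = (%x y. pr (p1 x \<oplus>\<^bsub>Q\<^esub> p1 y) (p2 x \<oplus>\<^bsub>T\<^esub> p2 y)),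
    smult = (%a z. pr (p1 z \<cdot>\<^bsub>Q\<^esub> fst a) (\<tau> (p1 z) (snd a) \<oplus>\<^bsub>T\<^esub> p2 z \<cdot>\<^bsub>T\<^esub> fst a)),
    component = (%i. if i = n then {pr q (zero T) | q. q \<in> carrier Q}
      else if i = n + 1 then {pr (zero Q) t | t. t \<in> carrier T} else {pr (zero Q) (zero T)})\<rparr>"

lemma ext_mod_sel [simp]:
  "carrier (ext_mod C Q T \<tau> n) = {pr q t | q t. q \<in> carrier Q \<and> t \<in> carrier T}"
  "(zero (ext_mod C Q T \<tau> n)) = pr (zero Q) (zero T)"
  "x \<oplus>\<^bsub>ext_mod C Q T \<tau> n\<^esub> y = pr (p1 x \<oplus>\<^bsub>Q\<^esub> p1 y) (p2 x \<oplus>\<^bsub>T\<^esub> p2 y)"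
  "z \<cdot>\<^bsub>ext_mod C Q T \<tau> n\<^esub> a = pr (p1 z \<cdot>\<^bsub>Q\<^esub> fst a) (\<tau> (p1 z) (snd a) \<oplus>\<^bsub>T\<^esub> p2 z \<cdot>\<^bsub>T\<^esub> fst a)"
  "component (ext_mod C Q T \<tau> n) i = (if i = n then {pr q (zero T) | q. q \<in> carrier Q}
      else if i = n + 1 then {pr (zero Q) t | t. t \<in> carrier T} else {pr (zero Q) (zero T)})"
  by (simp_all add: ext_mod_def)

lemma trivial_ext_sel [simp]:
  "carrier (trivial_ext R C) = carrier R \<times> carrier C"
  "\<one>\<^bsub>trivial_ext R C\<^esub> = (\<one>\<^bsub>R\<^esub>, (zero C))" "(zero (trivial_ext R C)) = ((zero R), (zero C))"
  "a \<oplus>\<^bsub>trivial_ext R C\<^esub> b = (fst a \<oplus>\<^bsub>R\<^esub> fst b, snd a \<oplus>\<^bsub>C\<^esub> snd b)"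
  "a \<otimes>\<^bsub>trivial_ext R C\<^esub> b = (fst a \<otimes>\<^bsub>R\<^esub> fst b, fst a \<bullet>\<^bsub>C\<^esub> snd b \<oplus>\<^bsub>C\<^esub> snd a \<cdot>\<^bsub>C\<^esub> fst b)"
  by (simp_all add: trivial_ext_def split: prod.split)

lemma (in bimodule) lsmult_zero: "r \<in> carrier R ==> r \<bullet>\<^bsub>C\<^esub> (zero C) = (zero C)"
  using lsmult_add[of r "(zero C)" "(zero C)"] lsmult_closed[of r "(zero C)"] by simp

lemma (in bimodule) lsmult_zero_scalar: "c \<in> carrier C ==> (zero R) \<bullet>\<^bsub>C\<^esub> c = (zero C)"
  using lsmult_add_scalar[of "(zero R)" "(zero R)" c] lsmult_closed[of "(zero R)" c] by simp

section \<open>Graded modules over the trivial extension\<close>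

locale triv_ext = C: bimodule R C for R :: "('u::infinite, 'x) ring_scheme" and C :: "('u, 'u) bimodule"
begin

lemmas C = C.bimodule_axioms

abbreviation "A \<equiv> trivial_ext R C"
abbreviation "G \<equiv> trivial_ext_grading R C"

lemma GA: "G j \<subseteq> carrier A"
  by (auto simp: trivial_ext_grading_def)

lemma ring_A: "ring A"
proof (rule ringI)
  show "abelian_group A"
  proof (rule abelian_groupI)
    show "\<exists>y\<in>carrier A. y \<oplus>\<^bsub>A\<^esub> x = (zero A)" if "x \<in> carrier A" for x
      using that by (intro bexI[of _ "(\<ominus>\<^bsub>R\<^esub> fst x, \<ominus>\<^bsub>C\<^esub> snd x)"]) (auto simp: C.R.l_neg C.M.l_neg)
  qed (auto simp: C.R.a_ac C.M.a_ac)
  show "monoid A"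
    by (rule monoidI) (auto simp: C.R.m_assoc C.lsmult_closed C.rsmult_closed C.lsmult_add C.rsmult_add
        C.lsmult_assoc C.rsmult_assoc C.lsmult_rsmult C.M.a_assoc C.lsmult_one C.rsmult_one
        C.lsmult_zero C.rsmult_zero)
qed (auto simp: C.R.l_distr C.R.r_distr C.lsmult_closed C.rsmult_closed C.lsmult_add C.rsmult_add
    C.lsmult_add_scalar C.rsmult_add_scalar C.M.a_ac)

context
  fixes M :: "('u \<times> 'u, 'v) gmodule"
  assumes M: "graded_module A G M"
begin

interpretation M: graded_module A G M by (rule M)

lemma deg0_closed: "m \<in> component M j ==> r \<in> carrier R ==> m \<cdot>\<^bsub>M\<^esub> (r, (zero C)) \<in> component M j"
  using M.component_rsmult[of m j "(r, (zero C))" 0] by (simp add: trivial_ext_grading_def)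

lemma deg1_closed: "m \<in> component M j ==> c \<in> carrier C ==> m \<cdot>\<^bsub>M\<^esub> ((zero R), c) \<in> component M (j + 1)"
  using M.component_rsmult[of m j "((zero R), c)" 1] by (simp add: trivial_ext_grading_def)

lemma split_smult:
  assumes "m \<in> carrier M" "r \<in> carrier R" "c \<in> carrier C"
  shows "m \<cdot>\<^bsub>M\<^esub> (r, c) = m \<cdot>\<^bsub>M\<^esub> (r, (zero C)) \<oplus>\<^bsub>M\<^esub> m \<cdot>\<^bsub>M\<^esub> ((zero R), c)"
  using M.rsmult_add_scalar[of m "(r, (zero C))" "((zero R), c)"] assms by simp

text \<open>\<open>C\<close> has degree 1, so the component of degree j receives \<open>r\<close>
  from degree j and \<open>c\<close> from degree j - 1.\<close>

lemma hc_smult: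
  assumes m: "m \<in> carrier M" and r: "r \<in> carrier R" and c: "c \<in> carrier C"
  shows "M.hc j (m \<cdot>\<^bsub>M\<^esub> (r, c)) = M.hc j m \<cdot>\<^bsub>M\<^esub> (r, (zero C)) \<oplus>\<^bsub>M\<^esub> M.hc (j - 1) m \<cdot>\<^bsub>M\<^esub> ((zero R), c)"
proof -
  have rc: "(r, c) \<in> carrier A" "(r, (zero C)) \<in> carrier A" "((zero R), c) \<in> carrier A" using r c by simp_all
  show ?thesis
  proof (rule M.homogeneous_induct[OF m])
    show "M.hc j ((zero M) \<cdot>\<^bsub>M\<^esub> (r, c)) = M.hc j (zero M) \<cdot>\<^bsub>M\<^esub> (r, (zero C)) \<oplus>\<^bsub>M\<^esub> M.hc (j - 1) (zero M) \<cdot>\<^bsub>M\<^esub> ((zero R), c)"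
      using rc by (simp add: M.hc_zero M.rsmult_zero)
  next
    fix i x assume x: "x \<in> component M i"
    note xc = M.comp_carrier[OF x] and x0 = deg0_closed[OF x r] and x1 = deg1_closed[OF x c]
    show "M.hc j (x \<cdot>\<^bsub>M\<^esub> (r, c)) = M.hc j x \<cdot>\<^bsub>M\<^esub> (r, (zero C)) \<oplus>\<^bsub>M\<^esub> M.hc (j - 1) x \<cdot>\<^bsub>M\<^esub> ((zero R), c)"
      unfolding split_smult[OF xc r c] M.hc_add[OF M.comp_carrier[OF x0] M.comp_carrier[OF x1]]
        M.hc_homogeneous[OF x0] M.hc_homogeneous[OF x1] M.hc_homogeneous[OF x]
      using rc by (auto simp: M.rsmult_zero)
  next
    fix x y assume x: "x \<in> carrier M" and y: "y \<in> carrier M"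
      and IH: "M.hc j (x \<cdot>\<^bsub>M\<^esub> (r, c)) = M.hc j x \<cdot>\<^bsub>M\<^esub> (r, (zero C)) \<oplus>\<^bsub>M\<^esub> M.hc (j - 1) x \<cdot>\<^bsub>M\<^esub> ((zero R), c)"
       "M.hc j (y \<cdot>\<^bsub>M\<^esub> (r, c)) = M.hc j y \<cdot>\<^bsub>M\<^esub> (r, (zero C)) \<oplus>\<^bsub>M\<^esub> M.hc (j - 1) y \<cdot>\<^bsub>M\<^esub> ((zero R), c)"
    show "M.hc j ((x \<oplus>\<^bsub>M\<^esub> y) \<cdot>\<^bsub>M\<^esub> (r, c)) = M.hc j (x \<oplus>\<^bsub>M\<^esub> y) \<cdot>\<^bsub>M\<^esub> (r, (zero C)) \<oplus>\<^bsub>M\<^esub> M.hc (j - 1) (x \<oplus>\<^bsub>M\<^esub> y) \<cdot>\<^bsub>M\<^esub> ((zero R), c)"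
      using x y rc IH by (simp add: M.rsmult_add M.hc_add M.hc_carrier M.rsmult_closed M.M.a_ac)
  qed
qed

lemma deg_part_module: "right_module R (deg_part C M j)"
proof (rule right_moduleI)
  show "\<exists>y\<in>carrier (deg_part C M j). y \<oplus>\<^bsub>deg_part C M j\<^esub> x = (zero (deg_part C M j))"
    if "x \<in> carrier (deg_part C M j)" for x
    using that M.comp_neg M.comp_carrier by (intro bexI[of _ "\<ominus>\<^bsub>M\<^esub> x"]) (simp_all add: M.M.l_neg)
next
  fix m r s assume "m \<in> carrier (deg_part C M j)" and r: "r \<in> carrier R" "s \<in> carrier R"
  then have m: "m \<in> carrier M" using M.comp_carrier by simp
  show "m \<cdot>\<^bsub>deg_part C M j\<^esub> (r \<oplus>\<^bsub>R\<^esub> s) = m \<cdot>\<^bsub>deg_part C M j\<^esub> r \<oplus>\<^bsub>deg_part C M j\<^esub> m \<cdot>\<^bsub>deg_part C M j\<^esub> s"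
    using M.rsmult_add_scalar[OF m, of "(r, (zero C))" "(s, (zero C))"] r by simp
  show "m \<cdot>\<^bsub>deg_part C M j\<^esub> (r \<otimes>\<^bsub>R\<^esub> s) = (m \<cdot>\<^bsub>deg_part C M j\<^esub> r) \<cdot>\<^bsub>deg_part C M j\<^esub> s"
    using M.rsmult_assoc[OF m, of "(r, (zero C))" "(s, (zero C))"] r by (simp add: C.lsmult_zero C.rsmult_zero)
next
  fix m n r assume "m \<in> carrier (deg_part C M j)" "n \<in> carrier (deg_part C M j)" and r: "r \<in> carrier R"
  then show "(m \<oplus>\<^bsub>deg_part C M j\<^esub> n) \<cdot>\<^bsub>deg_part C M j\<^esub> r = m \<cdot>\<^bsub>deg_part C M j\<^esub> r \<oplus>\<^bsub>deg_part C M j\<^esub> n \<cdot>\<^bsub>deg_part C M j\<^esub> r"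
    using M.rsmult_add[of m n "(r, (zero C))"] M.comp_carrier by simp
next
  fix x y assume "x \<in> carrier (deg_part C M j)" "y \<in> carrier (deg_part C M j)"
  then show "x \<oplus>\<^bsub>deg_part C M j\<^esub> y = y \<oplus>\<^bsub>deg_part C M j\<^esub> x" using M.M.a_comm M.comp_carrier by simp
next
  fix m assume "m \<in> carrier (deg_part C M j)"
  then show "m \<cdot>\<^bsub>deg_part C M j\<^esub> \<one>\<^bsub>R\<^esub> = m" using M.rsmult_one[of m] M.comp_carrier by simp
qed (use M.comp_carrier in \<open>simp_all add: C.R.ring_axioms M.comp_add M.comp_zero M.M.a_assoc deg0_closed\<close>)

end

lemma deg_part_hom: "f \<in> gmod_hom A M N ==> graded_module A G M ==> f \<in> mod_hom R (deg_part C M j) (deg_part C N j)"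
  using mod_homD[OF gmod_homD(1), of f A M N] gmod_homD(2)[of f A M N] graded_module.comp_carrier[of A G M]
  by (intro mod_homI) simp_all

lemma infl_module:
  assumes M: "right_module R M"
  shows "right_module A (infl n M)"
proof -
  interpret M: right_module R M by (rule M)
  show ?thesis
  proof (rule right_moduleI)
    show "\<exists>y\<in>carrier (infl n M). y \<oplus>\<^bsub>infl n M\<^esub> x = (zero (infl n M))" if "x \<in> carrier (infl n M)" for x
      using that by (intro bexI[of _ "\<ominus>\<^bsub>M\<^esub> x"]) (simp_all add: M.M.l_neg)
  next
    fix x y assume "x \<in> carrier (infl n M)" "y \<in> carrier (infl n M)"
    then show "x \<oplus>\<^bsub>infl n M\<^esub> y = y \<oplus>\<^bsub>infl n M\<^esub> x" using M.M.a_comm by simp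
  qed (auto simp: ring_A M.M.a_assoc M.rsmult_closed M.rsmult_add M.rsmult_add_scalar M.rsmult_assoc M.rsmult_one)
qed

lemma infl_graded:
  fixes M :: "('u, 'v, 'e) module_scheme"
  assumes M: "right_module R M"
  shows "graded_module A G (infl n M)"
proof -
  interpret M: right_module R M by (rule M)
  interpret I: right_module A "infl n M" by (rule infl_module[OF M])
  let ?I = "infl n M :: ('u \<times> 'u, 'v) gmodule"
  have neg: "\<ominus>\<^bsub>?I\<^esub> x = \<ominus>\<^bsub>M\<^esub> x" if "x \<in> carrier M" for x
    using that by (intro I.M.minus_equality) (simp_all add: M.M.l_neg)
  have nz: "\<ominus>\<^bsub>?I\<^esub> (zero M) = (zero M)" by (intro I.M.minus_equality) simp_all
  show ?thesis
  proof (rule graded_moduleI[OF infl_module[OF M], where q = "%i m. if i = n then m else (zero M)"])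
    show "\<ominus>\<^bsub>?I\<^esub> x \<in> component (?I) i" if "x \<in> component (?I) i" for i x
      using that neg nz by (auto split: if_splits)
    show "m \<cdot>\<^bsub>?I\<^esub> r \<in> component (?I) (i + j)" if "m \<in> component (?I) i" "r \<in> G j" for i j m r
      using that by (auto simp: trivial_ext_grading_def M.rsmult_closed M.rsmult_zero M.rsmult_zero_scalar split: if_splits)
    show "\<exists>S. finite S \<and> (\<forall>i. i \<notin> S --> (if i = n then m else (zero M)) = (zero ?I)) \<and>
        m = finsum (?I) (%i. if i = n then m else (zero M)) S" if "m \<in> carrier (?I)" for m
      using that I.M.finsum_insert[of "{}" n "%i. if i = n then m else (zero M)"]
      by (intro exI[of _ "{n}"]) simp
  qed (auto split: if_splits)
qed

lemma infl_hom:
  assumes f: "f \<in> mod_hom R M N" and M: "right_module R M" and N: "right_module R N"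
  shows "f \<in> gmod_hom A (infl n M) (infl n N)"
  using mod_homD[OF f] mod_hom_zero[OF f M N] by (intro gmod_homI mod_homI) (auto split: if_splits)

end

section \<open>Induced modules\<close>

context triv_ext begin

context
  fixes Q T :: "('u, 'u) module" and \<tau> and n :: int
  assumes Q: "right_module R Q" and T: "is_tensor R Q C T \<tau>"
begin

interpretation Q: right_module R Q by (rule Q)
interpretation T: right_module R T by (rule tensorD(1)[OF T])

abbreviation (input) "E \<equiv> ext_mod C Q T \<tau> n"

lemmas \<tau>D = balancedD[OF tensorD(2)[OF T]]
lemmas \<tau>0 = balanced_zero[OF Q C T.M.abelian_group_axioms tensorD(2)[OF T]]

lemma \<tau>_zero_right: "q \<in> carrier Q ==> \<tau> q (zero C) = (zero T)"
  using \<tau>D(3)[of q "(zero C)" "(zero C)"] \<tau>D(1)[of q "(zero C)"] by simp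

lemma ext_mod_module: "right_module A E"
proof (rule right_moduleI)
  show "\<exists>y\<in>carrier E. y \<oplus>\<^bsub>E\<^esub> x = (zero E)" if x: "x \<in> carrier E" for x
  proof -
    obtain q t where "x = pr q t" "q \<in> carrier Q" "t \<in> carrier T" using x by auto
    then show ?thesis by (intro bexI[of _ "pr (\<ominus>\<^bsub>Q\<^esub> q) (\<ominus>\<^bsub>T\<^esub> t)"]) (simp_all add: Q.M.l_neg T.M.l_neg)
  qed
  show "x \<oplus>\<^bsub>E\<^esub> y = y \<oplus>\<^bsub>E\<^esub> x" if "x \<in> carrier E" "y \<in> carrier E" for x y
    using that Q.M.a_comm T.M.a_comm by auto
  fix m r assume "m \<in> carrier E" "r \<in> carrier A"
  then obtain q t a c where m: "m = pr q t" "q \<in> carrier Q" "t \<in> carrier T" and r: "r = (a, c)" "a \<in> carrier R" "c \<in> carrier C"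
    by auto
  show "m \<cdot>\<^bsub>E\<^esub> r \<in> carrier E" using m r by (simp add: \<tau>D Q.rsmult_closed T.rsmult_closed)
  show "(m \<oplus>\<^bsub>E\<^esub> n) \<cdot>\<^bsub>E\<^esub> r = m \<cdot>\<^bsub>E\<^esub> r \<oplus>\<^bsub>E\<^esub> n \<cdot>\<^bsub>E\<^esub> r" if "n \<in> carrier E" for n
    using that m r by (auto simp: \<tau>D Q.rsmult_closed T.rsmult_closed Q.rsmult_add T.rsmult_add T.M.a_ac)
  fix s assume "s \<in> carrier A"
  then obtain b d where s: "s = (b, d)" "b \<in> carrier R" "d \<in> carrier C" by auto
  show "m \<cdot>\<^bsub>E\<^esub> (r \<oplus>\<^bsub>A\<^esub> s) = m \<cdot>\<^bsub>E\<^esub> r \<oplus>\<^bsub>E\<^esub> m \<cdot>\<^bsub>E\<^esub> s"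
    using m r s by (simp add: \<tau>D T.rsmult_closed Q.rsmult_add_scalar T.rsmult_add_scalar T.M.a_ac)
  show "m \<cdot>\<^bsub>E\<^esub> (r \<otimes>\<^bsub>A\<^esub> s) = (m \<cdot>\<^bsub>E\<^esub> r) \<cdot>\<^bsub>E\<^esub> s"
    using m r s by (simp add: \<tau>D T.rsmult_closed Q.rsmult_closed Q.rsmult_assoc T.rsmult_assoc T.M.a_ac
        C.lsmult_closed C.rsmult_closed T.rsmult_add tensorD(3)[OF T])
qed (auto simp: ring_A Q.M.a_assoc T.M.a_assoc Q.rsmult_one T.rsmult_one \<tau>_zero_right)

interpretation E: right_module A E by (rule ext_mod_module)

lemma ext_mod_graded: "graded_module A G E"
proof -
  have neg: "\<ominus>\<^bsub>E\<^esub> pr q t = pr (\<ominus>\<^bsub>Q\<^esub> q) (\<ominus>\<^bsub>T\<^esub> t)" if "q \<in> carrier Q" "t \<in> carrier T" for q t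
    using that by (intro E.M.minus_equality) (simp_all add: Q.M.l_neg T.M.l_neg)
  have nz: "\<ominus>\<^bsub>Q\<^esub> (zero Q) = (zero Q)" "\<ominus>\<^bsub>T\<^esub> (zero T) = (zero T)" by (intro Q.M.minus_equality T.M.minus_equality; simp)+
  let ?q = "%i z. if i = n then pr (p1 z) (zero T) else if i = n + 1 then pr (zero Q) (p2 z) else pr (zero Q) (zero T)"
  show ?thesis
  proof (rule graded_moduleI[OF ext_mod_module, where q = ?q])
    show "\<ominus>\<^bsub>E\<^esub> x \<in> component E i" if "x \<in> component E i" for i x
      using that neg nz by (auto split: if_splits)
    show "m \<cdot>\<^bsub>E\<^esub> r \<in> component E (i + j)" if "m \<in> component E i" "r \<in> G j" for i j m r
      using that by (auto simp: trivial_ext_grading_def Q.rsmult_closed T.rsmult_closed \<tau>D(1) \<tau>0 \<tau>_zero_right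
          Q.rsmult_zero T.rsmult_zero Q.rsmult_zero_scalar T.rsmult_zero_scalar split: if_splits)
    fix m assume m: "m \<in> carrier E"
    then obtain q t where qt: "m = pr q t" "q \<in> carrier Q" "t \<in> carrier T" by auto
    have "finsum E (%i. ?q i m) {n, n + 1} = ?q n m \<oplus>\<^bsub>E\<^esub> (?q (n + 1) m \<oplus>\<^bsub>E\<^esub> (zero E))"
    proof -
      have 1: "(%i. ?q i m) \<in> {n + 1} \<rightarrow> carrier E" "?q n m \<in> carrier E" "?q (n + 1) m \<in> carrier E" using qt by auto
      have 2: "finsum E (%i. ?q i m) {n + 1} = ?q (n + 1) m \<oplus>\<^bsub>E\<^esub> (zero E)"
        using E.M.finsum_insert[of "{}" "n + 1" "%i. ?q i m"] 1(3) by simp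
      show ?thesis using E.M.finsum_insert[of "{n + 1}" n "%i. ?q i m"] 1 unfolding 2 by simp
    qed
    then have "m = finsum E (%i. ?q i m) {n, n + 1}" using qt by simp
    then show "\<exists>S. finite S \<and> (\<forall>i. i \<notin> S --> ?q i m = (zero E)) \<and> m = finsum E (%i. ?q i m) S"
      by (intro exI[of _ "{n, n + 1}"] conjI) simp_all
  qed (auto split: if_splits)
qed

lemma ext_mod_p1: "p1 \<in> gmod_hom A E (infl n Q)"
  by (intro gmod_homI mod_homI) (auto split: if_splits)

lemma ext_mod_in2: "(%t. pr (zero Q) t) \<in> gmod_hom A (infl (n + 1) T) E"
  by (intro gmod_homI mod_homI) (auto simp: Q.rsmult_zero \<tau>0 T.rsmult_closed split: if_splits)

lemma ext_mod_gen: "q \<in> carrier Q ==> c \<in> carrier C ==> pr q (zero T) \<cdot>\<^bsub>E\<^esub> ((zero R), c) = pr (zero Q) (\<tau> q c)"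
  by (simp add: \<tau>D Q.rsmult_zero_scalar T.rsmult_zero)

text \<open>The summand \<open>T\<close> is spanned by the products of elements of \<open>Q\<close>
  with elements of \<open>C\<close>, so linearity over \<open>A\<close> determines a homomorphism
  from its values on \<open>Q\<close>.\<close>

lemma ext_mod_hom_ext:
  fixes N :: "('u \<times> 'u, 'u) gmodule"
  assumes N: "graded_module A G N" and f: "f \<in> mod_hom A E N" and g: "g \<in> mod_hom A E N"
    and eq: "!!q. q \<in> carrier Q ==> f (pr q (zero T)) = g (pr q (zero T))" and z: "z \<in> carrier E"
  shows "f z = g z"
proof -
  interpret N: graded_module A G N by (rule N)
  have hom: "(%t. h (pr (zero Q) t)) \<in> hom (add_monoid T) (add_monoid N)" if "h \<in> mod_hom A E N" for h
  proof (rule homI)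
    show "h (pr (zero Q) t) \<in> carrier (add_monoid N)" if "t \<in> carrier (add_monoid T)" for t
      using mod_homD(1)[OF \<open>h \<in> mod_hom A E N\<close>, of "pr (zero Q) t"] that by simp
    show "h (pr (zero Q) (s \<otimes>\<^bsub>add_monoid T\<^esub> t)) = h (pr (zero Q) s) \<otimes>\<^bsub>add_monoid N\<^esub> h (pr (zero Q) t)"
      if "s \<in> carrier (add_monoid T)" "t \<in> carrier (add_monoid T)" for s t
      using mod_homD(2)[OF \<open>h \<in> mod_hom A E N\<close>, of "pr (zero Q) s" "pr (zero Q) t"] that by simp
  qed
  have eqT: "f (pr (zero Q) t) = g (pr (zero Q) t)" if t: "t \<in> carrier T" for t
  proof (rule tensor_ext[OF T N.M.abelian_group_axioms hom[OF f] hom[OF g] _ t Q C])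
    fix q c assume qc: "q \<in> carrier Q" "c \<in> carrier C"
    then have "f (pr q (zero T) \<cdot>\<^bsub>E\<^esub> ((zero R), c)) = g (pr q (zero T) \<cdot>\<^bsub>E\<^esub> ((zero R), c))"
      using mod_homD(3)[OF f, of "pr q (zero T)" "((zero R), c)"] mod_homD(3)[OF g, of "pr q (zero T)" "((zero R), c)"] eq
      by simp
    then show "f (pr (zero Q) (\<tau> q c)) = g (pr (zero Q) (\<tau> q c))" unfolding ext_mod_gen[OF qc] .
  qed
  obtain q t where qt: "z = pr q t" "q \<in> carrier Q" "t \<in> carrier T" using z by auto
  have "z = pr q (zero T) \<oplus>\<^bsub>E\<^esub> pr (zero Q) t" using qt by simp
  then show ?thesis
    using mod_homD(2)[OF f, of "pr q (zero T)" "pr (zero Q) t"] mod_homD(2)[OF g, of "pr q (zero T)" "pr (zero Q) t"]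
      eq eqT qt(2,3) by simp
qed

text \<open>Homomorphisms out of the induced module \<open>Q \<otimes> A\<close> are determined by a homomorphism on \<open>Q\<close>.\<close>

lemma ext_mod_lift:
  fixes N :: "('u \<times> 'u, 'u) gmodule"
  assumes N: "graded_module A G N" and h: "h \<in> mod_hom R Q (deg_part C N n)"
  obtains H where "H \<in> gmod_hom A E N" "\<forall>q\<in>carrier Q. H (pr q (zero T)) = h q"
proof -
  interpret N: graded_module A G N by (rule N)
  note ND = deg_part_module[OF N] and N0 = deg0_closed[OF N] and N1 = deg1_closed[OF N]
    and Ns = split_smult[OF N]
  have hc: "h q \<in> component N n" "h q \<in> carrier N" if "q \<in> carrier Q" for q
    using mod_homD(1)[OF h that] N.comp_carrier by simp_all
  have hr: "h (q \<cdot>\<^bsub>Q\<^esub> r) = h q \<cdot>\<^bsub>N\<^esub> (r, (zero C))" if "q \<in> carrier Q" "r \<in> carrier R" for q r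
    using mod_homD(3)[OF h that] by simp
  have ha: "h (q \<oplus>\<^bsub>Q\<^esub> q') = h q \<oplus>\<^bsub>N\<^esub> h q'" if "q \<in> carrier Q" "q' \<in> carrier Q" for q q'
    using mod_homD(2)[OF h that] by simp
  have as: "(m \<cdot>\<^bsub>N\<^esub> a) \<cdot>\<^bsub>N\<^esub> b = m \<cdot>\<^bsub>N\<^esub> (a \<otimes>\<^bsub>A\<^esub> b)" if "m \<in> carrier N" "a \<in> carrier A" "b \<in> carrier A" for m a b
    using N.rsmult_assoc[OF that] by simp
  \<comment> \<open>On \<open>T\<close> the extension is forced by linearity: the tensor of q and c
    must go to the product of \<open>h q\<close> with c.\<close>
  obtain k where k: "k \<in> mod_hom R T (deg_part C N (n + 1))"
    and kt: "\<forall>q\<in>carrier Q. \<forall>c\<in>carrier C. k (\<tau> q c) = h q \<cdot>\<^bsub>N\<^esub> ((zero R), c)"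
  proof (rule tensor_universal_mod[OF C T Q ND])
    show "balanced R Q C (deg_part C N (n + 1)) (%q c. h q \<cdot>\<^bsub>N\<^esub> ((zero R), c))"
    proof (rule balancedI)
      fix q c d assume q: "q \<in> carrier Q" and c: "c \<in> carrier C" and d: "d \<in> carrier C"
      show "h q \<cdot>\<^bsub>N\<^esub> ((zero R), c \<oplus>\<^bsub>C\<^esub> d) = h q \<cdot>\<^bsub>N\<^esub> ((zero R), c) \<oplus>\<^bsub>deg_part C N (n + 1)\<^esub> h q \<cdot>\<^bsub>N\<^esub> ((zero R), d)"
        using N.rsmult_add_scalar[of "h q" "((zero R), c)" "((zero R), d)"] hc[OF q] c d by simp
    next
      fix q r c assume q: "q \<in> carrier Q" and r: "r \<in> carrier R" and c: "c \<in> carrier C"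
      show "h (q \<cdot>\<^bsub>Q\<^esub> r) \<cdot>\<^bsub>N\<^esub> ((zero R), c) = h q \<cdot>\<^bsub>N\<^esub> ((zero R), r \<bullet>\<^bsub>C\<^esub> c)"
        using as[of "h q" "(r, (zero C))" "((zero R), c)"] hc[OF q] r c
        by (simp add: hr[OF q r] C.rsmult_zero C.lsmult_closed)
    qed (use hc N1 ha N.rsmult_add in simp_all)
    fix q c r assume q: "q \<in> carrier Q" and c: "c \<in> carrier C" and r: "r \<in> carrier R"
    show "h q \<cdot>\<^bsub>N\<^esub> ((zero R), c) \<cdot>\<^bsub>deg_part C N (n + 1)\<^esub> r = h q \<cdot>\<^bsub>N\<^esub> ((zero R), c \<cdot>\<^bsub>C\<^esub> r)"
      using as[of "h q" "((zero R), c)" "(r, (zero C))"] hc[OF q] r c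
      by (simp add: C.lsmult_zero C.rsmult_closed)
  qed
  have kc: "k t \<in> component N (n + 1)" "k t \<in> carrier N" if "t \<in> carrier T" for t
    using mod_homD(1)[OF k that] N.comp_carrier by simp_all
  have ka: "k (s \<oplus>\<^bsub>T\<^esub> t) = k s \<oplus>\<^bsub>N\<^esub> k t" if "s \<in> carrier T" "t \<in> carrier T" for s t
    using mod_homD(2)[OF k that] by simp
  have kr: "k (t \<cdot>\<^bsub>T\<^esub> r) = k t \<cdot>\<^bsub>N\<^esub> (r, (zero C))" if "t \<in> carrier T" "r \<in> carrier R" for t r
    using mod_homD(3)[OF k that] by simp
  \<comment> \<open>Products of two elements of \<open>C\<close> vanish in \<open>A\<close>, so
    \<open>C\<close> annihilates the image of \<open>T\<close>, as linearity of \<open>H\<close>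
    requires.\<close>
  have kz: "k t \<cdot>\<^bsub>N\<^esub> ((zero R), d) = (zero N)" if t: "t \<in> carrier T" and d: "d \<in> carrier C" for t d
  proof (rule tensor_ext[OF T N.M.abelian_group_axioms _ _ _ t Q C])
    have dA: "((zero R), d) \<in> carrier A" using d by simp
    show "(%t. k t \<cdot>\<^bsub>N\<^esub> ((zero R), d)) \<in> hom (add_monoid T) (add_monoid N)"
      by (rule homI) (use kc ka dA N.rsmult_closed N.rsmult_add in simp_all)
    show "(%t. (zero N)) \<in> hom (add_monoid T) (add_monoid N)" by (rule homI) simp_all
    fix q c assume q: "q \<in> carrier Q" and c: "c \<in> carrier C"
    have "k (\<tau> q c) \<cdot>\<^bsub>N\<^esub> ((zero R), d) = h q \<cdot>\<^bsub>N\<^esub> (((zero R), c) \<otimes>\<^bsub>A\<^esub> ((zero R), d))"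
      using kt q c as[OF hc(2)[OF q], of "((zero R), c)" "((zero R), d)"] d by simp
    also have "\<dots> = h q \<cdot>\<^bsub>N\<^esub> (zero A)" using c d by (simp add: C.lsmult_zero_scalar C.rsmult_zero_scalar)
    also have "\<dots> = (zero N)" by (rule N.rsmult_zero_scalar[OF hc(2)[OF q]])
    finally show "k (\<tau> q c) \<cdot>\<^bsub>N\<^esub> ((zero R), d) = (zero N)" .
  qed
  define H where "H = (%z. h (p1 z) \<oplus>\<^bsub>N\<^esub> k (p2 z))"
  have h0: "h (zero Q) = (zero N)" using mod_hom_zero[OF h Q ND] by simp
  have k0: "k (zero T) = (zero N)" using mod_hom_zero[OF k T.right_module_axioms ND] by simp
  have "H \<in> gmod_hom A E N"
  proof (rule gmod_homI)
    show "H x \<in> component N i" if "x \<in> component E i" for i x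
      using that hc kc h0 k0 N.comp_zero by (auto simp: H_def split: if_splits)
    show "H \<in> mod_hom A E N"
    proof (rule mod_homI)
      show "H x \<in> carrier N" if "x \<in> carrier E" for x using that hc kc by (auto simp: H_def)
      show "H (x \<oplus>\<^bsub>E\<^esub> y) = H x \<oplus>\<^bsub>N\<^esub> H y" if "x \<in> carrier E" "y \<in> carrier E" for x y
        using that hc kc ha ka by (auto simp: H_def N.M.a_ac)
      fix z r assume "z \<in> carrier E" "r \<in> carrier A"
      then obtain q t a c where z: "z = pr q t" "q \<in> carrier Q" "t \<in> carrier T"
        and r: "r = (a, c)" "a \<in> carrier R" "c \<in> carrier C" by auto
      have qt: "h q \<oplus>\<^bsub>N\<^esub> k t \<in> carrier N" using hc kc z by simp
      have rA: "(a, (zero C)) \<in> carrier A" "((zero R), c) \<in> carrier A" using r by simp_all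
      have cl: "h q \<cdot>\<^bsub>N\<^esub> (a, (zero C)) \<in> carrier N" "h q \<cdot>\<^bsub>N\<^esub> ((zero R), c) \<in> carrier N" "k t \<cdot>\<^bsub>N\<^esub> (a, (zero C)) \<in> carrier N"
        using N.rsmult_closed[OF hc(2)[OF z(2)] rA(1)] N.rsmult_closed[OF hc(2)[OF z(2)] rA(2)]
          N.rsmult_closed[OF kc(2)[OF z(3)] rA(1)] by simp_all
      have "H (z \<cdot>\<^bsub>E\<^esub> r) = h q \<cdot>\<^bsub>N\<^esub> (a, (zero C)) \<oplus>\<^bsub>N\<^esub> (h q \<cdot>\<^bsub>N\<^esub> ((zero R), c) \<oplus>\<^bsub>N\<^esub> k t \<cdot>\<^bsub>N\<^esub> (a, (zero C)))"
        using z r kt by (simp add: H_def hr ka kr \<tau>D T.rsmult_closed)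
      also have "\<dots> = (h q \<oplus>\<^bsub>N\<^esub> k t) \<cdot>\<^bsub>N\<^esub> (a, (zero C)) \<oplus>\<^bsub>N\<^esub> (h q \<oplus>\<^bsub>N\<^esub> k t) \<cdot>\<^bsub>N\<^esub> ((zero R), c)"
        unfolding N.rsmult_add[OF hc(2)[OF z(2)] kc(2)[OF z(3)] rA(1)] N.rsmult_add[OF hc(2)[OF z(2)] kc(2)[OF z(3)] rA(2)]
          kz[OF z(3) r(3)] using cl by (simp add: N.M.a_ac)
      also have "\<dots> = H z \<cdot>\<^bsub>N\<^esub> r" unfolding r(1) z(1) H_def p1_pr p2_pr by (rule Ns[OF qt r(2,3), symmetric])
      finally show "H (z \<cdot>\<^bsub>E\<^esub> r) = H z \<cdot>\<^bsub>N\<^esub> r" .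
    qed
  qed
  moreover have "\<forall>q\<in>carrier Q. H (pr q (zero T)) = h q" using hc k0 by (simp add: H_def)
  ultimately show thesis by (rule that)
qed

text \<open>Forming the induced module is left adjoint to taking the part of degree n, by
  \<open>ext_mod_lift\<close> and \<open>ext_mod_hom_ext\<close>, and the latter functor preserves
  surjections; hence projectives are preserved.\<close>

lemma ext_mod_gr_proj:
  assumes QP: "Q \<in> proj R"
  shows "E \<in> gr_proj A G"
proof -
  have in1: "(%q. pr q (zero T)) \<in> mod_hom R Q (deg_part C E n)"
    by (rule mod_homI) (auto simp: \<tau>_zero_right T.rsmult_zero)
  have "projective (GrMod_cat A G) E"
    unfolding projective_def Ob_GrMod_cat Hom_GrMod_cat
  proof (intro conjI ballI impI)
    show "graded_module A G E" by (rule ext_mod_graded)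
    fix M N :: "('u \<times> 'u, 'u) gmodule" and g f
    assume "M \<in> Ob (GrMod_cat A G)" "N \<in> Ob (GrMod_cat A G)" and g: "g \<in> gmod_hom A M N"
      and f: "f \<in> gmod_hom A E N" and s: "g ` carrier M = carrier N"
    then have M: "graded_module A G M" and N: "graded_module A G N" by simp_all
    interpret M: graded_module A G M by (rule M)
    interpret N: graded_module A G N by (rule N)
    \<comment> \<open>A homogeneous element has a homogeneous preimage: the component of degree n of
      any preimage.\<close>
    have sn: "g ` carrier (deg_part C M n) = carrier (deg_part C N n)"
    proof (intro equalityI subsetI)
      fix y assume "y \<in> carrier (deg_part C N n)"
      then have y: "y \<in> component N n" by simp
      then obtain x where x: "x \<in> carrier M" "y = g x" using N.comp_carrier s by blast
      have "y = g (M.hc n x)" using gmod_hom_hc[OF g M N x(1), of n] N.hc_homogeneous[OF y, of n] x(2) by simp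
      then show "y \<in> g ` carrier (deg_part C M n)" using M.hc(1)[OF x(1), of n] by simp
    qed (use gmod_homD(2)[OF g] in auto)
    obtain h where h: "h \<in> mod_hom R Q (deg_part C M n)" "\<forall>q\<in>carrier Q. g (h q) = f (pr q (zero T))"
      by (rule mod_hom_proj_lift[OF QP deg_part_module[OF M] deg_part_module[OF N] deg_part_hom[OF g M] sn
          mod_hom_comp[OF in1 deg_part_hom[OF f ext_mod_graded]]])
    obtain H where H: "H \<in> gmod_hom A E M" "\<forall>q\<in>carrier Q. H (pr q (zero T)) = h q" by (rule ext_mod_lift[OF M h(1)])
    have "g (H z) = f z" if "z \<in> carrier E" for z
      by (rule ext_mod_hom_ext[OF N mod_hom_comp[OF gmod_homD(1)[OF H(1)] gmod_homD(1)[OF g]] gmod_homD(1)[OF f] _ that])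
        (use h(2) H(2) in simp)
    then show "\<exists>h\<in>gmod_hom A E M. \<forall>p\<in>carrier E. g (h p) = f p" using H(1) by (intro bexI[of _ H] ballI)
  qed
  moreover have "fin_gen A E"
  proof -
    have "fin_gen R Q" using QP by (simp add: proj_def)
    then obtain S where S: "finite S" "S \<subseteq> carrier Q" "!!H. Q.submod H ==> S \<subseteq> H ==> H = carrier Q"
      using Q.fin_gen_iff by blast
    have "H = carrier E" if H: "E.submod H" "(%s. pr s (zero T)) ` S \<subseteq> H" for H
    proof
      have Ha: "x \<in> H ==> y \<in> H ==> x \<oplus>\<^bsub>E\<^esub> y \<in> H" and Hs: "x \<in> H ==> r \<in> carrier A ==> x \<cdot>\<^bsub>E\<^esub> r \<in> H"
        and H0: "(zero E) \<in> H" for x y r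
        using H(1) unfolding E.submod_def by blast+
      have "Q.submod {q \<in> carrier Q. pr q (zero T) \<in> H}"
        unfolding Q.submod_def
      proof (intro conjI ballI)
        fix x assume x: "x \<in> {q \<in> carrier Q. pr q (zero T) \<in> H}"
        show "x \<oplus>\<^bsub>Q\<^esub> y \<in> {q \<in> carrier Q. pr q (zero T) \<in> H}" if "y \<in> {q \<in> carrier Q. pr q (zero T) \<in> H}" for y
          using Ha[of "pr x (zero T)" "pr y (zero T)"] x that by simp
        show "x \<cdot>\<^bsub>Q\<^esub> r \<in> {q \<in> carrier Q. pr q (zero T) \<in> H}" if "r \<in> carrier R" for r
          using Hs[of "pr x (zero T)" "(r, (zero C))"] x that by (simp add: \<tau>_zero_right T.rsmult_zero Q.rsmult_closed)
      qed (use H0 in auto)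
      then have 1: "{q \<in> carrier Q. pr q (zero T) \<in> H} = carrier Q" using S(2) H(2) by (intro S(3)) auto
      have q: "pr q (zero T) \<in> H" if "q \<in> carrier Q" for q using 1 that unfolding set_eq_iff mem_Collect_eq by blast
      \<comment> \<open>The elements of \<open>T\<close> whose copies lie in \<open>H\<close>. The
        map \<open>\<tau>\<close> takes its values there, so by the universal property the identity
        of \<open>T\<close> factors through this submodule, which is therefore all of
        \<open>T\<close>.\<close>
      define K where "K = T\<lparr>carrier := {t \<in> carrier T. pr (zero Q) t \<in> H}\<rparr>"
      have Ksel: "carrier K = {t \<in> carrier T. pr (zero Q) t \<in> H}" "(zero K) = (zero T)"
        "!!x y. x \<oplus>\<^bsub>K\<^esub> y = x \<oplus>\<^bsub>T\<^esub> y" "!!x r. x \<cdot>\<^bsub>K\<^esub> r = x \<cdot>\<^bsub>T\<^esub> r" by (simp_all add: K_def)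
      have Ts: "T.submod {t \<in> carrier T. pr (zero Q) t \<in> H}"
        unfolding T.submod_def
      proof (intro conjI ballI)
        fix x assume x: "x \<in> {t \<in> carrier T. pr (zero Q) t \<in> H}"
        show "x \<oplus>\<^bsub>T\<^esub> y \<in> {t \<in> carrier T. pr (zero Q) t \<in> H}" if "y \<in> {t \<in> carrier T. pr (zero Q) t \<in> H}" for y
          using Ha[of "pr (zero Q) x" "pr (zero Q) y"] x that by simp
        show "x \<cdot>\<^bsub>T\<^esub> r \<in> {t \<in> carrier T. pr (zero Q) t \<in> H}" if "r \<in> carrier R" for r
          using Hs[of "pr (zero Q) x" "(r, (zero C))"] x that by (simp add: \<tau>0 Q.rsmult_zero T.rsmult_closed)
      qed (use H0 in auto)
      have KM: "right_module R K" by (rule T.right_module_sub[OF Ts Ksel])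
      obtain g where g: "g \<in> mod_hom R T K" "\<forall>q\<in>carrier Q. \<forall>c\<in>carrier C. g (\<tau> q c) = \<tau> q c"
      proof (rule tensor_universal_mod[OF C T Q KM])
        show "balanced R Q C K \<tau>"
        proof (rule balancedI)
          show "\<tau> m c \<in> carrier K" if "m \<in> carrier Q" "c \<in> carrier C" for m c
            using Hs[OF q[OF that(1)], of "((zero R), c)"] ext_mod_gen[OF that] that by (simp add: Ksel \<tau>D(1))
        qed (simp_all add: Ksel \<tau>D)
      qed (simp add: Ksel tensorD(3)[OF T])
      have inc: "(%x. x) \<in> mod_hom R K T" by (rule mod_homI) (simp_all add: Ksel)
      have "g t = t" if t: "t \<in> carrier T" for t
        by (rule tensor_mod_hom_ext[OF C T Q T.right_module_axioms mod_hom_comp[OF g(1) inc] mod_hom_id _ t]) (simp add: g(2))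
      then have t: "pr (zero Q) t \<in> H" if "t \<in> carrier T" for t
        using mod_homD(1)[OF g(1) that] that by (simp add: Ksel)
      show "carrier E \<subseteq> H"
      proof
        fix z assume "z \<in> carrier E"
        then obtain a b where ab: "z = pr a b" "a \<in> carrier Q" "b \<in> carrier T" by auto
        then show "z \<in> H" using Ha[OF q[OF ab(2)] t[OF ab(3)]] by simp
      qed
    qed (use H(1) in \<open>simp add: E.submod_def\<close>)
    then show ?thesis unfolding E.fin_gen_iff using S(1,2)
      by (intro exI[of _ "(%s. pr s (zero T)) ` S"]) auto
  qed
  ultimately show ?thesis by (simp add: gr_proj_def)
qed

end

end

section \<open>The reduction of a graded module from A to R, degree by degree\<close>

context triv_ext begin

abbreviation "D P j \<equiv> deg_part C P j"

text \<open>
  \<open>\<pi>\<close> is the projection of the degree \<open>j\<close> part of \<open>P\<close> onto the degree \<open>j\<close> part of \<open>P \<otimes>\<^bsub>A\<^esub> R\<close>: its kernel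
  is the least submodule containing the products of elements of degree \<open>j - 1\<close> with elements of \<open>C\<close>.
\<close>

definition top :: "('u \<times> 'u, 'v) gmodule => int => ('u, 'v) module => ('v => 'v) => bool"
  where "top P j Q \<pi> \<longleftrightarrow> right_module R Q \<and> \<pi> \<in> mod_hom R (D P j) Q \<and> \<pi> ` component P j = carrier Q \<and>
    (\<forall>x\<in>component P j. \<pi> x = (zero Q) \<longleftrightarrow> (\<forall>H. right_module.submod R (D P j) H -->
      (\<forall>p\<in>component P (j - 1). \<forall>c\<in>carrier C. p \<cdot>\<^bsub>P\<^esub> ((zero R), c) \<in> H) --> x \<in> H))"

lemma topD:
  assumes "top P j Q \<pi>"
  shows "right_module R Q" "\<pi> \<in> mod_hom R (D P j) Q" "\<pi> ` component P j = carrier Q" "\<pi> ` carrier (D P j) = carrier Q"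
  using assms by (simp_all add: top_def)

context
  fixes P :: "('u \<times> 'u, 'v) gmodule"
  assumes P: "graded_module A G P"
begin

interpretation P: graded_module A G P by (rule P)

lemma smult_smult1:
  assumes "p \<in> carrier P" "c \<in> carrier C" "d \<in> carrier C"
  shows "(p \<cdot>\<^bsub>P\<^esub> ((zero R), c)) \<cdot>\<^bsub>P\<^esub> ((zero R), d) = (zero P)"
  using P.rsmult_assoc[OF assms(1), of "((zero R), c)" "((zero R), d)"] P.rsmult_zero_scalar[OF assms(1)] assms(2,3)
  by (simp add: C.lsmult_zero_scalar C.rsmult_zero_scalar)

lemma ex_top:
  obtains Q \<pi> where "top P j Q \<pi>"
proof -
  interpret D: right_module R "D P j" by (rule deg_part_module[OF P])
  let ?gen = "%H. \<forall>p\<in>component P (j - 1). \<forall>c\<in>carrier C. p \<cdot>\<^bsub>P\<^esub> ((zero R), c) \<in> H"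
  let ?I = "{x \<in> carrier (D P j). \<forall>H. D.submod H --> ?gen H --> x \<in> H}"
  have "D.submod ?I"
  proof (rule D.submod_def[THEN iffD2], intro conjI ballI)
    show "(zero (D P j)) \<in> ?I" unfolding D.submod_def by (intro CollectI conjI D.M.zero_closed) blast
    fix x assume x: "x \<in> ?I"
    show "x \<oplus>\<^bsub>D P j\<^esub> y \<in> ?I" if y: "y \<in> ?I" for y
    proof (intro CollectI conjI allI impI)
      show "x \<oplus>\<^bsub>D P j\<^esub> y \<in> carrier (D P j)" using x y by (intro D.M.a_closed) blast+
      fix H assume H: "D.submod H" "?gen H"
      then have "x \<in> H" "y \<in> H" using x y by blast+
      then show "x \<oplus>\<^bsub>D P j\<^esub> y \<in> H" using H(1) unfolding D.submod_def by blast
    qed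
    show "x \<cdot>\<^bsub>D P j\<^esub> r \<in> ?I" if r: "r \<in> carrier R" for r
    proof (intro CollectI conjI allI impI)
      show "x \<cdot>\<^bsub>D P j\<^esub> r \<in> carrier (D P j)" using x r by (intro D.rsmult_closed) blast+
      fix H assume H: "D.submod H" "?gen H"
      then have "x \<in> H" using x by blast
      then show "x \<cdot>\<^bsub>D P j\<^esub> r \<in> H" using H(1) r unfolding D.submod_def by blast
    qed
  qed blast
  from D.ex_quotient[OF this] obtain Q :: "('u, 'v) module" and \<pi> where Q: "right_module R Q" "\<pi> \<in> mod_hom R (D P j) Q"
    "\<pi> ` carrier (D P j) = carrier Q" "\<forall>x\<in>carrier (D P j). \<pi> x = (zero Q) \<longleftrightarrow> x \<in> ?I" by blast
  have "top P j Q \<pi>" unfolding top_def using Q by simp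
  then show thesis by (rule that)
qed

text \<open>Induction over the kernel of \<open>\<pi>\<close>: its minimality replaces the
  representation of its elements as sums of products with \<open>C\<close>.\<close>

lemma top_induct:
  assumes t: "top P j Q \<pi>" and x: "x \<in> component P j" "\<pi> x = (zero Q)" and H: "right_module.submod R (D P j) {x \<in> carrier (D P j). S x}"
    and gen: "!!p c. p \<in> component P (j - 1) ==> c \<in> carrier C ==> S (p \<cdot>\<^bsub>P\<^esub> ((zero R), c))"
  shows "S x"
proof -
  have "\<forall>p\<in>component P (j - 1). \<forall>c\<in>carrier C. p \<cdot>\<^bsub>P\<^esub> ((zero R), c) \<in> {x \<in> carrier (D P j). S x}"
    using gen deg1_closed[OF P, of _ "j - 1"] by simp
  then have "x \<in> {x \<in> carrier (D P j). S x}" using t x H unfolding top_def by blast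
  then show ?thesis by blast
qed

lemma top_mod_ext:
  fixes N :: "('u, 'v) module"
  assumes t: "top P j Q \<pi>" and N: "right_module R N" and f: "f \<in> mod_hom R (D P j) N" and g: "g \<in> mod_hom R (D P j) N"
    and eq: "!!p c. p \<in> component P (j - 1) ==> c \<in> carrier C ==> f (p \<cdot>\<^bsub>P\<^esub> ((zero R), c)) = g (p \<cdot>\<^bsub>P\<^esub> ((zero R), c))"
    and x: "x \<in> component P j" "\<pi> x = (zero Q)"
  shows "f x = g x"
proof (rule top_induct[where S = "%x. f x = g x", OF t x _ eq])
  interpret D: right_module R "D P j" by (rule deg_part_module[OF P])
  have "f (zero (D P j)) = g (zero (D P j))"
    using mod_hom_zero[OF f D.right_module_axioms N] mod_hom_zero[OF g D.right_module_axioms N] by simp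
  then show "D.submod {x \<in> carrier (D P j). f x = g x}"
    unfolding D.submod_def using mod_homD(2,3)[OF f] mod_homD(2,3)[OF g] D.rsmult_closed D.M.a_closed D.M.zero_closed
    by (intro conjI ballI; clarify) metis+
qed

lemma top_factor:
  fixes N :: "('u, 'v) module"
  assumes t: "top P j Q \<pi>" and N: "right_module R N" and f: "f \<in> mod_hom R (D P j) N"
    and z: "!!p c. p \<in> component P (j - 1) ==> c \<in> carrier C ==> f (p \<cdot>\<^bsub>P\<^esub> ((zero R), c)) = (zero N)"
  obtains h where "h \<in> mod_hom R Q N" "\<forall>x\<in>component P j. h (\<pi> x) = f x"
proof -
  have "f x = (zero N)" if "x \<in> component P j" "\<pi> x = (zero Q)" for x
    by (rule top_mod_ext[OF t N f mod_hom_const_zero[OF N] _ that]) (rule z)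
  then obtain h where "h \<in> mod_hom R Q N" "\<forall>x\<in>carrier (D P j). h (\<pi> x) = f x"
    using mod_hom_factor[OF deg_part_module[OF P] topD(1)[OF t] N topD(2,4)[OF t] f] unfolding deg_part_sel by metis
  then show thesis using that by simp
qed

lemma top_kills:
  assumes t: "top P j Q \<pi>" and p: "p \<in> component P (j - 1)" and c: "c \<in> carrier C"
  shows "\<pi> (p \<cdot>\<^bsub>P\<^esub> ((zero R), c)) = (zero Q)"
proof -
  have "p \<cdot>\<^bsub>P\<^esub> ((zero R), c) \<in> component P j" using deg1_closed[OF P p c] by simp
  then show ?thesis using t p c unfolding top_def by blast
qed

text \<open>Products of two elements of \<open>C\<close> vanish in \<open>A\<close>, and the kernel
  of \<open>\<pi>\<close> is generated by products with \<open>C\<close>. Consequently the action of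
  \<open>C\<close> on an element of degree j depends only on its image in \<open>Q\<close>.\<close>

lemma top_smult1:
  assumes t: "top P j Q \<pi>" and x: "x \<in> component P j" "\<pi> x = (zero Q)" and c: "c \<in> carrier C"
  shows "x \<cdot>\<^bsub>P\<^esub> ((zero R), c) = (zero P)"
proof -
  interpret D: right_module R "D P j" by (rule deg_part_module[OF P])
  have cl: "((zero R), d) \<in> carrier A" if "d \<in> carrier C" for d using that by simp
  have "\<forall>d\<in>carrier C. x \<cdot>\<^bsub>P\<^esub> ((zero R), d) = (zero P)"
  proof (rule top_induct[OF t x])
    show "D.submod {x \<in> carrier (D P j). \<forall>d\<in>carrier C. x \<cdot>\<^bsub>P\<^esub> ((zero R), d) = (zero P)}"
      unfolding D.submod_def
    proof (intro conjI ballI)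
      fix x assume "x \<in> {x \<in> carrier (D P j). \<forall>d\<in>carrier C. x \<cdot>\<^bsub>P\<^esub> ((zero R), d) = (zero P)}"
      then have xj: "x \<in> component P j" and x0: "\<forall>d\<in>carrier C. x \<cdot>\<^bsub>P\<^esub> ((zero R), d) = (zero P)" by simp_all
      note x = xj P.comp_carrier[OF xj] x0
      show "x \<oplus>\<^bsub>D P j\<^esub> y \<in> {x \<in> carrier (D P j). \<forall>d\<in>carrier C. x \<cdot>\<^bsub>P\<^esub> ((zero R), d) = (zero P)}"
        if "y \<in> {x \<in> carrier (D P j). \<forall>d\<in>carrier C. x \<cdot>\<^bsub>P\<^esub> ((zero R), d) = (zero P)}" for y
        using that x P.comp_carrier[of _ j] P.comp_add cl by (simp add: P.rsmult_add)
      show "x \<cdot>\<^bsub>D P j\<^esub> r \<in> {x \<in> carrier (D P j). \<forall>d\<in>carrier C. x \<cdot>\<^bsub>P\<^esub> ((zero R), d) = (zero P)}" if r: "r \<in> carrier R" for r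
      proof -
        have "(x \<cdot>\<^bsub>P\<^esub> (r, (zero C))) \<cdot>\<^bsub>P\<^esub> ((zero R), d) = x \<cdot>\<^bsub>P\<^esub> ((zero R), r \<bullet>\<^bsub>C\<^esub> d)" if d: "d \<in> carrier C" for d
          using P.rsmult_assoc[OF x(2), of "(r, (zero C))" "((zero R), d)"] r d by (simp add: C.rsmult_zero C.lsmult_closed)
        then show ?thesis using x(3) r deg0_closed[OF P x(1) r] by (simp add: C.lsmult_closed)
      qed
    qed (auto simp: P.comp_zero P.rsmult_zero)
  qed (simp add: smult_smult1 P.comp_carrier c)
  then show ?thesis using c by blast
qed

text \<open>\<open>C\<close> acts as zero on the inflation, so killing the products with
  \<open>C\<close> makes the composite with the projection to degree j linear over \<open>A\<close>.
  Lifting problems for \<open>P\<close> are posed through such maps.\<close>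

lemma infl_hom_of_deg_part:
  fixes N :: "('u, 'v) module"
  assumes N: "right_module R N" and f: "f \<in> mod_hom R (D P j) N"
    and z: "!!p c. p \<in> component P (j - 1) ==> c \<in> carrier C ==> f (p \<cdot>\<^bsub>P\<^esub> ((zero R), c)) = (zero N)"
  shows "(%x. f (P.hc j x)) \<in> gmod_hom A P (infl j N)"
proof (rule gmod_homI)
  interpret N: right_module R N by (rule N)
  have f0: "f (zero P) = (zero N)" using mod_hom_zero[OF f deg_part_module[OF P] N] by simp
  have fc: "f x \<in> carrier N" if "x \<in> component P j" for x using mod_homD(1)[OF f] that by simp
  have fa: "f (x \<oplus>\<^bsub>P\<^esub> y) = f x \<oplus>\<^bsub>N\<^esub> f y" if "x \<in> component P j" "y \<in> component P j" for x y
    using mod_homD(2)[OF f, of x y] that by simp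
  have fs: "f (x \<cdot>\<^bsub>P\<^esub> (r, (zero C))) = f x \<cdot>\<^bsub>N\<^esub> r" if "x \<in> component P j" "r \<in> carrier R" for x r
    using mod_homD(3)[OF f, of x r] that by simp
  show "(%x. f (P.hc j x)) \<in> mod_hom A P (infl j N)"
  proof (rule mod_homI)
    fix x r assume x: "x \<in> carrier P" and "r \<in> carrier A"
    then obtain a c where r: "r = (a, c)" "a \<in> carrier R" "c \<in> carrier C" by auto
    have c1: "P.hc (j - 1) x \<cdot>\<^bsub>P\<^esub> ((zero R), c) \<in> component P j"
      using deg1_closed[OF P P.hc(1)[OF x] r(3), of "j - 1"] by simp
    show "f (P.hc j (x \<cdot>\<^bsub>P\<^esub> r)) = f (P.hc j x) \<cdot>\<^bsub>infl j N\<^esub> r"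
      unfolding r(1) hc_smult[OF P x r(2,3)] fa[OF deg0_closed[OF P P.hc(1)[OF x] r(2)] c1] fs[OF P.hc(1)[OF x] r(2)]
        z[OF P.hc(1)[OF x] r(3)] using fc[OF P.hc(1)[OF x]] r(2) by (simp add: N.rsmult_closed)
  qed (simp_all add: fc fa P.hc(1) P.hc_add)
qed (use mod_homD(1)[OF f] mod_hom_zero[OF f deg_part_module[OF P] N] in \<open>auto simp: P.hc_homogeneous\<close>)

lemma infl_hom_top:
  assumes t: "top P j Q \<pi>"
  shows "(%x. \<pi> (P.hc j x)) \<in> gmod_hom A P (infl j Q)" "(%x. \<pi> (P.hc j x)) ` carrier P = carrier (infl j Q)"
proof -
  show h: "(%x. \<pi> (P.hc j x)) \<in> gmod_hom A P (infl j Q)"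
    by (rule infl_hom_of_deg_part[OF topD(1,2)[OF t] top_kills[OF t]])
  have "y \<in> (%x. \<pi> (P.hc j x)) ` carrier P" if "y \<in> carrier Q" for y
  proof -
    obtain x where x: "x \<in> component P j" "y = \<pi> x" using topD(3)[OF t] \<open>y \<in> carrier Q\<close> by blast
    then show ?thesis using P.hc_homogeneous[OF x(1), of j] P.comp_carrier by (intro image_eqI[of _ _ x]) simp_all
  qed
  then show "(%x. \<pi> (P.hc j x)) ` carrier P = carrier (infl j Q)" using mod_homD(1)[OF gmod_homD(1)[OF h]] by auto
qed

text \<open>As \<open>C\<close> acts as zero on the inflation, a submodule over \<open>R\<close> is
  also one over \<open>A\<close>.\<close>

lemma fin_gen_infl:
  fixes Q :: "('u, 'v) module"
  assumes Q: "right_module R Q" and fg: "fin_gen A (infl j Q :: ('u \<times> 'u, 'v) gmodule)"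
  shows "fin_gen R Q"
proof -
  interpret Q: right_module R Q by (rule Q)
  let ?I = "infl j Q :: ('u \<times> 'u, 'v) gmodule"
  interpret I: right_module A ?I by (rule infl_module[OF Q])
  obtain S where S: "finite S" "S \<subseteq> carrier Q" "\<forall>H. I.submod H --> S \<subseteq> H --> H = carrier Q"
    using fg unfolding I.fin_gen_iff infl_sel by blast
  have "I.submod H" if "Q.submod H" for H using that unfolding Q.submod_def I.submod_def infl_sel trivial_ext_sel
    by (intro conjI ballI) (blast, blast, blast, simp add: mem_Times_iff)
  then show ?thesis unfolding Q.fin_gen_iff using S by (intro exI[of _ S]) simp
qed

text \<open>A generator of \<open>P\<close> without component in degree j is sent to zero by the
  surjection of \<open>P\<close> onto the inflation of \<open>Q j\<close>. So \<open>Q j\<close> can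
  be nonzero only in the finitely many degrees of components of generators.\<close>

lemma top_bounded:
  assumes fg: "fin_gen A P" and t: "!!j. top P j (Q j) (\<pi> j)"
  shows "finite {j. carrier (Q j) \<noteq> {(zero (Q j))}}"
proof -
  obtain S where S: "finite S" "S \<subseteq> carrier P" "\<forall>H. P.submod H --> S \<subseteq> H --> H = carrier P"
    using P.fin_gen_iff fg by blast
  have "carrier (Q j) = {(zero (Q j))}" if j: "j \<notin> (\<Union>s\<in>S. {j. P.hc j s \<noteq> (zero P)})" for j
  proof -
    note h = gmod_homD(1)[OF infl_hom_top(1)[OF t]]
    let ?H = "{x \<in> carrier P. \<pi> j (P.hc j x) = (zero (Q j))}"
    have "S \<subseteq> ?H"
      using S(2) j mod_hom_zero[OF topD(2)[OF t[of j]] deg_part_module[OF P] topD(1)[OF t]] by auto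
    then have "?H = carrier P"
      using S(3) kernel_submod[OF h P.right_module_axioms infl_module[OF topD(1)[OF t]]] unfolding infl_sel by blast
    then have "(%x. \<pi> j (P.hc j x)) ` carrier P \<subseteq> {(zero (Q j))}" by auto
    then show ?thesis using infl_hom_top(2)[OF t[of j]]
      abelian_monoid.zero_closed[OF abelian_group.axioms(1)[OF right_module_group[OF topD(1)[OF t[of j]]]]] by auto
  qed
  then have "{j. carrier (Q j) \<noteq> {(zero (Q j))}} \<subseteq> (\<Union>s\<in>S. {j. P.hc j s \<noteq> (zero P)})" by blast
  then show ?thesis by (rule finite_subset) (use S(1,2) P.hc(2) in auto)
qed

end

lemma gr_projD:
  assumes "P \<in> gr_proj A G"
  shows "graded_module A G P" "fin_gen A P" "projective (GrMod_cat A G) P"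
  using assms by (simp_all add: gr_proj_def projective_def)

lemma gr_proj_lift:
  fixes P M N :: "('u \<times> 'u, 'v) gmodule"
  assumes "P \<in> gr_proj A G" "graded_module A G M" "graded_module A G N" "g \<in> gmod_hom A M N" "f \<in> gmod_hom A P N"
    "g ` carrier M = carrier N"
  obtains h where "h \<in> gmod_hom A P M" "\<forall>p\<in>carrier P. g (h p) = f p"
  using gr_projD(3)[OF assms(1)] assms(4-) assms(2,3)[THEN Ob_GrMod_cat[THEN iffD2]] that
  unfolding projective_def Hom_GrMod_cat by blast

text \<open>A lifting problem over \<open>R\<close> is inflated to degree j and solved for
  \<open>P\<close>. Since \<open>C\<close> acts as zero on the inflation, the solution kills the
  products with \<open>C\<close> and factors through \<open>Q\<close>.\<close>

lemma top_proj:
  fixes P :: "('u \<times> 'u, 'v) gmodule"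
  assumes P: "P \<in> gr_proj A G" and t: "top P j Q \<pi>"
  shows "Q \<in> proj R"
proof -
  note PG = gr_projD(1)[OF P]
  interpret P: graded_module A G P by (rule PG)
  note tD = topD[OF t]
  have "projective (Mod_cat R) Q"
    unfolding projective_def Ob_Mod_cat Hom_Mod_cat
  proof (intro conjI ballI impI)
    fix M N :: "('u, 'v) module" and g f
    assume M: "M \<in> Ob (Mod_cat R)" and N: "N \<in> Ob (Mod_cat R)" and g: "g \<in> mod_hom R M N"
      and f: "f \<in> mod_hom R Q N" and s: "g ` carrier M = carrier N"
    have M: "right_module R M" and N: "right_module R N" using M N by simp_all
    interpret M: right_module R M by (rule M)
    have f': "(%x. f (\<pi> (P.hc j x))) \<in> gmod_hom A P (infl j N)"
      by (rule infl_hom_of_deg_part[OF PG N mod_hom_comp[OF tD(2) f]])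
        (use top_kills[OF PG t] mod_hom_zero[OF f tD(1) N] in simp)
    obtain h where h: "h \<in> gmod_hom A P (infl j M)" "\<forall>p\<in>carrier P. g (h p) = f (\<pi> (P.hc j p))"
      by (rule gr_proj_lift[OF P infl_graded[OF M] infl_graded[OF N] infl_hom[OF g M N] f']) (use s in simp_all)
    have hc: "h p \<in> carrier M" if "p \<in> component P i" for p i
      using mod_homD(1)[OF gmod_homD(1)[OF h(1)] P.comp_carrier[OF that]] by simp
    have h1: "h \<in> mod_hom R (D P j) M"
    proof (rule mod_homI)
      show "h x \<in> carrier M" if "x \<in> carrier (D P j)" for x using that hc by simp
      show "h (x \<oplus>\<^bsub>D P j\<^esub> y) = h x \<oplus>\<^bsub>M\<^esub> h y" if "x \<in> carrier (D P j)" "y \<in> carrier (D P j)" for x y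
        using mod_homD(2)[OF gmod_homD(1)[OF h(1)], of x y] that P.comp_carrier by simp
      show "h (x \<cdot>\<^bsub>D P j\<^esub> r) = h x \<cdot>\<^bsub>M\<^esub> r" if "x \<in> carrier (D P j)" "r \<in> carrier R" for x r
        using mod_homD(3)[OF gmod_homD(1)[OF h(1)], of x "(r, (zero C))"] that P.comp_carrier by simp
    qed
    have h0: "h (p \<cdot>\<^bsub>P\<^esub> ((zero R), c)) = (zero M)" if p: "p \<in> component P (j - 1)" and c: "c \<in> carrier C" for p c
      using mod_homD(3)[OF gmod_homD(1)[OF h(1)], of p "((zero R), c)"] P.comp_carrier[OF p] c
        M.rsmult_zero_scalar[OF hc[OF p]] by simp
    obtain h' where h': "h' \<in> mod_hom R Q M" "\<forall>x\<in>component P j. h' (\<pi> x) = h x"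
      by (rule top_factor[OF PG t M h1 h0])
    have "g (h' y) = f y" if "y \<in> carrier Q" for y
    proof -
      obtain x where "x \<in> component P j" "y = \<pi> x" using tD(3) \<open>y \<in> carrier Q\<close> by blast
      then show ?thesis using h'(2) h(2) P.comp_carrier P.hc_homogeneous[of x j j] by simp
    qed
    then show "\<exists>h\<in>mod_hom R Q M. \<forall>p\<in>carrier Q. g (h p) = f p" using h'(1) by (intro bexI[of _ h'] ballI)
  qed (rule tD(1))
  moreover have "fin_gen R Q"
    by (rule fin_gen_infl[OF PG tD(1) fin_gen_image[OF P.right_module_axioms infl_module[OF tD(1)]
          gmod_homD(1)[OF infl_hom_top(1)[OF PG t]] infl_hom_top(2)[OF PG t] gr_projD(2)[OF P]]])
  ultimately show ?thesis by (simp add: proj_def)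
qed

lemma top_section:
  fixes P :: "('u \<times> 'u, 'v) gmodule"
  assumes P: "P \<in> gr_proj A G" and t: "top P j Q \<pi>"
  obtains \<sigma> where "\<sigma> \<in> mod_hom R Q (D P j)" "\<forall>q\<in>carrier Q. \<pi> (\<sigma> q) = q"
  by (rule mod_hom_proj_lift[OF top_proj[OF P t] deg_part_module[OF gr_projD(1)[OF P]] topD(1,2,4)[OF t] mod_hom_id]) (auto intro: that)

text \<open>Projectivity enters twice: a section of \<open>\<pi>'\<close>, extended over the induced
  module, gives the inclusion \<open>\<nu>\<close>; the projection of \<open>P\<close> onto
  \<open>Q'\<close>, lifted to the induced module, gives the retraction
  \<open>\<phi>\<close>.\<close>

lemma top_split:
  fixes T :: "('u, 'u) module"
  assumes P: "P \<in> gr_proj A G" and t': "top P (j - 1) Q' \<pi>'" and t: "top P j Q \<pi>" and T: "is_tensor R Q' C T \<tau>"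
  obtains \<nu> \<phi> where "\<nu> \<in> mod_hom R T (D P j)" "\<phi> \<in> mod_hom R (D P j) T"
    "\<forall>p\<in>component P (j - 1). \<forall>c\<in>carrier C. \<nu> (\<tau> (\<pi>' p) c) = p \<cdot>\<^bsub>P\<^esub> ((zero R), c)"
    "\<forall>t\<in>carrier T. \<phi> (\<nu> t) = t" "\<forall>t\<in>carrier T. \<pi> (\<nu> t) = (zero Q)"
    "\<forall>x\<in>component P j. \<pi> x = (zero Q) --> x = \<nu> (\<phi> x)"
proof -
  note PG = gr_projD(1)[OF P]
  interpret P: graded_module A G P by (rule PG)
  note DM = deg_part_module[OF PG]
  note Q' = topD(1)[OF t'] and Q = topD(1)[OF t] and TM = tensorD(1)[OF T]
  interpret Q': right_module R Q' by (rule Q')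
  interpret T: right_module R T by (rule TM)
  let ?E = "ext_mod C Q' T \<tau> (j - 1)"
  have EG: "graded_module A G ?E" by (rule ext_mod_graded[OF Q' T])
  obtain \<sigma> where \<sigma>: "\<sigma> \<in> mod_hom R Q' (D P (j - 1))" "\<forall>q\<in>carrier Q'. \<pi>' (\<sigma> q) = q" by (rule top_section[OF P t'])
  \<comment> \<open>The induced module on \<open>Q'\<close> has degrees j - 1 and j; the restriction
    of \<open>H\<close> to its part \<open>T\<close> of degree j becomes
    \<open>\<nu>\<close>.\<close>
  obtain H where H: "H \<in> gmod_hom A ?E P" "\<forall>q\<in>carrier Q'. H (pr q (zero T)) = \<sigma> q"
    by (rule ext_mod_lift[OF Q' T PG \<sigma>(1)])
  define \<nu> where "\<nu> = (%t. H (pr (zero Q') t))"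
  have "\<nu> \<in> gmod_hom A (infl j T) P"
    unfolding \<nu>_def gmod_hom_def mem_Collect_eq
  proof (intro conjI allI)
    have i: "(%t. pr (zero Q') t) \<in> gmod_hom A (infl j T) ?E" using ext_mod_in2[OF Q' T, of "j - 1"] by simp
    show "(%t. H (pr (zero Q') t)) \<in> mod_hom A (infl j T) P"
      by (rule mod_hom_comp[OF gmod_homD(1)[OF i] gmod_homD(1)[OF H(1)]])
    show "(%t. H (pr (zero Q') t)) ` component (infl j T :: ('u \<times> 'u, 'u) gmodule) i \<subseteq> component P i" for i
      by (rule image_subsetI) (rule gmod_homD(2)[OF H(1) gmod_homD(2)[OF i]])
  qed
  then have nu: "\<nu> \<in> mod_hom R T (D P j)"
  proof -
    assume n: "\<nu> \<in> gmod_hom A (infl j T) P"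
    show ?thesis
    proof (rule mod_homI)
      show "\<nu> t \<in> carrier (D P j)" if "t \<in> carrier T" for t using gmod_homD(2)[OF n, of t j] that by simp
      show "\<nu> (s \<oplus>\<^bsub>T\<^esub> t) = \<nu> s \<oplus>\<^bsub>D P j\<^esub> \<nu> t" if "s \<in> carrier T" "t \<in> carrier T" for s t
        using mod_homD(2)[OF gmod_homD(1)[OF n], of s t] that by simp
      show "\<nu> (t \<cdot>\<^bsub>T\<^esub> r) = \<nu> t \<cdot>\<^bsub>D P j\<^esub> r" if "t \<in> carrier T" "r \<in> carrier R" for t r
        using mod_homD(3)[OF gmod_homD(1)[OF n], of t "(r, (zero C))"] that by simp
    qed
  qed
  have \<nu>\<tau>: "\<nu> (\<tau> q c) = \<sigma> q \<cdot>\<^bsub>P\<^esub> ((zero R), c)" if q: "q \<in> carrier Q'" and c: "c \<in> carrier C" for q c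
    using mod_homD(3)[OF gmod_homD(1)[OF H(1)], of "pr q (zero T)" "((zero R), c)"] q c H(2)
    unfolding \<nu>_def ext_mod_gen[OF Q' T q c] by simp
  have \<sigma>c: "\<sigma> q \<in> component P (j - 1)" if "q \<in> carrier Q'" for q using mod_homD(1)[OF \<sigma>(1) that] by simp
  have \<pi>'c: "\<pi>' p \<in> carrier Q'" if "p \<in> component P (j - 1)" for p using mod_homD(1)[OF topD(2)[OF t']] that by simp
  \<comment> \<open>\<open>p\<close> and \<open>\<sigma> (\<pi>' p)\<close> differ by an element of
    the kernel of \<open>\<pi>'\<close>, which \<open>C\<close> annihilates by
    \<open>top_smult1\<close>; so the choice of the section does not matter.\<close>
  have \<nu>\<pi>: "\<nu> (\<tau> (\<pi>' p) c) = p \<cdot>\<^bsub>P\<^esub> ((zero R), c)" if p: "p \<in> component P (j - 1)" and c: "c \<in> carrier C" for p c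
  proof -
    let ?q = "\<sigma> (\<pi>' p)"
    have q: "?q \<in> component P (j - 1)" "?q \<in> carrier P" "\<ominus>\<^bsub>P\<^esub> ?q \<in> component P (j - 1)" "\<pi>' ?q = \<pi>' p"
      using \<sigma>c[OF \<pi>'c[OF p]] P.comp_carrier P.comp_neg \<sigma>(2) \<pi>'c[OF p] by simp_all
    note d = P.comp_add[OF p q(3)]
    have "p = (p \<oplus>\<^bsub>P\<^esub> \<ominus>\<^bsub>P\<^esub> ?q) \<oplus>\<^bsub>P\<^esub> ?q"
      using P.comp_carrier[OF p] q(2) by (simp add: P.M.a_assoc P.M.l_neg)
    then have "\<pi>' p = \<pi>' (p \<oplus>\<^bsub>P\<^esub> \<ominus>\<^bsub>P\<^esub> ?q) \<oplus>\<^bsub>Q'\<^esub> \<pi>' p"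
      using mod_homD(2)[OF topD(2)[OF t'], of "p \<oplus>\<^bsub>P\<^esub> \<ominus>\<^bsub>P\<^esub> ?q" ?q] d q by simp
    then have "\<pi>' (p \<oplus>\<^bsub>P\<^esub> \<ominus>\<^bsub>P\<^esub> ?q) = (zero Q')" using \<pi>'c[OF p] \<pi>'c[OF d] by simp
    from top_smult1[OF PG t' d this c] have z: "(p \<oplus>\<^bsub>P\<^esub> \<ominus>\<^bsub>P\<^esub> ?q) \<cdot>\<^bsub>P\<^esub> ((zero R), c) = (zero P)" .
    have "p \<cdot>\<^bsub>P\<^esub> ((zero R), c) = ((p \<oplus>\<^bsub>P\<^esub> \<ominus>\<^bsub>P\<^esub> ?q) \<oplus>\<^bsub>P\<^esub> ?q) \<cdot>\<^bsub>P\<^esub> ((zero R), c)"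
      using \<open>p = _\<close> by simp
    also have "\<dots> = (p \<oplus>\<^bsub>P\<^esub> \<ominus>\<^bsub>P\<^esub> ?q) \<cdot>\<^bsub>P\<^esub> ((zero R), c) \<oplus>\<^bsub>P\<^esub> ?q \<cdot>\<^bsub>P\<^esub> ((zero R), c)"
      using P.rsmult_add[OF P.comp_carrier[OF d] q(2), of "((zero R), c)"] c by simp
    finally show ?thesis using z \<nu>\<tau>[OF \<pi>'c[OF p] c] P.rsmult_closed[OF q(2), of "((zero R), c)"] c by simp
  qed
  have sp: "p1 ` carrier ?E = carrier (infl (j - 1) Q')"
    unfolding ext_mod_sel infl_sel using T.M.zero_closed by force
  \<comment> \<open>The component of this lift in \<open>T\<close>, restricted to degree j, is
    \<open>\<phi>\<close>. Its values on products of \<open>p\<close> with \<open>C\<close> follow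
    by linearity, because for \<open>p\<close> of degree j - 1 the element \<open>h p\<close> is the
    copy of \<open>\<pi>' p\<close>.\<close>
  obtain h where h: "h \<in> gmod_hom A P ?E" "\<forall>x\<in>carrier P. p1 (h x) = \<pi>' (P.hc (j - 1) x)"
    by (rule gr_proj_lift[OF P EG infl_graded[OF Q'] ext_mod_p1[OF Q' T] infl_hom_top(1)[OF PG t'] sp])
  have hE: "h x \<in> component ?E i" if "x \<in> component P i" for x i using gmod_homD(2)[OF h(1) that] .
  define \<phi> where "\<phi> = (%x. p2 (h x))"
  have hj: "\<exists>t\<in>carrier T. h x = pr (zero Q') t" if "x \<in> component P j" for x using hE[OF that] by auto
  have phi: "\<phi> \<in> mod_hom R (D P j) T"
  proof (rule mod_homI)
    show "\<phi> x \<in> carrier T" if "x \<in> carrier (D P j)" for x using hj[of x] that by (auto simp: \<phi>_def)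
    show "\<phi> (x \<oplus>\<^bsub>D P j\<^esub> y) = \<phi> x \<oplus>\<^bsub>T\<^esub> \<phi> y" if "x \<in> carrier (D P j)" "y \<in> carrier (D P j)" for x y
      using mod_homD(2)[OF gmod_homD(1)[OF h(1)], of x y] that P.comp_carrier by (simp add: \<phi>_def)
    fix x r assume x: "x \<in> carrier (D P j)" and r: "r \<in> carrier R"
    then obtain t where t: "t \<in> carrier T" "h x = pr (zero Q') t" using hj by auto
    show "\<phi> (x \<cdot>\<^bsub>D P j\<^esub> r) = \<phi> x \<cdot>\<^bsub>T\<^esub> r"
      using mod_homD(3)[OF gmod_homD(1)[OF h(1)], of x "(r, (zero C))"] x r t P.comp_carrier
        balanced_zero[OF Q' C T.M.abelian_group_axioms tensorD(2)[OF T]]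
      by (simp add: \<phi>_def T.rsmult_closed)
  qed
  have \<phi>p: "\<phi> (p \<cdot>\<^bsub>P\<^esub> ((zero R), c)) = \<tau> (\<pi>' p) c" if p: "p \<in> component P (j - 1)" and c: "c \<in> carrier C" for p c
  proof -
    obtain q where q: "q \<in> carrier Q'" "h p = pr q (zero T)" using hE[OF p] by auto
    have "q = \<pi>' p" using h(2)[rule_format, OF P.comp_carrier[OF p]] q(2) P.hc_homogeneous[OF p, of "j - 1"] by simp
    then have "h (p \<cdot>\<^bsub>P\<^esub> ((zero R), c)) = pr (zero Q') (\<tau> (\<pi>' p) c)"
      using mod_homD(3)[OF gmod_homD(1)[OF h(1)] P.comp_carrier[OF p], of "((zero R), c)"] c q ext_mod_gen[OF Q' T q(1) c, of "j - 1"]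
      by simp
    then show ?thesis by (simp add: \<phi>_def)
  qed
  show thesis
  proof (rule that[OF nu phi])
    show "\<forall>t\<in>carrier T. \<phi> (\<nu> t) = t"
    proof
      fix x assume x: "x \<in> carrier T"
      show "\<phi> (\<nu> x) = x"
        by (rule tensor_mod_hom_ext[OF C T Q' TM mod_hom_comp[OF nu phi] mod_hom_id _ x])
          (simp add: \<nu>\<tau> \<phi>p \<sigma>c \<sigma>(2))
    qed
    show "\<forall>x\<in>carrier T. \<pi> (\<nu> x) = (zero Q)"
    proof
      fix x assume x: "x \<in> carrier T"
      show "\<pi> (\<nu> x) = (zero Q)"
        by (rule tensor_mod_hom_ext[OF C T Q' Q mod_hom_comp[OF nu topD(2)[OF t]] mod_hom_const_zero[OF Q] _ x])
          (simp add: \<nu>\<tau> top_kills[OF PG t] \<sigma>c)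
    qed
    show "\<forall>x\<in>component P j. \<pi> x = (zero Q) --> x = \<nu> (\<phi> x)"
    proof (intro ballI impI)
      fix x assume x: "x \<in> component P j" "\<pi> x = (zero Q)"
      show "x = \<nu> (\<phi> x)"
        by (rule top_mod_ext[OF PG t DM mod_hom_id mod_hom_comp[OF phi nu] _ x]) (simp add: \<phi>p \<nu>\<pi>)
    qed
  qed (use \<nu>\<pi> in blast)
qed

end

section \<open>Degree parts and reductions of complexes\<close>

context triv_ext begin

sublocale Mod: perf_cat "Mod_cat R :: ('u, ('u, 'u, unit) module_ext) concrete_cat" mbp mkn "proj R"
  by (rule perf_cat_Mod)

sublocale Gr: perf_cat "GrMod_cat A G :: ('u, ('u \<times> 'u, 'u, ('u, unit) gmodule_ext) module_ext) concrete_cat" gbp gkn "gr_proj A G"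
  by (rule perf_cat_GrMod[OF GA])

interpretation M0: mod_cat0 "Mod_cat R :: ('v, ('u, 'v, unit) module_ext) concrete_cat" mkn
  by (rule mod_cat0_Mod)

interpretation G0: mod_cat0 "GrMod_cat A G :: ('v, ('u \<times> 'u, 'v, ('v, unit) gmodule_ext) module_ext) concrete_cat" gkn
  by (rule mod_cat0_GrMod[OF GA])

definition deg_cpx :: "('u \<times> 'u, 'v) gmod_cpx => int => ('u, 'v) mod_cpx"
  where "deg_cpx X j = \<lparr>obj = (%i. D (obj X i) j), diff = diff X\<rparr>"

lemma deg_cpx_sel [simp]: "obj (deg_cpx X j) i = D (obj X i) j" "diff (deg_cpx X j) = diff X"
  by (simp_all add: deg_cpx_def)

lemma gcpxD:
  fixes X :: "('u \<times> 'u, 'v) gmod_cpx"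
  assumes "X \<in> complexes (GrMod_cat A G)"
  shows "graded_module A G (obj X i)" "diff X i \<in> gmod_hom A (obj X i) (obj X (i + 1))"
  using G0.cpx_Ob[OF assms, of i] G0.cpx_diff_Hom[OF assms refl, of i] by simp_all

lemma deg_cpx_complex:
  assumes X: "X \<in> complexes (GrMod_cat A G)"
  shows "deg_cpx X j \<in> complexes (Mod_cat R)"
proof (rule M0.complexesI)
  show "obj (deg_cpx X j) i \<in> Ob (Mod_cat R)" for i using deg_part_module[OF gcpxD(1)[OF X]] by simp
  show "diff (deg_cpx X j) i \<in> Hom (Mod_cat R) (obj (deg_cpx X j) i) (obj (deg_cpx X j) (i + 1))" for i
    using deg_part_hom[OF gcpxD(2)[OF X] gcpxD(1)[OF X]] by simp
  show "diff (deg_cpx X j) (i + 1) (diff (deg_cpx X j) i x) = (zero (obj (deg_cpx X j) (i + 2)))"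
    if "x \<in> carrier (obj (deg_cpx X j) i)" for i x
    using G0.cpx_diff_diff[OF X, of x i "i + 1"] graded_module.comp_carrier[OF gcpxD(1)[OF X]] that by (simp add: add.assoc)
qed

text \<open>Taking the component of degree j commutes with graded maps, so preimages and bounding
  elements can be replaced by homogeneous ones.\<close>

lemma deg_cpx_qis:
  assumes X: "X \<in> complexes (GrMod_cat A G)" and Y: "Y \<in> complexes (GrMod_cat A G)" and q: "G0.qis X Y f"
  shows "M0.qis (deg_cpx X j) (deg_cpx Y j) f"
  unfolding M0.qis_def
proof (intro conjI allI ballI impI)
  note f = G0.qisD(1)[OF q]
  have fh: "f i \<in> gmod_hom A (obj X i) (obj Y i)" for i using G0.chain_map_Hom[OF f, of i] by simp
  note XG = gcpxD(1)[OF X] and YG = gcpxD(1)[OF Y]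
  let ?hX = "%i. graded_module.hc (obj X i) j" and ?hY = "%i. graded_module.hc (obj Y i) j"
  note cX = graded_module.comp_carrier[OF XG] and cY = graded_module.comp_carrier[OF YG]
  note dX = gmod_hom_hc[OF gcpxD(2)[OF X] XG XG] and dY = gmod_hom_hc[OF gcpxD(2)[OF Y] YG YG]
  show "f \<in> chain_maps (Mod_cat R) (deg_cpx X j) (deg_cpx Y j)"
  proof (rule M0.chain_mapsI)
    show "f i \<in> Hom (Mod_cat R) (obj (deg_cpx X j) i) (obj (deg_cpx Y j) i)" for i
      using deg_part_hom[OF fh XG] by simp
    show "f (i + 1) (diff (deg_cpx X j) i x) = diff (deg_cpx Y j) i (f i x)" if "x \<in> carrier (obj (deg_cpx X j) i)" for i x
      using G0.chain_map_diff[OF f _ refl, of x i] cX that by simp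
  qed
  fix i
  show "x \<in> coboundaries (deg_cpx X j) i"
    if x: "x \<in> cocycles (deg_cpx X j) i" and fx: "f i x \<in> coboundaries (deg_cpx Y j) i" for x
  proof -
    have xj: "x \<in> component (obj X i) j" "x \<in> cocycles X i" using x cX unfolding cocycles_def by auto
    have "f i x \<in> coboundaries Y i" using fx cY unfolding coboundaries_def by auto
    from G0.qisD(2)[OF q xj(2) this] obtain w where w: "w \<in> carrier (obj X (i - 1))" "x = diff X (i - 1) w"
      unfolding coboundaries_def by blast
    have "diff X (i - 1) (?hX (i - 1) w) = x"
      using dX[of w "i - 1" j] w graded_module.hc_homogeneous[OF XG xj(1), of j] by simp
    then show ?thesis using graded_module.hc(1)[OF XG w(1), of j] unfolding coboundaries_def deg_cpx_sel by force
  qed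
  show "\<exists>x\<in>cocycles (deg_cpx X j) i. \<exists>b\<in>coboundaries (deg_cpx Y j) i. y = f i x \<oplus>\<^bsub>obj (deg_cpx Y j) i\<^esub> b"
    if y: "y \<in> cocycles (deg_cpx Y j) i" for y
  proof -
    have yj: "y \<in> component (obj Y i) j" "y \<in> cocycles Y i" using y cY unfolding cocycles_def by auto
    obtain x b where x: "x \<in> cocycles X i" and b: "b \<in> coboundaries Y i" and e: "y = f i x \<oplus>\<^bsub>obj Y i\<^esub> b"
      using G0.qisD(3)[OF q yj(2)] by blast
    obtain w where w: "w \<in> carrier (obj Y (i - 1))" "b = diff Y (i - 1) w" using b unfolding coboundaries_def by blast
    have xc: "x \<in> carrier (obj X i)" and x0: "diff X i x = (zero (obj X (i + 1)))" using x unfolding cocycles_def by auto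
    have fx: "f i x \<in> carrier (obj Y i)" by (rule G0.chain_map_closed[OF f xc])
    have bc: "b \<in> carrier (obj Y i)" using G0.cpx_diff_closed[OF Y w(1), of i] w(2) by simp
    have "diff X i (?hX i x) = (zero (obj X (i + 1)))"
      using dX[OF xc, of j] x0 graded_module.hc_zero[OF XG, of "i + 1" j] by simp
    then have 1: "?hX i x \<in> cocycles (deg_cpx X j) i"
      using graded_module.hc(1)[OF XG xc, of j] unfolding cocycles_def by simp
    have "?hY i b = diff Y (i - 1) (?hY (i - 1) w)" using dY[of w "i - 1" j] w by simp
    then have 2: "?hY i b \<in> coboundaries (deg_cpx Y j) i"
      using graded_module.hc(1)[OF YG w(1), of j] unfolding coboundaries_def deg_cpx_sel by simp
    have "y = f i (?hX i x) \<oplus>\<^bsub>obj Y i\<^esub> ?hY i b"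
      using graded_module.hc_add[OF YG fx bc, of j] gmod_hom_hc[OF fh XG YG xc, of j] graded_module.hc_homogeneous[OF YG yj(1), of j] e
      by simp
    then show ?thesis using 1 2 by (intro bexI[of _ "?hX i x"] bexI[of _ "?hY i b"]) simp_all
  qed
qed

text \<open>The quotients are chosen independently for all pairs of degrees; the differential of
  \<open>P\<close> descends to them because it commutes with the action of \<open>C\<close>.\<close>

lemma gr_top_cpx:
  fixes P :: "('u \<times> 'u, 'v) gmod_cpx"
  assumes Pc: "P \<in> complexes (GrMod_cat A G)"
  obtains Q \<pi> where "!!i j. top (obj P i) j (obj (Q j) i) (\<pi> j i)" "!!j. Q j \<in> complexes (Mod_cat R)"
    "!!i j x. x \<in> component (obj P i) j ==> diff (Q j) i (\<pi> j i x) = \<pi> j (i + 1) (diff P i x)"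
proof -
  note PG = gcpxD(1)[OF Pc] and PD = gcpxD(2)[OF Pc]
  note DM = deg_part_module[OF PG]
  have "\<forall>z. \<exists>q. top (obj P (fst z)) (snd z) (fst q) (snd q)"
    using ex_top[OF PG] by (metis fst_conv snd_conv)
  from choice[OF this] obtain q where q: "!!z. top (obj P (fst z)) (snd z) (fst (q z)) (snd (q z))" by blast
  define Q0 where "Q0 = (%j i. fst (q (i, j)))"
  define \<pi> where "\<pi> = (%j i. snd (q (i, j)))"
  have t: "top (obj P i) j (Q0 j i) (\<pi> j i)" for i j using q[of "(i, j)"] by (simp add: Q0_def \<pi>_def)
  note tD = topD[OF t]
  note pd = mod_hom_comp[OF deg_part_hom[OF PD PG] tD(2)]
  have dc: "diff P i x \<in> component (obj P (i + 1)) j" if "x \<in> component (obj P i) j" for i j x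
    by (rule gmod_homD(2)[OF PD that])
  have ds: "diff P i (p \<cdot>\<^bsub>obj P i\<^esub> ((zero R), c)) = diff P i p \<cdot>\<^bsub>obj P (i + 1)\<^esub> ((zero R), c)"
    if "p \<in> component (obj P i) j" "c \<in> carrier C" for i j p c
    using mod_homD(3)[OF gmod_homD(1)[OF PD] graded_module.comp_carrier[OF PG that(1)], of "((zero R), c)"] that(2) by simp
  have pk: "\<pi> j (i + 1) (diff P i (p \<cdot>\<^bsub>obj P i\<^esub> ((zero R), c))) = (zero (Q0 j (i + 1)))"
    if "p \<in> component (obj P i) (j - 1)" "c \<in> carrier C" for i j p c
    unfolding ds[OF that] by (rule top_kills[OF PG t dc[OF that(1)] that(2)])
  have "\<forall>z. \<exists>h. h \<in> mod_hom R (Q0 (snd z) (fst z)) (Q0 (snd z) (fst z + 1)) \<and>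
      (\<forall>x\<in>component (obj P (fst z)) (snd z). h (\<pi> (snd z) (fst z) x) = \<pi> (snd z) (fst z + 1) (diff P (fst z) x))"
    using top_factor[OF PG t tD(1) pd pk] by metis
  from choice[OF this] obtain dq where dq: "!!z. dq z \<in> mod_hom R (Q0 (snd z) (fst z)) (Q0 (snd z) (fst z + 1))"
    "!!z x. x \<in> component (obj P (fst z)) (snd z) ==>
      dq z (\<pi> (snd z) (fst z) x) = \<pi> (snd z) (fst z + 1) (diff P (fst z) x)" by blast
  define Q where "Q = (%j. \<lparr>obj = Q0 j, diff = (%i. dq (i, j))\<rparr>)"
  have Qo: "obj (Q j) i = Q0 j i" and Qd: "diff (Q j) i \<in> mod_hom R (Q0 j i) (Q0 j (i + 1))"
    and Q\<pi>: "x \<in> component (obj P i) j ==> diff (Q j) i (\<pi> j i x) = \<pi> j (i + 1) (diff P i x)" for i j x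
    using dq(1)[of "(i, j)"] dq(2)[of x "(i, j)"] by (simp_all add: Q_def)
  have \<pi>s: "\<exists>p\<in>component (obj P i) j. x = \<pi> j i p" if "x \<in> carrier (Q0 j i)" for x i j
    using tD(3) that by blast
  have Qc: "Q j \<in> complexes (Mod_cat R)" for j
  proof (rule M0.complexesI)
    show "obj (Q j) i \<in> Ob (Mod_cat R)" for i using tD(1) by (simp add: Qo)
    show "diff (Q j) i \<in> Hom (Mod_cat R) (obj (Q j) i) (obj (Q j) (i + 1))" for i using Qd by (simp add: Qo)
    fix i x assume "x \<in> carrier (obj (Q j) i)"
    then obtain p where p: "p \<in> component (obj P i) j" "x = \<pi> j i p" using \<pi>s unfolding Qo by blast
    have "diff P (i + 1) (diff P i p) = (zero (obj P (i + 2)))"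
      using G0.cpx_diff_diff[OF Pc graded_module.comp_carrier[OF PG p(1)] refl] by (simp add: add.assoc)
    then have "diff (Q j) (i + 1) (diff (Q j) i x) = \<pi> j (i + 2) (zero (obj P (i + 2)))"
      using p Q\<pi>[OF p(1)] Q\<pi>[OF dc[OF p(1)]] by (simp add: add.assoc)
    then show "diff (Q j) (i + 1) (diff (Q j) i x) = (zero (obj (Q j) (i + 2)))"
      using mod_hom_zero[OF tD(2) DM tD(1)] by (simp add: Qo)
  qed
  show thesis by (rule that[of Q \<pi>]) (use t Qo Qc Q\<pi> in simp_all)
qed

lemma gr_smult1_diff:
  fixes P :: "('u \<times> 'u, 'v) gmod_cpx"
  assumes Pc: "P \<in> complexes (GrMod_cat A G)" and p: "p \<in> component (obj P i) j" "c \<in> carrier C"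
  shows "diff P i (p \<cdot>\<^bsub>obj P i\<^esub> ((zero R), c)) = diff P i p \<cdot>\<^bsub>obj P (i + 1)\<^esub> ((zero R), c)"
  using mod_homD(3)[OF gmod_homD(1)[OF gcpxD(2)[OF Pc]] graded_module.comp_carrier[OF gcpxD(1)[OF Pc] p(1)], of "((zero R), c)"] p(2)
  by simp

lemma top_zero:
  assumes P: "graded_module A G P" and t: "top P j Q \<pi>" and z: "carrier P = {(zero P)}"
  shows "carrier Q = {(zero Q)}"
proof -
  have "component P j = {(zero P)}" using z graded_module.comp_carrier[OF P] graded_module.comp_zero[OF P] by blast
  then show ?thesis using topD(3)[OF t] mod_hom_zero[OF topD(2)[OF t] deg_part_module[OF P] topD(1)[OF t]] by auto
qed

text \<open>By \<open>top_split\<close> the sequence of \<open>T\<close>, the part of degree j of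
  \<open>P\<close> and \<open>Q j\<close> is split exact in every complex degree. The last two
  conclusions are the cases of its long exact sequence in which the middle or the left term is
  acyclic.\<close>

lemma gr_perf_structure:
  assumes P: "Gr.perf P"
  obtains Q where "!!j. Mod.perf (Q j)" "finite {j. \<not> zero_cpx (Q j)}"
    "!!j T \<tau>. tens R C (Q (j - 1)) T \<tau> ==> acyclic_cpx (deg_cpx P j) ==> \<exists>\<theta>. Mod.qis (shift (Q j)) T \<theta>"
    "!!j T \<tau>. tens R C (Q (j - 1)) T \<tau> ==> acyclic_cpx T ==> \<exists>e. Mod.qis (deg_cpx P j) (Q j) e"
proof -
  have Pc: "P \<in> complexes (GrMod_cat A G)" and Pp: "!!i. obj P i \<in> gr_proj A G"
    and Pb: "finite {i. carrier (obj P i) \<noteq> {(zero (obj P i))}}"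
    using P by (simp_all add: Gr.perf_def bounded_cpx_def)
  note PG = gcpxD(1)[OF Pc] and PD = gcpxD(2)[OF Pc]
  note DM = deg_part_module[OF PG]
  obtain Q \<pi> where t: "!!i j. top (obj P i) j (obj (Q j) i) (\<pi> j i)" and Qc: "!!j. Q j \<in> complexes (Mod_cat R)"
    and Q\<pi>: "!!i j x. x \<in> component (obj P i) j ==> diff (Q j) i (\<pi> j i x) = \<pi> j (i + 1) (diff P i x)"
    by (rule gr_top_cpx[OF Pc], rule that; assumption)
  define Q0 where "Q0 = (%j. obj (Q j))"
  have Qo: "obj (Q j) i = Q0 j i" for i j by (simp add: Q0_def)
  note t = t[unfolded Qo]
  note tD = topD[OF t]
  have dc: "diff P i x \<in> component (obj P (i + 1)) j" if "x \<in> component (obj P i) j" for i j x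
    by (rule gmod_homD(2)[OF PD that])
  note ds = gr_smult1_diff[OF Pc]
  have \<pi>s: "\<exists>p\<in>component (obj P i) j. x = \<pi> j i p" if "x \<in> carrier (Q0 j i)" for x i j
    using tD(3) that by blast
  note z = top_zero[OF PG t]
  have "finite {i. carrier (obj (Q j) i) \<noteq> {(zero (obj (Q j) i))}}" for j
    by (rule finite_subset[OF _ Pb]) (use z Qo in auto)
  then have 1: "Mod.perf (Q j)" for j
    unfolding Mod.perf_def bounded_cpx_def using Qc top_proj[OF Pp t] by (simp add: Qo)
  \<comment> \<open>The complex has finitely many nonzero terms, and each reaches only finitely many
    internal degrees by \<open>top_bounded\<close>.\<close>
  have "{j. \<not> zero_cpx (Q j)} \<subseteq> (\<Union>i\<in>{i. carrier (obj P i) \<noteq> {(zero (obj P i))}}. {j. carrier (Q0 j i) \<noteq> {(zero (Q0 j i))}})"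
    using z by (auto simp: zero_cpx_def Qo)
  then have 2: "finite {j. \<not> zero_cpx (Q j)}"
    by (rule finite_subset) (use Pb top_bounded[OF PG gr_projD(2)[OF Pp] t] in blast)
  have 3: "(acyclic_cpx (deg_cpx P j) --> (\<exists>\<theta>. Mod.qis (shift (Q j)) T \<theta>)) \<and>
      (acyclic_cpx T --> (\<exists>e. Mod.qis (deg_cpx P j) (Q j) e))" if T: "tens R C (Q (j - 1)) T \<tau>" for j T \<tau>
  proof -
    have Tt: "is_tensor R (Q0 (j - 1) i) C (obj T i) (\<tau> i)" for i using tensD(2)[OF C T, of i] by (simp add: Qo)
    have Tc: "T \<in> complexes (Mod_cat R)" by (rule tensD(1)[OF C T])
    have "\<forall>i. \<exists>w. fst w \<in> mod_hom R (obj T i) (D (obj P i) j) \<and> snd w \<in> mod_hom R (D (obj P i) j) (obj T i) \<and>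
      (\<forall>p\<in>component (obj P i) (j - 1). \<forall>c\<in>carrier C. fst w (\<tau> i (\<pi> (j - 1) i p) c) = p \<cdot>\<^bsub>obj P i\<^esub> ((zero R), c)) \<and>
      (\<forall>t\<in>carrier (obj T i). snd w (fst w t) = t) \<and> (\<forall>t\<in>carrier (obj T i). \<pi> j i (fst w t) = (zero (Q0 j i))) \<and>
      (\<forall>x\<in>component (obj P i) j. \<pi> j i x = (zero (Q0 j i)) --> x = fst w (snd w x))" (is "\<forall>i. ?E i")
    proof
      fix i
      obtain \<nu> \<phi> where "\<nu> \<in> mod_hom R (obj T i) (D (obj P i) j)" "\<phi> \<in> mod_hom R (D (obj P i) j) (obj T i)"
        "\<forall>p\<in>component (obj P i) (j - 1). \<forall>c\<in>carrier C. \<nu> (\<tau> i (\<pi> (j - 1) i p) c) = p \<cdot>\<^bsub>obj P i\<^esub> ((zero R), c)"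
        "\<forall>t\<in>carrier (obj T i). \<phi> (\<nu> t) = t" "\<forall>t\<in>carrier (obj T i). \<pi> j i (\<nu> t) = (zero (Q0 j i))"
        "\<forall>x\<in>component (obj P i) j. \<pi> j i x = (zero (Q0 j i)) --> x = \<nu> (\<phi> x)"
        by (rule top_split[OF Pp t t Tt])
      then show "?E i" by (intro exI[of _ "(\<nu>, \<phi>)"]) simp
    qed
    from choice[OF this] obtain w where w: "!!i. fst (w i) \<in> mod_hom R (obj T i) (D (obj P i) j)"
      "!!i. snd (w i) \<in> mod_hom R (D (obj P i) j) (obj T i)"
      "!!i p c. p \<in> component (obj P i) (j - 1) ==> c \<in> carrier C ==>
        fst (w i) (\<tau> i (\<pi> (j - 1) i p) c) = p \<cdot>\<^bsub>obj P i\<^esub> ((zero R), c)"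
      "!!i t. t \<in> carrier (obj T i) ==> snd (w i) (fst (w i) t) = t"
      "!!i t. t \<in> carrier (obj T i) ==> \<pi> j i (fst (w i) t) = (zero (Q0 j i))"
      "!!i x. x \<in> component (obj P i) j ==> \<pi> j i x = (zero (Q0 j i)) ==> x = fst (w i) (snd (w i) x)" by blast
    have "\<forall>i. \<exists>\<sigma>. \<sigma> \<in> mod_hom R (Q0 j i) (D (obj P i) j) \<and> (\<forall>q\<in>carrier (Q0 j i). \<pi> j i (\<sigma> q) = q)"
      using top_section[OF Pp t] by metis
    from choice[OF this] obtain \<sigma> where \<sigma>: "!!i. \<sigma> i \<in> mod_hom R (Q0 j i) (D (obj P i) j)"
      "!!i q. q \<in> carrier (Q0 j i) ==> \<pi> j i (\<sigma> i q) = q" by blast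
    note Fc = deg_cpx_complex[OF Pc, of j]
    have \<nu>: "(%i. fst (w i)) \<in> chain_maps (Mod_cat R) T (deg_cpx P j)"
    proof (rule Mod.chain_mapsI)
      show "fst (w i) \<in> Hom (Mod_cat R) (obj T i) (obj (deg_cpx P j) i)" for i using w(1) by simp
      fix i x assume x: "x \<in> carrier (obj T i)"
      have dT: "diff T i \<in> mod_hom R (obj T i) (obj T (i + 1))" using Mod.cpx_diff_Hom[OF Tc refl, of i] by simp
      show "fst (w (i + 1)) (diff T i x) = diff (deg_cpx P j) i (fst (w i) x)" unfolding deg_cpx_sel
      proof (rule tensor_mod_hom_ext[OF C Tt tD(1) DM mod_hom_comp[OF dT w(1)] mod_hom_comp[OF w(1) deg_part_hom[OF PD PG]] _ x])
        fix y c assume "y \<in> carrier (Q0 (j - 1) i)" and c: "c \<in> carrier C"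
        then obtain p where p: "p \<in> component (obj P i) (j - 1)" "y = \<pi> (j - 1) i p" using \<pi>s by blast
        have "y \<in> carrier (obj (Q (j - 1)) i)" using \<open>y \<in> carrier (Q0 (j - 1) i)\<close> Qo by simp
        then have "diff T i (\<tau> i y c) = \<tau> (i + 1) (\<pi> (j - 1) (i + 1) (diff P i p)) c"
          using tensD(3)[OF C T _ c refl, of y i] Q\<pi>[OF p(1)] p(2) by simp
        then show "fst (w (i + 1)) (diff T i (\<tau> i y c)) = diff P i (fst (w i) (\<tau> i y c))"
          using w(3)[OF dc[OF p(1)] c] w(3)[OF p(1) c] ds[OF p(1) c] p(2) by simp
      qed
    qed
    have \<pi>: "\<pi> j \<in> chain_maps (Mod_cat R) (deg_cpx P j) (Q j)"
      by (rule Mod.chain_mapsI) (use tD(2) Q\<pi> in \<open>simp_all add: Qo\<close>)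
    have ex: "\<exists>x\<in>carrier (obj T i). y = fst (w i) x"
      if "y \<in> carrier (obj (deg_cpx P j) i)" "\<pi> j i y = (zero (obj (Q j) i))" for i y
      using w(6)[of y i] mod_homD(1)[OF w(2), of y i] that by (intro bexI[of _ "snd (w i) y"]) (simp_all add: Qo)
    have ze: "\<pi> j i (fst (w i) x) = (zero (obj (Q j) i))" if "x \<in> carrier (obj T i)" for i x using w(5)[OF that] by (simp add: Qo)
    have "\<exists>\<theta>. Mod.qis (shift (Q j)) T \<theta>" if ac: "acyclic_cpx (deg_cpx P j)"
    proof -
      obtain \<theta> where "Mod.qis (shift (Q j)) T \<theta>"
        by (rule Mod.connecting_qis[OF Tc Fc Qc \<nu> \<pi> ex ze, of "%i. snd (w i)" \<sigma>])
          (use w(2,4) \<sigma> ac in \<open>simp_all add: Qo\<close>)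
      then show ?thesis by blast
    qed
    moreover have "Mod.qis (deg_cpx P j) (Q j) (\<pi> j)" if ac: "acyclic_cpx T"
    proof (rule Mod.ses_qis[OF Tc Fc Qc \<nu> \<pi> _ ze ex _ ac])
      show "x = (zero (obj T i))" if "x \<in> carrier (obj T i)" "fst (w i) x = (zero (obj (deg_cpx P j) i))" for i x
        using w(4)[OF that(1)] that(2) mod_hom_zero[OF w(2) DM tensorD(1)[OF Tt], of i] by simp
      show "\<pi> j i ` carrier (obj (deg_cpx P j) i) = carrier (obj (Q j) i)" for i using tD(4) by (simp add: Qo)
    qed
    ultimately show ?thesis by blast
  qed
  show thesis by (rule that[OF 1 2]) (use 3 in blast)+
qed

end

section \<open>Contracting the kernel of the reduction, in an arbitrary universe\<close>

context triv_ext begin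

interpretation M0: mod_cat0 "Mod_cat R :: ('v, ('u, 'v, unit) module_ext) concrete_cat" mkn
  by (rule mod_cat0_Mod)

interpretation G0: mod_cat0 "GrMod_cat A G :: ('v, ('u \<times> 'u, 'v, ('v, unit) gmodule_ext) module_ext) concrete_cat" gkn
  by (rule mod_cat0_GrMod[OF GA])

text \<open>A contraction of \<open>Q'\<close> lifts to graded maps \<open>H\<close> on
  \<open>P\<close>, which act on degree j as well. In degree j - 1 the sum \<open>d H + H d\<close>
  is the identity up to the kernel of \<open>\<pi>'\<close>, which \<open>C\<close> annihilates;
  hence it is exactly the identity on products with \<open>C\<close>, and so on the kernel of
  \<open>\<pi>\<close>.\<close>

lemma qis_top_if_acyclic:
  fixes P :: "('u \<times> 'u, 'v) gmod_cpx" and Q Q' :: "('u, 'v) mod_cpx"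
  assumes Pc: "P \<in> complexes (GrMod_cat A G)" and Pp: "!!i. obj P i \<in> gr_proj A G"
    and Q'c: "Q' \<in> complexes (Mod_cat R)" and Qc: "Q \<in> complexes (Mod_cat R)"
    and t': "!!i. top (obj P i) (j - 1) (obj Q' i) (\<pi>' i)" and t: "!!i. top (obj P i) j (obj Q i) (\<pi> i)"
    and \<pi>': "!!i x. x \<in> component (obj P i) (j - 1) ==> diff Q' i (\<pi>' i x) = \<pi>' (i + 1) (diff P i x)"
    and \<pi>: "!!i x. x \<in> component (obj P i) j ==> diff Q i (\<pi> i x) = \<pi> (i + 1) (diff P i x)"
    and K: "K_projective (Mod_cat R) Q'" and ac: "acyclic_cpx Q'"
  shows "M0.qis (deg_cpx P j) Q \<pi>"
proof -
  note PG = gcpxD(1)[OF Pc] and PD = gcpxD(2)[OF Pc]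
  note DM = deg_part_module[OF PG]
  have QM: "right_module R (obj Q i)" and Q'M: "right_module R (obj Q' i)" for i
    using M0.cpx_Ob[OF Qc, of i] M0.cpx_Ob[OF Q'c, of i] by simp_all
  note Fc = deg_cpx_complex[OF Pc, of j]
  have dD: "diff P i \<in> mod_hom R (D (obj P i) j) (D (obj P (i + 1)) j)" for i j by (rule deg_part_hom[OF PD PG])
  have dc: "diff P i x \<in> component (obj P (i + 1)) j" if "x \<in> component (obj P i) j" for i j x by (rule gmod_homD(2)[OF PD that])
  have "homotopic (Mod_cat R) Q' Q' (%i x. x) (%i x. (zero (obj Q' i)))"
    using K Q'c ac M0.chain_map_id[OF Q'c] unfolding K_projective_def by blast
  then obtain h where h: "!!i. h i \<in> mod_hom R (obj Q' i) (obj Q' (i - 1))"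
    and hh: "!!i x. x \<in> carrier (obj Q' i) ==>
      x = (zero (obj Q' i)) \<oplus>\<^bsub>obj Q' i\<^esub> (diff Q' (i - 1) (h i x) \<oplus>\<^bsub>obj Q' i\<^esub> h (i + 1) (diff Q' i x))"
    unfolding homotopic_def Hom_Mod_cat by blast
  \<comment> \<open>The contraction, inflated to degree j - 1, is lifted through the surjection of
    \<open>P\<close> onto the inflation of \<open>Q'\<close>. The lifts need not satisfy any
    homotopy identity on all of \<open>P\<close>.\<close>
  have "\<exists>H. H \<in> gmod_hom A (obj P i) (obj P (i - 1)) \<and>
      (\<forall>p\<in>component (obj P i) (j - 1). \<pi>' (i - 1) (H p) = h i (\<pi>' i p))" for i
  proof -
    let ?f = "%x. h i (\<pi>' i (graded_module.hc (obj P i) (j - 1) x))"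
    have f: "?f \<in> gmod_hom A (obj P i) (infl (j - 1) (obj Q' (i - 1)))"
      by (rule infl_hom_of_deg_part[OF PG Q'M mod_hom_comp[OF topD(2)[OF t'] h]])
        (use top_kills[OF PG t'] mod_hom_zero[OF h Q'M Q'M] in simp)
    obtain H where H: "H \<in> gmod_hom A (obj P i) (obj P (i - 1))"
      "\<forall>p\<in>carrier (obj P i). \<pi>' (i - 1) (graded_module.hc (obj P (i - 1)) (j - 1) (H p)) = ?f p"
      by (rule gr_proj_lift[OF Pp PG infl_graded[OF Q'M] infl_hom_top(1)[OF PG t'] f infl_hom_top(2)[OF PG t']])
    have "\<pi>' (i - 1) (H p) = h i (\<pi>' i p)" if p: "p \<in> component (obj P i) (j - 1)" for p
      using H(2)[rule_format, OF graded_module.comp_carrier[OF PG p]] graded_module.hc_homogeneous[OF PG p, of "j - 1"]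
        graded_module.hc_homogeneous[OF PG gmod_homD(2)[OF H(1) p], of "j - 1"] by simp
    then show ?thesis using H(1) by blast
  qed
  then obtain H where H: "!!i. H i \<in> gmod_hom A (obj P i) (obj P (i - 1))"
    and H\<pi>: "!!i p. p \<in> component (obj P i) (j - 1) ==> \<pi>' (i - 1) (H i p) = h i (\<pi>' i p)" by metis
  have HD: "H i \<in> mod_hom R (D (obj P i) j) (D (obj P (i - 1)) j)" for i j by (rule deg_part_hom[OF H PG])
  have Hc: "H i x \<in> component (obj P (i - 1)) j" if "x \<in> component (obj P i) j" for i j x by (rule gmod_homD(2)[OF H that])
  have H1: "H i (p \<cdot>\<^bsub>obj P i\<^esub> ((zero R), c)) = H i p \<cdot>\<^bsub>obj P (i - 1)\<^esub> ((zero R), c)"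
    if "p \<in> component (obj P i) k" "c \<in> carrier C" for i p c k
    using mod_homD(3)[OF gmod_homD(1)[OF H] graded_module.comp_carrier[OF PG that(1)], of "((zero R), c)"] that(2) by simp
  have Hk: "\<pi> (i - 1) (H i x) = (zero (obj Q (i - 1)))" if x: "x \<in> component (obj P i) j" "\<pi> i x = (zero (obj Q i))" for i x
    by (rule top_mod_ext[OF PG t QM mod_hom_comp[OF HD topD(2)[OF t]] mod_hom_const_zero[OF QM] _ x])
      (simp add: H1 top_kills[OF PG t] Hc)
  have dH: "diff P (i - 1) \<in> mod_hom R (D (obj P (i - 1)) k) (D (obj P i) k)" for i k using dD[of "i - 1" k] by simp
  have Hd: "H (i + 1) \<in> mod_hom R (D (obj P (i + 1)) k) (D (obj P i) k)" for i k using HD[of "i + 1" k] by simp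
  \<comment> \<open>By \<open>top_mod_ext\<close> it suffices to compare both sides on products of
    elements of degree j - 1 with \<open>C\<close>.\<close>
  have con: "x = diff P (i - 1) (H i x) \<oplus>\<^bsub>obj P i\<^esub> H (i + 1) (diff P i x)"
    if x: "x \<in> component (obj P i) j" "\<pi> i x = (zero (obj Q i))" for i x
  proof -
    interpret P: graded_module A G "obj P i" by (rule PG)
    interpret Q': right_module R "obj Q' i" by (rule Q'M)
    note s = mod_hom_add[OF mod_hom_comp[OF HD dH] mod_hom_comp[OF dD Hd] DM]
    have "x = diff P (i - 1) (H i x) \<oplus>\<^bsub>D (obj P i) j\<^esub> H (i + 1) (diff P i x)"
    proof (rule top_mod_ext[OF PG t DM mod_hom_id s _ x])
      fix p c assume p: "p \<in> component (obj P i) (j - 1)" and c: "c \<in> carrier C"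
      have a: "diff P (i - 1) (H i p) \<in> component (obj P i) (j - 1)" using dc[OF Hc[OF p]] by simp
      have b: "H (i + 1) (diff P i p) \<in> component (obj P i) (j - 1)" using Hc[OF dc[OF p]] by simp
      note m = mod_homD[OF topD(2)[OF t'[of i]]]
      let ?s = "diff P (i - 1) (H i p) \<oplus>\<^bsub>obj P i\<^esub> H (i + 1) (diff P i p)"
      note sc = P.comp_add[OF a b]
      have pc: "\<pi>' i y \<in> carrier (obj Q' i)" if "y \<in> component (obj P i) (j - 1)" for y using m(1) that by simp
      have "\<pi>' i ?s = \<pi>' i (diff P (i - 1) (H i p)) \<oplus>\<^bsub>obj Q' i\<^esub> \<pi>' i (H (i + 1) (diff P i p))"
        using m(2)[of "diff P (i - 1) (H i p)" "H (i + 1) (diff P i p)"] a b by simp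
      also have "\<dots> = diff Q' (i - 1) (h i (\<pi>' i p)) \<oplus>\<^bsub>obj Q' i\<^esub> h (i + 1) (diff Q' i (\<pi>' i p))"
        using \<pi>'[OF Hc[OF p]] H\<pi>[OF p] H\<pi>[OF dc[OF p]] \<pi>'[OF p] by simp
      also have "\<dots> = \<pi>' i p"
      proof -
        have dh: "diff Q' (i - 1) (h i (\<pi>' i p)) \<in> carrier (obj Q' i)"
          using M0.cpx_diff_closed[OF Q'c, of "h i (\<pi>' i p)" "i - 1" i] mod_homD(1)[OF h pc[OF p]] by simp
        have "diff Q' i (\<pi>' i p) \<in> carrier (obj Q' (i + 1))" by (rule M0.cpx_diff_closed[OF Q'c pc[OF p] refl])
        then have hd: "h (i + 1) (diff Q' i (\<pi>' i p)) \<in> carrier (obj Q' i)" using mod_homD(1)[OF h[of "i + 1"]] by simp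
        show ?thesis using hh[OF pc[OF p]] dh hd by simp
      qed
      finally have e: "\<pi>' i ?s = \<pi>' i p" .
      have n: "\<ominus>\<^bsub>obj P i\<^esub> p \<in> component (obj P i) (j - 1)" by (rule P.comp_neg[OF p])
      have "\<pi>' i p \<oplus>\<^bsub>obj Q' i\<^esub> \<pi>' i (\<ominus>\<^bsub>obj P i\<^esub> p) = \<pi>' i (p \<oplus>\<^bsub>obj P i\<^esub> \<ominus>\<^bsub>obj P i\<^esub> p)"
        using m(2)[of p "\<ominus>\<^bsub>obj P i\<^esub> p"] p n by simp
      also have "\<dots> = (zero (obj Q' i))"
        using mod_hom_zero[OF topD(2)[OF t'[of i]] DM Q'M] P.comp_carrier[OF p] by (simp add: P.M.r_neg)
      finally have "\<pi>' i (?s \<oplus>\<^bsub>obj P i\<^esub> \<ominus>\<^bsub>obj P i\<^esub> p) = (zero (obj Q' i))" using m(2)[of ?s "\<ominus>\<^bsub>obj P i\<^esub> p"] sc n e by simp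
      from top_smult1[OF PG t' P.comp_add[OF sc n] this c]
      have z: "(?s \<oplus>\<^bsub>obj P i\<^esub> \<ominus>\<^bsub>obj P i\<^esub> p) \<cdot>\<^bsub>obj P i\<^esub> ((zero R), c) = (zero (obj P i))" .
      have cA: "((zero R), c) \<in> carrier A" using c by simp
      note cc = P.comp_carrier[OF p] P.comp_carrier[OF a] P.comp_carrier[OF b] P.comp_carrier[OF sc] P.comp_carrier[OF n]
      have "?s = (?s \<oplus>\<^bsub>obj P i\<^esub> \<ominus>\<^bsub>obj P i\<^esub> p) \<oplus>\<^bsub>obj P i\<^esub> p" using P.M.a_assoc[OF cc(4,5,1)] cc by (simp add: P.M.l_neg)
      then have "?s \<cdot>\<^bsub>obj P i\<^esub> ((zero R), c) = p \<cdot>\<^bsub>obj P i\<^esub> ((zero R), c)"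
        using P.rsmult_add[OF P.M.a_closed[OF cc(4,5)] cc(1) cA] z P.rsmult_closed[OF cc(1) cA] by simp
      then have "p \<cdot>\<^bsub>obj P i\<^esub> ((zero R), c) = diff P (i - 1) (H i p) \<cdot>\<^bsub>obj P i\<^esub> ((zero R), c) \<oplus>\<^bsub>obj P i\<^esub> H (i + 1) (diff P i p) \<cdot>\<^bsub>obj P i\<^esub> ((zero R), c)"
        using P.rsmult_add[OF cc(2,3) cA] by simp
      then show "p \<cdot>\<^bsub>obj P i\<^esub> ((zero R), c) = diff P (i - 1) (H i (p \<cdot>\<^bsub>obj P i\<^esub> ((zero R), c))) \<oplus>\<^bsub>D (obj P i) j\<^esub>
          H (i + 1) (diff P i (p \<cdot>\<^bsub>obj P i\<^esub> ((zero R), c)))"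
        using H1[OF p c] H1[OF dc[OF p] c] gr_smult1_diff[OF Pc p c] gr_smult1_diff[OF Pc Hc[OF p] c] by simp
    qed
    then show ?thesis by simp
  qed
  have cm: "\<pi> \<in> chain_maps (Mod_cat R) (deg_cpx P j) Q"
    by (rule M0.chain_mapsI) (use topD(2)[OF t] \<pi> in simp_all)
  have split: "\<exists>v\<in>component (obj P (i - 1)) j. x = diff P (i - 1) v"
    if x: "x \<in> component (obj P i) j" "\<pi> i x = (zero (obj Q i))" "diff P i x = (zero (obj P (i + 1)))" for i x
  proof -
    have "H (i + 1) (diff P i x) = (zero (obj P i))" using mod_hom_zero[OF Hd DM DM, of "i"] x(3) by simp
    moreover have "diff P (i - 1) (H i x) \<in> carrier (obj P i)"
      using graded_module.comp_carrier[OF PG] dc[OF Hc[OF x(1)]] by simp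
    ultimately show ?thesis using con[OF x(1,2)] Hc[OF x(1)] G0.Ob_closed(5)[OF G0.cpx_Ob[OF Pc]] by (intro bexI[of _ "H i x"]) simp_all
  qed
  show ?thesis unfolding M0.qis_def
  proof (intro conjI allI ballI impI cm)
    fix i
    interpret P: graded_module A G "obj P i" by (rule PG)
    interpret Q: right_module R "obj Q i" by (rule QM)
    note m = mod_homD[OF topD(2)[OF t[of i]]]
    have m0: "\<pi> i (zero (obj P i)) = (zero (obj Q i))" using mod_hom_zero[OF topD(2)[OF t[of i]] DM QM] by simp
    have mn: "\<pi> i (\<ominus>\<^bsub>obj P i\<^esub> x) = \<ominus>\<^bsub>obj Q i\<^esub> \<pi> i x" if x: "x \<in> component (obj P i) j" for x
    proof -
      have "\<pi> i (\<ominus>\<^bsub>obj P i\<^esub> x) \<oplus>\<^bsub>obj Q i\<^esub> \<pi> i x = (zero (obj Q i))"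
        using m(2)[of "\<ominus>\<^bsub>obj P i\<^esub> x" x] x P.comp_neg[OF x] P.comp_carrier[OF x] m0 by (simp add: P.M.l_neg)
      then show ?thesis using m(1) x P.comp_neg[OF x] by (intro Q.M.minus_equality[symmetric]) simp_all
    qed
    have d0: "diff P i (\<ominus>\<^bsub>obj P i\<^esub> x) = (zero (obj P (i + 1)))" if "x \<in> carrier (obj P i)" "diff P i x = (zero (obj P (i + 1)))" for x
      using G0.Hom_map_neg[OF G0.cpx_diff_Hom[OF Pc refl] G0.cpx_Ob[OF Pc] G0.cpx_Ob[OF Pc] that(1)] that(2)
        G0.Ob_closed(6)[OF G0.cpx_Ob[OF Pc]] by simp
    show "x \<in> coboundaries (deg_cpx P j) i"
      if x: "x \<in> cocycles (deg_cpx P j) i" and px: "\<pi> i x \<in> coboundaries Q i" for x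
    proof -
      have xj: "x \<in> component (obj P i) j" and dx: "diff P i x = (zero (obj P (i + 1)))" using x unfolding cocycles_def by simp_all
      obtain q where q: "q \<in> carrier (obj Q (i - 1))" "\<pi> i x = diff Q (i - 1) q" using px unfolding coboundaries_def by blast
      then obtain w where w: "w \<in> component (obj P (i - 1)) j" "q = \<pi> (i - 1) w" using topD(3)[OF t[of "i - 1"]] by blast
      have dw: "diff P (i - 1) w \<in> component (obj P i) j" using dc[OF w(1)] by simp
      have pw: "\<pi> i (diff P (i - 1) w) = \<pi> i x" using \<pi>[OF w(1)] q(2) w(2) by simp
      let ?y = "x \<oplus>\<^bsub>obj P i\<^esub> \<ominus>\<^bsub>obj P i\<^esub> diff P (i - 1) w"
      note nw = P.comp_neg[OF dw]
      have "\<pi> i ?y = (zero (obj Q i))"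
        using m(2)[of x "\<ominus>\<^bsub>obj P i\<^esub> diff P (i - 1) w"] xj nw mn[OF dw] pw m(1) by (simp add: Q.M.r_neg)
      moreover have "diff P i (diff P (i - 1) w) = (zero (obj P (i + 1)))"
        using G0.cpx_diff_diff[OF Pc graded_module.comp_carrier[OF PG w(1)], of i] by simp
      then have "diff P i ?y = (zero (obj P (i + 1)))"
        using G0.cpx_diff_map(1)[OF Pc P.comp_carrier[OF xj] P.comp_carrier[OF nw]] d0[OF P.comp_carrier[OF dw]] dx
          G0.Ob_closed(1,4)[OF G0.cpx_Ob[OF Pc]] by simp
      ultimately obtain v where v: "v \<in> component (obj P (i - 1)) j" "?y = diff P (i - 1) v" using split[OF P.comp_add[OF xj nw]] by blast
      have "x = ?y \<oplus>\<^bsub>obj P i\<^esub> diff P (i - 1) w"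
        using P.M.a_assoc[OF P.comp_carrier[OF xj] P.comp_carrier[OF nw] P.comp_carrier[OF dw]] P.comp_carrier[OF xj] P.comp_carrier[OF dw]
        by (simp add: P.M.l_neg)
      also have "\<dots> = diff P (i - 1) (v \<oplus>\<^bsub>obj P (i - 1)\<^esub> w)"
        using mod_homD(2)[OF dH[of i j], of v w] v w(1) by simp
      finally show ?thesis using graded_module.comp_add[OF PG v(1) w(1)] unfolding coboundaries_def deg_cpx_sel by force
    qed
    show "\<exists>x\<in>cocycles (deg_cpx P j) i. \<exists>b\<in>coboundaries Q i. y = \<pi> i x \<oplus>\<^bsub>obj Q i\<^esub> b" if y: "y \<in> cocycles Q i" for y
    proof -
      have yc: "y \<in> carrier (obj Q i)" and dy: "diff Q i y = (zero (obj Q (i + 1)))" using y unfolding cocycles_def by simp_all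
      obtain w where w: "w \<in> component (obj P i) j" "y = \<pi> i w" using yc topD(3)[OF t[of i]] by blast
      have pdw: "\<pi> (i + 1) (diff P i w) = (zero (obj Q (i + 1)))" using \<pi>[OF w(1)] dy w(2) by simp
      have ddw: "diff P (i + 1) (diff P i w) = (zero (obj P (i + 1 + 1)))"
        by (rule G0.cpx_diff_diff[OF Pc P.comp_carrier[OF w(1)] refl])
      \<comment> \<open>The differential of \<open>w\<close> lies in the kernel of
        \<open>\<pi>\<close> and is a cocycle, so by \<open>con\<close> it is the differential of
        \<open>?u\<close>. Since \<open>\<pi>\<close> kills \<open>?u\<close>, subtracting it turns
        \<open>w\<close> into a cocycle with the same image.\<close>
      let ?u = "H (i + 1) (diff P i w)"
      have u: "?u \<in> component (obj P i) j" using Hc[OF dc[OF w(1)]] by simp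
      have pu: "\<pi> i ?u = (zero (obj Q i))" using Hk[OF dc[OF w(1)] pdw] by simp
      have H0: "H (i + 1 + 1) (zero (obj P (i + 1 + 1))) = (zero (obj P (i + 1)))"
        using mod_hom_zero[OF Hd[of "i + 1" j] DM DM] by simp
      have du: "diff P i ?u = diff P i w"
        using con[OF dc[OF w(1)] pdw] ddw H0 graded_module.comp_carrier[OF PG dc[OF u]] G0.Ob_closed(5)[OF G0.cpx_Ob[OF Pc]] by simp
      note nu = P.comp_neg[OF u]
      let ?x = "w \<oplus>\<^bsub>obj P i\<^esub> \<ominus>\<^bsub>obj P i\<^esub> ?u"
      have "diff P i ?x = diff P i w \<oplus>\<^bsub>obj P (i + 1)\<^esub> \<ominus>\<^bsub>obj P (i + 1)\<^esub> diff P i w"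
        using G0.cpx_diff_map(1)[OF Pc P.comp_carrier[OF w(1)] P.comp_carrier[OF nu]]
          G0.Hom_map_neg[OF G0.cpx_diff_Hom[OF Pc refl] G0.cpx_Ob[OF Pc] G0.cpx_Ob[OF Pc] P.comp_carrier[OF u]] du by simp
      also have "\<dots> = (zero (obj P (i + 1)))"
        by (rule abelian_group.r_neg[OF right_module_group[OF graded_module_right[OF PG]] graded_module.comp_carrier[OF PG dc[OF w(1)]]])
      finally have 1: "?x \<in> cocycles (deg_cpx P j) i" using P.comp_add[OF w(1) nu] unfolding cocycles_def by simp
      have "\<pi> i ?x = y" using m(2)[of w "\<ominus>\<^bsub>obj P i\<^esub> ?u"] w nu mn[OF u] pu yc by simp
      then have 2: "y = \<pi> i ?x \<oplus>\<^bsub>obj Q i\<^esub> (zero (obj Q i))" using yc by simp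
      have "(zero (obj Q i)) \<in> coboundaries Q i" by (rule M0.coboundaries_zero[OF Qc])
      then show ?thesis using 1 2 by blast
    qed
  qed
qed

end

lemma (in mod_cat0) qis_trans:
  assumes "qis X Y f" "qis Y Z g" "X \<in> complexes \<A>" "Y \<in> complexes \<A>" "Z \<in> complexes \<A>"
  shows "qis X Z (%i x. g i (f i x))"
  by (rule qis_comp[OF assms(3-5) qisD(1)[OF assms(1)] qisD(1)[OF assms(2)] assms(1,2)])

section \<open>From graded perfect complexes to kernels of tensor powers\<close>

context triv_ext begin

interpretation M0: mod_cat0 "Mod_cat R :: ('v, ('u, 'v, unit) module_ext) concrete_cat" mkn
  by (rule mod_cat0_Mod)

interpretation G0: mod_cat0 "GrMod_cat A G :: ('v, ('u \<times> 'u, 'v, ('v, unit) gmodule_ext) module_ext) concrete_cat" gkn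
  by (rule mod_cat0_GrMod[OF GA])

definition infl_cpx :: "int => ('u, 'v) mod_cpx => ('u \<times> 'u, 'v) gmod_cpx"
  where "infl_cpx n X = \<lparr>obj = (%i. infl n (obj X i)), diff = diff X\<rparr>"

lemma infl_cpx_sel [simp]: "obj (infl_cpx n X) i = infl n (obj X i)" "diff (infl_cpx n X) = diff X"
  by (simp_all add: infl_cpx_def)

lemma infl_cpx_0: "infl_cpx 0 X = inflate_cpx X"
  by (simp add: infl_cpx_def inflate_cpx_def infl_0)

lemma mcpxD:
  fixes X :: "('u, 'v) mod_cpx"
  assumes "X \<in> complexes (Mod_cat R)"
  shows "right_module R (obj X i)" "diff X i \<in> mod_hom R (obj X i) (obj X (i + 1))"
  using M0.cpx_Ob[OF assms, of i] M0.cpx_diff_Hom[OF assms refl, of i] by simp_all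

lemma infl_cpx_complex:
  assumes X: "X \<in> complexes (Mod_cat R)"
  shows "infl_cpx n X \<in> complexes (GrMod_cat A G)"
proof (rule G0.complexesI)
  show "obj (infl_cpx n X) i \<in> Ob (GrMod_cat A G)" for i using infl_graded[OF mcpxD(1)[OF X]] by simp
  show "diff (infl_cpx n X) i \<in> Hom (GrMod_cat A G) (obj (infl_cpx n X) i) (obj (infl_cpx n X) (i + 1))" for i
    using infl_hom[OF mcpxD(2)[OF X] mcpxD(1)[OF X] mcpxD(1)[OF X]] by simp
  show "diff (infl_cpx n X) (i + 1) (diff (infl_cpx n X) i x) = (zero (obj (infl_cpx n X) (i + 2)))"
    if "x \<in> carrier (obj (infl_cpx n X) i)" for i x
    using M0.cpx_diff_diff[OF X, of x i "i + 1"] that by (simp add: add.assoc)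
qed

lemma infl_chain_map:
  assumes X: "X \<in> complexes (Mod_cat R)" and Y: "Y \<in> complexes (Mod_cat R)" and f: "f \<in> chain_maps (Mod_cat R) X Y"
  shows "f \<in> chain_maps (GrMod_cat A G) (infl_cpx n X) (infl_cpx n Y)"
proof (rule G0.chain_mapsI)
  show "f i \<in> Hom (GrMod_cat A G) (obj (infl_cpx n X) i) (obj (infl_cpx n Y) i)" for i
    using infl_hom[OF _ mcpxD(1)[OF X] mcpxD(1)[OF Y]] M0.chain_map_Hom[OF f, of i] by simp
  show "f (i + 1) (diff (infl_cpx n X) i x) = diff (infl_cpx n Y) i (f i x)" if "x \<in> carrier (obj (infl_cpx n X) i)" for i x
    using M0.chain_map_diff[OF f _ refl, of x i] that by simp
qed

lemma infl_cohomology: "cocycles (infl_cpx n X) i = cocycles X i" "coboundaries (infl_cpx n X) i = coboundaries X i"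
  unfolding cocycles_def coboundaries_def infl_cpx_sel infl_sel by (rule refl)+

lemma infl_qis:
  assumes X: "X \<in> complexes (Mod_cat R)" and Y: "Y \<in> complexes (Mod_cat R)" and f: "M0.qis X Y f"
  shows "G0.qis (infl_cpx n X) (infl_cpx n Y) f"
  using f infl_chain_map[OF X Y, of f n] unfolding G0.qis_def M0.qis_def infl_cohomology infl_cpx_sel infl_sel by blast

lemma infl_acyclic: "acyclic_cpx (infl_cpx n X) \<longleftrightarrow> acyclic_cpx X"
  unfolding acyclic_cpx_def infl_cohomology by (rule refl)

lemma deg_infl_acyclic:
  assumes M: "M \<in> complexes (Mod_cat R)" and j: "j \<noteq> n"
  shows "acyclic_cpx (deg_cpx (infl_cpx n M) j)"
  by (rule M0.zero_cpx_acyclic[OF deg_cpx_complex[OF infl_cpx_complex[OF M]]]) (simp add: zero_cpx_def j)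

lemma deg_infl_qis:
  assumes M: "M \<in> complexes (Mod_cat R)"
  shows "M0.qis (deg_cpx (infl_cpx n M) n) M (%i x. x)"
proof -
  let ?D = "deg_cpx (infl_cpx n M) n"
  have "(%i x. x) \<in> chain_maps (Mod_cat R) ?D M"
    by (rule M0.chain_mapsI) (auto intro!: mod_homI)
  moreover have "cocycles ?D i = cocycles M i" "coboundaries ?D i = coboundaries M i" for i
    unfolding cocycles_def coboundaries_def by simp_all
  ultimately show ?thesis using M0.qisD(3)[OF M0.qis_id[OF M]] unfolding M0.qis_def by simp
qed

text \<open>Perfectness of \<open>M\<close> and the vanishing of a tensor power come from the same
  family \<open>Q\<close>: the negative degrees serve to identify \<open>Q 0\<close> with
  \<open>M\<close>, the positive ones give the tensor powers.\<close>

lemma perf_of_inflated: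
  assumes P: "Gr.perf P" and M: "M \<in> complexes (Mod_cat R)" and p: "Gr.qis P (infl_cpx 0 M) p"
  shows "M \<in> Kb_proj R \<and> (\<exists>a. M \<in> Ker_derived_tensor R C a)"
proof -
  note Pc = Gr.perf_complex[OF P] and Ic = infl_cpx_complex[OF M]
  note dq = deg_cpx_qis[OF Pc Ic p]
  have ac: "acyclic_cpx (deg_cpx P j)" if "j \<noteq> 0" for j
    using Mod.qis_acyclic[OF dq deg_cpx_complex[OF Pc] deg_cpx_complex[OF Ic]] deg_infl_acyclic[OF M that] by blast
  have d0: "Mod.qis (deg_cpx P 0) M p" using Mod.qis_trans[OF dq deg_infl_qis[OF M] deg_cpx_complex[OF Pc] deg_cpx_complex[OF Ic] M] by simp
  obtain Q where Q: "!!j. Mod.perf (Q j)" and fin: "finite {j. \<not> zero_cpx (Q j)}"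
    and con: "!!j T \<tau>. tens R C (Q (j - 1)) T \<tau> ==> acyclic_cpx (deg_cpx P j) ==> \<exists>\<theta>. Mod.qis (shift (Q j)) T \<theta>"
    and quo: "!!j T \<tau>. tens R C (Q (j - 1)) T \<tau> ==> acyclic_cpx T ==> \<exists>e. Mod.qis (deg_cpx P j) (Q j) e"
    by (rule gr_perf_structure[OF P], rule that; assumption)
  note Qc = Mod.perf_complex[OF Q] and QK = Mod.perf_K_projective[OF Q]
  have step: "\<exists>e. Mod.qis (deg_cpx P j) (Q j) e" if "acyclic_cpx (Q (j - 1))" for j
  proof -
    obtain T \<tau> where t: "tens R C (Q (j - 1)) T \<tau>" by (rule ex_tens[OF C Qc])
    show ?thesis by (rule quo[OF t tens_acyclic[OF C QK that t]])
  qed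
  obtain N where N: "!!j. j < - int N ==> zero_cpx (Q j)" and N': "!!j. j > int N ==> zero_cpx (Q j)"
  proof -
    have f: "finite ((%j. nat \<bar>j\<bar>) ` {j. \<not> zero_cpx (Q j)})" using fin by simp
    then obtain N where "!!k. k \<in> (%j. nat \<bar>j\<bar>) ` {j. \<not> zero_cpx (Q j)} ==> k \<le> N"
      using finite_nat_set_iff_bounded_le by metis
    then have "!!j. \<not> zero_cpx (Q j) ==> nat \<bar>j\<bar> \<le> N" by blast
    then show thesis by (intro that[of N]) force+
  qed
  \<comment> \<open>The degree runs from - N - 1, where \<open>Q\<close> vanishes, up to - 1. Here
    the parts of \<open>P\<close> are acyclic, so acyclicity passes from each
    \<open>Q (j - 1)\<close> to \<open>Q j\<close>.\<close>
  have neg: "n \<le> N --> acyclic_cpx (Q (int n - int N - 1))" for n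
  proof (induction n)
    case 0
    show ?case by (intro impI Mod.zero_cpx_acyclic[OF Qc] N) simp
  next
    case (Suc n)
    show ?case
    proof
      assume le: "Suc n \<le> N"
      let ?j = "int (Suc n) - int N - 1"
      have "?j - 1 = int n - int N - 1" by simp
      then have "acyclic_cpx (Q (?j - 1))" using Suc.IH le by (metis Suc_leD)
      then obtain e where "Mod.qis (deg_cpx P ?j) (Q ?j) e" using step by blast
      moreover have "?j \<noteq> 0" using le by linarith
      ultimately show "acyclic_cpx (Q ?j)" using Mod.qis_acyclic[OF _ deg_cpx_complex[OF Pc] Qc] ac by blast
    qed
  qed
  have "acyclic_cpx (Q (0 - 1))" using neg[of N] by simp
  then obtain e where e: "Mod.qis (deg_cpx P 0) (Q 0) e" using step by blast
  \<comment> \<open>Both \<open>M\<close> and \<open>Q 0\<close> receive a quasi-isomorphism from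
    the part of degree 0 of \<open>P\<close>; K-projectivity of \<open>Q 0\<close> turns this roof
    into a map.\<close>
  obtain s0 where s0: "Mod.qis (Q 0) M s0"
    by (rule Mod.transfer_qis[OF QK deg_cpx_complex[OF Pc] M Qc d0 e Mod.qis_id[OF Qc]])
  have MKb: "M \<in> Kb_proj R" unfolding Mod.Kb_iff using M Q s0 by blast
  have sp: "Mod.perf ((shift ^^ a) (Q j))" for a j by (induction a) (simp_all add: Q Mod.perf_shift)
  have sq: "\<exists>f'. Mod.qis ((shift ^^ a) X) ((shift ^^ a) Y) f'" if "Mod.qis X Y f" for a X Y f
  proof (induction a)
    case (Suc a)
    then obtain g where "Mod.qis ((shift ^^ a) X) ((shift ^^ a) Y) g" by blast
    from Mod.shift_qis[OF this] show ?case by auto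
  qed (use that in auto)
  have st: "\<exists>\<tau>'. tens R C ((shift ^^ a) X) ((shift ^^ a) Y) \<tau>'" if "tens R C X Y \<tau>" for a X Y \<tau>
  proof (induction a)
    case (Suc a)
    then obtain \<sigma> where "tens R C ((shift ^^ a) X) ((shift ^^ a) Y) \<sigma>" by blast
    from tens_shift[OF C this] show ?case by auto
  qed (use that in auto)
  \<comment> \<open>By induction \<open>(shift ^^ a) (Q (int a))\<close> is a K-projective
    resolution of the a-fold derived tensor product, so tensoring it computes the next one.
    Acyclicity of the part of degree a + 1 identifies the result with one more shift of the next
    \<open>Q\<close>.\<close>
  have key: "(derived_tensor R C ^^ a) M \<in> complexes (Mod_cat R) \<and>
      (\<exists>s. Mod.qis ((shift ^^ a) (Q (int a))) ((derived_tensor R C ^^ a) M) s)" for a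
  proof (induction a)
    case 0
    show ?case using M s0 by auto
  next
    case (Suc a)
    let ?M = "(derived_tensor R C ^^ a) M"
    obtain s where Mc: "?M \<in> complexes (Mod_cat R)" and s: "Mod.qis ((shift ^^ a) (Q (int a))) ?M s" using Suc.IH by blast
    obtain T \<tau> where t: "tens R C (Q (int a)) T \<tau>" by (rule ex_tens[OF C Qc])
    obtain \<tau>' where t': "tens R C ((shift ^^ a) (Q (int a))) ((shift ^^ a) T) \<tau>'" using st[OF t] by blast
    obtain u where dc: "derived_tensor R C ?M \<in> complexes (Mod_cat R)" and u: "Mod.qis (derived_tensor R C ?M) ((shift ^^ a) T) u"
      by (rule derived_tensor_qis[OF C Mod.perf_K_projective[OF sp] Mc s t'])
    obtain \<theta> where "Mod.qis (shift (Q (int (Suc a)))) T \<theta>"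
      using con[of "int (Suc a)" T \<tau>] t ac[of "int (Suc a)"] by auto
    then obtain \<theta>' where "Mod.qis ((shift ^^ a) (shift (Q (int (Suc a))))) ((shift ^^ a) T) \<theta>'" using sq by blast
    then have th: "Mod.qis ((shift ^^ Suc a) (Q (int (Suc a)))) ((shift ^^ a) T) \<theta>'" by (simp only: funpow_Suc_right comp_apply)
    obtain v where "Mod.qis ((shift ^^ Suc a) (Q (int (Suc a)))) (derived_tensor R C ?M) v"
      by (rule Mod.qis_lift_qis[OF Mod.perf_K_projective[OF sp] dc tensD(1)[OF C t'] u th])
    then show ?case using dc by auto
  qed
  \<comment> \<open>All \<open>Q j\<close> with j > N vanish, so the tensor power N + 1 kills
    \<open>M\<close>.\<close>
  let ?a = "Suc N" and ?Z = "(shift ^^ Suc N) (Q (int (Suc N)))"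
  obtain s where dc: "(derived_tensor R C ^^ ?a) M \<in> complexes (Mod_cat R)" and s: "Mod.qis ?Z ((derived_tensor R C ^^ ?a) M) s"
    using key[of ?a] by blast
  note Zc = Mod.perf_complex[OF sp]
  have "zero_cpx ((shift ^^ a) (Q (int (Suc N))))" for a
    by (induction a) (use N'[of "int (Suc N)"] in \<open>simp_all add: zero_cpx_def\<close>)
  moreover have "derived_iso (Mod_cat R) ((derived_tensor R C ^^ ?a) M) ?Z"
    by (rule Mod.derived_isoI[OF dc Zc Zc s Mod.qis_id[OF Zc]])
  ultimately have "M \<in> Ker_derived_tensor R C ?a" unfolding Ker_derived_tensor_def using MKb by blast
  then show ?thesis using MKb by blast
qed

end

lemma bounded_top_int: "finite (S :: int set) ==> \<exists>n. \<forall>i\<in>S. i \<le> n"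
  by (rule exI[of _ "Max (insert 0 S)"]) simp

section \<open>From kernels to graded perfect complexes, and the two equations\<close>

context triv_ext begin

text \<open>The complex induced from \<open>Q\<close> to \<open>A\<close>, generated in degree
  n.\<close>

definition ext_cpx :: "('u, 'u) mod_cpx => ('u, 'u) mod_cpx => (int => 'u => 'u => 'u) => int => ('u \<times> 'u, 'u) gmod_cpx"
  where "ext_cpx Q T \<tau> n = \<lparr>obj = (%i. ext_mod C (obj Q i) (obj T i) (\<tau> i) n),
    diff = (%i z. pr (diff Q i (p1 z)) (diff T i (p2 z)))\<rparr>"

lemma ext_cpx_sel [simp]: "obj (ext_cpx Q T \<tau> n) i = ext_mod C (obj Q i) (obj T i) (\<tau> i) n"
  "diff (ext_cpx Q T \<tau> n) i z = pr (diff Q i (p1 z)) (diff T i (p2 z))"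
  by (simp_all add: ext_cpx_def)

lemma ext_cpx_perf:
  assumes Q: "Mod.perf Q" and t: "tens R C Q T \<tau>"
  shows "Gr.perf (ext_cpx Q T \<tau> n)"
proof -
  note Qc = Mod.perf_complex[OF Q] and Tc = tensD(1)[OF C t] and Ti = tensD(2)[OF C t]
  note QM = mcpxD(1)[OF Qc] and TM = mcpxD(1)[OF Tc] and dQ = mcpxD(2)[OF Qc] and dT = mcpxD(2)[OF Tc]
  have Qp: "obj Q i \<in> proj R" for i using Q by (simp add: Mod.perf_def)
  have pE: "obj (ext_cpx Q T \<tau> n) i \<in> gr_proj A G" for i
    unfolding ext_cpx_sel by (rule ext_mod_gr_proj[OF QM Ti Qp])
  have Q0: "diff Q i (zero (obj Q i)) = (zero (obj Q (i + 1)))" and T0: "diff T i (zero (obj T i)) = (zero (obj T (i + 1)))" for i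
    by (rule mod_hom_zero[OF dQ QM QM], rule mod_hom_zero[OF dT TM TM])
  have "ext_cpx Q T \<tau> n \<in> complexes (GrMod_cat A G)"
  proof (rule Gr.complexesI)
    show "obj (ext_cpx Q T \<tau> n) i \<in> Ob (GrMod_cat A G)" for i using gr_projD(1)[OF pE] by simp
    show "diff (ext_cpx Q T \<tau> n) i \<in> Hom (GrMod_cat A G) (obj (ext_cpx Q T \<tau> n) i) (obj (ext_cpx Q T \<tau> n) (i + 1))" for i
      unfolding Hom_GrMod_cat
    proof (intro gmod_homI mod_homI)
      let ?d = "diff (ext_cpx Q T \<tau> n) i" and ?E = "obj (ext_cpx Q T \<tau> n)"
      note mQ = mod_homD[OF dQ[of i]] and mT = mod_homD[OF dT[of i]]
      show "?d z \<in> carrier (?E (i + 1))" if "z \<in> carrier (?E i)" for z using that mQ(1) mT(1) by auto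
      show "?d (z \<oplus>\<^bsub>?E i\<^esub> w) = ?d z \<oplus>\<^bsub>?E (i + 1)\<^esub> ?d w" if "z \<in> carrier (?E i)" "w \<in> carrier (?E i)" for z w
        using that mQ(2) mT(2) by auto
      show "?d z \<in> component (?E (i + 1)) j" if "z \<in> component (?E i) j" for z j
        using that mQ(1) mT(1) Q0 T0 by (auto split: if_splits)
      fix z a assume z: "z \<in> carrier (?E i)" and a: "a \<in> carrier A"
      obtain q s where qs: "z = pr q s" "q \<in> carrier (obj Q i)" "s \<in> carrier (obj T i)" using z by auto
      have ac: "fst a \<in> carrier R" "snd a \<in> carrier C" using a by auto
      have "\<tau> i q (snd a) \<in> carrier (obj T i)" by (rule balancedD(1)[OF tensorD(2)[OF Ti] qs(2) ac(2)])
      moreover have "s \<cdot>\<^bsub>obj T i\<^esub> fst a \<in> carrier (obj T i)" by (rule right_module.rsmult_closed[OF TM qs(3) ac(1)])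
      ultimately show "?d (z \<cdot>\<^bsub>?E i\<^esub> a) = ?d z \<cdot>\<^bsub>?E (i + 1)\<^esub> a"
        using mT(2) mT(3)[OF qs(3) ac(1)] mQ(3)[OF qs(2) ac(1)] tensD(3)[OF C t qs(2) ac(2) refl] qs(1) by simp
    qed
    show "diff (ext_cpx Q T \<tau> n) (i + 1) (diff (ext_cpx Q T \<tau> n) i z) = (zero (obj (ext_cpx Q T \<tau> n) (i + 2)))"
      if "z \<in> carrier (obj (ext_cpx Q T \<tau> n) i)" for i z
      using that Mod.cpx_diff_diff[OF Qc _ refl, of _ i] Mod.cpx_diff_diff[OF Tc _ refl, of _ i] by (auto simp: add.assoc)
  qed
  moreover have "carrier (obj (ext_cpx Q T \<tau> n) i) = {(zero (obj (ext_cpx Q T \<tau> n) i))}"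
    if z: "carrier (obj Q i) = {(zero (obj Q i))}" for i
    using tensor_zero[OF C QM z Ti] z by auto
  then have "{i. carrier (obj (ext_cpx Q T \<tau> n) i) \<noteq> {(zero (obj (ext_cpx Q T \<tau> n) i))}}
      \<subseteq> {i. carrier (obj Q i) \<noteq> {(zero (obj Q i))}}" by blast
  then have "bounded_cpx (ext_cpx Q T \<tau> n)"
    using Q finite_subset unfolding Mod.perf_def bounded_cpx_def by blast
  ultimately show ?thesis using pE unfolding Gr.perf_def by blast
qed

lemma ext_cpx_maps:
  assumes Q: "Q \<in> complexes (Mod_cat R)" and t: "tens R C Q T \<tau>"
  shows "(%i t. pr (zero (obj Q i)) t) \<in> chain_maps (GrMod_cat A G) (infl_cpx (n + 1) T) (ext_cpx Q T \<tau> n)"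
    "(%i. p1) \<in> chain_maps (GrMod_cat A G) (ext_cpx Q T \<tau> n) (infl_cpx n Q)"
proof -
  note Ti = tensD(2)[OF C t] and QM = mcpxD(1)[OF Q]
  show "(%i t. pr (zero (obj Q i)) t) \<in> chain_maps (GrMod_cat A G) (infl_cpx (n + 1) T) (ext_cpx Q T \<tau> n)"
    by (rule Gr.chain_mapsI)
      (use ext_mod_in2[OF QM Ti, where n = n] mod_hom_zero[OF mcpxD(2)[OF Q] QM QM] in simp_all)
  show "(%i. p1) \<in> chain_maps (GrMod_cat A G) (ext_cpx Q T \<tau> n) (infl_cpx n Q)"
    by (rule Gr.chain_mapsI) (use ext_mod_p1[OF QM Ti] in simp_all)
qed

text \<open>The induced complex on a perfect resolution \<open>Q\<close> of \<open>M\<close> is an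
  extension of \<open>Q\<close> in degree n by the tensor product \<open>T\<close> in degree n + 1.
  As \<open>T\<close> represents an object of the previous kernel, the induction hypothesis resolves
  it in degree n + 1, whence the generalization over n; a cone combines the two.\<close>

lemma inflated_perf:
  assumes C_Kb: "stalk (module.truncate C) \<in> Kb_proj R" and M: "M \<in> Ker_derived_tensor R C a"
  shows "\<exists>P p. Gr.perf P \<and> Gr.qis P (infl_cpx n M) p"
  using M
proof (induction a arbitrary: M n)
  case 0
  \<comment> \<open>Here \<open>M\<close> is acyclic, so the inflated zero complex resolves it
    through the zero map.\<close>
  then obtain Z where Z: "zero_cpx Z" and i: "derived_iso (Mod_cat R) M Z" unfolding Ker_derived_tensor_def by auto
  obtain W s u where c: "M \<in> complexes (Mod_cat R)" "Z \<in> complexes (Mod_cat R)" "W \<in> complexes (Mod_cat R)"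
    and q: "Mod.qis W M s" "Mod.qis W Z u" by (rule Mod.derived_isoE[OF i])
  have Za: "acyclic_cpx Z" by (rule Mod.zero_cpx_acyclic[OF c(2) Z])
  then have Ma: "acyclic_cpx M"
    using Mod.qis_acyclic[OF q(1) c(3,1)] Mod.qis_acyclic[OF q(2) c(3,2)] by blast
  note ZG = infl_cpx_complex[OF c(2), of n] and MG = infl_cpx_complex[OF c(1), of n]
  have zo: "carrier (obj (infl_cpx n Z) i) = {(zero (obj (infl_cpx n Z) i))}" for i
    using Z unfolding zero_cpx_def by simp
  have "Gr.perf (infl_cpx n Z)"
    unfolding Gr.perf_def bounded_cpx_def using ZG zo Gr.\<P>_zero[OF Gr.cpx_Ob[OF ZG] zo] by simp
  moreover have "Gr.qis (infl_cpx n Z) (infl_cpx n M) (%i x. (zero (obj (infl_cpx n M) i)))"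
    by (rule Gr.acyclic_qis[OF ZG MG _ _ Gr.zero_chain_map[OF ZG MG]]) (simp_all add: infl_acyclic Za Ma)
  ultimately show ?case by blast
next
  case (Suc a)
  then obtain Z where MK: "M \<in> Kb_proj R" and Z: "zero_cpx Z"
    and i: "derived_iso (Mod_cat R) ((derived_tensor R C ^^ a) (derived_tensor R C M)) Z"
    unfolding Ker_derived_tensor_def by (auto simp: funpow_swap1)
  obtain Q q where Mc: "M \<in> complexes (Mod_cat R)" and Q: "Mod.perf Q" and q: "Mod.qis Q M q"
    using MK unfolding Mod.Kb_iff by blast
  note Qc = Mod.perf_complex[OF Q]
  obtain T \<tau> where t: "tens R C Q T \<tau>" by (rule ex_tens[OF C Qc])
  note Tc = tensD(1)[OF C t] and Ti = tensD(2)[OF C t] and QM = mcpxD(1)[OF Qc]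
  obtain u where dc: "derived_tensor R C M \<in> complexes (Mod_cat R)" and u: "Mod.qis (derived_tensor R C M) T u"
    by (rule derived_tensor_qis[OF C Mod.perf_K_projective[OF Q] Mc q t])
  \<comment> \<open>Membership in a kernel includes perfectness, so the tensor product must first be
    resolved by a perfect complex; this is where the hypothesis on \<open>C\<close> enters.\<close>
  obtain P' p' where P': "Mod.perf P'" and p': "Mod.qis P' T p'" using tens_perf[OF C C_Kb Q t] by blast
  obtain v where "Mod.qis P' (derived_tensor R C M) v"
    by (rule Mod.qis_lift_qis[OF Mod.perf_K_projective[OF P'] dc Tc u p'])
  then have "derived_tensor R C M \<in> Kb_proj R" unfolding Mod.Kb_iff using dc P' by blast
  then have "derived_tensor R C M \<in> Ker_derived_tensor R C a" unfolding Ker_derived_tensor_def using Z i by blast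
  from Suc.IH[OF this] obtain K k where K: "Gr.perf K" and k: "Gr.qis K (infl_cpx (n + 1) (derived_tensor R C M)) k" by blast
  note Kc = Gr.perf_complex[OF K] and TI = infl_cpx_complex[OF Tc, of "n + 1"] and QI = infl_cpx_complex[OF Qc, of n]
  \<comment> \<open>\<open>K\<close> resolves the chosen derived tensor product; composed with
    \<open>u\<close> it resolves the particular tensor product \<open>T\<close> that occurs in the
    induced complex.\<close>
  define r where "r = (%i x. u i (k i x))"
  have r: "Gr.qis K (infl_cpx (n + 1) T) r"
    unfolding r_def by (rule Gr.qis_trans[OF k infl_qis[OF dc Tc u] Kc infl_cpx_complex[OF dc] TI])
  note F = ext_cpx_perf[OF Q t, of n] and maps = ext_cpx_maps[OF Qc t, of n]
  note Fc = Gr.perf_complex[OF F]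
  let ?F = "ext_cpx Q T \<tau> n" and ?\<iota> = "%i t. pr (zero (obj Q i)) t"
  have T0: "(zero (obj T i)) \<in> carrier (obj T i)" for i
    by (rule abelian_monoid.zero_closed[OF abelian_group.axioms(1)[OF right_module_group[OF mcpxD(1)[OF Tc]]]])
  have res: "Gr.qis (Gr.cone K ?F (%i x. ?\<iota> i (r i x))) (infl_cpx n Q) (%i z. p1 (p2 z))"
  proof (rule Gr.cone_resolution[OF TI Fc QI maps _ _ _ _ Kc r])
    show "p1 ` carrier (obj ?F i) = carrier (obj (infl_cpx n Q) i)" for i using T0[of i] by force
  qed auto
  have cm: "(%i x. ?\<iota> i (r i x)) \<in> chain_maps (GrMod_cat A G) K ?F"
    by (rule Gr.chain_map_comp[OF Gr.qisD(1)[OF r] maps(1) Kc TI Fc])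
  have cp: "Gr.perf (Gr.cone K ?F (%i x. ?\<iota> i (r i x)))" by (rule Gr.perf_cone[OF K F cm])
  show ?case
    using cp Gr.qis_trans[OF res infl_qis[OF Qc Mc q] Gr.perf_complex[OF cp] QI infl_cpx_complex[OF Mc]] by blast
qed

interpretation M0: mod_cat0 "Mod_cat R :: ('v, ('u, 'v, unit) module_ext) concrete_cat" mkn
  by (rule mod_cat0_Mod)

interpretation G0: mod_cat0 "GrMod_cat A G :: ('v, ('u \<times> 'u, 'v, ('v, unit) gmodule_ext) module_ext) concrete_cat" gkn
  by (rule mod_cat0_GrMod[OF GA])

text \<open>The projection to degree 0 followed by the quotient map is defined on all of
  \<open>P\<close>. It therefore compares \<open>P\<close> directly with the inflation of
  \<open>Q 0\<close>, and no roof has to be inverted.\<close>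

lemma gr_perf_inflated:
  fixes P :: "('u \<times> 'u, 'v) gmod_cpx"
  assumes Pc: "P \<in> complexes (GrMod_cat A G)" and Pp: "!!i. obj P i \<in> gr_proj A G" and Pb: "bounded_cpx P"
    and ac: "!!j. j \<noteq> 0 ==> acyclic_cpx (deg_cpx P j)"
  obtains Q e where "Q \<in> complexes (Mod_cat R)" "bounded_cpx Q" "!!i. obj Q i \<in> proj R" "G0.qis P (infl_cpx 0 Q) e"
proof -
  note PG = gcpxD(1)[OF Pc] and PD = gcpxD(2)[OF Pc]
  have Pf: "finite {i. carrier (obj P i) \<noteq> {(zero (obj P i))}}" using Pb by (simp add: bounded_cpx_def)
  obtain Q \<pi> where t: "!!i j. top (obj P i) j (obj (Q j) i) (\<pi> j i)" and Qc: "!!j. Q j \<in> complexes (Mod_cat R)"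
    and Q\<pi>: "!!i j x. x \<in> component (obj P i) j ==> diff (Q j) i (\<pi> j i x) = \<pi> j (i + 1) (diff P i x)"
    by (rule gr_top_cpx[OF Pc], rule that; assumption)
  note z = top_zero[OF PG t]
  have Qb: "finite {i. carrier (obj (Q j) i) \<noteq> {(zero (obj (Q j) i))}}" for j
    by (rule finite_subset[OF _ Pf]) (use z in blast)
  have Qp: "obj (Q j) i \<in> proj R" for i j by (rule top_proj[OF Pp t])
  have K: "K_projective (Mod_cat R) (Q j)" for j
  proof -
    obtain n where n: "!!i. i \<in> {i. carrier (obj (Q j) i) \<noteq> {(zero (obj (Q j) i))}} ==> i \<le> n"
      using bounded_top_int[OF Qb] by blast
    show ?thesis
    proof (rule M0.bounded_projective_K_projective[OF Qc])
      show "projective (Mod_cat R) (obj (Q j) i)" for i using Qp by (simp add: proj_def)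
      show "carrier (obj (Q j) i) = {(zero (obj (Q j) i))}" if "i > n" for i using n[of i] that by force
    qed
  qed
  have "{j. \<not> zero_cpx (Q j)} \<subseteq> (\<Union>i\<in>{i. carrier (obj P i) \<noteq> {(zero (obj P i))}}. {j. carrier (obj (Q j) i) \<noteq> {(zero (obj (Q j) i))}})"
    using z by (auto simp: zero_cpx_def)
  then have fin: "finite {j. \<not> zero_cpx (Q j)}"
    by (rule finite_subset) (intro finite_UN_I Pf top_bounded[OF PG gr_projD(2)[OF Pp] t])
  have step: "M0.qis (deg_cpx P j) (Q j) (\<pi> j)" if "acyclic_cpx (Q (j - 1))" for j
    by (rule qis_top_if_acyclic[OF Pc Pp Qc Qc t t Q\<pi> Q\<pi> K that])
  obtain N where N: "!!j. j < - int N ==> zero_cpx (Q j)"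
  proof -
    have "finite (uminus ` {j. \<not> zero_cpx (Q j)})" using fin by simp
    from bounded_top_int[OF this] obtain n where n: "\<forall>i\<in>uminus ` {j. \<not> zero_cpx (Q j)}. i \<le> n" ..
    have "zero_cpx (Q j)" if "j < - int (nat n)" for j
    proof (rule ccontr)
      assume "\<not> zero_cpx (Q j)"
      then have "- j \<in> uminus ` {j. \<not> zero_cpx (Q j)}" by (intro imageI CollectI)
      from bspec[OF n this] have "- j \<le> n" .
      then show False using that by linarith
    qed
    then show thesis by (rule that)
  qed
  have neg: "n \<le> N --> acyclic_cpx (Q (int n - int N - 1))" for n
  proof (induction n)
    case 0
    show ?case by (intro impI M0.zero_cpx_acyclic[OF Qc] N) simp
  next
    case (Suc n)
    show ?case
    proof
      assume le: "Suc n \<le> N"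
      let ?j = "int (Suc n) - int N - 1"
      have "?j - 1 = int n - int N - 1" by simp
      then have "acyclic_cpx (Q (?j - 1))" using Suc.IH le by (metis Suc_leD)
      from step[OF this] have "M0.qis (deg_cpx P ?j) (Q ?j) (\<pi> ?j)" .
      moreover have "?j \<noteq> 0" using le by linarith
      ultimately show "acyclic_cpx (Q ?j)" using M0.qis_acyclic[OF _ deg_cpx_complex[OF Pc] Qc] ac by blast
    qed
  qed
  have "acyclic_cpx (Q (0 - 1))" using neg[of N] by simp
  note e0 = step[OF this]
  let ?h = "%j i. graded_module.hc (obj P i) j"
  let ?e = "%i x. \<pi> 0 i (?h 0 i x)"
  have hd: "diff P i (?h j i x) = ?h j (i + 1) (diff P i x)" if "x \<in> carrier (obj P i)" for i j x
    by (rule gmod_hom_hc[OF PD PG PG that])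
  have DB: "coboundaries (deg_cpx P j) i \<subseteq> coboundaries P i" for i j
    using graded_module.comp_carrier[OF PG] unfolding coboundaries_def by auto
  have qe: "G0.qis P (infl_cpx 0 (Q 0)) ?e"
    unfolding G0.qis_def infl_cohomology infl_cpx_sel infl_sel
  proof (intro conjI allI ballI impI)
    show "?e \<in> chain_maps (GrMod_cat A G) P (infl_cpx 0 (Q 0))"
    proof (rule G0.chain_mapsI)
      show "?e i \<in> Hom (GrMod_cat A G) (obj P i) (obj (infl_cpx 0 (Q 0)) i)" for i
        using infl_hom_top(1)[OF PG t] by simp
      show "?e (i + 1) (diff P i x) = diff (infl_cpx 0 (Q 0)) i (?e i x)" if x: "x \<in> carrier (obj P i)" for i x
        using Q\<pi>[OF graded_module.hc(1)[OF PG x], of 0] hd[OF x, of 0] by simp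
    qed
    fix i
    interpret P: graded_module A G "obj P i" by (rule PG)
    show "x \<in> coboundaries P i" if x: "x \<in> cocycles P i" and ex: "?e i x \<in> coboundaries (Q 0) i" for x
    proof -
      have xc: "x \<in> carrier (obj P i)" and dx: "diff P i x = (zero (obj P (i + 1)))" using x unfolding cocycles_def by auto
      have hz: "P.hc j x \<in> cocycles (deg_cpx P j) i" for j
        using P.hc(1)[OF xc, of j] hd[OF xc, of j] dx graded_module.hc_zero[OF PG, of "i + 1" j] unfolding cocycles_def by simp
      \<comment> \<open>The component of degree 0 bounds because \<open>\<pi> 0\<close> is injective
        on cohomology, the others because their parts are acyclic; so the finite sum of all
        components bounds as well.\<close>
      have hb: "P.hc j x \<in> coboundaries P i" for j
      proof (cases "j = 0")
        case True
        then show ?thesis using M0.qisD(2)[OF e0 hz ex] DB by blast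
      next
        case False
        then show ?thesis using ac[OF False] hz[of j] DB unfolding acyclic_cpx_def by blast
      qed
      have "finsum (obj P i) (%j. P.hc j x) S \<in> coboundaries P i" if "finite S" for S
        using that
      proof induction
        case empty
        show ?case using G0.coboundaries_zero[OF Pc] by simp
      next
        case (insert a S)
        have "finsum (obj P i) (%j. P.hc j x) (insert a S) = P.hc a x \<oplus>\<^bsub>obj P i\<^esub> finsum (obj P i) (%j. P.hc j x) S"
          using insert(1,2) P.hc_carrier[OF xc] by (intro P.M.finsum_insert) auto
        then show ?case using G0.coboundaries_add[OF Pc hb insert(3)] by simp
      qed
      from this[OF P.hc(2)[OF xc]] show ?thesis unfolding P.hc(3)[OF xc] .
    qed
    show "\<exists>x\<in>cocycles P i. \<exists>b\<in>coboundaries (Q 0) i. y = ?e i x \<oplus>\<^bsub>obj (Q 0) i\<^esub> b" if y: "y \<in> cocycles (Q 0) i" for y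
    proof -
      obtain x b where x: "x \<in> cocycles (deg_cpx P 0) i" and b: "b \<in> coboundaries (Q 0) i"
        and e: "y = \<pi> 0 i x \<oplus>\<^bsub>obj (Q 0) i\<^esub> b" using M0.qisD(3)[OF e0 y] by blast
      have xj: "x \<in> component (obj P i) 0" and "diff P i x = (zero (obj P (i + 1)))" using x unfolding cocycles_def by simp_all
      then have "x \<in> cocycles P i" using P.comp_carrier unfolding cocycles_def by blast
      moreover have "y = ?e i x \<oplus>\<^bsub>obj (Q 0) i\<^esub> b" using e P.hc_homogeneous[OF xj, of 0] by simp
      ultimately show ?thesis using b by blast
    qed
  qed
  have "bounded_cpx (Q 0)" using Qb by (simp add: bounded_cpx_def)
  then show thesis by (rule that[OF Qc _ Qp qe])
qed

text \<open>Nothing is lifted along quasi-isomorphisms here. The zigzags only transport the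
  acyclicity of the parts of nonzero degree from the inflation of \<open>M\<close> to
  \<open>P\<close>; then \<open>M\<close> is replaced by the complex of projectives that
  \<open>gr_perf_inflated\<close> extracts from \<open>P\<close>.\<close>

lemma in_graded_complexes_eq:
  "(in_graded R C (complexes (Mod_cat R)) \<inter> Kb_gr_proj A G :: ('u \<times> 'u, 'v) gmod_cpx set) = in_graded R C (Kb_proj R) \<inter> Kb_gr_proj A G"
proof (intro equalityI subsetI)
  fix X :: "('u \<times> 'u, 'v) gmod_cpx"
  assume X: "X \<in> in_graded R C (complexes (Mod_cat R)) \<inter> Kb_gr_proj A G"
  then obtain M where Mc: "M \<in> complexes (Mod_cat R)" and XM: "derived_iso (GrMod_cat A G) X (infl_cpx 0 M)"
    unfolding in_graded_def infl_cpx_0 by blast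
  obtain P where Pc: "P \<in> complexes (GrMod_cat A G)" and Pb: "bounded_cpx P" and Pp: "!!i. obj P i \<in> gr_proj A G"
    and XP: "derived_iso (GrMod_cat A G) X P" using X unfolding Kb_def by blast
  obtain Z s t where Xc: "X \<in> complexes (GrMod_cat A G)" and Ic: "infl_cpx 0 M \<in> complexes (GrMod_cat A G)"
    and Zc: "Z \<in> complexes (GrMod_cat A G)" and s: "G0.qis Z X s" and t: "G0.qis Z (infl_cpx 0 M) t" by (rule G0.derived_isoE[OF XM])
  obtain W u v where Wc: "W \<in> complexes (GrMod_cat A G)" and u: "G0.qis W X u" and v: "G0.qis W P v" by (rule G0.derived_isoE[OF XP])
  have tr: "acyclic_cpx (deg_cpx Y j) \<longleftrightarrow> acyclic_cpx (deg_cpx Y' j)" if "G0.qis Y Y' f" "Y \<in> complexes (GrMod_cat A G)"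
    "Y' \<in> complexes (GrMod_cat A G)" for Y Y' :: "('u \<times> 'u, 'v) gmod_cpx" and f j
    using M0.qis_acyclic[OF deg_cpx_qis[OF that(2,3,1)] deg_cpx_complex[OF that(2)] deg_cpx_complex[OF that(3)]] .
  have ac: "acyclic_cpx (deg_cpx P j)" if "j \<noteq> 0" for j
    using deg_infl_acyclic[OF Mc that] tr[OF t Zc Ic, of j] tr[OF s Zc Xc, of j] tr[OF u Wc Xc, of j] tr[OF v Wc Pc, of j] by simp
  obtain Q e where Q: "Q \<in> complexes (Mod_cat R)" "bounded_cpx Q" "!!i. obj Q i \<in> proj R" and e: "G0.qis P (infl_cpx 0 Q) e"
    by (rule gr_perf_inflated[OF Pc Pp Pb ac], assumption, rule that; assumption)
  note QI = infl_cpx_complex[OF Q(1), of 0]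
  have "derived_iso (Mod_cat R) Q Q" by (rule M0.derived_isoI[OF Q(1) Q(1) Q(1) M0.qis_id[OF Q(1)] M0.qis_id[OF Q(1)]])
  then have "Q \<in> Kb_proj R" unfolding Kb_def using Q by blast
  moreover have "derived_iso (GrMod_cat A G) X (inflate_cpx Q)"
    using G0.derived_isoI[OF Xc QI Wc u G0.qis_trans[OF v e Wc Pc QI]] unfolding infl_cpx_0 .
  ultimately show "X \<in> in_graded R C (Kb_proj R) \<inter> Kb_gr_proj A G" using X unfolding in_graded_def by blast
qed (unfold in_graded_def Kb_def, blast)

text \<open>In an infinite universe a perfect resolution moves along roofs, so \<open>X\<close> may
  be exchanged for the inflation of \<open>M\<close>; the inclusions are then
  \<open>perf_of_inflated\<close> and \<open>inflated_perf\<close>.\<close>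

lemma in_graded_Ker_eq:
  assumes C_Kb: "stalk (module.truncate C) \<in> Kb_proj R"
  shows "in_graded R C (Kb_proj R) \<inter> Kb_gr_proj A G = (\<Union>a. in_graded R C (Ker_derived_tensor R C a))"
proof (intro equalityI subsetI)
  fix X :: "('u \<times> 'u, 'u) gmod_cpx" assume X: "X \<in> in_graded R C (Kb_proj R) \<inter> Kb_gr_proj A G"
  then obtain M :: "('u, 'u) mod_cpx" where M: "M \<in> complexes (Mod_cat R)" and XM: "derived_iso (GrMod_cat A G) X (inflate_cpx M)"
    unfolding in_graded_def Kb_def by blast
  have "X \<in> Kb_gr_proj A G" using X by (rule IntD2)
  then obtain P q where P: "Gr.perf P" and q: "Gr.qis P X q" unfolding Gr.Kb_iff by blast
  obtain Z s t where Xc: "X \<in> complexes (GrMod_cat A G)" and Ic: "inflate_cpx M \<in> complexes (GrMod_cat A G)"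
    and Zc: "Z \<in> complexes (GrMod_cat A G)" and s: "Gr.qis Z X s" and t: "Gr.qis Z (inflate_cpx M) t" by (rule Gr.derived_isoE[OF XM])
  obtain v where v: "Gr.qis P Z v" by (rule Gr.qis_lift_qis[OF Gr.perf_K_projective[OF P] Zc Xc s q])
  note w = Gr.qis_trans[OF v t Gr.perf_complex[OF P] Zc Ic, folded infl_cpx_0]
  obtain a where "M \<in> Ker_derived_tensor R C a" using perf_of_inflated[OF P M w] by blast
  then show "X \<in> (\<Union>a. in_graded R C (Ker_derived_tensor R C a))" using XM unfolding in_graded_def by blast
next
  fix X :: "('u \<times> 'u, 'u) gmod_cpx" assume "X \<in> (\<Union>a. in_graded R C (Ker_derived_tensor R C a))"
  then obtain a M where M: "M \<in> Ker_derived_tensor R C a" and XM: "derived_iso (GrMod_cat A G) X (inflate_cpx M)"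
    unfolding in_graded_def by blast
  obtain P p where P: "Gr.perf P" and p: "Gr.qis P (inflate_cpx M) p"
    using inflated_perf[OF C_Kb M, of 0] unfolding infl_cpx_0 by blast
  obtain Z s t where Xc: "X \<in> complexes (GrMod_cat A G)" and Ic: "inflate_cpx M \<in> complexes (GrMod_cat A G)"
    and Zc: "Z \<in> complexes (GrMod_cat A G)" and s: "Gr.qis Z X s" and t: "Gr.qis Z (inflate_cpx M) t" by (rule Gr.derived_isoE[OF XM])
  obtain q where "Gr.qis P X q" by (rule Gr.transfer_qis[OF Gr.perf_K_projective[OF P] Zc Xc Ic s t p])
  then have "X \<in> Kb_gr_proj A G" using P Xc unfolding Gr.Kb_iff by blast
  moreover have "M \<in> Kb_proj R" using M by (simp add: Ker_derived_tensor_def)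
  ultimately show "X \<in> in_graded R C (Kb_proj R) \<inter> Kb_gr_proj A G" using XM unfolding in_graded_def by blast
qed

end

theorem corollary4p18:
  fixes k :: "('k, 'x) ring_scheme" and \<Lambda> :: "('u::infinite) ring" and \<eta> :: "'k \<Rightarrow> 'u"
    and C :: "('u, 'u) bimodule"
  defines "A \<equiv> trivial_ext \<Lambda> C" and "G \<equiv> trivial_ext_grading \<Lambda> C"
  assumes "nc_algebra k \<Lambda> \<eta>"
    and "central_bimodule k \<Lambda> \<eta> C"
    and "stalk (module.truncate C) \<in> Kb_proj \<Lambda>"
  shows "in_graded \<Lambda> C (complexes (Mod_cat \<Lambda>)) \<inter> Kb_gr_proj A G
           = in_graded \<Lambda> C (Kb_proj \<Lambda>) \<inter> Kb_gr_proj A G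
       \<and> in_graded \<Lambda> C (Kb_proj \<Lambda>) \<inter> Kb_gr_proj A G
           = (\<Union>a. in_graded \<Lambda> C (Ker_derived_tensor \<Lambda> C a))"
proof -
  interpret E: triv_ext \<Lambda> C by (rule triv_ext.intro[OF central_bimodule.axioms(2)[OF assms(4)]])
  show ?thesis unfolding A_def G_def by (rule conjI[OF E.in_graded_complexes_eq E.in_graded_Ker_eq[OF assms(5)]])
qed

end
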